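(* Let $G=G_1\ast\cdots\ast G_n$ be a free product of finitely many nontrivial finite groups. Fix any well order $g_1,g_2,\dots$ of $G$, order $\mathbb{Z}^G$ lexicographically, and for a nuclear vertex $v=[\mathcal{H},\underline{\underline{0}}]$ of $L(G)$ let $\|v\|\in\mathbb{Z}^G$ have $i$-th coordinate $|g_i|_{\mathcal{H}}$; write $u<v$ if $\|u\|<\|v\|$. Then for every nuclear vertex $v$ which is not minimal, $$st(v)\cap\Big(\bigcup_{u<v} st(u)\Big)$$ is contractible, the union being over nuclear vertices $u$. Consequently $L(G)$ is contractible.
   Context: A basis of $G$ is a set $\mathcal{H}=\{H_1,\dots,H_n\}$ of subgroups with $H_i$ conjugate to $G_i$ and $G=H_1\ast\cdots\ast H_n$; $|g|_{\mathcal{H}}$ is the (non-cyclic) length of the reduced word for $g$ in $H_1\ast\cdots\ast H_n$. A pointed labelled tree is a finite bipartite tree whose vertices are labelled (labels $\ast,1,\dots,n$, each once) or unlabelled, each edge joining a labelled and an unlabelled vertex, unlabelled vertices of valence at least 2, $\ast$ of valence 1. For a labelled vertex $k$, the petals at $k$ are the label sets of components of $T-\{k\}$, forming a partition $\underline{\underline{A}}(k)$; the tree is identified with the family $\underline{\underline{A}}$; $\underline{\underline{A}}\le\underline{\underline{B}}$ means each petal of $\underline{\underline{A}}(k)$ is a union of petals of $\underline{\underline{B}}(k)$. The trivial tree $\underline{\underline{0}}$ has one unlabelled vertex adjacent to all labelled ones. For a basis $\mathcal{H}$, $k$ and $x_j\in H_k$ ($x_k=1$), the symmetric Whitehead automorphism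 $(\mathcal{H},x)$ acts on $H_j$ by $h\mapsto x_jhx_j^{-1}$, trivially on $H_k$; it is carried by $(\mathcal{H},\underline{\underline{A}})$ if $x$ is constant on petals of $\underline{\underline{A}}(k)$ and trivial on the petal containing $\ast$. Pairs $(\mathcal{H},\underline{\underline{A}})$, $(\rho(\mathcal{H}),\underline{\underline{A}})$ with $\rho$ a product of carried symmetric Whitehead automorphisms are identified; classes are ordered by: $[\mathcal{H},\underline{\underline{A}}]\le[\mathcal{K},\underline{\underline{B}}]$ iff they have representatives with common basis and $\underline{\underline{A}}\le\underline{\underline{B}}$. $L(G)$ is the realization of this poset. Nuclear vertices are those of the form $[\mathcal{H},\underline{\underline{0}}]$; these are minimal in the poset. The star $st(v)$ of a nuclear vertex $v$ is the subcomplex of $L(G)$ spanned by all vertices $w\ge v$. *)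

theory Defs
  imports "HOL-Algebra.Algebra" "HOL-Analysis.Analysis"
begin

section \<open>Free products (internal, via normal forms)\<close>

text \<open>A word is a list of (factor index, element) pairs; it is reduced if
every letter is a nontrivial element of its factor (index in 1..n) and
consecutive letters come from different factors.\<close>

definition reduced_word :: "('a,'b) monoid_scheme \<Rightarrow> nat \<Rightarrow> (nat \<Rightarrow> 'a set) \<Rightarrow> (nat \<times> 'a) list \<Rightarrow> bool" where
  "reduced_word G n K w \<longleftrightarrow>
     (\<forall>p\<in>set w. fst p \<in> {1..n} \<and> snd p \<in> K (fst p) - {\<one>\<^bsub>G\<^esub>}) \<and>
     (\<forall>i. Suc i < length w \<longrightarrow> fst (w ! i) \<noteq> fst (w ! Suc i))"

definition word_eval :: "('a,'b) monoid_scheme \<Rightarrow> (nat \<times> 'a) list \<Rightarrow> 'a" where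
  "word_eval G w = foldr (\<lambda>p acc. snd p \<otimes>\<^bsub>G\<^esub> acc) w \<one>\<^bsub>G\<^esub>"

text \<open>G is the (internal) free product K 1 * ... * K n: every element has a
unique reduced word.\<close>
definition is_free_product :: "('a,'b) monoid_scheme \<Rightarrow> nat \<Rightarrow> (nat \<Rightarrow> 'a set) \<Rightarrow> bool" where
  "is_free_product G n K \<longleftrightarrow>
     (\<forall>i\<in>{1..n}. subgroup (K i) G) \<and>
     (\<forall>g\<in>carrier G. \<exists>!w. reduced_word G n K w \<and> word_eval G w = g)"

text \<open>The (non-cyclic) length of g with respect to the decomposition K.\<close>
definition word_length :: "('a,'b) monoid_scheme \<Rightarrow> nat \<Rightarrow> (nat \<Rightarrow> 'a set) \<Rightarrow> 'a \<Rightarrow> nat" where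
  "word_length G n K g = length (THE w. reduced_word G n K w \<and> word_eval G w = g)"

definition conjugate_subgroups :: "('a,'b) monoid_scheme \<Rightarrow> 'a set \<Rightarrow> 'a set \<Rightarrow> bool" where
  "conjugate_subgroups G H K \<longleftrightarrow>
     (\<exists>g\<in>carrier G. H = (\<lambda>h. g \<otimes>\<^bsub>G\<^esub> h \<otimes>\<^bsub>G\<^esub> inv\<^bsub>G\<^esub> g) ` K)"

text \<open>A basis, indexed by 1..n (H i conjugate to Gs i), normalised to {} off 1..n.\<close>
definition is_basis :: "('a,'b) monoid_scheme \<Rightarrow> nat \<Rightarrow> (nat \<Rightarrow> 'a set) \<Rightarrow> (nat \<Rightarrow> 'a set) \<Rightarrow> bool" where
  "is_basis G n Gs H \<longleftrightarrow>
     is_free_product G n H \<and>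
     (\<forall>i\<in>{1..n}. conjugate_subgroups G (H i) (Gs i)) \<and>
     (\<forall>i. i \<notin> {1..n} \<longrightarrow> H i = {})"

section \<open>Pointed labelled trees\<close>

text \<open>A tree is a pair (U, E): U the (finite) set of unlabelled vertices
(named by naturals), E \<subseteq> labels \<times> U the edges. Labelled vertices are
Inl 0 (= the label *) and Inl 1, ..., Inl n; unlabelled ones are Inr m.\<close>

type_synonym ltree = "nat set \<times> (nat \<times> nat) set"

definition tverts :: "nat \<Rightarrow> ltree \<Rightarrow> (nat + nat) set" where
  "tverts n T = Inl ` {0..n} \<union> Inr ` fst T"

definition tadj :: "ltree \<Rightarrow> nat + nat \<Rightarrow> nat + nat \<Rightarrow> bool" where
  "tadj T a b \<longleftrightarrow> (\<exists>k m. (k, m) \<in> snd T \<and>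
      ((a = Inl k \<and> b = Inr m) \<or> (a = Inr m \<and> b = Inl k)))"

definition adj_in :: "ltree \<Rightarrow> (nat + nat) set \<Rightarrow> ((nat + nat) \<times> (nat + nat)) set" where
  "adj_in T W = {(x, y). x \<in> W \<and> y \<in> W \<and> tadj T x y}"

definition connected_in :: "ltree \<Rightarrow> (nat + nat) set \<Rightarrow> bool" where
  "connected_in T W \<longleftrightarrow> (\<forall>a\<in>W. \<forall>b\<in>W. (a, b) \<in> (adj_in T W)\<^sup>*)"

text \<open>Finite tree = finite connected graph with |E| = |V| - 1; bipartite by
construction; unlabelled vertices have valence \<ge> 2; * has valence 1.\<close>
definition pointed_labelled_tree :: "nat \<Rightarrow> ltree \<Rightarrow> bool" where
  "pointed_labelled_tree n T \<longleftrightarrow>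
     finite (fst T) \<and> snd T \<subseteq> {0..n} \<times> fst T \<and>
     connected_in T (tverts n T) \<and>
     card (snd T) + 1 = card (tverts n T) \<and>
     (\<forall>m\<in>fst T. card {k. (k, m) \<in> snd T} \<ge> 2) \<and>
     card {m. (0, m) \<in> snd T} = 1"

definition component :: "ltree \<Rightarrow> (nat + nat) set \<Rightarrow> nat + nat \<Rightarrow> (nat + nat) set" where
  "component T W a = {b \<in> W. (a, b) \<in> (adj_in T W)\<^sup>*}"

text \<open>Petals at labelled vertex k: label sets of the components of T - {k}.\<close>
definition petals :: "nat \<Rightarrow> ltree \<Rightarrow> nat \<Rightarrow> nat set set" where
  "petals n T k = (let W = tverts n T - {Inl k} in
      {{j. Inl j \<in> component T W a} | a. a \<in> W})"

definition petal_family :: "nat \<Rightarrow> ltree \<Rightarrow> nat \<Rightarrow> nat set set" where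
  "petal_family n T = (\<lambda>k. if k \<le> n then petals n T k else {})"

definition family_le :: "nat \<Rightarrow> (nat \<Rightarrow> nat set set) \<Rightarrow> (nat \<Rightarrow> nat set set) \<Rightarrow> bool" where
  "family_le n A B \<longleftrightarrow> (\<forall>k\<le>n. \<forall>P\<in>A k. \<exists>Q\<subseteq>B k. P = \<Union>Q)"

definition trivial_tree :: "nat \<Rightarrow> ltree" where
  "trivial_tree n = ({0}, {(k, 0) | k. k \<le> n})"

section \<open>Symmetric Whitehead automorphisms and the complex L(G)\<close>

definition sym_whitehead :: "('a,'b) monoid_scheme \<Rightarrow> nat \<Rightarrow> (nat \<Rightarrow> 'a set) \<Rightarrow> nat \<Rightarrow> (nat \<Rightarrow> 'a) \<Rightarrow> ('a \<Rightarrow> 'a) \<Rightarrow> bool" where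
  "sym_whitehead G n H k x \<phi> \<longleftrightarrow>
     k \<in> {1..n} \<and> x k = \<one>\<^bsub>G\<^esub> \<and> (\<forall>j\<in>{1..n}. x j \<in> H k) \<and>
     \<phi> \<in> iso G G \<and>
     (\<forall>j\<in>{1..n}. \<forall>h\<in>H j. \<phi> h = x j \<otimes>\<^bsub>G\<^esub> h \<otimes>\<^bsub>G\<^esub> inv\<^bsub>G\<^esub> (x j))"

definition carried_by :: "('a,'b) monoid_scheme \<Rightarrow> (nat \<Rightarrow> nat set set) \<Rightarrow> nat \<Rightarrow> (nat \<Rightarrow> 'a) \<Rightarrow> bool" where
  "carried_by G A k x \<longleftrightarrow>
     (\<forall>P\<in>A k. \<forall>i\<in>P. \<forall>j\<in>P. x i = x j) \<and>
     (\<forall>P\<in>A k. 0 \<in> P \<longrightarrow> (\<forall>j\<in>P. x j = \<one>\<^bsub>G\<^esub>))"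

definition carried_whitehead :: "('a,'b) monoid_scheme \<Rightarrow> nat \<Rightarrow> (nat \<Rightarrow> 'a set) \<Rightarrow> (nat \<Rightarrow> nat set set) \<Rightarrow> ('a \<Rightarrow> 'a) \<Rightarrow> bool" where
  "carried_whitehead G n H A \<phi> \<longleftrightarrow> (\<exists>k x. sym_whitehead G n H k x \<phi> \<and> carried_by G A k x)"

type_synonym 'a lpair = "(nat \<Rightarrow> 'a set) \<times> (nat \<Rightarrow> nat set set)"

definition lpairs :: "('a,'b) monoid_scheme \<Rightarrow> nat \<Rightarrow> (nat \<Rightarrow> 'a set) \<Rightarrow> 'a lpair set" where
  "lpairs G n Gs = {(H, A). is_basis G n Gs H \<and>
      (\<exists>T. pointed_labelled_tree n T \<and> A = petal_family n T)}"

text \<open>(H,A) ~ (rho(H),A) for rho a product of symmetric Whitehead automorphisms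
carried by (H,A).\<close>
definition wh_step :: "('a,'b) monoid_scheme \<Rightarrow> nat \<Rightarrow> (nat \<Rightarrow> 'a set) \<Rightarrow> ('a lpair \<times> 'a lpair) set" where
  "wh_step G n Gs = {((H, A), (K, A')) | H A K A'.
      (H, A) \<in> lpairs G n Gs \<and> (K, A') \<in> lpairs G n Gs \<and> A' = A \<and>
      (\<exists>\<phi>s. (\<forall>\<phi>\<in>set \<phi>s. carried_whitehead G n H A \<phi>) \<and>
            K = (\<lambda>i. foldr (\<circ>) \<phi>s id ` H i))}"

definition lequiv :: "('a,'b) monoid_scheme \<Rightarrow> nat \<Rightarrow> (nat \<Rightarrow> 'a set) \<Rightarrow> ('a lpair \<times> 'a lpair) set" where
  "lequiv G n Gs = (wh_step G n Gs \<union> (wh_step G n Gs)\<inverse>)\<^sup>*"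

definition LG_vertices :: "('a,'b) monoid_scheme \<Rightarrow> nat \<Rightarrow> (nat \<Rightarrow> 'a set) \<Rightarrow> 'a lpair set set" where
  "LG_vertices G n Gs = lpairs G n Gs // lequiv G n Gs"

definition LG_le :: "nat \<Rightarrow> 'a lpair set \<Rightarrow> 'a lpair set \<Rightarrow> bool" where
  "LG_le n V W \<longleftrightarrow> (\<exists>H A B. (H, A) \<in> V \<and> (H, B) \<in> W \<and> family_le n A B)"

text \<open>Order complex (geometric realisation of the poset): simplices are the
finite nonempty chains.\<close>
definition LG_complex :: "('a,'b) monoid_scheme \<Rightarrow> nat \<Rightarrow> (nat \<Rightarrow> 'a set) \<Rightarrow> 'a lpair set set set" where
  "LG_complex G n Gs = {\<sigma>. \<sigma> \<noteq> {} \<and> finite \<sigma> \<and> \<sigma> \<subseteq> LG_vertices G n Gs \<and>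
      (\<forall>a\<in>\<sigma>. \<forall>b\<in>\<sigma>. LG_le n a b \<or> LG_le n b a)}"

definition nuclear :: "('a,'b) monoid_scheme \<Rightarrow> nat \<Rightarrow> (nat \<Rightarrow> 'a set) \<Rightarrow> (nat \<Rightarrow> 'a set) \<Rightarrow> 'a lpair set" where
  "nuclear G n Gs H = lequiv G n Gs `` {(H, petal_family n (trivial_tree n))}"

definition nuclear_vertices :: "('a,'b) monoid_scheme \<Rightarrow> nat \<Rightarrow> (nat \<Rightarrow> 'a set) \<Rightarrow> 'a lpair set set" where
  "nuclear_vertices G n Gs = {nuclear G n Gs H | H. is_basis G n Gs H}"

text \<open>Star of v: the subcomplex spanned by the vertices w \<ge> v.\<close>
definition LG_star :: "('a,'b) monoid_scheme \<Rightarrow> nat \<Rightarrow> (nat \<Rightarrow> 'a set) \<Rightarrow> 'a lpair set \<Rightarrow> 'a lpair set set set" where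
  "LG_star G n Gs v = {\<sigma> \<in> LG_complex G n Gs. \<forall>w\<in>\<sigma>. LG_le n v w}"

text \<open>Lexicographic order on functions A \<Rightarrow> nat w.r.t. a well order r on A.\<close>
definition lex_less :: "'a set \<Rightarrow> ('a \<times> 'a) set \<Rightarrow> ('a \<Rightarrow> nat) \<Rightarrow> ('a \<Rightarrow> nat) \<Rightarrow> bool" where
  "lex_less A r f g \<longleftrightarrow>
     (\<exists>a\<in>A. f a < g a \<and> (\<forall>b\<in>A. (b, a) \<in> r \<and> b \<noteq> a \<longrightarrow> f b = g b))"

definition nuclear_less :: "('a,'b) monoid_scheme \<Rightarrow> nat \<Rightarrow> (nat \<Rightarrow> 'a set) \<Rightarrow> ('a \<times> 'a) set \<Rightarrow> 'a lpair set \<Rightarrow> 'a lpair set \<Rightarrow> bool" where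
  "nuclear_less G n Gs r u v \<longleftrightarrow>
     (\<exists>H K. is_basis G n Gs H \<and> is_basis G n Gs K \<and>
        u = nuclear G n Gs H \<and> v = nuclear G n Gs K \<and>
        lex_less (carrier G) r (word_length G n H) (word_length G n K))"

section \<open>Geometric realisation of a simplicial complex (weak topology)\<close>

definition geom_simplex :: "'v set \<Rightarrow> ('v \<Rightarrow> real) set" where
  "geom_simplex \<sigma> = {f. (\<forall>v. 0 \<le> f v) \<and> (\<forall>v. v \<notin> \<sigma> \<longrightarrow> f v = 0) \<and> sum f \<sigma> = 1}"

definition realization :: "'v set set \<Rightarrow> ('v \<Rightarrow> real) set" where
  "realization K = (\<Union>\<sigma>\<in>K. geom_simplex \<sigma>)"

definition realization_top :: "'v set set \<Rightarrow> ('v \<Rightarrow> real) topology" where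
  "realization_top K = topology (\<lambda>U. U \<subseteq> realization K \<and>
      (\<forall>\<sigma>\<in>K. openin (top_of_set (geom_simplex \<sigma>)) (U \<inter> geom_simplex \<sigma>)))"

definition contractible_complex :: "'v set set \<Rightarrow> bool" where
  "contractible_complex K \<longleftrightarrow>
     realization K \<noteq> {} \<and> contractible_space (realization_top K)"

end

theory Submission
  imports Defs
begin

text \<open>
  A move at a basis \<open>H\<close> conjugates each factor \<open>H j\<close> by an element \<open>x j\<close> of one factor \<open>H k\<close>. It changes the number of
  \<open>k\<close>-letters of a word but not the number of letters of any other factor. Hence compatible moves (those carried
  by a common tree) have independent effects on the norm, and a tree \<open>A\<close> lies in the star of a smaller nuclear
  vertex iff \<open>A\<close> carries a single reductive move at \<open>H\<close>.

  Two moves which are not compatible can be uncrossed without increasing the sum of their norms. Peak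
  reduction along paths of moves (which exist by Nielsen's argument) then produces a reductive move at every
  basis that is not minimal. For an arbitrary well order the lexicographic order is replaced by a suitable
  positive integer combination of finitely many lengths, since norms need not be well-founded.

  Fix a reductive move \<open>m\<close> of maximal reduction. Among the reductive moves crossing \<open>m\<close>, one that spreads least
  is dominated by its uncrossed version: whatever is compatible with the former is compatible with the latter.
  Removing such moves one by one deforms the poset of trees carrying a reductive move, by comparable monotone
  maps, to the poset of those carrying a reductive move compatible with \<open>m\<close>, which is conically contractible.

  For the contractibility of the whole complex the order is immaterial, so it is chosen such that only finitely
  many bases lie below a given one. The stars are then glued in a sequence; each is a cone attached along a
  contractible subcomplex and so deforms into its predecessors, and these deformations are concatenated.
\<close>

section \<open>Normal forms in free products\<close>

text \<open>Why maximal reduction matters: uncrossing \<open>m\<close> with a crossing reductive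
  move \<open>a\<close> gives \<open>m'\<close> and \<open>a'\<close> whose reductions add up to at
  least those of \<open>m\<close> and \<open>a\<close>. By the choice of \<open>m\<close>,
  \<open>m'\<close> does not reduce more than \<open>m\<close>, so \<open>a'\<close> reduces at
  least as much as \<open>a\<close> and stays reductive. This only uses that integer functions under
  the lexicographic order form a totally ordered group; descent is needed in peak reduction alone.
  The weights used there exist because finite factors leave only finitely many moves at a basis,
  hence finitely many inequalities to respect.

  Trees are traded for families of partitions because compatibility is a pairwise matter: moves that
  are compatible two by two are carried by one common family, and there is a smallest such family.
  Posets of trees are thereby controlled by cliques of moves.

  The obstacle in the final gluing is that there may be infinitely many stars. A simplex lies in
  some finite stage, and the part of the deformation that belongs to later stages does not move it;
  in the weak topology continuity can be checked on each simplex.\<close>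

definition nf :: "('a,'b) monoid_scheme \<Rightarrow> nat \<Rightarrow> (nat \<Rightarrow> 'a set) \<Rightarrow> 'a \<Rightarrow> (nat \<times> 'a) list" where
  "nf G n H g = (THE w. reduced_word G n H w \<and> word_eval G w = g)"

definition letter_count :: "nat \<Rightarrow> (nat \<times> 'a) list \<Rightarrow> nat" where
  "letter_count i w = length (filter (\<lambda>p. fst p = i) w)"

definition cnt :: "('a,'b) monoid_scheme \<Rightarrow> nat \<Rightarrow> (nat \<Rightarrow> 'a set) \<Rightarrow> nat \<Rightarrow> 'a \<Rightarrow> nat" where
  "cnt G n H i g = letter_count i (nf G n H g)"

lemma letter_count_simps [simp]:
  "letter_count i [] = 0"
  "letter_count i (p # w) = (if fst p = i then Suc (letter_count i w) else letter_count i w)"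
  by (auto simp: letter_count_def)

lemma reduced_word_Nil [simp]: "reduced_word G n H []"
  by (simp add: reduced_word_def)

lemma reduced_word_Cons [simp]:
  "reduced_word G n H (p # w) \<longleftrightarrow>
     fst p \<in> {1..n} \<and> snd p \<in> H (fst p) \<and> snd p \<noteq> \<one>\<^bsub>G\<^esub> \<and> reduced_word G n H w \<and>
     (w = [] \<or> fst (hd w) \<noteq> fst p)" (is "?L = ?R")
proof
  assume L: ?L
  have "\<forall>i. Suc i < length w \<longrightarrow> fst (w ! i) \<noteq> fst (w ! Suc i)"
    using L by (auto simp: reduced_word_def dest: spec[where x = "Suc _"])
  moreover have "w = [] \<or> fst (hd w) \<noteq> fst p"
    using L by (cases w) (auto simp: reduced_word_def dest: spec[where x = 0])
  ultimately show ?R using L by (auto simp: reduced_word_def)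
next
  assume R: ?R
  have "fst ((p # w) ! i) \<noteq> fst ((p # w) ! Suc i)" if "Suc i < length (p # w)" for i
    using R that by (cases i; cases w) (auto simp: reduced_word_def)
  with R show ?L by (auto simp: reduced_word_def)
qed

lemma word_eval_Nil [simp]: "word_eval G [] = \<one>\<^bsub>G\<^esub>"
  by (simp add: word_eval_def)

lemma word_eval_Cons [simp]: "word_eval G (p # w) = snd p \<otimes>\<^bsub>G\<^esub> word_eval G w"
  by (simp add: word_eval_def)

lemma letter_count_sum:
  assumes "reduced_word G n H w"
  shows "length w = (\<Sum>i\<in>{1..n}. letter_count i w)"
  using assms
proof (induction w)
  case (Cons p w)
  then have "(\<Sum>i\<in>{1..n}. letter_count i (p # w))
      = (\<Sum>i\<in>{1..n}. letter_count i w + (if i = fst p then 1 else 0))"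
    by (intro sum.cong) auto
  also have "\<dots> = length w + 1"
    using Cons by (simp add: sum.distrib)
  finally show ?case by simp
qed simp

locale factored_group = group G for G (structure) + fixes n :: nat
begin

abbreviation "fp \<equiv> is_free_product G n"

lemma fp_subgroup: "fp H \<Longrightarrow> i \<in> {1..n} \<Longrightarrow> subgroup (H i) G"
  by (simp add: is_free_product_def)

lemma fp_carrier: "fp H \<Longrightarrow> i \<in> {1..n} \<Longrightarrow> h \<in> H i \<Longrightarrow> h \<in> carrier G"
  by (rule subgroup.mem_carrier[OF fp_subgroup])

lemma reduced_eval_closed:
  assumes "fp H" "reduced_word G n H w" shows "word_eval G w \<in> carrier G"
  using assms(2)
proof (induction w)
  case (Cons p w)
  then show ?case using fp_carrier[OF assms(1), of "fst p" "snd p"] by simp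
qed simp

lemma nf_props:
  assumes "fp H" "g \<in> carrier G"
  shows nf_reduced: "reduced_word G n H (nf G n H g)" and nf_eval: "word_eval G (nf G n H g) = g"
proof -
  have "\<exists>!w. reduced_word G n H w \<and> word_eval G w = g"
    using assms by (simp add: is_free_product_def)
  from theI'[OF this] show "reduced_word G n H (nf G n H g)" "word_eval G (nf G n H g) = g"
    by (auto simp: nf_def)
qed

lemma nf_unique:
  assumes "fp H" "reduced_word G n H w" "word_eval G w = g" shows "nf G n H g = w"
proof -
  have "g \<in> carrier G" using reduced_eval_closed assms by blast
  then have "\<exists>!w. reduced_word G n H w \<and> word_eval G w = g"
    using assms(1) by (simp add: is_free_product_def)
  with assms show ?thesis unfolding nf_def by (intro the1_equality) auto
qed

lemma nf_one: "fp H \<Longrightarrow> nf G n H \<one> = []"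
  by (rule nf_unique) auto

lemma nf_letter: "fp H \<Longrightarrow> i \<in> {1..n} \<Longrightarrow> h \<in> H i \<Longrightarrow> h \<noteq> \<one> \<Longrightarrow> nf G n H h = [(i, h)]"
  using fp_carrier[of H i h] by (intro nf_unique) auto

lemma word_length_nf: "word_length G n H g = length (nf G n H g)"
  by (simp add: word_length_def nf_def)

lemma word_length_cnt:
  "fp H \<Longrightarrow> g \<in> carrier G \<Longrightarrow> word_length G n H g = (\<Sum>i\<in>{1..n}. cnt G n H i g)"
  unfolding word_length_nf cnt_def by (rule letter_count_sum[OF nf_reduced])

definition lmul :: "nat \<Rightarrow> 'a \<Rightarrow> (nat \<times> 'a) list \<Rightarrow> (nat \<times> 'a) list" where
  "lmul i h w = (if h = \<one> then w else
     case w of [] \<Rightarrow> [(i, h)]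
     | p # w' \<Rightarrow> if fst p = i then (if h \<otimes> snd p = \<one> then w' else (i, h \<otimes> snd p) # w')
                else (i, h) # w)"

text \<open>Left multiplication by a letter meets only the first letter of the normal form, which it
  merges with, cancels or precedes. Multiplicativity of extended homomorphisms and the triangle
  inequality for lengths rest on this rule.\<close>

lemma nf_lmul:
  assumes H: "fp H" and i: "i \<in> {1..n}" and h: "h \<in> H i" and g: "g \<in> carrier G"
  shows "nf G n H (h \<otimes> g) = lmul i h (nf G n H g)"
proof (rule nf_unique[OF H])
  let ?w = "nf G n H g"
  have w: "reduced_word G n H ?w" "word_eval G ?w = g" using nf_props[OF H g] by auto
  have hc: "h \<in> carrier G" using fp_carrier[OF H i h] .
  have mc: "h' \<in> H i \<Longrightarrow> h \<otimes> h' \<in> H i" for h'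
    using subgroup.m_closed[OF fp_subgroup[OF H i] h] .
  have lc: "p \<in> set ?w \<Longrightarrow> snd p \<in> carrier G" for p
    using w(1) fp_carrier[OF H] unfolding reduced_word_def by (metis DiffD1)
  show "reduced_word G n H (lmul i h ?w)"
    using w(1) i h mc by (auto simp: lmul_def split: list.split)
  show "word_eval G (lmul i h ?w) = h \<otimes> g"
  proof (cases ?w)
    case Nil
    with w have "g = \<one>" by simp
    with Nil hc show ?thesis by (simp add: lmul_def)
  next
    case (Cons p w')
    have pc: "snd p \<in> carrier G" using lc Cons by simp
    have wc: "word_eval G w' \<in> carrier G" using reduced_eval_closed[OF H] w(1) Cons by simp
    have g: "g = snd p \<otimes> word_eval G w'" using w(2) Cons by simp
    have a: "h \<otimes> g = h \<otimes> snd p \<otimes> word_eval G w'" using hc pc wc by (simp add: g m_assoc)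
    consider "h = \<one>" | "h \<noteq> \<one>" "fst p \<noteq> i" | "h \<noteq> \<one>" "fst p = i" "h \<otimes> snd p = \<one>"
      | "h \<noteq> \<one>" "fst p = i" "h \<otimes> snd p \<noteq> \<one>" by blast
    then show ?thesis
    proof cases
      case 1
      then show ?thesis using w(2) assms(4) by (simp add: lmul_def)
    next
      case 2
      then show ?thesis using Cons g by (simp add: lmul_def)
    next
      case 3
      then show ?thesis using Cons a wc by (simp add: lmul_def)
    next
      case 4
      then show ?thesis using Cons a by (simp add: lmul_def)
    qed
  qed
qed

lemma fp_induct [consumes 2, case_names one mult]:
  assumes H: "fp H" and g: "g \<in> carrier G"
    and one: "P \<one>"
    and mult: "\<And>i h g. i \<in> {1..n} \<Longrightarrow> h \<in> H i \<Longrightarrow> g \<in> carrier G \<Longrightarrow> P g \<Longrightarrow> P (h \<otimes> g)"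
  shows "P g"
proof -
  have "P (word_eval G w)" if "reduced_word G n H w" for w
    using that
  proof (induction w)
    case (Cons p w)
    then show ?case using mult[of "fst p" "snd p" "word_eval G w"] reduced_eval_closed[OF H, of w] by simp
  qed (simp add: one)
  from this[OF nf_reduced[OF H g]] show ?thesis by (simp add: nf_eval[OF H g])
qed

text \<open>The universal property of the free product: homomorphisms \<open>f i\<close> on the
  factors extend to the group. Normal forms do not simply concatenate under multiplication, so
  multiplicativity is shown for one letter on the left and then by induction on the left
  argument.\<close>

definition hom_ext :: "(nat \<Rightarrow> 'a set) \<Rightarrow> (nat \<Rightarrow> 'a \<Rightarrow> 'a) \<Rightarrow> 'a \<Rightarrow> 'a" where
  "hom_ext H f g = foldr (\<lambda>p acc. f (fst p) (snd p) \<otimes> acc) (nf G n H g) \<one>"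

context
  fixes H f
  assumes H: "fp H"
    and fc: "\<And>i h. i \<in> {1..n} \<Longrightarrow> h \<in> H i \<Longrightarrow> f i h \<in> carrier G"
    and fh: "\<And>i h h'. i \<in> {1..n} \<Longrightarrow> h \<in> H i \<Longrightarrow> h' \<in> H i \<Longrightarrow> f i (h \<otimes> h') = f i h \<otimes> f i h'"
begin

lemma hom_ext_f_one: "i \<in> {1..n} \<Longrightarrow> f i \<one> = \<one>"
proof -
  assume i: "i \<in> {1..n}"
  have o: "\<one> \<in> H i" using subgroup.one_closed[OF fp_subgroup[OF H i]] .
  have "f i \<one> \<otimes> f i \<one> = f i \<one>" using fh[OF i o o] by simp
  then show ?thesis using fc[OF i o] by simp
qed

lemma hom_ext_word_closed:
  "reduced_word G n H w \<Longrightarrow> foldr (\<lambda>p acc. f (fst p) (snd p) \<otimes> acc) w \<one> \<in> carrier G"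
proof (induction w)
  case (Cons p w)
  then show ?case using fc[of "fst p" "snd p"] by simp
qed simp

lemma hom_ext_closed: "g \<in> carrier G \<Longrightarrow> hom_ext H f g \<in> carrier G"
  unfolding hom_ext_def by (rule hom_ext_word_closed[OF nf_reduced[OF H]])

lemma hom_ext_letter_mult:
  assumes i: "i \<in> {1..n}" and h: "h \<in> H i" and g: "g \<in> carrier G"
  shows "hom_ext H f (h \<otimes> g) = f i h \<otimes> hom_ext H f g"
proof -
  have w: "reduced_word G n H (nf G n H g)" using nf_reduced[OF H g] .
  let ?F = "\<lambda>w. foldr (\<lambda>p acc. f (fst p) (snd p) \<otimes> acc) w \<one>"
  have "?F (lmul i h (nf G n H g)) = f i h \<otimes> ?F (nf G n H g)"
  proof (cases "h = \<one> \<or> nf G n H g = []")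
    case True
    then show ?thesis
      using hom_ext_f_one[OF i] hom_ext_word_closed[OF w] fc[OF i h] by (auto simp: lmul_def)
  next
    case False
    then obtain p w' where pw: "nf G n H g = p # w'" by (cases "nf G n H g") auto
    have p: "fst p \<in> {1..n}" "snd p \<in> H (fst p)" "reduced_word G n H w'" using w pw by auto
    have c: "f (fst p) (snd p) \<in> carrier G" "?F w' \<in> carrier G" "f i h \<in> carrier G"
      using p fc hom_ext_word_closed i h by auto
    show ?thesis
    proof (cases "fst p = i")
      case True
      have e: "f i (h \<otimes> snd p) = f i h \<otimes> f i (snd p)" using fh[OF i h] p True by auto
      show ?thesis
      proof (cases "h \<otimes> snd p = \<one>")
        case t: True
        then have "f i h \<otimes> f i (snd p) = \<one>" using e hom_ext_f_one[OF i] by simp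
        then have "f i h \<otimes> (f i (snd p) \<otimes> ?F w') = ?F w'" using c True by (simp flip: m_assoc)
        then show ?thesis using True t False pw by (simp add: lmul_def)
      qed (use True False pw e c in \<open>simp add: lmul_def m_assoc\<close>)
    qed (use False pw in \<open>simp add: lmul_def\<close>)
  qed
  then show ?thesis by (simp add: hom_ext_def nf_lmul[OF H i h g])
qed

lemma hom_ext_one: "hom_ext H f \<one> = \<one>"
  by (simp add: hom_ext_def nf_one[OF H])

lemma hom_ext_letter: "i \<in> {1..n} \<Longrightarrow> h \<in> H i \<Longrightarrow> hom_ext H f h = f i h"
  using hom_ext_letter_mult[of i h \<one>] fc[of i h] fp_carrier[OF H] by (simp add: hom_ext_one)

lemma hom_ext_hom: "hom_ext H f \<in> hom G G"
proof (rule homI)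
  show "\<And>x. x \<in> carrier G \<Longrightarrow> hom_ext H f x \<in> carrier G" by (rule hom_ext_closed)
  fix x y assume x: "x \<in> carrier G" and y: "y \<in> carrier G"
  show "hom_ext H f (x \<otimes> y) = hom_ext H f x \<otimes> hom_ext H f y"
    using H x
  proof (induction rule: fp_induct)
    case one
    then show ?case using y by (simp add: hom_ext_one hom_ext_closed)
  next
    case (mult i h g)
    have hc: "h \<in> carrier G" using fp_carrier[OF H] mult by blast
    then have "hom_ext H f (h \<otimes> g \<otimes> y) = f i h \<otimes> hom_ext H f (g \<otimes> y)"
      using hom_ext_letter_mult mult y by (simp add: m_assoc)
    then show ?case
      using mult y hom_ext_letter_mult fc by (simp add: m_assoc hom_ext_closed)
  qed
qed

end

lemma hom_eq_on:
  assumes H: "fp H" and f: "f \<in> hom G G" and f': "f' \<in> hom G G"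
    and eq: "\<And>i h. i \<in> {1..n} \<Longrightarrow> h \<in> H i \<Longrightarrow> f h = f' h" and g: "g \<in> carrier G"
  shows "f g = f' g"
  using H g
proof (induction rule: fp_induct)
  case one
  then show ?case using hom_one[OF f] hom_one[OF f'] by (simp add: is_group)
next
  case (mult i h g)
  then show ?case using hom_mult[OF f] hom_mult[OF f'] eq fp_carrier[OF H] by metis
qed

text \<open>A homomorphism that respects the factors and kills no letter sends reduced words to
  reduced words, and by uniqueness the image word is the normal form.\<close>

lemma nf_transport:
  assumes H: "fp H" and K: "fp K" and f: "f \<in> hom G G"
    and HK: "\<And>i h. i \<in> {1..n} \<Longrightarrow> h \<in> H i \<Longrightarrow> f h \<in> K i"
    and ker: "\<And>i h. i \<in> {1..n} \<Longrightarrow> h \<in> H i \<Longrightarrow> f h = \<one> \<Longrightarrow> h = \<one>"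
    and g: "g \<in> carrier G"
  shows "nf G n K (f g) = map (\<lambda>p. (fst p, f (snd p))) (nf G n H g)"
proof -
  have "reduced_word G n K (map (\<lambda>p. (fst p, f (snd p))) w) \<and>
      word_eval G (map (\<lambda>p. (fst p, f (snd p))) w) = f (word_eval G w)"
    if "reduced_word G n H w" for w
    using that
  proof (induction w)
    case Nil
    then show ?case using hom_one[OF f] by (simp add: is_group)
  next
    case (Cons p w)
    have "f (snd p \<otimes> word_eval G w) = f (snd p) \<otimes> f (word_eval G w)"
      using hom_mult[OF f] fp_carrier[OF H, of "fst p" "snd p"] reduced_eval_closed[OF H, of w] Cons by simp
    then show ?case using Cons HK[of "fst p" "snd p"] ker[of "fst p" "snd p"] by (auto simp: hd_map)
  qed
  from this[OF nf_reduced[OF H g]] nf_eval[OF H g] show ?thesis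
    using nf_unique[OF K] by metis
qed

lemma cnt_transport:
  assumes H: "fp H" and K: "fp K" and f: "f \<in> hom G G"
    and HK: "\<And>i h. i \<in> {1..n} \<Longrightarrow> h \<in> H i \<Longrightarrow> f h \<in> K i"
    and ker: "\<And>i h. i \<in> {1..n} \<Longrightarrow> h \<in> H i \<Longrightarrow> f h = \<one> \<Longrightarrow> h = \<one>"
    and g: "g \<in> carrier G"
  shows "cnt G n K i (f g) = cnt G n H i g" "word_length G n K (f g) = word_length G n H g"
proof -
  have e: "nf G n K (f g) = map (\<lambda>p. (fst p, f (snd p))) (nf G n H g)"
    using nf_transport[OF H K f HK ker g] .
  show "cnt G n K i (f g) = cnt G n H i g"
    unfolding cnt_def letter_count_def e by (simp add: filter_map comp_def)
  show "word_length G n K (f g) = word_length G n H g"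
    unfolding word_length_nf e by simp
qed

lemma iso_ker: "f \<in> iso G G \<Longrightarrow> h \<in> carrier G \<Longrightarrow> f h = \<one> \<Longrightarrow> h = \<one>"
  using hom_one[of f G G] by (auto simp: iso_iff is_group inj_on_def)

lemma iso_free_product:
  assumes H: "fp H" and f: "f \<in> iso G G"
  shows "fp (\<lambda>i. f ` H i)"
proof -
  have hom: "f \<in> hom G G" and inj: "inj_on f (carrier G)" and sur: "f ` carrier G = carrier G"
    using f by (auto simp: iso_iff)
  define f' where "f' = inv_into (carrier G) f"
  have f'f: "f' (f g) = g" if "g \<in> carrier G" for g
    using that inj by (simp add: f'_def)
  have f'h: "f' \<in> hom G G" using iso_set_sym[OF f] unfolding f'_def iso_def by blast
  let ?K = "\<lambda>i. f ` H i"
  let ?m = "\<lambda>f. map (\<lambda>p. (fst p, f (snd p)))"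
  have red: "reduced_word G n ?K (?m f w) \<and> word_eval G (?m f w) = f (word_eval G w)"
    if "reduced_word G n H w" for w
    using that
  proof (induction w)
    case Nil
    then show ?case using hom_one[OF hom] by (simp add: is_group)
  next
    case (Cons p w)
    have c: "snd p \<in> carrier G" "word_eval G w \<in> carrier G"
      using fp_carrier[OF H, of "fst p" "snd p"] reduced_eval_closed[OF H, of w] Cons by auto
    have "f (snd p \<otimes> word_eval G w) = f (snd p) \<otimes> f (word_eval G w)"
      using hom_mult[OF hom c] .
    moreover have "f (snd p) \<noteq> \<one>" using iso_ker[OF f c(1)] Cons by auto
    ultimately show ?case using Cons by (auto simp: hd_map)
  qed
  \<comment> \<open>Uniqueness comes from \<open>H\<close>: a reduced word over the images is pulled
    back letter by letter along the inverse of \<open>f\<close>.\<close>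
  have red': "reduced_word G n H (?m f' w) \<and> ?m f (?m f' w) = w"
    if "reduced_word G n ?K w" for w
    using that
  proof (induction w)
    case (Cons p w)
    then obtain h where h: "h \<in> H (fst p)" "snd p = f h" by auto
    have hc: "h \<in> carrier G" using fp_carrier[OF H, of "fst p" h] Cons h by simp
    have "f' (snd p) = h" using f'f hc h by simp
    moreover have "h \<noteq> \<one>" using Cons h hom_one[OF hom] by (auto simp: is_group)
    ultimately show ?case using Cons h by (auto simp: hd_map prod_eq_iff)
  qed simp
  show ?thesis unfolding is_free_product_def
  proof (intro conjI ballI)
    fix i assume "i \<in> {1..n}"
    then show "subgroup (f ` H i) G"
      using group_hom.subgroup_img_is_subgroup[of G G f] hom fp_subgroup[OF H]
      by (simp add: group_hom_def group_hom_axioms_def is_group)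
  next
    fix g assume "g \<in> carrier G"
    then obtain g' where g': "g' \<in> carrier G" "g = f g'" using sur by blast
    show "\<exists>!w. reduced_word G n ?K w \<and> word_eval G w = g"
    proof
      show "reduced_word G n ?K (?m f (nf G n H g')) \<and> word_eval G (?m f (nf G n H g')) = g"
        using red[OF nf_reduced[OF H g'(1)]] nf_eval[OF H g'(1)] g' by simp
    next
      fix w assume w: "reduced_word G n ?K w \<and> word_eval G w = g"
      then have r: "reduced_word G n H (?m f' w)" "?m f (?m f' w) = w" using red' by auto
      have "f (word_eval G (?m f' w)) = f g'" using red[OF r(1)] r(2) w g' by simp
      then have "word_eval G (?m f' w) = g'"
        using inj reduced_eval_closed[OF H r(1)] g' by (simp add: inj_on_eq_iff)
      then show "w = ?m f (nf G n H g')" using nf_unique[OF H r(1)] r(2) by simp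
    qed
  qed
qed

end

section \<open>Endomorphisms that conjugate the factors, and moves\<close>

context factored_group
begin

lemma reduced_word_cong:
  "(\<And>i. i \<in> {1..n} \<Longrightarrow> H i = K i) \<Longrightarrow> reduced_word G n H w = reduced_word G n K w"
  unfolding reduced_word_def by (intro conj_cong ball_cong refl) auto

lemma fp_cong:
  assumes "\<And>i. i \<in> {1..n} \<Longrightarrow> H i = K i" "fp H" shows "fp K"
  using assms reduced_word_cong[of H K] by (simp add: is_free_product_def)

text \<open>For arbitrary \<open>c\<close> this is only an endomorphism. For moves it is the
  symmetric Whitehead automorphism.\<close>

definition endo :: "(nat \<Rightarrow> 'a set) \<Rightarrow> (nat \<Rightarrow> 'a) \<Rightarrow> 'a \<Rightarrow> 'a" where
  "endo H c = hom_ext H (\<lambda>i h. c i \<otimes> h \<otimes> inv (c i))"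

lemma conj_mult:
  "c \<in> carrier G \<Longrightarrow> h \<in> carrier G \<Longrightarrow> h' \<in> carrier G \<Longrightarrow>
    c \<otimes> (h \<otimes> h') \<otimes> inv c = (c \<otimes> h \<otimes> inv c) \<otimes> (c \<otimes> h' \<otimes> inv c)"
  by (simp add: m_assoc inv_solve_left)

lemma conj_conj:
  "c \<in> carrier G \<Longrightarrow> d \<in> carrier G \<Longrightarrow> h \<in> carrier G \<Longrightarrow>
    d \<otimes> (c \<otimes> h \<otimes> inv c) \<otimes> inv d = (d \<otimes> c) \<otimes> h \<otimes> inv (d \<otimes> c)"
  by (simp add: m_assoc inv_mult_group)

lemma conj_eq_one:
  assumes c: "c \<in> carrier G" and h: "h \<in> carrier G" and e: "c \<otimes> h \<otimes> inv c = \<one>"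
  shows "h = \<one>"
proof -
  have "c \<otimes> h \<otimes> inv c \<otimes> c = c" using e c by simp
  then have "c \<otimes> h = c" using c h by (simp add: m_assoc)
  then show ?thesis using c h by simp
qed

context
  fixes H c
  assumes H: "fp H" and c: "\<And>i. i \<in> {1..n} \<Longrightarrow> c i \<in> carrier G"
begin

lemma endo_ass:
  "i \<in> {1..n} \<Longrightarrow> h \<in> H i \<Longrightarrow> c i \<otimes> h \<otimes> inv (c i) \<in> carrier G"
  "i \<in> {1..n} \<Longrightarrow> h \<in> H i \<Longrightarrow> h' \<in> H i \<Longrightarrow>
    c i \<otimes> (h \<otimes> h') \<otimes> inv (c i) = (c i \<otimes> h \<otimes> inv (c i)) \<otimes> (c i \<otimes> h' \<otimes> inv (c i))"
  using c fp_carrier[OF H] conj_mult by auto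

lemma endo_hom: "endo H c \<in> hom G G"
  unfolding endo_def by (rule hom_ext_hom[OF H]) (use endo_ass in auto)

lemma endo_letter: "i \<in> {1..n} \<Longrightarrow> h \<in> H i \<Longrightarrow> endo H c h = c i \<otimes> h \<otimes> inv (c i)"
  unfolding endo_def by (rule hom_ext_letter[OF H]) (use endo_ass in auto)

lemma endo_letter_mult:
  "i \<in> {1..n} \<Longrightarrow> h \<in> H i \<Longrightarrow> g \<in> carrier G \<Longrightarrow>
    endo H c (h \<otimes> g) = c i \<otimes> h \<otimes> inv (c i) \<otimes> endo H c g"
  using hom_mult[OF endo_hom] endo_letter fp_carrier[OF H] by simp

lemma endo_closed: "g \<in> carrier G \<Longrightarrow> endo H c g \<in> carrier G"
  using hom_in_carrier[OF endo_hom] .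

lemma endo_one: "endo H c \<one> = \<one>"
  using hom_one[OF endo_hom] by (simp add: is_group)

end

definition conj_basis :: "(nat \<Rightarrow> 'a) \<Rightarrow> (nat \<Rightarrow> 'a set) \<Rightarrow> nat \<Rightarrow> 'a set" where
  "conj_basis c H = (\<lambda>i. (\<lambda>h. c i \<otimes> h \<otimes> inv (c i)) ` H i)"

text \<open>A move at \<open>k\<close>. The entry \<open>x 0\<close> at the base point is \<open>\<one>\<close>, as are all entries outside \<open>1..n\<close>,
  so that a basis with finite factors has only finitely many moves.\<close>

definition is_move :: "(nat \<Rightarrow> 'a set) \<Rightarrow> nat \<Rightarrow> (nat \<Rightarrow> 'a) \<Rightarrow> bool" where
  "is_move H k x \<longleftrightarrow> k \<in> {1..n} \<and> x k = \<one> \<and> (\<forall>j\<in>{1..n}. x j \<in> H k) \<and> (\<forall>j. j \<notin> {1..n} \<longrightarrow> x j = \<one>)"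

lemma is_move_mem: "fp H \<Longrightarrow> is_move H k x \<Longrightarrow> x j \<in> H k"
  using subgroup.one_closed[OF fp_subgroup[of H k]] by (cases "j \<in> {1..n}") (auto simp: is_move_def)

lemma is_move_carrier: "fp H \<Longrightarrow> is_move H k x \<Longrightarrow> x j \<in> carrier G"
  using is_move_mem fp_carrier by (auto simp: is_move_def)

lemma is_move_zero: "is_move H k x \<Longrightarrow> x 0 = \<one>"
  by (simp add: is_move_def)

lemma is_move_inv:
  assumes "fp H" "is_move H k x" shows "is_move H k (\<lambda>j. inv (x j))"
  using assms subgroup.m_inv_closed[OF fp_subgroup[of H k]] by (auto simp: is_move_def)

text \<open>As \<open>x k\<close> is trivial, the map fixes \<open>H k\<close> pointwise, and all
  entries \<open>x i\<close> lie in \<open>H k\<close>. So the outer map leaves the conjugators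
  introduced by the inner one alone, and the two conjugations cancel.\<close>

lemma endo_is_move_inverse:
  assumes H: "fp H" and x: "is_move H k x" and g: "g \<in> carrier G"
  shows "endo H x (endo H (\<lambda>j. inv (x j)) g) = g"
proof -
  let ?z = "\<lambda>j. inv (x j)"
  have xc: "\<And>j. x j \<in> carrier G" using is_move_carrier[OF H x] .
  have zc: "\<And>j. ?z j \<in> carrier G" using xc by simp
  have k: "k \<in> {1..n}" "x k = \<one>" using x by (auto simp: is_move_def)
  have hx: "endo H x \<in> hom G G" and hz: "endo H ?z \<in> hom G G"
    using endo_hom[OF H] xc zc by auto
  have hc: "endo H x \<circ> endo H ?z \<in> hom G G" using hx hz by (auto simp: hom_def Pi_iff)
  have xx: "endo H x a = a" if "a \<in> H k" for a
    using endo_letter[OF H xc k(1) that] k fp_carrier[OF H k(1) that] by simp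
  have "(endo H x \<circ> endo H ?z) g = id g"
  proof (rule hom_eq_on[OF H hc _ _ g])
    show "id \<in> hom G G" by (simp add: hom_def)
    fix i h assume i: "i \<in> {1..n}" and h: "h \<in> H i"
    have hh: "h \<in> carrier G" using fp_carrier[OF H i h] .
    have e1: "endo H ?z h = inv (x i) \<otimes> h \<otimes> x i"
      using endo_letter[OF H zc i h] xc by simp
    have e2: "endo H x (inv (x i)) = inv (x i)" "endo H x (x i) = x i"
      using xx is_move_mem[OF H x] subgroup.m_inv_closed[OF fp_subgroup[OF H k(1)]] by auto
    have "endo H x (inv (x i) \<otimes> h \<otimes> x i) = inv (x i) \<otimes> (x i \<otimes> h \<otimes> inv (x i)) \<otimes> x i"
      using xc hh hom_mult[OF hx] e2 endo_letter[OF H xc i h] by simp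
    also have "\<dots> = h" using xc[of i] hh conj_conj[of "x i" "inv (x i)" h] by simp
    finally show "(endo H x \<circ> endo H ?z) h = id h" using e1 by simp
  qed
  then show ?thesis by simp
qed

lemma endo_is_move_iso:
  assumes H: "fp H" and x: "is_move H k x"
  shows "endo H x \<in> iso G G"
proof -
  let ?z = "\<lambda>j. inv (x j)"
  have xc: "\<And>j. x j \<in> carrier G" using is_move_carrier[OF H x] .
  have a: "endo H x (endo H ?z g) = g" if "g \<in> carrier G" for g
    using endo_is_move_inverse[OF H x that] .
  have b: "endo H ?z (endo H x g) = g" if "g \<in> carrier G" for g
    using endo_is_move_inverse[OF H is_move_inv[OF H x] that] xc by simp
  have c: "endo H x \<in> hom G G" "endo H ?z \<in> hom G G" using endo_hom[OF H] xc by auto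
  have "bij_betw (endo H x) (carrier G) (carrier G)"
    by (rule bij_betw_byWitness[where f' = "endo H ?z"]) (use a b c in \<open>auto simp: hom_def\<close>)
  then show ?thesis using c by (simp add: iso_def)
qed

lemma conj_basis_eq_endo:
  assumes H: "fp H" and c: "\<And>j. c j \<in> carrier G" and i: "i \<in> {1..n}"
  shows "endo H c ` H i = conj_basis c H i"
  using endo_letter[OF H c i] by (auto simp: conj_basis_def)

lemma conj_basis_fp:
  assumes H: "fp H" and x: "is_move H k x" shows "fp (conj_basis x H)"
  using fp_cong[OF _ iso_free_product[OF H endo_is_move_iso[OF H x]]]
    conj_basis_eq_endo[OF H is_move_carrier[OF H x]] by auto

section \<open>Letter counts under a move\<close>

definition ind :: "bool \<Rightarrow> nat" where
  "ind P = (if P then 1 else 0)"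

text \<open>\<open>move_cost k x \<one> w\<close> is the number of letters of the factor \<open>k\<close> after the move \<open>x\<close>: the argument \<open>a\<close> collects
  the value \<open>x j\<close> of the last letter outside the factor and the letters in the factor read since then, and
  nothing is left of it iff it equals \<open>x\<close> at the next letter outside (the base point \<open>0\<close> at the end).\<close>

fun move_cost :: "nat \<Rightarrow> (nat \<Rightarrow> 'a) \<Rightarrow> 'a \<Rightarrow> (nat \<times> 'a) list \<Rightarrow> nat" where
  "move_cost k x a [] = ind (a \<noteq> x 0)"
| "move_cost k x a (p # w) = (if fst p = k then move_cost k x (a \<otimes> snd p) w
     else ind (a \<noteq> x (fst p)) + move_cost k x (x (fst p)) w)"

definition prepend_letter :: "nat \<Rightarrow> 'a \<Rightarrow> (nat \<times> 'a) list \<Rightarrow> (nat \<times> 'a) list" where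
  "prepend_letter k b w = (if b = \<one> then w else (k, b) # w)"

text \<open>Rewrites the normal form \<open>w\<close> of \<open>g\<close> into that of \<open>a \<otimes> g'\<close>, where \<open>g'\<close> is the image of \<open>g\<close> under the
  inverse of the Whitehead automorphism of \<open>x\<close>.\<close>

fun rewrite_word :: "nat \<Rightarrow> (nat \<Rightarrow> 'a) \<Rightarrow> 'a \<Rightarrow> (nat \<times> 'a) list \<Rightarrow> (nat \<times> 'a) list" where
  "rewrite_word k x a [] = prepend_letter k a []"
| "rewrite_word k x a (p # w) = (if fst p = k then rewrite_word k x (a \<otimes> snd p) w
     else prepend_letter k (a \<otimes> inv (x (fst p))) (p # rewrite_word k x (x (fst p)) w))"

lemma prepend_letter_hd: "j \<noteq> k \<Longrightarrow> w = [] \<or> fst (hd w) \<noteq> j \<Longrightarrow> prepend_letter k b w = [] \<or> fst (hd (prepend_letter k b w)) \<noteq> j"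
  by (auto simp: prepend_letter_def)

text \<open>The word rewritten after a letter of the factor \<open>j\<close> must not begin with
  \<open>j\<close> again. The only danger is a \<open>k\<close>-letter enclosed by two
  \<open>j\<close>-letters: it reappears conjugated by \<open>x j\<close>, hence does not
  vanish.\<close>

lemma rewrite_word_hd:
  assumes H: "fp H" and x: "is_move H k x" and w: "reduced_word G n H w" and j: "j \<noteq> k"
    and hd: "w = [] \<or> fst (hd w) \<noteq> j"
  shows "rewrite_word k x (x j) w = [] \<or> fst (hd (rewrite_word k x (x j) w)) \<noteq> j"
proof (cases w)
  case Nil
  then show ?thesis using j prepend_letter_hd[of j k "[]"] by simp
next
  case (Cons p w2)
  have xc: "\<And>j. x j \<in> carrier G" using is_move_carrier[OF H x] .
  show ?thesis
  proof (cases "fst p = k")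
    case False
    then show ?thesis using Cons hd prepend_letter_hd[of j k "p # rewrite_word k x (x (fst p)) w2"] j by simp
  next
    case True
    have pc: "snd p \<in> carrier G" "snd p \<noteq> \<one>"
      using w Cons fp_carrier[OF H, of "fst p" "snd p"] by auto
    show ?thesis
    proof (cases w2)
      case Nil
      then show ?thesis using j prepend_letter_hd[of j k "[]"] Cons True by simp
    next
      case c2: (Cons q w3)
      have q: "fst q \<noteq> k" using w Cons c2 True by auto
      show ?thesis
      proof (cases "fst q = j")
        case False
        then show ?thesis
          using prepend_letter_hd[of j k "q # rewrite_word k x (x (fst q)) w3"] j Cons c2 True q by simp
      next
        case qj: True
        have "x j \<otimes> snd p \<otimes> inv (x j) \<noteq> \<one>" using conj_eq_one[OF xc pc(1)] pc(2) by blast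
        then show ?thesis using Cons c2 True q qj j by (simp add: prepend_letter_def)
      qed
    qed
  qed
qed

text \<open>The state \<open>a\<close> is a pending element of \<open>H k\<close>. When a letter of
  another factor \<open>j\<close> arrives, \<open>a\<close> is emitted after multiplication by the
  inverse of \<open>x j\<close>, and \<open>x j\<close> becomes the new pending element: these are
  the two halves of the conjugation of that letter.\<close>

lemma rewrite_word_props:
  assumes H: "fp H" and x: "is_move H k x" and w: "reduced_word G n H w" and a: "a \<in> H k"
  shows "reduced_word G n H (rewrite_word k x a w) \<and>
     word_eval G (rewrite_word k x a w) = a \<otimes> endo H (\<lambda>j. inv (x j)) (word_eval G w) \<and>
     letter_count k (rewrite_word k x a w) = move_cost k x a w \<and>
     (\<forall>i. i \<noteq> k \<longrightarrow> letter_count i (rewrite_word k x a w) = letter_count i w)"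
  using w a
proof (induction w arbitrary: a)
  let ?z = "\<lambda>j. inv (x j)"
  have xc: "\<And>j. x j \<in> carrier G" using is_move_carrier[OF H x] .
  have zc: "\<And>j. ?z j \<in> carrier G" using xc by simp
  have k: "k \<in> {1..n}" "x k = \<one>" "x 0 = \<one>" using x by (auto simp: is_move_def)
  have lkr: "reduced_word G n H (prepend_letter k b w)"
    if "b \<in> H k" "reduced_word G n H w" "w = [] \<or> fst (hd w) \<noteq> k" for b w
    using that k by (auto simp: prepend_letter_def)
  have lke: "word_eval G (prepend_letter k b w) = b \<otimes> word_eval G w"
    if "b \<in> H k" "word_eval G w \<in> carrier G" for b w
    using that k fp_carrier[OF H k(1)] by (auto simp: prepend_letter_def)
  {
    case Nil
    have ac: "a \<in> carrier G" using fp_carrier[OF H k(1)] Nil by auto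
    show ?case using Nil k lkr[of a "[]"] lke[of a "[]"] ac endo_one[OF H zc] by (auto simp: prepend_letter_def ind_def)
  next
    case (Cons p w)
    have ac: "a \<in> carrier G" using fp_carrier[OF H k(1)] Cons by auto
    have p: "fst p \<in> {1..n}" "snd p \<in> H (fst p)" "snd p \<noteq> \<one>" "reduced_word G n H w"
       "w = [] \<or> fst (hd w) \<noteq> fst p" using Cons.prems by auto
    have pc: "snd p \<in> carrier G" using fp_carrier[OF H p(1,2)] .
    have wc: "word_eval G w \<in> carrier G" using reduced_eval_closed[OF H p(4)] .
    have ec: "endo H ?z (word_eval G w) \<in> carrier G" using endo_closed[OF H zc wc] .
    have em: "endo H ?z (snd p \<otimes> word_eval G w)
        = inv (x (fst p)) \<otimes> snd p \<otimes> x (fst p) \<otimes> endo H ?z (word_eval G w)"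
      using endo_letter_mult[OF H zc p(1,2) wc] xc by simp
    show ?case
    proof (cases "fst p = k")
      case True
      have "a \<otimes> snd p \<in> H k"
        using subgroup.m_closed[OF fp_subgroup[OF H k(1)]] Cons.prems p True by auto
      from Cons.IH[OF p(4) this] show ?thesis
        using True em k ac pc wc ec by (simp add: m_assoc)
    next
      case False
      let ?j = "fst p" and ?t = "rewrite_word k x (x (fst p)) w"
      have IH: "reduced_word G n H ?t"
        "word_eval G ?t = x ?j \<otimes> endo H ?z (word_eval G w)"
        "letter_count k ?t = move_cost k x (x ?j) w" "\<forall>i. i \<noteq> k \<longrightarrow> letter_count i ?t = letter_count i w"
        using Cons.IH[OF p(4) is_move_mem[OF H x]] by auto
      have b: "a \<otimes> inv (x ?j) \<in> H k"
        using is_move_mem[OF H x] Cons.prems(2) fp_subgroup[OF H k(1)]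
        by (simp add: subgroup.m_closed subgroup.m_inv_closed)
      have r: "reduced_word G n H (p # ?t)"
        using rewrite_word_hd[OF H x p(4) False p(5)] IH p by simp
      have e: "word_eval G (p # ?t) = snd p \<otimes> (x ?j \<otimes> endo H ?z (word_eval G w))"
        using IH by simp
      have ev: "word_eval G (prepend_letter k (a \<otimes> inv (x ?j)) (p # ?t)) = (a \<otimes> inv (x ?j)) \<otimes> word_eval G (p # ?t)"
        using lke[OF b] e pc xc ec by simp
      have b1: "a \<otimes> inv (x ?j) = \<one> \<longleftrightarrow> a = x ?j"
        using ac xc by (metis inv_closed inv_equality inv_inv r_inv)
      have "word_eval G (rewrite_word k x a (p # w)) = a \<otimes> endo H ?z (word_eval G (p # w))"
        using False ev e em ac xc pc ec by (simp add: m_assoc)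
      moreover have "reduced_word G n H (rewrite_word k x a (p # w))"
        using False lkr[OF b r] by simp
      moreover have "letter_count k (rewrite_word k x a (p # w)) = move_cost k x a (p # w)"
        using False IH(3) b1 by (simp add: prepend_letter_def ind_def)
      moreover have "letter_count i (rewrite_word k x a (p # w)) = letter_count i (p # w)" if "i \<noteq> k" for i
        using False IH(4) that by (auto simp: prepend_letter_def)
      ultimately show ?thesis by blast
    qed
  }
qed

text \<open>The Whitehead automorphism carries \<open>H\<close> to the moved basis, so the letters
  of \<open>g\<close> over the moved basis correspond to the letters over \<open>H\<close> of the
  preimage of \<open>g\<close>. That preimage is what \<open>rewrite_word\<close> computes.\<close>

lemma cnt_conj_basis:
  assumes H: "fp H" and x: "is_move H k x" and g: "g \<in> carrier G"
  shows cnt_conj_basis_self: "cnt G n (conj_basis x H) k g = move_cost k x \<one> (nf G n H g)"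
    and cnt_conj_basis_other: "i \<noteq> k \<Longrightarrow> cnt G n (conj_basis x H) i g = cnt G n H i g"
proof -
  let ?z = "\<lambda>j. inv (x j)"
  have xc: "\<And>j. x j \<in> carrier G" using is_move_carrier[OF H x] .
  have zc: "\<And>j. ?z j \<in> carrier G" using xc by simp
  have k: "k \<in> {1..n}" using x by (auto simp: is_move_def)
  let ?g = "endo H ?z g"
  have gc: "?g \<in> carrier G" using endo_closed[OF H zc g] .
  have T: "cnt G n (conj_basis x H) i g = cnt G n H i ?g" for i
  proof -
    have "cnt G n (conj_basis x H) i (endo H x ?g) = cnt G n H i ?g"
    proof (rule cnt_transport[OF H conj_basis_fp[OF H x] endo_hom[OF H xc] _ _ gc])
      fix i h assume i: "i \<in> {1..n}" "h \<in> H i"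
      show "endo H x h \<in> conj_basis x H i" using endo_letter[OF H xc i] i by (auto simp: conj_basis_def)
      show "endo H x h = \<one> \<Longrightarrow> h = \<one>"
        using endo_letter[OF H xc i] conj_eq_one[OF xc fp_carrier[OF H i]] by simp
    qed
    then show ?thesis using endo_is_move_inverse[OF H x g] by simp
  qed
  have o: "\<one> \<in> H k" using subgroup.one_closed[OF fp_subgroup[OF H k]] .
  have t: "reduced_word G n H (rewrite_word k x \<one> (nf G n H g))"
     "word_eval G (rewrite_word k x \<one> (nf G n H g)) = ?g"
     "letter_count k (rewrite_word k x \<one> (nf G n H g)) = move_cost k x \<one> (nf G n H g)"
     "\<And>i. i \<noteq> k \<Longrightarrow> letter_count i (rewrite_word k x \<one> (nf G n H g)) = letter_count i (nf G n H g)"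
    using rewrite_word_props[OF H x nf_reduced[OF H g] o] nf_eval[OF H g] gc by auto
  have "nf G n H ?g = rewrite_word k x \<one> (nf G n H g)" using nf_unique[OF H t(1,2)] .
  then show "cnt G n (conj_basis x H) k g = move_cost k x \<one> (nf G n H g)"
    "i \<noteq> k \<Longrightarrow> cnt G n (conj_basis x H) i g = cnt G n H i g"
    using T t(3,4) by (auto simp: cnt_def)
qed

lemma word_length_conj_basis:
  assumes H: "fp H" and x: "is_move H k x" and g: "g \<in> carrier G"
  shows "int (word_length G n (conj_basis x H) g) - int (word_length G n H g)
    = int (cnt G n (conj_basis x H) k g) - int (cnt G n H k g)"
proof -
  have k: "k \<in> {1..n}" using x by (auto simp: is_move_def)
  have "(\<Sum>i\<in>{1..n}. int (cnt G n (conj_basis x H) i g) - int (cnt G n H i g))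
      = (\<Sum>i\<in>{1..n}. if i = k then int (cnt G n (conj_basis x H) k g) - int (cnt G n H k g) else 0)"
    using cnt_conj_basis_other[OF H x g] by (intro sum.cong) auto
  then show ?thesis using k
    by (simp add: word_length_cnt[OF H g] word_length_cnt[OF conj_basis_fp[OF H x] g] sum_subtractf)
qed

section \<open>Composing moves\<close>

lemma conj_basis_conj_basis:
  assumes H: "\<And>i h. h \<in> H i \<Longrightarrow> h \<in> carrier G"
    and c: "\<And>i. c i \<in> carrier G" and d: "\<And>i. d i \<in> carrier G"
  shows "conj_basis d (conj_basis c H) = conj_basis (\<lambda>i. d i \<otimes> c i) H"
proof
  fix i
  have "(\<lambda>h. d i \<otimes> (c i \<otimes> h \<otimes> inv (c i)) \<otimes> inv (d i)) ` H i = (\<lambda>h. (d i \<otimes> c i) \<otimes> h \<otimes> inv (d i \<otimes> c i)) ` H i"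
    using conj_conj c d H by (intro image_cong) auto
  then show "conj_basis d (conj_basis c H) i = conj_basis (\<lambda>i. d i \<otimes> c i) H i" by (simp add: conj_basis_def image_image)
qed

lemma conj_basis_one:
  assumes "\<And>i h. h \<in> H i \<Longrightarrow> h \<in> carrier G" shows "conj_basis (\<lambda>i. \<one>) H = H"
  using assms by (force simp: conj_basis_def intro!: ext image_eqI)

lemma conj_basis_self:
  assumes H: "fp H" and x: "is_move H k x" shows "conj_basis x H k = H k"
proof -
  have k: "k \<in> {1..n}" "x k = \<one>" using x by (auto simp: is_move_def)
  have "(\<lambda>h. x k \<otimes> h \<otimes> inv (x k)) ` H k = id ` H k"
    using k fp_carrier[OF H k(1)] by (intro image_cong) auto
  then show ?thesis by (simp add: conj_basis_def)
qed

end

context factored_group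
begin

lemma ind_False [simp]: "ind False = 0"
  by (simp add: ind_def)

lemma is_move_mult:
  assumes H: "fp H" and x: "is_move H k x" and z: "is_move (conj_basis x H) k z"
  shows "is_move H k (\<lambda>j. z j \<otimes> x j)"
  using x z conj_basis_self[OF H x] subgroup.m_closed[OF fp_subgroup[OF H, of k]] by (auto simp: is_move_def)

lemma is_move_div:
  assumes H: "fp H" and x: "is_move H k x" and x': "is_move H k x'"
  shows "is_move (conj_basis x H) k (\<lambda>j. x' j \<otimes> inv (x j))"
  using x x' conj_basis_self[OF H x] fp_subgroup[OF H, of k]
  by (auto simp: is_move_def subgroup.m_closed subgroup.m_inv_closed)

text \<open>After a move \<open>x\<close> the factor at \<open>l\<close> is the conjugate of
  \<open>H l\<close> by \<open>x l\<close>. Conjugating the entries of a move at \<open>l\<close> by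
  the same element makes it a move of the new basis.\<close>

definition conj_by :: "'a \<Rightarrow> (nat \<Rightarrow> 'a) \<Rightarrow> nat \<Rightarrow> 'a" where
  "conj_by c y = (\<lambda>j. c \<otimes> y j \<otimes> inv c)"

lemma is_move_conj_by:
  assumes H: "fp H" and x: "is_move H k x" and y: "is_move H l y"
  shows "is_move (conj_basis x H) l (conj_by (x l) y)"
  using y is_move_carrier[OF H x] by (auto simp: is_move_def conj_basis_def conj_by_def)

lemma is_move_conj_by_inverse:
  assumes H: "fp H" and x: "is_move H k x" and y: "is_move (conj_basis x H) l y"
  shows "is_move H l (conj_by (inv (x l)) y)" "conj_by (x l) (conj_by (inv (x l)) y) = y"
proof -
  have xc: "\<And>j. x j \<in> carrier G" using is_move_carrier[OF H x] .
  have l: "l \<in> {1..n}" using y by (auto simp: is_move_def)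
  have hc: "h \<in> carrier G" if "h \<in> H l" for h using fp_carrier[OF H l that] .
  have e: "inv (x l) \<otimes> (x l \<otimes> h \<otimes> inv (x l)) \<otimes> inv (inv (x l)) = h" if "h \<in> carrier G" for h
    using conj_conj[of "x l" "inv (x l)" h] xc that by simp
  have yc: "\<And>j. y j \<in> carrier G" using is_move_carrier[OF conj_basis_fp[OF H x] y] .
  show "is_move H l (conj_by (inv (x l)) y)"
    using y xc e hc by (auto simp: is_move_def conj_basis_def conj_by_def)
  show "conj_by (x l) (conj_by (inv (x l)) y) = y"
    using conj_conj[of "inv (x l)" "x l"] xc yc by (auto simp: conj_by_def)
qed

text \<open>Two moves at distinct factors are compatible iff some labelled tree carries both.\<close>

definition compat :: "nat \<times> (nat \<Rightarrow> 'a) \<Rightarrow> nat \<times> (nat \<Rightarrow> 'a) \<Rightarrow> bool" where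
  "compat a b \<longleftrightarrow> fst a = fst b \<or>
     (\<forall>j\<le>n. j \<noteq> fst a \<longrightarrow> j \<noteq> fst b \<longrightarrow> snd a j = snd a (fst b) \<or> snd b j = snd b (fst a))"

lemma compat_sym: "compat a b \<Longrightarrow> compat b a"
  by (auto simp: compat_def)

text \<open>If \<open>x l\<close> is trivial, both composites conjugate each factor by the same
  element: away from \<open>k\<close> and \<open>l\<close>, either \<open>x j\<close> is trivial or
  \<open>y j = y k\<close>, and the two products agree in either case.\<close>

lemma conj_basis_commute_aux:
  assumes H: "fp H" and Hc: "\<And>i. i \<notin> {1..n} \<Longrightarrow> H i = {}" and x: "is_move H k x" and y: "is_move H l y"
    and kl: "k \<noteq> l" and c: "compat (k, x) (l, y)" and xl: "x l = \<one>"
  shows "conj_basis (conj_by (x l) y) (conj_basis x H) = conj_basis (conj_by (y k) x) (conj_basis y H)"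
proof -
  have xc: "\<And>j. x j \<in> carrier G" using is_move_carrier[OF H x] .
  have yc: "\<And>j. y j \<in> carrier G" using is_move_carrier[OF H y] .
  have Hcar: "\<And>i h. h \<in> H i \<Longrightarrow> h \<in> carrier G" using fp_carrier[OF H] Hc by blast
  have e: "conj_by (x l) y j \<otimes> x j = conj_by (y k) x j \<otimes> y j" if j: "j \<in> {1..n}" for j
  proof (cases "j = k \<or> j = l")
    case True
    then show ?thesis using x y xl xc yc by (auto simp: is_move_def conj_by_def m_assoc)
  next
    case False
    then have "x j = \<one> \<or> y j = y k" using c kl xl j by (auto simp: compat_def)
    then show ?thesis using xl xc yc by (auto simp: conj_by_def m_assoc simp flip: m_assoc[of "y k" "inv (y k)" "y j"])
  qed
  have "conj_basis (\<lambda>j. conj_by (x l) y j \<otimes> x j) H = conj_basis (\<lambda>j. conj_by (y k) x j \<otimes> y j) H"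
  proof
    fix i show "conj_basis (\<lambda>j. conj_by (x l) y j \<otimes> x j) H i = conj_basis (\<lambda>j. conj_by (y k) x j \<otimes> y j) H i"
      using e[of i] Hc[of i] by (cases "i \<in> {1..n}") (auto simp: conj_basis_def)
  qed
  then show ?thesis
    using conj_basis_conj_basis[where H = H and c = x and d = "conj_by (x l) y", OF Hcar] xc yc
      conj_basis_conj_basis[where H = H and c = y and d = "conj_by (y k) x", OF Hcar]
    by (simp add: conj_by_def)
qed

lemma conj_basis_commute:
  assumes H: "fp H" and Hc: "\<And>i. i \<notin> {1..n} \<Longrightarrow> H i = {}" and x: "is_move H k x" and y: "is_move H l y"
    and kl: "k \<noteq> l" and c: "compat (k, x) (l, y)"
  shows "conj_basis (conj_by (x l) y) (conj_basis x H) = conj_basis (conj_by (y k) x) (conj_basis y H)"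
proof -
  have "k \<noteq> 0" "l \<noteq> 0" using x y by (auto simp: is_move_def)
  \<comment> \<open>Compatibility at the base point \<open>0\<close>, where both moves are
    trivial.\<close>
  then have "x l = \<one> \<or> y k = \<one>"
    using c kl is_move_zero[OF x] is_move_zero[OF y] unfolding compat_def fst_conv snd_conv
    by (metis le0)
  then show ?thesis
    using conj_basis_commute_aux[OF H Hc x y kl c] conj_basis_commute_aux[OF H Hc y x] kl compat_sym[OF c] by metis
qed

text \<open>Each side is a change in the number of \<open>l\<close>-letters, and a move at
  \<open>k\<close> does not affect these numbers.\<close>

lemma word_length_commute:
  assumes H: "fp H" and Hc: "\<And>i. i \<notin> {1..n} \<Longrightarrow> H i = {}" and x: "is_move H k x" and y: "is_move H l y"
    and kl: "k \<noteq> l" and c: "compat (k, x) (l, y)" and g: "g \<in> carrier G"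
  shows "int (word_length G n (conj_basis (conj_by (x l) y) (conj_basis x H)) g) - int (word_length G n (conj_basis x H) g)
     = int (word_length G n (conj_basis y H) g) - int (word_length G n H g)"
proof -
  have fx: "fp (conj_basis x H)" and fy: "fp (conj_basis y H)" using conj_basis_fp H x y by auto
  have ax: "is_move (conj_basis x H) l (conj_by (x l) y)" and ay: "is_move (conj_basis y H) k (conj_by (y k) x)"
    using is_move_conj_by H x y by auto
  have "cnt G n (conj_basis (conj_by (x l) y) (conj_basis x H)) l g = cnt G n (conj_basis y H) l g"
    using conj_basis_commute[OF H Hc x y kl c] cnt_conj_basis_other[OF fy ay g, of l] kl by simp
  moreover have "cnt G n (conj_basis x H) l g = cnt G n H l g" using cnt_conj_basis_other[OF H x g] kl by auto
  ultimately show ?thesis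
    using word_length_conj_basis[OF fx ax g] word_length_conj_basis[OF H y g] by simp
qed

section \<open>Uncrossing two moves\<close>

text \<open>The uncrossing inequality, with the recursion of \<open>move_cost\<close> run in parallel for four functions. A letter
  \<open>k\<close> following a letter of \<open>Z\<close> saves one unit at \<open>l\<close>; the term \<open>ind (a \<noteq> a')\<close> is that credit.\<close>

context
  fixes k l :: nat and x y x' y' :: "nat \<Rightarrow> 'a" and Z :: "nat set"
  assumes kl: "k \<noteq> l" and kZ: "k \<notin> Z" and lZ: "l \<notin> Z" and k0: "k \<noteq> 0" and l0: "l \<noteq> 0"
    and x': "x' = (\<lambda>j. if j \<in> Z then x l else x j)" and y': "y' = (\<lambda>j. if j \<in> Z then y k else y j)"
    and Z: "\<And>j. j \<in> Z \<Longrightarrow> x j \<noteq> x l \<and> y j \<noteq> y k"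
begin

text \<open>A passage between \<open>Z\<close> and its complement. If the outer label agrees with
  \<open>x l\<close>, the original pair pays at \<open>k\<close>, while the uncrossed pair pays
  nothing at \<open>k\<close> and at most one unit at \<open>l\<close>; the other case is
  symmetric.\<close>

lemma uncross_pair:
  assumes "p \<notin> Z \<Longrightarrow> x p = x l \<or> y p = y k" "q \<notin> Z \<Longrightarrow> x q = x l \<or> y q = y k"
  shows "ind (x' p \<noteq> x' q) + ind (y' p \<noteq> y' q)
    \<le> (ind (x p \<noteq> x q) + ind (y p \<noteq> y q))"
proof -
  consider "p \<in> Z" "q \<in> Z" | "p \<in> Z" "q \<notin> Z" | "p \<notin> Z" "q \<in> Z" | "p \<notin> Z" "q \<notin> Z"
    by blast
  then show ?thesis
  proof cases
    case 2
    then have "x p \<noteq> x l" "y p \<noteq> y k" "x q = x l \<or> y q = y k" using Z assms by auto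
    then show ?thesis using 2 unfolding x' y' by (elim disjE) (simp_all add: ind_def)
  next
    case 3
    then have "x q \<noteq> x l" "y q \<noteq> y k" "x p = x l \<or> y p = y k" using Z assms by auto
    then show ?thesis using 3 unfolding x' y' by (elim disjE) (simp_all add: ind_def)
  qed (simp_all add: x' y' ind_def)
qed

text \<open>A \<open>k\<close>-letter leaves the state \<open>y k\<close> at \<open>l\<close> and,
  at \<open>k\<close>, a state that need not be an entry of \<open>x\<close>. Hence the two further
  clauses, for the situation after a \<open>k\<close>-letter and after an \<open>l\<close>-letter,
  with arbitrary and possibly different states in the original and the uncrossed run.\<close>

lemma uncross_move_cost:
  assumes w: "\<forall>r\<in>insert 0 (fst ` set w) - {k, l} - Z. x r = x l \<or> y r = y k"
  shows "(\<forall>p. p \<noteq> k \<longrightarrow> p \<noteq> l \<longrightarrow> (p \<notin> Z \<longrightarrow> x p = x l \<or> y p = y k) \<longrightarrow>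
           move_cost k x' (x' p) w + move_cost l y' (y' p) w \<le> move_cost k x (x p) w + move_cost l y (y p) w) \<and>
         (\<forall>a a'. move_cost k x' a' w + move_cost l y' (y k) w
             \<le> move_cost k x a w + move_cost l y (y k) w + ind (a \<noteq> a')) \<and>
         (\<forall>b b'. move_cost k x' (x l) w + move_cost l y' b' w
             \<le> move_cost k x (x l) w + move_cost l y b w + ind (b \<noteq> b'))"
  using w
proof (induction w)
  case Nil
  have 0: "0 \<notin> Z \<Longrightarrow> x 0 = x l \<or> y 0 = y k" using Nil k0 l0 by auto
  show ?case using uncross_pair[OF _ 0] Z[of 0] by (auto simp: x' y' ind_def)
next
  case (Cons q w)
  let ?j = "fst q"
  have "\<forall>r\<in>insert 0 (fst ` set w) - {k, l} - Z. x r = x l \<or> y r = y k" using Cons.prems by auto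
  note IH = Cons.IH[OF this]
  have IH1: "move_cost k x' (x' p) w + move_cost l y' (y' p) w \<le> move_cost k x (x p) w + move_cost l y (y p) w"
    if "p \<noteq> k" "p \<noteq> l" "p \<notin> Z \<Longrightarrow> x p = x l \<or> y p = y k" for p using IH that by blast
  have IH2: "move_cost k x' a' w + move_cost l y' (y k) w
      \<le> move_cost k x a w + move_cost l y (y k) w + ind (a \<noteq> a')" for a a' using IH by blast
  have IH3: "move_cost k x' (x l) w + move_cost l y' b' w
      \<le> move_cost k x (x l) w + move_cost l y b w + ind (b \<noteq> b')" for b b' using IH by blast
  have yk: "y' k = y k" and xl: "x' l = x l" using kZ lZ by (auto simp: x' y' ind_def)
  consider "?j = k" | "?j = l" "?j \<noteq> k" | "?j \<noteq> k" "?j \<noteq> l" by blast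
  then show ?case
  proof cases
    case 1
    \<comment> \<open>For \<open>p\<close> in \<open>Z\<close> the original run is charged at
      \<open>l\<close>, as \<open>y p\<close> differs from \<open>y k\<close>. The uncrossed run
      saves this unit, which pays for the different \<open>k\<close>-states in which the two runs
      read the letter.\<close>
    have a: "ind (y' p \<noteq> y k) + ind (x p \<otimes> snd q \<noteq> x' p \<otimes> snd q) \<le> (ind (y p \<noteq> y k))"
      for p using Z[of p] by (auto simp: x' y' ind_def)
    show ?thesis
    proof (intro conjI allI impI)
      fix p assume "p \<noteq> k" "p \<noteq> l" "p \<notin> Z \<longrightarrow> x p = x l \<or> y p = y k"
      show "move_cost k x' (x' p) (q # w) + move_cost l y' (y' p) (q # w) \<le> move_cost k x (x p) (q # w) + move_cost l y (y p) (q # w)"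
        using 1 kl yk IH2[of "x' p \<otimes> snd q" "x p \<otimes> snd q"] a[of p] by simp
    next
      fix a a'
      have "ind (a \<otimes> snd q \<noteq> a' \<otimes> snd q) \<le> (ind (a \<noteq> a'))" by (auto simp: ind_def)
      then show "move_cost k x' a' (q # w) + move_cost l y' (y k) (q # w)
          \<le> move_cost k x a (q # w) + move_cost l y (y k) (q # w) + ind (a \<noteq> a')"
        using 1 kl yk IH2[of "a' \<otimes> snd q" "a \<otimes> snd q"] by simp
    next
      fix b b'
      have "ind (b' \<noteq> y k) \<le> (ind (b \<noteq> y k) + ind (b \<noteq> b'))" by (auto simp: ind_def)
      then show "move_cost k x' (x l) (q # w) + move_cost l y' b' (q # w)
          \<le> move_cost k x (x l) (q # w) + move_cost l y b (q # w) + ind (b \<noteq> b')"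
        using 1 kl yk IH2[of "x l \<otimes> snd q" "x l \<otimes> snd q"] by simp
    qed
  next
    case 2
    have a: "ind (x' p \<noteq> x l) + ind (y p \<otimes> snd q \<noteq> y' p \<otimes> snd q) \<le> (ind (x p \<noteq> x l))"
      for p using Z[of p] by (auto simp: x' y' ind_def)
    show ?thesis
    proof (intro conjI allI impI)
      fix p assume "p \<noteq> k" "p \<noteq> l" "p \<notin> Z \<longrightarrow> x p = x l \<or> y p = y k"
      show "move_cost k x' (x' p) (q # w) + move_cost l y' (y' p) (q # w) \<le> move_cost k x (x p) (q # w) + move_cost l y (y p) (q # w)"
        using 2 xl IH3[of "y' p \<otimes> snd q" "y p \<otimes> snd q"] a[of p] by simp
    next
      fix a a'
      have "ind (a' \<noteq> x l) \<le> (ind (a \<noteq> x l) + ind (a \<noteq> a'))" by (auto simp: ind_def)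
      then show "move_cost k x' a' (q # w) + move_cost l y' (y k) (q # w)
          \<le> move_cost k x a (q # w) + move_cost l y (y k) (q # w) + ind (a \<noteq> a')"
        using 2 xl IH3[of "y k \<otimes> snd q" "y k \<otimes> snd q"] by simp
    next
      fix b b'
      have "ind (b \<otimes> snd q \<noteq> b' \<otimes> snd q) \<le> (ind (b \<noteq> b'))" by (auto simp: ind_def)
      then show "move_cost k x' (x l) (q # w) + move_cost l y' b' (q # w)
          \<le> move_cost k x (x l) (q # w) + move_cost l y b (q # w) + ind (b \<noteq> b')"
        using 2 xl IH3[of "b' \<otimes> snd q" "b \<otimes> snd q"] by simp
    qed
  next
    case 3
    have j: "?j \<notin> Z \<Longrightarrow> x ?j = x l \<or> y ?j = y k" using Cons.prems 3 by auto
    note i1 = IH1[OF 3 j]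
    show ?thesis
    proof (intro conjI allI impI)
      fix p assume "p \<noteq> k" "p \<noteq> l" and p: "p \<notin> Z \<longrightarrow> x p = x l \<or> y p = y k"
      show "move_cost k x' (x' p) (q # w) + move_cost l y' (y' p) (q # w) \<le> move_cost k x (x p) (q # w) + move_cost l y (y p) (q # w)"
        using 3 i1 uncross_pair[of p ?j] p j by simp
    next
      fix a a'
      have "ind (a' \<noteq> x' ?j) + ind (y k \<noteq> y' ?j)
          \<le> (ind (a \<noteq> x ?j) + ind (y k \<noteq> y ?j) + ind (a \<noteq> a'))"
        using Z[of ?j] by (auto simp: x' y' ind_def)
      then show "move_cost k x' a' (q # w) + move_cost l y' (y k) (q # w)
          \<le> move_cost k x a (q # w) + move_cost l y (y k) (q # w) + ind (a \<noteq> a')"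
        using 3 i1 by simp
    next
      fix b b'
      have "ind (x l \<noteq> x' ?j) + ind (b' \<noteq> y' ?j)
          \<le> (ind (x l \<noteq> x ?j) + ind (b \<noteq> y ?j) + ind (b \<noteq> b'))"
        using Z[of ?j] by (auto simp: x' y' ind_def)
      then show "move_cost k x' (x l) (q # w) + move_cost l y' b' (q # w)
          \<le> move_cost k x (x l) (q # w) + move_cost l y b (q # w) + ind (b \<noteq> b')"
        using 3 i1 by simp
    qed
  qed
qed

end

lemma move_cost_cong:
  assumes "x 0 = z 0" "\<And>j. j \<in> fst ` set w \<Longrightarrow> j \<noteq> k \<Longrightarrow> x j = z j"
  shows "move_cost k x a w = move_cost k z a w"
  using assms by (induction w arbitrary: a) auto

lemma move_cost_left:
  assumes c: "c \<in> carrier G" and x: "\<And>j. x j \<in> carrier G"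
    and "\<And>p. p \<in> set w \<Longrightarrow> snd p \<in> carrier G" "a \<in> carrier G"
  shows "move_cost k (\<lambda>j. c \<otimes> x j) (c \<otimes> a) w = move_cost k x a w"
  using assms(3,4)
proof (induction w arbitrary: a)
  case Nil
  then show ?case using c x by simp
next
  case (Cons p w)
  have pc: "snd p \<in> carrier G" using Cons by simp
  show ?case using Cons.IH[of "a \<otimes> snd p"] Cons.IH[of "x (fst p)"] Cons.prems c x pc
    by (simp add: m_assoc)
qed

text \<open>Uncrossing may change the entry at \<open>0\<close>. Multiplying all entries on the left
  by one element of \<open>H k\<close> restores triviality there; neither the cost, which only
  compares states, nor the partition of the labels changes.\<close>

definition normalise :: "nat \<Rightarrow> (nat \<Rightarrow> 'a) \<Rightarrow> nat \<Rightarrow> 'a" where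
  "normalise k x = (\<lambda>j. if j \<in> {1..n} \<and> j \<noteq> k then inv (x 0) \<otimes> x j else \<one>)"

lemma normalise_is_move:
  assumes H: "fp H" and k: "k \<in> {1..n}" and x: "\<And>j. x j \<in> H k"
  shows "is_move H k (normalise k x)"
  using assms fp_subgroup[OF H k]
  by (auto simp: is_move_def normalise_def subgroup.m_closed subgroup.m_inv_closed subgroup.one_closed)

lemma normalise_eq_iff:
  assumes H: "fp H" and k: "k \<in> {1..n}" and x: "\<And>j. x j \<in> H k"
    and j: "j \<le> n" "j \<noteq> k" "i \<le> n" "i \<noteq> k"
  shows "normalise k x i = normalise k x j \<longleftrightarrow> x i = x j"
proof -
  have xc: "\<And>j. x j \<in> carrier G" using fp_carrier[OF H k x] .
  have "normalise k x i = inv (x 0) \<otimes> x i" if "i \<le> n" "i \<noteq> k" for i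
    using that xc by (cases "i = 0") (auto simp: normalise_def)
  then show ?thesis using j xc by simp
qed

lemma move_cost_normalise:
  assumes H: "fp H" and k: "k \<in> {1..n}" and x: "\<And>j. x j \<in> H k" and w: "reduced_word G n H w"
  shows "move_cost k (normalise k x) \<one> w = move_cost k x (x 0) w"
proof -
  have xc: "\<And>j. x j \<in> carrier G" using fp_carrier[OF H k x] .
  have p: "fst p \<in> {1..n}" "snd p \<in> carrier G" if "p \<in> set w" for p
    using w that fp_carrier[OF H, of "fst p" "snd p"] unfolding reduced_word_def by auto
  have "move_cost k (normalise k x) \<one> w = move_cost k (\<lambda>j. inv (x 0) \<otimes> x j) \<one> w"
    using p(1) xc k by (intro move_cost_cong) (auto simp: normalise_def)
  also have "\<dots> = move_cost k (\<lambda>j. inv (x 0) \<otimes> x j) (inv (x 0) \<otimes> x 0) w" using xc by simp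
  also have "\<dots> = move_cost k x (x 0) w" using xc p by (intro move_cost_left) auto
  finally show ?thesis .
qed

text \<open>Where \<open>x\<close> leaves the petal of \<open>l\<close> and \<open>y\<close> leaves the petal of \<open>k\<close>, reset \<open>x\<close> to its value at \<open>l\<close>.\<close>

definition uncross :: "nat \<times> (nat \<Rightarrow> 'a) \<Rightarrow> nat \<times> (nat \<Rightarrow> 'a) \<Rightarrow> nat \<Rightarrow> 'a" where
  "uncross a b = normalise (fst a) (\<lambda>j. if j \<le> n \<and> j \<noteq> fst a \<and> j \<noteq> fst b \<and>
      snd a j \<noteq> snd a (fst b) \<and> snd b j \<noteq> snd b (fst a) then snd a (fst b) else snd a j)"

lemma uncross_is_move:
  assumes H: "fp H" and x: "is_move H k x" shows "is_move H k (uncross (k, x) (l, y))"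
  unfolding uncross_def fst_conv snd_conv
  by (rule normalise_is_move[OF H]) (use is_move_mem[OF H x] x in \<open>auto simp: is_move_def\<close>)

lemma uncross_eq_iff:
  fixes l y
  assumes H: "fp H" and x: "is_move H k x" and j: "j \<le> n" "j \<noteq> k" "i \<le> n" "i \<noteq> k"
  defines "u \<equiv> \<lambda>j. if j \<le> n \<and> j \<noteq> k \<and> j \<noteq> l \<and> x j \<noteq> x l \<and> y j \<noteq> y k then x l else x j"
  shows "uncross (k, x) (l, y) i = uncross (k, x) (l, y) j \<longleftrightarrow> u i = u j"
  unfolding uncross_def fst_conv snd_conv u_def using is_move_mem[OF H x] x
  by (intro normalise_eq_iff[OF H _ _ j]) (auto simp: is_move_def)

lemma uncross_compat:
  assumes H: "fp H" and x: "is_move H k x" and y: "is_move H l y" and kl: "k \<noteq> l"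
  shows "compat (k, uncross (k, x) (l, y)) (l, y)"
proof -
  have l: "l \<le> n" using y by (auto simp: is_move_def)
  have "\<forall>j\<le>n. j \<noteq> k \<longrightarrow> j \<noteq> l \<longrightarrow> uncross (k, x) (l, y) j = uncross (k, x) (l, y) l \<or> y j = y k"
  proof (intro allI impI)
    fix j assume "j \<le> n" "j \<noteq> k" "j \<noteq> l"
    then show "uncross (k, x) (l, y) j = uncross (k, x) (l, y) l \<or> y j = y k"
      using uncross_eq_iff[OF H x l kl[symmetric], of j l y] by auto
  qed
  then show ?thesis by (simp add: compat_def)
qed

text \<open>A move at \<open>k\<close> changes only the number of \<open>k\<close>-letters. So only
  the \<open>k\<close>-count of one pair of moves and the \<open>l\<close>-count of the other are
  involved; these are move costs started at the base point, the instance \<open>p = 0\<close> of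
  \<open>uncross_move_cost\<close>.\<close>

lemma uncross_length:
  assumes H: "fp H" and x: "is_move H k x" and y: "is_move H l y" and kl: "k \<noteq> l" and g: "g \<in> carrier G"
  shows "word_length G n (conj_basis (uncross (k, x) (l, y)) H) g + word_length G n (conj_basis (uncross (l, y) (k, x)) H) g
    \<le> word_length G n (conj_basis x H) g + word_length G n (conj_basis y H) g"
proof -
  define Z where "Z = {j. j \<le> n \<and> j \<noteq> k \<and> j \<noteq> l \<and> x j \<noteq> x l \<and> y j \<noteq> y k}"
  define x' where "x' = (\<lambda>j. if j \<in> Z then x l else x j)"
  define y' where "y' = (\<lambda>j. if j \<in> Z then y k else y j)"
  let ?w = "nf G n H g"
  have k: "k \<in> {1..n}" and l: "l \<in> {1..n}" using x y by (auto simp: is_move_def)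
  have w: "reduced_word G n H ?w" using nf_reduced[OF H g] .
  have ux: "uncross (k, x) (l, y) = normalise k x'"
    unfolding uncross_def x'_def Z_def fst_conv snd_conv
    by (intro arg_cong[where f = "normalise k"] ext) auto
  have uy: "uncross (l, y) (k, x) = normalise l y'"
    unfolding uncross_def y'_def Z_def fst_conv snd_conv
    by (intro arg_cong[where f = "normalise l"] ext) auto
  have mx: "\<And>j. x' j \<in> H k" and my: "\<And>j. y' j \<in> H l"
    using is_move_mem[OF H x] is_move_mem[OF H y] by (auto simp: x'_def y'_def)
  have ax: "is_move H k (normalise k x')" and ay: "is_move H l (normalise l y')"
    using normalise_is_move[OF H k mx] normalise_is_move[OF H l my] by auto
  have wl: "\<forall>r\<in>insert 0 (fst ` set ?w) - {k, l} - Z. x r = x l \<or> y r = y k"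
  proof
    fix r assume r: "r \<in> insert 0 (fst ` set ?w) - {k, l} - Z"
    then have "r \<le> n" using w by (auto simp: reduced_word_def)
    then show "x r = x l \<or> y r = y k" using r by (auto simp: Z_def)
  qed
  have "\<forall>p. p \<noteq> k \<longrightarrow> p \<noteq> l \<longrightarrow> (p \<notin> Z \<longrightarrow> x p = x l \<or> y p = y k) \<longrightarrow>
     move_cost k x' (x' p) ?w + move_cost l y' (y' p) ?w \<le> move_cost k x (x p) ?w + move_cost l y (y p) ?w"
    by (rule uncross_move_cost[THEN conjunct1, OF kl _ _ _ _ x'_def y'_def _ wl]) (use k l in \<open>auto simp: Z_def\<close>)
  moreover have "0 \<notin> Z \<longrightarrow> x 0 = x l \<or> y 0 = y k" using wl k l by auto
  ultimately have "move_cost k x' (x' 0) ?w + move_cost l y' (y' 0) ?w \<le> move_cost k x (x 0) ?w + move_cost l y (y 0) ?w"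
    using k l by auto
  then have "cnt G n (conj_basis (normalise k x') H) k g + cnt G n (conj_basis (normalise l y') H) l g
      \<le> cnt G n (conj_basis x H) k g + cnt G n (conj_basis y H) l g"
    using cnt_conj_basis_self[OF H ax g] cnt_conj_basis_self[OF H ay g] cnt_conj_basis_self[OF H x g] cnt_conj_basis_self[OF H y g]
      move_cost_normalise[OF H k mx w] move_cost_normalise[OF H l my w] is_move_zero[OF x] is_move_zero[OF y] by simp
  then show ?thesis unfolding ux uy
    using word_length_conj_basis[OF H ax g] word_length_conj_basis[OF H ay g] word_length_conj_basis[OF H x g]
      word_length_conj_basis[OF H y g] by linarith
qed

end

section \<open>Normal forms of products and inverses\<close>

lemma reduced_word_append:
  "reduced_word G n H (v @ w) \<longleftrightarrow> reduced_word G n H v \<and> reduced_word G n H w \<and>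
     (v = [] \<or> w = [] \<or> fst (last v) \<noteq> fst (hd w))"
  by (induction v) (auto simp: hd_append)

context factored_group
begin

lemma inv_mult_cancel:
  assumes "a \<in> carrier G" "b \<in> carrier G"
  shows "inv a \<otimes> (a \<otimes> b) = b" "a \<otimes> (inv a \<otimes> b) = b"
  using assms by (simp_all flip: m_assoc)

lemma word_eval_append:
  assumes "fp H" "reduced_word G n H v" "reduced_word G n H w"
  shows "word_eval G (v @ w) = word_eval G v \<otimes> word_eval G w"
  using assms(2)
proof (induction v)
  case Nil
  then show ?case using reduced_eval_closed[OF assms(1,3)] by simp
next
  case (Cons p v)
  then show ?case using fp_carrier[OF assms(1), of "fst p" "snd p"] reduced_eval_closed[OF assms(1)] assms(3)
    by (simp add: m_assoc)
qed

lemma nf_mult: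
  assumes H: "fp H" and g: "g \<in> carrier G" and h: "h \<in> carrier G"
    and "nf G n H g = [] \<or> nf G n H h = [] \<or> fst (last (nf G n H g)) \<noteq> fst (hd (nf G n H h))"
  shows "nf G n H (g \<otimes> h) = nf G n H g @ nf G n H h"
  by (rule nf_unique[OF H])
     (use assms nf_reduced[OF H] nf_eval[OF H] word_eval_append[OF H] in \<open>auto simp: reduced_word_append\<close>)

lemma nf_inv:
  assumes H: "fp H" and g: "g \<in> carrier G"
  shows "nf G n H (inv g) = rev (map (\<lambda>p. (fst p, inv (snd p))) (nf G n H g))"
proof -
  have "reduced_word G n H (rev (map (\<lambda>p. (fst p, inv (snd p))) w)) \<and>
      word_eval G (rev (map (\<lambda>p. (fst p, inv (snd p))) w)) = inv (word_eval G w)"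
    if "reduced_word G n H w" for w
    using that
  proof (induction w)
    case (Cons p w)
    let ?r = "rev (map (\<lambda>p. (fst p, inv (snd p))) w)"
    have p: "fst p \<in> {1..n}" "snd p \<in> H (fst p)" "snd p \<noteq> \<one>" "reduced_word G n H w" using Cons by auto
    have pc: "snd p \<in> carrier G" using fp_carrier[OF H p(1,2)] .
    have s: "reduced_word G n H [(fst p, inv (snd p))]"
      using p pc subgroup.m_inv_closed[OF fp_subgroup[OF H p(1)] p(2)] by simp
    have "last ?r = (\<lambda>p. (fst p, inv (snd p))) (hd w)" if "w \<noteq> []"
      using that by (simp add: last_rev hd_map)
    then have "reduced_word G n H (?r @ [(fst p, inv (snd p))])"
      unfolding reduced_word_append using Cons s by auto
    moreover have "word_eval G (?r @ [(fst p, inv (snd p))]) = inv (word_eval G w) \<otimes> inv (snd p)"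
      using word_eval_append[OF H _ s, of ?r] Cons p pc by simp
    ultimately show ?case using pc p(4) reduced_eval_closed[OF H] by (simp add: inv_mult_group)
  qed simp
  from this[OF nf_reduced[OF H g]] show ?thesis
    using nf_unique[OF H] nf_eval[OF H g] by metis
qed

lemma word_length_mult_le:
  assumes H: "fp H" and g: "g \<in> carrier G" and h: "h \<in> carrier G"
  shows "word_length G n H (g \<otimes> h) \<le> word_length G n H g + word_length G n H h"
proof -
  have "length (nf G n H (word_eval G w \<otimes> h)) \<le> length w + length (nf G n H h)"
    if "reduced_word G n H w" for w
    using that
  proof (induction w)
    case (Cons p w)
    have p: "fst p \<in> {1..n}" "snd p \<in> H (fst p)" "reduced_word G n H w" using Cons by auto
    have c: "snd p \<in> carrier G" "word_eval G w \<in> carrier G"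
      using fp_carrier[OF H p(1,2)] reduced_eval_closed[OF H p(3)] by auto
    have "nf G n H (word_eval G (p # w) \<otimes> h) = lmul (fst p) (snd p) (nf G n H (word_eval G w \<otimes> h))"
      using nf_lmul[OF H p(1,2), of "word_eval G w \<otimes> h"] c h by (simp add: m_assoc)
    moreover have "length (lmul i a v) \<le> Suc (length v)" for i a v
      by (auto simp: lmul_def split: list.split)
    ultimately have "length (nf G n H (word_eval G (p # w) \<otimes> h)) \<le> Suc (length (nf G n H (word_eval G w \<otimes> h)))"
      by metis
    then show ?case using Cons.IH[OF p(3)] by simp
  qed (use h in simp)
  from this[OF nf_reduced[OF H g]] show ?thesis by (simp add: word_length_nf nf_eval[OF H g])
qed

end

section \<open>Bases and adjacency by moves\<close>

locale free_factors = factored_group G n for G (structure) and n +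
  fixes Gs :: "nat \<Rightarrow> 'a set"
  assumes Gs: "is_free_product G n Gs"
    and Gs_finite: "i \<in> {1..n} \<Longrightarrow> finite (Gs i)"
    and Gs_nontrivial: "i \<in> {1..n} \<Longrightarrow> Gs i \<noteq> {\<one>}"
begin

abbreviation "bas \<equiv> is_basis G n Gs"

lemma bas_fp: "bas H \<Longrightarrow> fp H"
  by (simp add: is_basis_def)

lemma bas_off: "bas H \<Longrightarrow> i \<notin> {1..n} \<Longrightarrow> H i = {}"
  unfolding is_basis_def by blast

lemma bas_carrier: "bas H \<Longrightarrow> h \<in> H i \<Longrightarrow> h \<in> carrier G"
  using fp_carrier[OF bas_fp, of H i h] bas_off[of H i] by (cases "i \<in> {1..n}") auto

lemma bas_from_Gs:
  assumes "bas H"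
  obtains c where "\<And>j. c j \<in> carrier G" "\<And>j. j \<in> {1..n} \<Longrightarrow> H j = (\<lambda>h. c j \<otimes> h \<otimes> inv (c j)) ` Gs j"
proof -
  have "\<forall>j. \<exists>g. g \<in> carrier G \<and> (j \<in> {1..n} \<longrightarrow> H j = (\<lambda>h. g \<otimes> h \<otimes> inv g) ` Gs j)"
    using assms one_closed unfolding is_basis_def conjugate_subgroups_def by blast
  then show ?thesis using that by metis
qed

lemma bas_finite: "bas H \<Longrightarrow> finite (H i)"
  using bas_from_Gs[of H] Gs_finite bas_off[of H i] by (metis finite.emptyI finite_imageI)

lemma bas_nontrivial:
  assumes "bas H" "i \<in> {1..n}" obtains h where "h \<in> H i" "h \<noteq> \<one>"
proof -
  obtain c where c: "\<And>j. c j \<in> carrier G"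
     "\<And>j. j \<in> {1..n} \<Longrightarrow> H j = (\<lambda>h. c j \<otimes> h \<otimes> inv (c j)) ` Gs j" using bas_from_Gs[OF assms(1)] by metis
  have "\<one> \<in> Gs i" using subgroup.one_closed[OF fp_subgroup[OF Gs assms(2)]] .
  then obtain h where h: "h \<in> Gs i" "h \<noteq> \<one>" using Gs_nontrivial[OF assms(2)] by blast
  have "c i \<otimes> h \<otimes> inv (c i) \<noteq> \<one>"
    using conj_eq_one[OF c(1) fp_carrier[OF Gs assms(2) h(1)]] h(2) by blast
  then show ?thesis using that c(2)[OF assms(2)] h(1) by blast
qed

lemma bas_conj:
  assumes "bas H" "bas K"
  obtains d where "\<And>j. d j \<in> carrier G" "H = conj_basis d K"
proof -
  obtain c where c: "\<And>j. c j \<in> carrier G"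
     "\<And>j. j \<in> {1..n} \<Longrightarrow> H j = (\<lambda>h. c j \<otimes> h \<otimes> inv (c j)) ` Gs j" using bas_from_Gs[OF assms(1)] by metis
  obtain e where e: "\<And>j. e j \<in> carrier G"
     "\<And>j. j \<in> {1..n} \<Longrightarrow> K j = (\<lambda>h. e j \<otimes> h \<otimes> inv (e j)) ` Gs j" using bas_from_Gs[OF assms(2)] by metis
  have "H j = conj_basis (\<lambda>j. c j \<otimes> inv (e j)) K j" for j
  proof (cases "j \<in> {1..n}")
    case True
    have "(c j \<otimes> inv (e j)) \<otimes> (e j \<otimes> h \<otimes> inv (e j)) \<otimes> inv (c j \<otimes> inv (e j)) = c j \<otimes> h \<otimes> inv (c j)"
      if "h \<in> carrier G" for h
      using conj_conj[of "e j" "c j \<otimes> inv (e j)" h] c(1)[of j] e(1)[of j] that by (simp add: m_assoc)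
    then show ?thesis using fp_carrier[OF Gs True] c(2)[OF True] e(2)[OF True]
      by (simp add: conj_basis_def image_image)
  qed (use bas_off[OF assms(1)] bas_off[OF assms(2)] in \<open>simp add: conj_basis_def\<close>)
  then show ?thesis using that[of "\<lambda>j. c j \<otimes> inv (e j)"] c(1) e(1) by blast
qed

lemma bas_conj_basis:
  assumes H: "bas H" and x: "is_move H k x" shows "bas (conj_basis x H)"
  unfolding is_basis_def
proof (intro conjI ballI allI impI)
  show "fp (conj_basis x H)" using conj_basis_fp[OF bas_fp[OF H] x] .
  fix i assume i: "i \<in> {1..n}"
  obtain c where c: "\<And>j. c j \<in> carrier G"
     "\<And>j. j \<in> {1..n} \<Longrightarrow> H j = (\<lambda>h. c j \<otimes> h \<otimes> inv (c j)) ` Gs j" using bas_from_Gs[OF H] by metis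
  have "conj_basis x H i = (\<lambda>h. (x i \<otimes> c i) \<otimes> h \<otimes> inv (x i \<otimes> c i)) ` Gs i"
    using c conj_conj[OF c(1) is_move_carrier[OF bas_fp[OF H] x]] fp_carrier[OF Gs i] i
    by (simp add: conj_basis_def image_image)
  then show "conjugate_subgroups G (conj_basis x H i) (Gs i)"
    using c(1) is_move_carrier[OF bas_fp[OF H] x] unfolding conjugate_subgroups_def by blast
qed (use bas_off[OF H] in \<open>auto simp: conj_basis_def\<close>)

definition adjacent :: "(nat \<Rightarrow> 'a set) \<Rightarrow> (nat \<Rightarrow> 'a set) \<Rightarrow> bool" where
  "adjacent H K \<longleftrightarrow> (\<exists>k x. is_move H k x \<and> K = conj_basis x H)"

lemma adjacent_bas: "bas H \<Longrightarrow> adjacent H K \<Longrightarrow> bas K"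
  unfolding adjacent_def using bas_conj_basis by blast

lemma conj_basis_comp:
  "bas H \<Longrightarrow> (\<And>i. c i \<in> carrier G) \<Longrightarrow> (\<And>i. d i \<in> carrier G) \<Longrightarrow> conj_basis d (conj_basis c H) = conj_basis (\<lambda>i. d i \<otimes> c i) H"
  using conj_basis_conj_basis[of H c d] bas_carrier[of H] by blast

lemma conj_basis_div:
  assumes H: "bas H" and x: "is_move H k x" and y: "is_move H l y"
  shows "conj_basis (\<lambda>j. y j \<otimes> inv (x j)) (conj_basis x H) = conj_basis y H"
proof -
  have "x j \<in> carrier G" "y j \<in> carrier G" for j using is_move_carrier[OF bas_fp[OF H]] x y by auto
  then show ?thesis using conj_basis_comp[OF H, of x "\<lambda>j. y j \<otimes> inv (x j)"] by (simp add: m_assoc)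
qed

text \<open>A move at \<open>k\<close> does not change \<open>H k\<close>, and the quotient of two
  moves at \<open>k\<close> has its entries in \<open>H k\<close>; it is therefore a move of the
  intermediate basis.\<close>

lemma adjacent_same:
  assumes H: "bas H" and x: "is_move H k x" and y: "is_move H k y" shows "adjacent (conj_basis x H) (conj_basis y H)"
  using is_move_div[OF bas_fp[OF H] x y] conj_basis_div[OF H x y] unfolding adjacent_def by metis

lemma is_move_one: "k \<in> {1..n} \<Longrightarrow> fp H \<Longrightarrow> is_move H k (\<lambda>j. \<one>)"
  using subgroup.one_closed[OF fp_subgroup] by (auto simp: is_move_def)

lemma conj_basis_trivial: "bas H \<Longrightarrow> conj_basis (\<lambda>j. \<one>) H = H"
  using conj_basis_one[of H] bas_carrier[of H] by blast

lemma adjacent_sym: assumes H: "bas H" and "adjacent H K" shows "adjacent K H"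
proof -
  obtain k x where x: "is_move H k x" "K = conj_basis x H" using assms by (auto simp: adjacent_def)
  have k: "k \<in> {1..n}" using x by (auto simp: is_move_def)
  show ?thesis using adjacent_same[OF H x(1) is_move_one[OF k bas_fp[OF H]]] x(2) conj_basis_trivial[OF H] by simp
qed

section \<open>Moves connect all bases\<close>

lemma conj_basis_cong: "bas K \<Longrightarrow> (\<And>j. j \<in> {1..n} \<Longrightarrow> conj_basis c K j = conj_basis d K j) \<Longrightarrow> conj_basis c K = conj_basis d K"
proof
  fix j assume "bas K" "\<And>j. j \<in> {1..n} \<Longrightarrow> conj_basis c K j = conj_basis d K j"
  then show "conj_basis c K j = conj_basis d K j" using bas_off[of K j] by (cases "j \<in> {1..n}") (auto simp: conj_basis_def)
qed

lemma subgroup_conj_self: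
  assumes S: "subgroup S G" and a: "a \<in> S" shows "(\<lambda>h. a \<otimes> h \<otimes> inv a) ` S = S"
proof
  show "(\<lambda>h. a \<otimes> h \<otimes> inv a) ` S \<subseteq> S"
    using S a by (auto simp: subgroup.m_closed subgroup.m_inv_closed)
  show "S \<subseteq> (\<lambda>h. a \<otimes> h \<otimes> inv a) ` S"
  proof
    fix s assume s: "s \<in> S"
    have c: "a \<in> carrier G" "s \<in> carrier G" using subgroup.mem_carrier[OF S] a s by auto
    have "s = a \<otimes> (inv a \<otimes> s \<otimes> a) \<otimes> inv a"
      using conj_conj[of "inv a" a s] c by simp
    moreover have "inv a \<otimes> s \<otimes> a \<in> S" using S a s by (auto simp: subgroup.m_closed subgroup.m_inv_closed)
    ultimately show "s \<in> (\<lambda>h. a \<otimes> h \<otimes> inv a) ` S" by blast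
  qed
qed

text \<open>Nielsen's cancellation argument. By \<open>a\<close> and \<open>b\<close>, conjugators
  and their quotients never begin or end in the factor whose letter they meet, so the core of every
  letter of an \<open>H\<close>-word survives in its \<open>K\<close>-normal form. Writing a letter
  of \<open>K k\<close> as an \<open>H\<close>-word therefore leaves no room for \<open>d k\<close>,
  and all conjugators are trivial.\<close>

lemma nielsen_reduced:
  assumes K: "bas K" and H: "bas H" and d: "\<And>j. d j \<in> carrier G" and HK: "H = conj_basis d K"
    and a: "\<And>j. j \<in> {1..n} \<Longrightarrow> nf G n K (d j) = [] \<or> fst (last (nf G n K (d j))) \<noteq> j"
    and b: "\<And>j k. j \<in> {1..n} \<Longrightarrow> k \<in> {1..n} \<Longrightarrow> j \<noteq> k \<Longrightarrow> nf G n K (inv (d k) \<otimes> d j) = [] \<or>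
       fst (hd (nf G n K (inv (d k) \<otimes> d j))) \<noteq> k"
  shows "H = K"
proof -
  note fK = bas_fp[OF K] and fH = bas_fp[OF H]
  let ?nf = "nf G n K"
  have P: "?nf (inv (d (fst (hd w))) \<otimes> word_eval G w) \<noteq> [] \<and>
      fst (hd (?nf (inv (d (fst (hd w))) \<otimes> word_eval G w))) = fst (hd w) \<and>
      length (?nf (inv (d (fst (hd w))) \<otimes> word_eval G w)) \<ge> length w"
    if "reduced_word G n H w" "w \<noteq> []" for w
    using that
  proof (induction w)
    case (Cons p w)
    let ?j = "fst p"
    have p: "?j \<in> {1..n}" "snd p \<in> H ?j" "snd p \<noteq> \<one>" "reduced_word G n H w" "w = [] \<or> fst (hd w) \<noteq> ?j"
      using Cons.prems by auto
    have wc: "word_eval G w \<in> carrier G" using reduced_eval_closed[OF fH p(4)] .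
    obtain t where t: "t \<in> K ?j" "snd p = d ?j \<otimes> t \<otimes> inv (d ?j)" using p(2) by (auto simp: HK conj_basis_def)
    have tc: "t \<in> carrier G" using bas_carrier[OF K t(1)] .
    have t1: "t \<noteq> \<one>" using p(3) t(2) d[of ?j] by auto
    let ?u = "inv (d ?j) \<otimes> word_eval G w"
    have uc: "?u \<in> carrier G" using d wc by simp
    have e: "inv (d ?j) \<otimes> word_eval G (p # w) = t \<otimes> ?u"
      using t(2) tc d[of ?j] wc by (simp add: m_assoc inv_mult_cancel)
    have u: "(?nf ?u = [] \<or> fst (hd (?nf ?u)) \<noteq> ?j) \<and> length (?nf ?u) \<ge> length w"
    proof (cases "w = []")
      case True
      have "fst (hd (?nf (inv (d ?j)))) \<noteq> ?j" if "?nf (inv (d ?j)) \<noteq> []"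
        using a[OF p(1)] that unfolding nf_inv[OF fK d[of ?j]] by (auto simp: hd_rev last_map)
      then show ?thesis using True d by auto
    next
      case False
      let ?i = "fst (hd w)"
      have i: "?i \<in> {1..n}" "?i \<noteq> ?j" using p(4,5) False by (cases w; auto)+
      let ?v = "inv (d ?i) \<otimes> word_eval G w" and ?m = "inv (d ?j) \<otimes> d ?i"
      have vc: "?v \<in> carrier G" "?m \<in> carrier G" using d wc by auto
      have uv: "?u = ?m \<otimes> ?v" using d wc by (simp add: m_assoc inv_mult_cancel)
      have IH: "?nf ?v \<noteq> []" "fst (hd (?nf ?v)) = ?i" "length (?nf ?v) \<ge> length w"
        using Cons.IH[OF p(4) False] by auto
      have "inv ?m = inv (d ?i) \<otimes> d ?j" using d by (simp add: inv_mult_group)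
      then have "?nf (inv ?m) = [] \<or> fst (hd (?nf (inv ?m))) \<noteq> ?i" using b[OF p(1) i(1)] i(2) by auto
      then have "?nf ?m = [] \<or> fst (last (?nf ?m)) \<noteq> ?i"
        unfolding nf_inv[OF fK vc(2)] by (auto simp: hd_rev last_map)
      then have "?nf ?u = ?nf ?m @ ?nf ?v" using nf_mult[OF fK vc(2,1)] uv IH by auto
      moreover have "?nf ?m = [] \<or> fst (hd (?nf ?m)) \<noteq> ?j" using b[OF i(1) p(1) i(2)] .
      ultimately show ?thesis using IH i(2) by (auto simp: hd_append)
    qed
    have "?nf (t \<otimes> ?u) = (?j, t) # ?nf ?u"
      using nf_lmul[OF fK p(1) t(1) uc] u t1 by (auto simp: lmul_def split: list.split)
    then show ?case using e u by simp
  qed simp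
  have "?nf (d k) = []" if k: "k \<in> {1..n}" for k
  proof -
    obtain t where t: "t \<in> K k" "t \<noteq> \<one>" using bas_nontrivial[OF K k] by metis
    have tc: "t \<in> carrier G" using bas_carrier[OF K t(1)] .
    let ?w = "nf G n H t"
    have w: "reduced_word G n H ?w" "word_eval G ?w = t" using nf_props[OF fH tc] by auto
    have w0: "?w \<noteq> []" using w(2) t(2) by auto
    let ?j = "fst (hd ?w)"
    have j: "?j \<in> {1..n}" using w(1) w0 by (cases ?w) auto
    let ?u = "inv (d ?j) \<otimes> t"
    have uc: "?u \<in> carrier G" using tc d by simp
    have u: "?nf ?u \<noteq> []" "fst (hd (?nf ?u)) = ?j" using P[OF w(1) w0] w(2) by auto
    have "?nf (d ?j \<otimes> ?u) = ?nf (d ?j) @ ?nf ?u"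
      using nf_mult[OF fK d uc] a[OF j] u by auto
    moreover have "d ?j \<otimes> ?u = t" using tc d[of ?j] by (simp flip: m_assoc)
    ultimately have "[(k, t)] = ?nf (d ?j) @ ?nf ?u" using nf_letter[OF fK k t] by simp
    then have "?nf (d ?j) = []" "?nf ?u = [(k, t)]" using u(1) by (auto simp: Cons_eq_append_conv)
    then show ?thesis using u(2) k by auto
  qed
  then have "d k = \<one>" if "k \<in> {1..n}" for k using nf_eval[OF fK d[of k]] that by auto
  then have "conj_basis d K = conj_basis (\<lambda>j. \<one>) K" by (intro conj_basis_cong[OF K]) (auto simp: conj_basis_def)
  then show ?thesis using HK conj_basis_trivial[OF K] by simp
qed

lemma adjacent_connected_aux:
  assumes K: "bas K" "bas H" "\<And>j. d j \<in> carrier G" "H = conj_basis d K"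
  shows "adjacent\<^sup>*\<^sup>* H K"
  using assms
proof (induction "\<Sum>j\<in>{1..n}. word_length G n K (d j)" arbitrary: H d rule: less_induct)
  case less
  note K = less.prems(1) and H = less.prems(2) and d = less.prems(3) and HK = less.prems(4)
  note fK = bas_fp[OF K]
  let ?nf = "nf G n K"
  have smaller: "(\<Sum>i\<in>{1..n}. word_length G n K ((d(j := e)) i)) < (\<Sum>i\<in>{1..n}. word_length G n K (d i))"
    if "j \<in> {1..n}" "word_length G n K e < word_length G n K (d j)" for j e
    by (rule sum_strict_mono_ex1) (use that in auto)
  consider (a) j where "j \<in> {1..n}" "?nf (d j) \<noteq> []" "fst (last (?nf (d j))) = j"
    | (b) j k where "j \<in> {1..n}" "k \<in> {1..n}" "j \<noteq> k" "?nf (inv (d k) \<otimes> d j) \<noteq> []"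
        "fst (hd (?nf (inv (d k) \<otimes> d j))) = k"
        "?nf (d k) = [] \<or> fst (last (?nf (d k))) \<noteq> k"
    | (c) "\<And>j. j \<in> {1..n} \<Longrightarrow> ?nf (d j) = [] \<or> fst (last (?nf (d j))) \<noteq> j"
       "\<And>j k. j \<in> {1..n} \<Longrightarrow> k \<in> {1..n} \<Longrightarrow> j \<noteq> k \<Longrightarrow> ?nf (inv (d k) \<otimes> d j) = [] \<or>
       fst (hd (?nf (inv (d k) \<otimes> d j))) \<noteq> k"
    by blast
  then show ?case
  proof cases
    case a
    obtain v t where s: "?nf (d j) = v @ [(j, t)]" using a by (metis append_butlast_last_id prod.collapse)
    have "reduced_word G n K (v @ [(j, t)])" using nf_reduced[OF fK d[of j]] s by metis
    then have r: "reduced_word G n K v" "t \<in> K j" "reduced_word G n K [(j, t)]" unfolding reduced_word_append by auto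
    let ?e = "word_eval G v"
    have ec: "?e \<in> carrier G" "t \<in> carrier G" using reduced_eval_closed[OF fK r(1)] bas_carrier[OF K r(2)] by auto
    have dj: "d j = ?e \<otimes> t"
      using word_eval_append[OF fK r(1,3)] s nf_eval[OF fK d[of j]] ec by simp
    have "?nf ?e = v" using nf_unique[OF fK r(1)] by simp
    then have "word_length G n K ?e < word_length G n K (d j)"
      using s by (simp add: word_length_nf)
    note sm = smaller[OF a(1) this]
    have "conj_basis d K = conj_basis (d(j := ?e)) K"
    proof (rule conj_basis_cong[OF K])
      fix i assume "i \<in> {1..n}"
      show "conj_basis d K i = conj_basis (d(j := ?e)) K i"
      proof (cases "i = j")
        case True
        have "(\<lambda>h. d j \<otimes> h \<otimes> inv (d j)) ` K j = (\<lambda>h. ?e \<otimes> h \<otimes> inv ?e) ` (\<lambda>h. t \<otimes> h \<otimes> inv t) ` K j"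
          unfolding image_image dj using conj_conj[OF ec(2,1)] bas_carrier[OF K] by (intro image_cong) auto
        also have "(\<lambda>h. t \<otimes> h \<otimes> inv t) ` K j = K j"
          using subgroup_conj_self[OF fp_subgroup[OF fK a(1)] r(2)] .
        finally show ?thesis using True by (simp add: conj_basis_def)
      qed (simp add: conj_basis_def)
    qed
    then have e: "H = conj_basis (d(j := ?e)) K" using HK by simp
    have "\<And>i. (d(j := ?e)) i \<in> carrier G" using d ec by simp
    from less.hyps[OF sm K H this e] show ?thesis .
  next
    case b
    let ?g = "inv (d k) \<otimes> d j"
    have gc: "?g \<in> carrier G" using d by simp
    obtain t u where tu: "?nf ?g = (k, t) # u" using b(4,5) by (cases "?nf ?g") auto
    have r: "t \<in> K k" "reduced_word G n K u" using nf_reduced[OF fK gc] tu by auto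
    have c: "t \<in> carrier G" "word_eval G u \<in> carrier G"
      using bas_carrier[OF K r(1)] reduced_eval_closed[OF fK r(2)] by auto
    have g: "?g = t \<otimes> word_eval G u" using nf_eval[OF fK gc] tu by simp
    have dj: "d j = d k \<otimes> ?g" using d[of k] d[of j] by (simp flip: m_assoc)
    have "?nf (d k \<otimes> ?g) = ?nf (d k) @ ?nf ?g" using nf_mult[OF fK d gc] b(5,6) by auto
    then have l: "word_length G n K (d j) = word_length G n K (d k) + Suc (length u)"
      using dj tu by (simp add: word_length_nf)
    let ?e = "d k \<otimes> word_eval G u"
    have "word_length G n K ?e \<le> word_length G n K (d k) + length u"
      using word_length_mult_le[OF fK d c(2), of k] nf_unique[OF fK r(2) refl] by (simp add: word_length_nf)
    then have sm: "(\<Sum>i\<in>{1..n}. word_length G n K ((d(j := ?e)) i)) < (\<Sum>i\<in>{1..n}. word_length G n K (d i))"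
      using smaller[OF b(1)] l by simp
    \<comment> \<open>In terms of \<open>K\<close> this is the inverse of the letter
      \<open>t\<close>, conjugated by \<open>d k\<close> so as to lie in \<open>H k\<close>. It
      deletes \<open>t\<close> between \<open>d k\<close> and the rest \<open>u\<close> of
      \<open>d j\<close>.\<close>
    define x where "x = (\<lambda>i. if i = j then d k \<otimes> inv t \<otimes> inv (d k) else \<one>)"
    have it: "inv t \<in> K k" using subgroup.m_inv_closed[OF fp_subgroup[OF fK b(2)] r(1)] .
    have "\<one> \<in> H k" using subgroup.one_closed[OF fp_subgroup[OF bas_fp[OF H] b(2)]] .
    then have ax: "is_move H k x" using b it by (auto simp: is_move_def x_def HK conj_basis_def)
    have xc: "\<And>i. x i \<in> carrier G" using is_move_carrier[OF bas_fp[OF H] ax] .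
    have "x j \<otimes> d j = ?e"
    proof -
      have "d j = d k \<otimes> (t \<otimes> word_eval G u)" using dj g by simp
      then show ?thesis using d[of k] c by (simp add: x_def m_assoc inv_mult_cancel)
    qed
    then have xd: "(\<lambda>i. x i \<otimes> d i) = d(j := ?e)" using d by (auto simp: x_def)
    have e: "conj_basis x H = conj_basis (d(j := ?e)) K" using conj_basis_comp[OF K d xc] xd HK by simp
    have "\<And>i. (d(j := ?e)) i \<in> carrier G" using d c by simp
    from less.hyps[OF sm K bas_conj_basis[OF H ax] this e] have "adjacent\<^sup>*\<^sup>* (conj_basis x H) K" .
    moreover have "adjacent H (conj_basis x H)" using ax by (auto simp: adjacent_def)
    ultimately show ?thesis by simp
  next
    case c
    then show ?thesis using nielsen_reduced[OF K H d HK] by auto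
  qed
qed

lemma adjacent_connected: "bas H \<Longrightarrow> bas K \<Longrightarrow> adjacent\<^sup>*\<^sup>* H K"
  using bas_conj[of H K] adjacent_connected_aux[of K H] by metis

end

section \<open>Total lengths of lists of words\<close>

context free_factors
begin

text \<open>Lists instead of sets: repetitions encode the integer weights by which a lexicographic
  norm is replaced later.\<close>

definition total_length :: "'a list \<Rightarrow> (nat \<Rightarrow> 'a set) \<Rightarrow> nat" where
  "total_length L H = (\<Sum>g\<leftarrow>L. word_length G n H g)"

lemma total_length_simps [simp]: "total_length [] H = 0" "total_length (g # L) H = word_length G n H g + total_length L H"
    "total_length (L @ M) H = total_length L H + total_length M H"
  by (auto simp: total_length_def)

lemma total_length_commute:
  assumes H: "bas H" and x: "is_move H k x" and y: "is_move H l y" and kl: "k \<noteq> l"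
    and c: "compat (k, x) (l, y)" and L: "set L \<subseteq> carrier G"
  shows "total_length L (conj_basis (conj_by (x l) y) (conj_basis x H)) + total_length L H = total_length L (conj_basis x H) + total_length L (conj_basis y H)"
  using L
proof (induction L)
  case (Cons g L)
  then show ?case using word_length_commute[OF bas_fp[OF H] bas_off[OF H] x y kl c, of g] by simp
qed simp

lemma total_length_uncross:
  assumes H: "bas H" and x: "is_move H k x" and y: "is_move H l y" and kl: "k \<noteq> l" and L: "set L \<subseteq> carrier G"
  shows "total_length L (conj_basis (uncross (k, x) (l, y)) H) + total_length L (conj_basis (uncross (l, y) (k, x)) H)
    \<le> total_length L (conj_basis x H) + total_length L (conj_basis y H)"
  using L
proof (induction L)
  case (Cons g L)
  then show ?case using uncross_length[OF bas_fp[OF H] x y kl, of g] by simp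
qed simp

section \<open>Peak reduction\<close>

lemma adjacent_square:
  assumes H: "bas H" and x: "is_move H k x" and y: "is_move H l y" and kl: "k \<noteq> l"
    and c: "compat (k, x) (l, y)" and L: "set L \<subseteq> carrier G"
  obtains z where "bas z" "adjacent (conj_basis x H) z" "adjacent z (conj_basis y H)" "total_length L z + total_length L H = total_length L (conj_basis x H) + total_length L (conj_basis y H)"
proof -
  let ?z = "conj_basis (conj_by (x l) y) (conj_basis x H)"
  have ax: "is_move (conj_basis x H) l (conj_by (x l) y)" and ay: "is_move (conj_basis y H) k (conj_by (y k) x)"
    using is_move_conj_by[OF bas_fp[OF H]] x y by auto
  have bz: "bas ?z" using bas_conj_basis[OF bas_conj_basis[OF H x] ax] .
  have "adjacent (conj_basis x H) ?z" using ax by (auto simp: adjacent_def)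
  moreover have "?z = conj_basis (conj_by (y k) x) (conj_basis y H)" using conj_basis_commute[OF bas_fp[OF H] bas_off[OF H] x y kl c] by simp
  then have "adjacent (conj_basis y H) ?z" using ay unfolding adjacent_def by blast
  then have "adjacent ?z (conj_basis y H)" using adjacent_sym[OF bas_conj_basis[OF H y]] by blast
  ultimately show ?thesis using that[OF bz] total_length_commute[OF assms] by blast
qed

text \<open>For compatible moves the fourth corner of the square lies below \<open>H\<close>,
  because the changes of length add. Otherwise the uncrossed moves have total less than twice the
  length of \<open>H\<close>, so one of them is strictly shorter. It is adjacent to the move it came
  from, having the same factor, and compatible with the other one, so a square finishes the
  detour.\<close>

lemma peak:
  assumes H: "bas H" and x: "is_move H k x" and y: "is_move H l y" and L: "set L \<subseteq> carrier G"
    and u: "total_length L (conj_basis x H) \<le> total_length L H" and w: "total_length L (conj_basis y H) < total_length L H"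
  shows "\<exists>q. successively adjacent (conj_basis x H # q @ [conj_basis y H]) \<and> (\<forall>z\<in>set q. bas z \<and> total_length L z < total_length L H)"
proof -
  have mvx: "adjacent (conj_basis a H) (conj_basis b H)" if "is_move H i a" "is_move H i b" for a b i
    using adjacent_same[OF H that] .
  consider "k = l" | "k \<noteq> l" "compat (k, x) (l, y)" | "k \<noteq> l" "total_length L (conj_basis (uncross (k, x) (l, y)) H) < total_length L H"
    | "k \<noteq> l" "total_length L (conj_basis (uncross (l, y) (k, x)) H) < total_length L H"
    using total_length_uncross[OF H x y _ L] u w by force
  then show ?thesis
  proof cases
    case 1
    then show ?thesis using mvx[OF x] y by (intro exI[of _ "[]"]) simp
  next
    case 2
    obtain z where "bas z" "adjacent (conj_basis x H) z" "adjacent z (conj_basis y H)" "total_length L z + total_length L H = total_length L (conj_basis x H) + total_length L (conj_basis y H)"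
      using adjacent_square[OF H x y 2 L] by blast
    then show ?thesis using u w by (intro exI[of _ "[z]"]) simp
  next
    case 3
    let ?x = "uncross (k, x) (l, y)"
    have ax: "is_move H k ?x" using uncross_is_move[OF bas_fp[OF H] x] .
    obtain z where "bas z" "adjacent (conj_basis ?x H) z" "adjacent z (conj_basis y H)" "total_length L z + total_length L H = total_length L (conj_basis ?x H) + total_length L (conj_basis y H)"
      using adjacent_square[OF H ax y 3(1) uncross_compat[OF bas_fp[OF H] x y 3(1)] L] by blast
    then show ?thesis using w 3 bas_conj_basis[OF H ax] mvx[OF x ax] by (intro exI[of _ "[conj_basis ?x H, z]"]) simp
  next
    case 4
    let ?y = "uncross (l, y) (k, x)"
    have ay: "is_move H l ?y" using uncross_is_move[OF bas_fp[OF H] y] .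
    obtain z where "bas z" "adjacent (conj_basis x H) z" "adjacent z (conj_basis ?y H)" "total_length L z + total_length L H = total_length L (conj_basis x H) + total_length L (conj_basis ?y H)"
      using adjacent_square[OF H x ay 4(1) compat_sym[OF uncross_compat[OF bas_fp[OF H] y x 4(1)[symmetric]]] L] by blast
    then show ?thesis using u 4 bas_conj_basis[OF H ay] mvx[OF ay y] by (intro exI[of _ "[z, conj_basis ?y H]"]) simp
  qed
qed

text \<open>Induction on the maximal norm along a path from \<open>H\<close> to \<open>K\<close> and on the number of times it is attained:
  \<open>peak\<close> bypasses the last maximum unless that is the starting point \<open>H\<close>.\<close>

lemma peak_reduction_aux:
  assumes L: "set L \<subseteq> carrier G" and p: "p \<noteq> []" "hd p = H" "successively adjacent p" "\<forall>z\<in>set p. bas z"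
    and M: "\<forall>z\<in>set p. total_length L z \<le> M" and K: "total_length L (last p) < total_length L H"
  shows "\<exists>k x. is_move H k x \<and> total_length L (conj_basis x H) < total_length L H"
  using p M K
proof (induction "(M, length (filter (\<lambda>z. total_length L z = M) p))" arbitrary: M p
    rule: wf_induct_rule[OF wf_lex_prod[OF wf_less_than wf_less_than]])
  case (1 M p)
  note IH = 1(1) and p = 1(2-5) and M = 1(6) and K = 1(7)
  show ?case
  proof (cases "\<exists>z\<in>set p. total_length L z = M")
    case False
    have "\<forall>z\<in>set p. total_length L z < M" using M False by (metis le_neq_implies_less)
    moreover from this have "M > 0" using p(1) by (cases p) auto
    ultimately have "M - 1 < M" "\<forall>z\<in>set p. total_length L z \<le> M - 1" by fastforce+
    then show ?thesis using IH[of "M - 1" p] p K by simp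
  next
    case True
    then obtain p1 v p2 where s: "p = p1 @ v # p2" "total_length L v = M" "\<forall>z\<in>set p2. total_length L z \<noteq> M"
      using split_list_last_prop[of p "\<lambda>z. total_length L z = M"] by metis
    have "total_length L H \<le> M" using M p by (metis hd_in_set)
    then have "p2 \<noteq> []" using K s by auto
    then obtain w p3 where p2: "p2 = w # p3" by (cases p2) auto
    have bv: "bas v" "bas w" using p(4) s p2 by auto
    have vw: "adjacent v w" using p(3) s p2 by (auto simp: successively_append_iff)
    have w: "total_length L w < M" using M s p2 by (auto simp: le_less)
    obtain l y where y: "is_move v l y" "w = conj_basis y v" using vw by (auto simp: adjacent_def)
    show ?thesis
    proof (cases "p1 = []")
      case True
      then have "v = H" using p s by simp
      then show ?thesis using y w s by blast
    next
      case False
      let ?u = "last p1"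
      have u: "bas ?u" "total_length L ?u \<le> M" using p(4) M s False by auto
      have "adjacent ?u v" using p(3) s False by (auto simp: successively_append_iff)
      then have "adjacent v ?u" using adjacent_sym u by blast
      then obtain k x where x: "is_move v k x" "?u = conj_basis x v" by (auto simp: adjacent_def)
      obtain q where q: "successively adjacent (?u # q @ [w])" "\<forall>z\<in>set q. bas z \<and> total_length L z < M"
        using peak[OF bv(1) x(1) y(1) L] x y u w s by auto
      let ?p = "p1 @ q @ p2"
      have s1: "successively adjacent p1" "successively adjacent p2"
        using p(3) s by (auto simp: successively_append_iff p2)
      have s2: "successively adjacent (q @ [w])" "adjacent ?u (hd (q @ p2))"
        using q(1) by (cases q; auto simp: p2)+
      have "successively adjacent (q @ p2)" using s1(2) s2(1) by (auto simp: successively_append_iff p2)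
      then have sp: "successively adjacent ?p"
        using s1(1) s2(2) unfolding successively_append_iff[of adjacent p1] by blast
      have "length (filter (\<lambda>z. total_length L z = M) ?p) < length (filter (\<lambda>z. total_length L z = M) p)"
      proof -
        have "filter (\<lambda>z. total_length L z = M) q = []" using q(2) by (auto simp: filter_empty_conv)
        then show ?thesis using s by simp
      qed
      moreover have "hd ?p = H" "last ?p = last p" using p(2) s False p2 by auto
      ultimately show ?thesis using IH[of M ?p] sp p(4) M s q(2) K False by (auto simp: le_less)
    qed
  qed
qed

lemma peak_reduction:
  assumes "bas H" "bas K" and L: "set L \<subseteq> carrier G" and "total_length L K < total_length L H"
  shows "\<exists>k x. is_move H k x \<and> total_length L (conj_basis x H) < total_length L H"
proof -
  have "\<exists>p. p \<noteq> [] \<and> hd p = H \<and> last p = K \<and> successively adjacent p \<and> (\<forall>z\<in>set p. bas z)"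
    using adjacent_connected[OF assms(1,2)]
  proof (induction rule: rtranclp_induct)
    case base
    then show ?case using assms by (intro exI[of _ "[H]"]) simp
  next
    case (step y z)
    then obtain p where p: "p \<noteq> []" "hd p = H" "last p = y" "successively adjacent p" "\<forall>z\<in>set p. bas z" by blast
    then have "bas y" by (metis last_in_set)
    then have "bas z" using step adjacent_bas by blast
    then show ?case using p step by (intro exI[of _ "p @ [z]"]) (auto simp: successively_append_iff)
  qed
  then obtain p where p: "p \<noteq> []" "hd p = H" "last p = K" "successively adjacent p" "\<forall>z\<in>set p. bas z" by blast
  have "\<forall>z\<in>set p. total_length L z \<le> Max (total_length L ` set p)" by simp
  then show ?thesis using peak_reduction_aux[OF L p(1,2,4,5)] p(3) assms(4) by blast
qed

lemma finite_is_move: "bas H \<Longrightarrow> finite {x. is_move H k x}"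
  by (rule finite_subset[OF _ finite_set_of_finite_funs[of "{1..n}" "H k" "\<one>"]])
     (auto simp: is_move_def bas_finite)

end

section \<open>Lexicographic positivity\<close>

text \<open>Positivity in the lexicographically ordered group of integer functions. Phrased for
  differences, comparisons of norms can be added and subtracted.\<close>

definition lexpos :: "'i set \<Rightarrow> ('i \<times> 'i) set \<Rightarrow> ('i \<Rightarrow> int) \<Rightarrow> bool" where
  "lexpos I r d \<longleftrightarrow> (\<exists>a\<in>I. d a > 0 \<and> (\<forall>b\<in>I. (b, a) \<in> r \<and> b \<noteq> a \<longrightarrow> d b = 0))"

lemma lex_less_lexpos: "lex_less I r f g \<longleftrightarrow> lexpos I r (\<lambda>a. int (g a) - int (f a))"
  unfolding lex_less_def lexpos_def by auto

context
  fixes I :: "'i set" and r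
  assumes wo: "well_order_on I r"
begin

lemma wo_total: "a \<in> I \<Longrightarrow> b \<in> I \<Longrightarrow> a \<noteq> b \<Longrightarrow> (a, b) \<in> r \<or> (b, a) \<in> r"
  using wo by (auto simp: well_order_on_def linear_order_on_def total_on_def)

lemma wo_trans: "(a, b) \<in> r \<Longrightarrow> (b, c) \<in> r \<Longrightarrow> (a, c) \<in> r"
  using wo by (auto simp: well_order_on_def linear_order_on_def partial_order_on_def preorder_on_def dest: transD)

lemma wo_antisym: "(a, b) \<in> r \<Longrightarrow> (b, a) \<in> r \<Longrightarrow> a = b"
  using wo by (auto simp: well_order_on_def linear_order_on_def partial_order_on_def dest: antisymD)

lemma wo_min:
  assumes "A \<subseteq> I" "A \<noteq> {}" obtains a where "a \<in> A" "\<And>b. b \<in> A \<Longrightarrow> b \<noteq> a \<Longrightarrow> (a, b) \<in> r"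
proof -
  have "wf (r - Id)" using wo by (simp add: well_order_on_def)
  then obtain a where a: "a \<in> A" "\<And>b. (b, a) \<in> r - Id \<Longrightarrow> b \<notin> A"
    using assms(2) by (metis all_not_in_conv wfE_min)
  have "(a, b) \<in> r" if "b \<in> A" "b \<noteq> a" for b
    using a that wo_total[of a b] assms(1) by blast
  then show ?thesis using that a by blast
qed

lemma lexpos_total: "a \<in> I \<Longrightarrow> d a \<noteq> 0 \<Longrightarrow> lexpos I r d \<or> lexpos I r (\<lambda>a. - d a)"
proof -
  assume a: "a \<in> I" "d a \<noteq> 0"
  obtain b where b: "b \<in> {b \<in> I. d b \<noteq> 0}" "\<And>c. c \<in> {b \<in> I. d b \<noteq> 0} \<Longrightarrow> c \<noteq> b \<Longrightarrow> (b, c) \<in> r"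
    using wo_min[of "{b \<in> I. d b \<noteq> 0}"] a by auto
  have "\<forall>c\<in>I. (c, b) \<in> r \<and> c \<noteq> b \<longrightarrow> d c = 0" using b wo_antisym by blast
  then have "lexpos I r d" if "d b > 0" using b that unfolding lexpos_def by (intro bexI[of _ b]) auto
  moreover have "lexpos I r (\<lambda>a. - d a)" if "d b < 0"
    using b that \<open>\<forall>c\<in>I. (c, b) \<in> r \<and> c \<noteq> b \<longrightarrow> d c = 0\<close> unfolding lexpos_def by (intro bexI[of _ b]) auto
  moreover have "d b \<noteq> 0" using b by simp
  ultimately show ?thesis by linarith
qed

lemma lexpos_add:
  assumes "lexpos I r d" "lexpos I r e" shows "lexpos I r (\<lambda>a. d a + e a)"
proof -
  obtain a where a: "a \<in> I" "d a > 0" "\<And>c. c \<in> I \<Longrightarrow> (c, a) \<in> r \<Longrightarrow> c \<noteq> a \<Longrightarrow> d c = 0"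
    using assms(1) unfolding lexpos_def by blast
  obtain b where b: "b \<in> I" "e b > 0" "\<And>c. c \<in> I \<Longrightarrow> (c, b) \<in> r \<Longrightarrow> c \<noteq> b \<Longrightarrow> e c = 0"
    using assms(2) unfolding lexpos_def by blast
  consider "a = b" | "a \<noteq> b" "(a, b) \<in> r" | "a \<noteq> b" "(b, a) \<in> r" using wo_total a b by blast
  then show ?thesis
  proof cases
    case 1
    then show ?thesis unfolding lexpos_def using a b by (intro bexI[of _ a]) auto
  next
    case 2
    have "d c + e c = 0" if "c \<in> I" "(c, a) \<in> r" "c \<noteq> a" for c
      using that a b 2 wo_trans[of c a b] wo_antisym[of c a] by (cases "c = b") auto
    then show ?thesis unfolding lexpos_def using a b 2 by (intro bexI[of _ a]) auto
  next
    case 3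
    have "d c + e c = 0" if "c \<in> I" "(c, b) \<in> r" "c \<noteq> b" for c
      using that a b 3 wo_trans[of c b a] wo_antisym[of c b] by (cases "c = a") auto
    then show ?thesis unfolding lexpos_def using a b 3 by (intro bexI[of _ b]) auto
  qed
qed

lemma lexpos_pos: "a \<in> I \<Longrightarrow> d a \<noteq> 0 \<Longrightarrow> (\<And>b. b \<in> I \<Longrightarrow> d b \<ge> 0) \<Longrightarrow> lexpos I r d"
proof -
  assume a: "a \<in> I" "d a \<noteq> 0" and d: "\<And>b. b \<in> I \<Longrightarrow> d b \<ge> 0"
  have "\<not> lexpos I r (\<lambda>a. - d a)"
  proof
    assume "lexpos I r (\<lambda>a. - d a)"
    then obtain b where "b \<in> I" "- d b > 0" by (auto simp: lexpos_def)
    then show False using d[of b] by simp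
  qed
  then show ?thesis using lexpos_total[of a d, OF a] by blast
qed

lemma lexpos_cong: "(\<And>a. a \<in> I \<Longrightarrow> d a = e a) \<Longrightarrow> lexpos I r d \<Longrightarrow> lexpos I r e"
proof -
  assume e: "\<And>a. a \<in> I \<Longrightarrow> d a = e a" and "lexpos I r d"
  then obtain a where "a \<in> I" "d a > 0" "\<forall>b\<in>I. (b, a) \<in> r \<and> b \<noteq> a \<longrightarrow> d b = 0"
    by (auto simp: lexpos_def)
  then show ?thesis unfolding lexpos_def using e by (intro bexI[of _ a]) auto
qed

lemma lexpos_mono:
  assumes "lexpos I r d" "\<And>a. a \<in> I \<Longrightarrow> d a \<le> e a" shows "lexpos I r e"
proof (cases "\<forall>a\<in>I. d a = e a")
  case False
  then obtain a where "a \<in> I" "e a - d a \<noteq> 0" by auto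
  then have "lexpos I r (\<lambda>a. e a - d a)" using lexpos_pos[of a "\<lambda>a. e a - d a"] assms(2) by simp
  from lexpos_add[OF assms(1) this] show ?thesis by simp
qed (use lexpos_cong assms in blast)

lemma lexpos_add_nonneg:
  assumes d: "lexpos I r d" and e: "\<not> lexpos I r (\<lambda>a. - e a)" shows "lexpos I r (\<lambda>a. d a + e a)"
proof (cases "\<forall>a\<in>I. e a = 0")
  case True
  then show ?thesis using lexpos_cong[OF _ d] by simp
next
  case False
  then show ?thesis using lexpos_total[of _ e] e lexpos_add[OF d] by blast
qed

text \<open>The order is total and compatible with addition: a summand that is not positive can be
  subtracted without losing positivity, and the empty sum is not positive.\<close>

lemma lexpos_sum:
  assumes "finite S" "lexpos I r (\<lambda>a. \<Sum>s\<in>S. d s a)" shows "\<exists>s\<in>S. lexpos I r (d s)"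
  using assms
proof (induction S)
  case empty
  then show ?case by (simp add: lexpos_def)
next
  case (insert s S)
  show ?case
  proof (rule ccontr)
    assume c: "\<not> ?thesis"
    have "lexpos I r (\<lambda>a. (\<Sum>s\<in>insert s S. d s a) + - d s a)"
      using lexpos_add_nonneg[OF insert.prems, of "\<lambda>a. - d s a"] c by simp
    then show False using insert c by auto
  qed
qed

lemma lexpos_max:
  assumes "finite S" "S \<noteq> {}" shows "\<exists>s\<in>S. \<forall>t\<in>S. \<not> lexpos I r (\<lambda>a. d t a - d s a)"
  using assms
proof (induction rule: finite_ne_induct)
  case (singleton s)
  then show ?case by (simp add: lexpos_def)
next
  case (insert u S)
  then obtain s where s: "s \<in> S" "\<forall>t\<in>S. \<not> lexpos I r (\<lambda>a. d t a - d s a)" by blast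
  show ?case
  proof (cases "lexpos I r (\<lambda>a. d u a - d s a)")
    case False
    then show ?thesis using s by blast
  next
    case True
    have "\<not> lexpos I r (\<lambda>a. d t a - d u a)" if "t \<in> S" for t
      using lexpos_add[OF True, of "\<lambda>a. d t a - d u a"] s that by auto
    moreover have "\<not> lexpos I r (\<lambda>a. d u a - d u a)" by (simp add: lexpos_def)
    ultimately show ?thesis by blast
  qed
qed

text \<open>It suffices to weight the leading coordinates of the finitely many functions. Going
  through them from the last to the first, each new weight is taken large enough to dominate
  whatever the later coordinates contribute.\<close>

lemma lexpos_weights:
  assumes "finite D" "\<And>d. d \<in> D \<Longrightarrow> lexpos I r d"
  shows "\<exists>F (w :: 'i \<Rightarrow> nat). finite F \<and> F \<subseteq> I \<and> (\<forall>d\<in>D. (\<Sum>a\<in>F. int (w a) * d a) > 0)"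
proof -
  have *: "\<exists>w :: 'i \<Rightarrow> nat. \<forall>d\<in>D. (\<Sum>a\<in>F. int (w a) * d a) > 0"
    if "finite F" "F \<subseteq> I" "finite D"
      "\<forall>d\<in>D. \<exists>a\<in>F. d a > 0 \<and> (\<forall>b\<in>I. (b, a) \<in> r \<and> b \<noteq> a \<longrightarrow> d b = 0)" for F D
    using that
  proof (induction "card F" arbitrary: F D)
    case 0
    then have "D = {}" by auto
    then show ?case by simp
  next
    case (Suc m)
    then have "F \<noteq> {}" by auto
    then obtain a where a: "a \<in> F" "\<And>b. b \<in> F \<Longrightarrow> b \<noteq> a \<Longrightarrow> (a, b) \<in> r" using wo_min[of F] Suc by metis
    let ?F = "F - {a}" and ?D = "{d \<in> D. d a = 0}"
    have D: "\<forall>d\<in>?D. \<exists>a\<in>?F. d a > 0 \<and> (\<forall>b\<in>I. (b, a) \<in> r \<and> b \<noteq> a \<longrightarrow> d b = 0)"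
      using Suc.prems(4) by force
    have "m = card ?F" "finite ?F" "?F \<subseteq> I" "finite ?D" using Suc.hyps(2) Suc.prems(1-3) a(1) by auto
    from Suc.hyps(1)[OF this D] obtain w where w: "\<forall>d\<in>?D. (\<Sum>a\<in>?F. int (w a) * d a) > 0"
      by blast
    \<comment> \<open>Larger than the absolute value of the later contributions for every function
      of \<open>D\<close>; the summand 1 makes this strict.\<close>
    define W where "W = nat (1 + (\<Sum>d\<in>D. \<bar>\<Sum>a\<in>?F. int (w a) * d a\<bar>))"
    have W: "int W = 1 + (\<Sum>d\<in>D. \<bar>\<Sum>a\<in>?F. int (w a) * d a\<bar>)"
      unfolding W_def by (simp add: sum_nonneg)
    have S: "(\<Sum>b\<in>F. int ((w(a := W)) b) * d b) = int W * d a + (\<Sum>b\<in>?F. int (w b) * d b)" for d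
      using a(1) Suc.prems(1) by (subst sum.remove[of _ a]) (auto intro!: sum.cong)
    show ?case
    proof (intro exI[of _ "w(a := W)"] ballI)
      fix d assume d: "d \<in> D"
      show "(\<Sum>b\<in>F. int ((w(a := W)) b) * d b) > 0"
      proof (cases "d a = 0")
        case True
        then show ?thesis using w d unfolding S by simp
      next
        case False
        obtain b where b: "b \<in> F" "d b > 0" "\<forall>c\<in>I. (c, b) \<in> r \<and> c \<noteq> b \<longrightarrow> d c = 0"
          using Suc.prems(4) d by blast
        \<comment> \<open>The leading coordinate \<open>b\<close> of \<open>d\<close> cannot come
          after \<open>a\<close>, since \<open>d a\<close> is not zero, and \<open>a\<close> is the
          least element of \<open>F\<close>.\<close>
        have "b = a" using a b False Suc.prems(2) by blast
        then have da: "d a \<ge> 1" using b by simp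
        have "\<bar>\<Sum>a\<in>?F. int (w a) * d a\<bar> < int W"
          using member_le_sum[OF d, of "\<lambda>d. \<bar>\<Sum>a\<in>?F. int (w a) * d a\<bar>"] Suc.prems(3) W by simp
        moreover have "int W * d a \<ge> int W" using da by (simp add: mult_le_cancel_left1)
        ultimately show ?thesis unfolding S by linarith
      qed
    qed
  qed
  have "\<forall>d\<in>D. \<exists>a. a \<in> I \<and> d a > 0 \<and> (\<forall>b\<in>I. (b, a) \<in> r \<and> b \<noteq> a \<longrightarrow> d b = 0)"
    using assms(2) by (auto simp: lexpos_def)
  then obtain f where f: "\<forall>d\<in>D. f d \<in> I \<and> d (f d) > 0 \<and> (\<forall>b\<in>I. (b, f d) \<in> r \<and> b \<noteq> f d \<longrightarrow> d b = 0)"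
    by metis
  have "\<exists>w :: 'i \<Rightarrow> nat. \<forall>d\<in>D. (\<Sum>a\<in>f ` D. int (w a) * d a) > 0"
    by (rule *) (use f assms(1) in auto)
  moreover have "finite (f ` D)" "f ` D \<subseteq> I" using f assms(1) by auto
  ultimately show ?thesis by blast
qed

end

section \<open>The lexicographic norm of a basis\<close>

locale normed_factors = free_factors G n Gs for G (structure) and n Gs +
  fixes r :: "('a \<times> 'a) set" and L :: "'a \<Rightarrow> 'a list"
  assumes wo: "well_order_on (carrier G) r"
    and L: "g \<in> carrier G \<Longrightarrow> set (L g) \<subseteq> carrier G"
begin

abbreviation "lpos \<equiv> lexpos (carrier G) r"

text \<open>The coordinate of the norm at \<open>g\<close> is the total length of the list
  \<open>L g\<close>. With \<open>L g = [g]\<close> this is the norm of the theorem; another choice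
  of \<open>L\<close> gives the auxiliary order used for the whole complex.\<close>

definition norm_diff :: "(nat \<Rightarrow> 'a set) \<Rightarrow> (nat \<Rightarrow> 'a set) \<Rightarrow> 'a \<Rightarrow> int" where
  "norm_diff H K g = int (total_length (L g) H) - int (total_length (L g) K)"

definition nless :: "(nat \<Rightarrow> 'a set) \<Rightarrow> (nat \<Rightarrow> 'a set) \<Rightarrow> bool" where
  "nless K H \<longleftrightarrow> lpos (norm_diff H K)"

definition reductive :: "(nat \<Rightarrow> 'a set) \<Rightarrow> (nat \<times> (nat \<Rightarrow> 'a)) set" where
  "reductive H = {(k, x). is_move H k x \<and> nless (conj_basis x H) H}"

text \<open>If no move were reductive, weights could be chosen that make \<open>K\<close> shorter
  than \<open>H\<close> while every move that changes the norm lengthens \<open>H\<close>. For the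
  resulting weighted length, which takes values in the natural numbers, this contradicts
  \<open>peak_reduction\<close>.\<close>

lemma reductive_exists:
  assumes H: "bas H" and K: "bas K" and less: "nless K H"
  shows "reductive H \<noteq> {}"
proof
  assume e: "reductive H = {}"
  \<comment> \<open>Moves that change no coordinate are left out: their difference is zero, which no
    weights make positive. They do not change the weighted length either, so they cannot be the move
    found by \<open>peak_reduction\<close>.\<close>
  define MX where "MX = {x. (\<exists>k\<in>{1..n}. is_move H k x) \<and> (\<exists>g\<in>carrier G. norm_diff H (conj_basis x H) g \<noteq> 0)}"
  have "MX \<subseteq> (\<Union>k\<in>{1..n}. {x. is_move H k x})" by (auto simp: MX_def)
  then have fMX: "finite MX" using finite_is_move[OF H] by (meson finite_UN_I finite_atLeastAtMost finite_subset)
  define D where "D = insert (norm_diff H K) ((\<lambda>x g. - norm_diff H (conj_basis x H) g) ` MX)"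
  have fD: "finite D" using fMX by (simp add: D_def)
  have lp: "lpos d" if dD: "d \<in> D" for d
  proof (cases "d = norm_diff H K")
    case True
    then show ?thesis using less by (simp add: nless_def)
  next
    case False
    then obtain x where x: "x \<in> MX" "d = (\<lambda>g. - norm_diff H (conj_basis x H) g)" using dD by (auto simp: D_def)
    then obtain k g where "is_move H k x" "g \<in> carrier G" "norm_diff H (conj_basis x H) g \<noteq> 0" by (auto simp: MX_def)
    then show ?thesis using lexpos_total[OF wo, of g "norm_diff H (conj_basis x H)"] e x(2)
      by (auto simp: reductive_def nless_def)
  qed
  obtain F and w :: "'a \<Rightarrow> nat" where F: "finite F" "F \<subseteq> carrier G"
      "\<And>d. d \<in> D \<Longrightarrow> (\<Sum>a\<in>F. int (w a) * d a) > 0"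
    using lexpos_weights[OF wo fD lp] by blast
  obtain fs where fs: "set fs = F" "distinct fs" using finite_distinct_list[OF F(1)] by blast
  define M where "M = concat (map (\<lambda>g. concat (replicate (w g) (L g))) fs)"
  have Mc: "set M \<subseteq> carrier G"
  proof
    fix y assume "y \<in> set M"
    then obtain g where g: "g \<in> F" "y \<in> set (L g)" by (auto simp: M_def fs(1))
    then have "g \<in> carrier G" using F(2) by blast
    from L[OF this] g(2) show "y \<in> carrier G" by blast
  qed
  have rep: "total_length (concat (replicate m xs)) Y = m * total_length xs Y" for m xs Y
    by (induction m) auto
  have "total_length (concat (map (\<lambda>g. concat (replicate (w g) (L g))) gs)) Y = (\<Sum>g\<leftarrow>gs. w g * total_length (L g) Y)" for gs Y
    by (induction gs) (auto simp: rep)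
  then have NM: "total_length M Y = (\<Sum>g\<in>F. w g * total_length (L g) Y)" for Y
    using fs by (simp add: M_def sum_list_distinct_conv_sum_set)
  have dM: "int (total_length M Y) - int (total_length M Y') = (\<Sum>g\<in>F. int (w g) * norm_diff Y Y' g)" for Y Y'
    by (simp add: NM norm_diff_def sum_subtractf right_diff_distrib)
  have "int (total_length M H) - int (total_length M K) > 0" using F(3)[of "norm_diff H K"] unfolding dM by (simp add: D_def)
  then have "total_length M K < total_length M H" by simp
  then obtain k x where x: "is_move H k x" "total_length M (conj_basis x H) < total_length M H" using peak_reduction[OF H K Mc] by blast
  have p: "(\<Sum>g\<in>F. int (w g) * norm_diff H (conj_basis x H) g) > 0" using x(2) unfolding dM[symmetric] by simp
  have k: "k \<in> {1..n}" using x by (auto simp: is_move_def)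
  show False
  proof (cases "x \<in> MX")
    case True
    then have "(\<lambda>g. - norm_diff H (conj_basis x H) g) \<in> D" by (auto simp: D_def)
    from F(3)[OF this] have "(\<Sum>g\<in>F. int (w g) * (- norm_diff H (conj_basis x H) g)) > 0" .
    then show False using p by (simp add: sum_negf)
  next
    case False
    then have "\<forall>g\<in>F. norm_diff H (conj_basis x H) g = 0" using x(1) k F(2) by (auto simp: MX_def)
    then show False using p by simp
  qed
qed

end

text \<open>The families of petals, described without trees. The single petal at \<open>0\<close>
  expresses valence 1. The covering condition says that no vertex is separated from \<open>l\<close>
  by \<open>k\<close> and at the same time from \<open>k\<close> by \<open>l\<close>. Emptiness
  beyond \<open>n\<close> makes equality of families equality of functions.\<close>

definition compatible_family :: "nat \<Rightarrow> (nat \<Rightarrow> nat set set) \<Rightarrow> bool" where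
  "compatible_family n A \<longleftrightarrow> (\<forall>k>n. A k = {}) \<and> (\<forall>k\<le>n. partition_on ({0..n} - {k}) (A k)) \<and> A 0 = {{1..n}} \<and>
     (\<forall>k l P Q. k \<le> n \<longrightarrow> l \<le> n \<longrightarrow> k \<noteq> l \<longrightarrow> P \<in> A k \<longrightarrow> Q \<in> A l \<longrightarrow> l \<in> P \<longrightarrow> k \<in> Q \<longrightarrow> {0..n} \<subseteq> P \<union> Q)"

lemma compatible_family_partition: "compatible_family n A \<Longrightarrow> k \<le> n \<Longrightarrow> partition_on ({0..n} - {k}) (A k)"
  by (simp add: compatible_family_def)

lemma compatible_family_block_unique:
  assumes "compatible_family n A" "k \<le> n" "P \<in> A k" "Q \<in> A k" "j \<in> P" "j \<in> Q" shows "P = Q"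
proof (rule ccontr)
  assume "P \<noteq> Q"
  then have "P \<inter> Q = {}"
    using disjointD[OF partition_onD2[OF compatible_family_partition[OF assms(1,2)]] assms(3,4)] by simp
  then show False using assms(5,6) by auto
qed

lemma compatible_family_block_exists:
  assumes "compatible_family n A" "k \<le> n" "j \<le> n" "j \<noteq> k" shows "\<exists>P\<in>A k. j \<in> P"
proof -
  have "j \<in> {0..n} - {k}" using assms(3,4) by simp
  then show ?thesis unfolding partition_onD1[OF compatible_family_partition[OF assms(1,2)]] by (simp only: Union_iff)
qed

lemma compatible_family_block_subset:
  assumes "compatible_family n A" "k \<le> n" "P \<in> A k" shows "P \<subseteq> {0..n} - {k}"
  using partition_onD1[OF compatible_family_partition[OF assms(1,2)]] assms(3) by blast

lemma compatible_family_cover: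
  assumes "compatible_family n A" "k \<le> n" "l \<le> n" "k \<noteq> l" "P \<in> A k" "Q \<in> A l" "l \<in> P" "k \<in> Q" "j \<le> n"
  shows "j \<in> P \<or> j \<in> Q"
proof -
  have "{0..n} \<subseteq> P \<union> Q"
    using assms(1)[unfolded compatible_family_def, THEN conjunct2, THEN conjunct2, THEN conjunct2, rule_format, OF assms(2-8)] .
  then show ?thesis using assms(9) by auto
qed

lemma compatible_family_zero: "compatible_family n A \<Longrightarrow> A 0 = {{1..n}}"
  by (simp add: compatible_family_def)

lemma adj_in_rtrancl_sym: "(a, b) \<in> (adj_in T W)\<^sup>* \<Longrightarrow> (b, a) \<in> (adj_in T W)\<^sup>*"
proof -
  have "sym (adj_in T W)" by (auto simp: sym_def adj_in_def tadj_def)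
  then show "(a, b) \<in> (adj_in T W)\<^sup>* \<Longrightarrow> (b, a) \<in> (adj_in T W)\<^sup>*"
    using sym_rtrancl[of "adj_in T W"] by (auto simp: sym_def)
qed

lemma component_eq:
  "(a, b) \<in> (adj_in T W)\<^sup>* \<Longrightarrow> component T W a = component T W b"
  unfolding component_def by (auto intro: rtrancl_trans adj_in_rtrancl_sym)

section \<open>From trees to families\<close>

context
  fixes n :: nat and T :: ltree
  assumes n: "n \<ge> 1" and T: "pointed_labelled_tree n T"
begin

lemma tree_edge: "(k, m) \<in> snd T \<Longrightarrow> k \<le> n \<and> m \<in> fst T"
  using T unfolding pointed_labelled_tree_def by auto

lemma tree_other_neighbour:
  assumes "m \<in> fst T" obtains j where "(j, m) \<in> snd T" "j \<noteq> k"
proof -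
  have "card {j. (j, m) \<in> snd T} \<ge> 2" using T assms unfolding pointed_labelled_tree_def by auto
  then have "\<not> {j. (j, m) \<in> snd T} \<subseteq> {k}"
    using card_mono[of "{k}" "{j. (j, m) \<in> snd T}"] by auto
  then show ?thesis using that by blast
qed

abbreviation "tw k \<equiv> tverts n T - {Inl k}"

text \<open>An unlabelled vertex has valence at least 2, hence a neighbour other than
  \<open>k\<close>. So every component contains a label, and no petal is empty.\<close>

lemma tree_component_label:
  assumes "a \<in> tw k" obtains j where "j \<le> n" "j \<noteq> k" "(a, Inl j) \<in> (adj_in T (tw k))\<^sup>*"
proof (cases a)
  case (Inl j)
  then show ?thesis using that assms by (auto simp: tverts_def)
next
  case (Inr m)
  then have m: "m \<in> fst T" using assms by (auto simp: tverts_def)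
  obtain j where j: "(j, m) \<in> snd T" "j \<noteq> k" using tree_other_neighbour[OF m] by blast
  then have "(a, Inl j) \<in> adj_in T (tw k)"
    using tree_edge[OF j(1)] m Inr by (auto simp: adj_in_def tadj_def tverts_def)
  then show ?thesis using that j tree_edge by blast
qed

lemma petals_iff:
  "P \<in> petals n T k \<longleftrightarrow> (\<exists>j\<le>n. j \<noteq> k \<and> P = {i. Inl i \<in> component T (tw k) (Inl j)})"
proof
  assume "P \<in> petals n T k"
  then obtain a where a: "a \<in> tw k" "P = {i. Inl i \<in> component T (tw k) a}"
    by (auto simp: petals_def Let_def)
  obtain j where "j \<le> n" "j \<noteq> k" "(a, Inl j) \<in> (adj_in T (tw k))\<^sup>*" using tree_component_label[OF a(1)] by blast
  then show "\<exists>j\<le>n. j \<noteq> k \<and> P = {i. Inl i \<in> component T (tw k) (Inl j)}"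
    using a component_eq by metis
next
  assume "\<exists>j\<le>n. j \<noteq> k \<and> P = {i. Inl i \<in> component T (tw k) (Inl j)}"
  then obtain j where "j \<le> n" "j \<noteq> k" "P = {i. Inl i \<in> component T (tw k) (Inl j)}" by blast
  then show "P \<in> petals n T k" unfolding petals_def Let_def
    by (auto simp: tverts_def)
qed

lemma petal_mem:
  assumes "P \<in> petals n T k" "i \<in> P"
  shows "P = {j. j \<le> n \<and> j \<noteq> k \<and> (Inl i, Inl j) \<in> (adj_in T (tw k))\<^sup>*}"
proof -
  obtain j where j: "P = {i. Inl i \<in> component T (tw k) (Inl j)}"
    using assms(1) unfolding petals_iff by (elim exE conjE) (rule that)
  then have "(Inl j, Inl i) \<in> (adj_in T (tw k))\<^sup>*" using assms(2) by (simp add: component_def)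
  then have "P = {j. Inl j \<in> component T (tw k) (Inl i)}" using j component_eq by metis
  then show ?thesis by (auto simp: component_def tverts_def)
qed

lemma petals_partition: "partition_on ({0..n} - {k}) (petals n T k)"
proof -
  have sub: "P \<subseteq> {0..n} - {k}" if "P \<in> petals n T k" for P
    using petal_mem[OF that] by force
  have ex: "\<exists>P\<in>petals n T k. j \<in> P" if "j \<le> n" "j \<noteq> k" for j
  proof
    show "{i. Inl i \<in> component T (tw k) (Inl j)} \<in> petals n T k"
      unfolding petals_iff using that by (intro exI[of _ j]) simp
    show "j \<in> {i. Inl i \<in> component T (tw k) (Inl j)}" using that by (simp add: component_def tverts_def)
  qed
  have dis: "P = Q" if "P \<in> petals n T k" "Q \<in> petals n T k" "j \<in> P" "j \<in> Q" for P Q j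
    using petal_mem[OF that(1,3)] petal_mem[OF that(2,4)] by simp
  have ne: "P \<noteq> {}" if P: "P \<in> petals n T k" for P
  proof -
    obtain j where "j \<le> n" "j \<noteq> k" "P = {i. Inl i \<in> component T (tw k) (Inl j)}"
      using P unfolding petals_iff by (elim exE conjE) (rule that)
    then have "j \<in> P" by (simp add: component_def tverts_def)
    then show ?thesis by blast
  qed
  show ?thesis
  proof (rule partition_onI)
    show "\<Union> (petals n T k) = {0..n} - {k}"
    proof
      show "\<Union> (petals n T k) \<subseteq> {0..n} - {k}" using sub by (rule Union_least)
      show "{0..n} - {k} \<subseteq> \<Union> (petals n T k)"
      proof
        fix j assume "j \<in> {0..n} - {k}"
        then have "j \<le> n" "j \<noteq> k" by auto
        from ex[OF this] show "j \<in> \<Union> (petals n T k)" by (simp only: Union_iff)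
      qed
    qed
    show "disjnt P Q" if "P \<in> petals n T k" "Q \<in> petals n T k" "P \<noteq> Q" for P Q
      using dis[OF that(1,2)] that(3) by (meson disjnt_iff)
    show "{} \<notin> petals n T k" using ne[of "{}"] by (simp only: simp_thms) metis
  qed
qed

lemma tree_connected: "a \<in> tverts n T \<Longrightarrow> b \<in> tverts n T \<Longrightarrow> (a, b) \<in> (adj_in T (tverts n T))\<^sup>*"
  using T unfolding pointed_labelled_tree_def connected_in_def by blast

text \<open>Removing a leaf does not disconnect: a path through \<open>0\<close> enters and leaves
  it by its only neighbour, and the detour can be cut out.\<close>

lemma petals_zero: "petals n T 0 = {{1..n}}"
proof -
  obtain m where m: "{m. (0, m) \<in> snd T} = {m}"
    using T card_1_singletonE unfolding pointed_labelled_tree_def by metis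
  have C: "(b \<noteq> Inl 0 \<longrightarrow> (a, b) \<in> (adj_in T (tw 0))\<^sup>*) \<and> (b = Inl 0 \<longrightarrow> (a, Inr m) \<in> (adj_in T (tw 0))\<^sup>*)"
    if "a \<in> tw 0" "(a, b) \<in> (adj_in T (tverts n T))\<^sup>*" for a b
    using that(2)
  proof (induction rule: rtrancl_induct)
    case base
    then show ?case using that by auto
  next
    case (step b c)
    have bc: "b \<in> tverts n T" "c \<in> tverts n T" "tadj T b c" using step(2) by (auto simp: adj_in_def)
    show ?case
    proof (cases "c = Inl 0")
      case True
      then have "b = Inr m" using bc(3) m by (auto simp: tadj_def)
      then show ?thesis using step True by simp
    next
      case c: False
      show ?thesis
      proof (cases "b = Inl 0")
        case True
        then have "c = Inr m" using bc(3) m by (auto simp: tadj_def)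
        then show ?thesis using step True by simp
      next
        case False
        then have "(b, c) \<in> adj_in T (tw 0)" using bc c by (auto simp: adj_in_def)
        then show ?thesis using step False c by (auto intro: rtrancl_into_rtrancl)
      qed
    qed
  qed
  have e: "{i. Inl i \<in> component T (tw 0) (Inl j)} = {1..n}" if "j \<le> n" "j \<noteq> 0" for j
  proof -
    have "(Inl j, Inl i) \<in> (adj_in T (tw 0))\<^sup>*" if "i \<in> {1..n}" for i
      using C[of "Inl j" "Inl i"] tree_connected[of "Inl j" "Inl i"] that \<open>j \<le> n\<close> \<open>j \<noteq> 0\<close>
      by (auto simp: tverts_def)
    then show ?thesis by (auto simp: component_def tverts_def)
  qed
  have "P \<in> petals n T 0 \<longleftrightarrow> P = {1..n}" for P
  proof
    assume "P \<in> petals n T 0"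
    then obtain j where "j \<le> n" "j \<noteq> 0" "P = {i. Inl i \<in> component T (tw 0) (Inl j)}"
      unfolding petals_iff by (elim exE conjE) (rule that)
    then show "P = {1..n}" using e by simp
  next
    assume "P = {1..n}"
    then show "P \<in> petals n T 0" unfolding petals_iff using e[of 1] n by (intro exI[of _ 1]) simp
  qed
  then show ?thesis by (simp add: set_eq_iff)
qed

text \<open>Follow a path from \<open>k\<close> to \<open>j\<close> and consider its last visit to
  \<open>k\<close> or \<open>l\<close>. From there on it avoids the other label, so \<open>j\<close>
  is in the petal \<open>Q\<close> at \<open>l\<close> if \<open>k\<close> was visited last and in
  the petal \<open>P\<close> at \<open>k\<close> if \<open>l\<close> was.\<close>

lemma petals_cover:
  assumes "k \<le> n" "l \<le> n" "k \<noteq> l" "P \<in> petals n T k" "Q \<in> petals n T l" "l \<in> P" "k \<in> Q"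
  shows "{0..n} \<subseteq> P \<union> Q"
proof
  fix j assume j: "j \<in> {0..n}"
  have kj: "(Inl k, Inl j) \<in> (adj_in T (tverts n T))\<^sup>*"
    using tree_connected[of "Inl k" "Inl j"] assms(1) j by (auto simp: tverts_def)
  have "b = Inl k \<or> b = Inl l \<or> (Inl l, b) \<in> (adj_in T (tw k))\<^sup>* \<or>
     (Inl k, b) \<in> (adj_in T (tw l))\<^sup>*" if "(Inl k, b) \<in> (adj_in T (tverts n T))\<^sup>*" for b
    using that
  proof (induction rule: rtrancl_induct)
    case base
    then show ?case by simp
  next
    case (step b c)
    have bc: "b \<in> tverts n T" "c \<in> tverts n T" "tadj T b c" using step(2) by (auto simp: adj_in_def)
    have k: "b \<noteq> Inl k \<Longrightarrow> c \<noteq> Inl k \<Longrightarrow> (b, c) \<in> adj_in T (tw k)" using bc by (auto simp: adj_in_def)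
    have l: "b \<noteq> Inl l \<Longrightarrow> c \<noteq> Inl l \<Longrightarrow> (b, c) \<in> adj_in T (tw l)" using bc by (auto simp: adj_in_def)
    show ?case
    proof (cases "c = Inl k \<or> c = Inl l")
      case False
      then have ck: "c \<noteq> Inl k" and cl: "c \<noteq> Inl l" by auto
      consider "b = Inl k" | "b = Inl l" | "b \<noteq> Inl k" "(Inl l, b) \<in> (adj_in T (tw k))\<^sup>*"
        | "b \<noteq> Inl l" "(Inl k, b) \<in> (adj_in T (tw l))\<^sup>*" using step.IH by blast
      then show ?thesis
      proof cases
        case 1
        then show ?thesis using l[OF _ cl] assms(3) by auto
      next
        case 2
        then show ?thesis using k[OF _ ck] assms(3) by auto
      next
        case 3
        then show ?thesis using rtrancl_into_rtrancl[OF 3(2) k[OF 3(1) ck]] by simp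
      next
        case 4
        then show ?thesis using rtrancl_into_rtrancl[OF 4(2) l[OF 4(1) cl]] by simp
      qed
    qed auto
  qed
  from this[OF kj] show "j \<in> P \<union> Q"
    using assms petal_mem[OF assms(4,6)] petal_mem[OF assms(5,7)] j by auto
qed

lemma petal_family_compatible_family: "compatible_family n (petal_family n T)"
  unfolding compatible_family_def petal_family_def
  using petals_partition petals_zero petals_cover by auto

end

section \<open>From families to trees\<close>

text \<open>Root the tree at the base point \<open>0\<close>. An unlabelled vertex is then determined by its parent \<open>k\<close> and the
  petal \<open>P\<close> below it, and the parent of the label \<open>j\<close> is the smallest petal avoiding \<open>0\<close> and containing \<open>j\<close>.\<close>

definition lower_petals :: "nat \<Rightarrow> (nat \<Rightarrow> nat set set) \<Rightarrow> (nat \<times> nat set) set" where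
  "lower_petals n A = {u. fst u \<le> n \<and> snd u \<in> A (fst u) \<and> 0 \<notin> snd u}"

definition parent :: "nat \<Rightarrow> (nat \<Rightarrow> nat set set) \<Rightarrow> nat \<Rightarrow> nat \<times> nat set" where
  "parent n A j = arg_min_on (card \<circ> snd) {u \<in> lower_petals n A. j \<in> snd u}"

definition blk :: "(nat \<Rightarrow> nat set set) \<Rightarrow> nat \<Rightarrow> nat \<Rightarrow> nat set" where
  "blk A k j = (THE P. P \<in> A k \<and> j \<in> P)"

lemma blk_eq: "compatible_family n A \<Longrightarrow> k \<le> n \<Longrightarrow> P \<in> A k \<Longrightarrow> j \<in> P \<Longrightarrow> blk A k j = P"
proof -
  assume a: "compatible_family n A" "k \<le> n" "P \<in> A k" "j \<in> P"
  show ?thesis unfolding blk_def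
  proof (rule the_equality)
    show "P \<in> A k \<and> j \<in> P" using a(3,4) by (rule conjI)
    show "Q = P" if "Q \<in> A k \<and> j \<in> Q" for Q
      by (rule compatible_family_block_unique[OF a(1,2) conjunct1[OF that] a(3) conjunct2[OF that] a(4)])
  qed
qed

lemma blk_props:
  assumes "compatible_family n A" "k \<le> n" "j \<le> n" "j \<noteq> k" shows "blk A k j \<in> A k" "j \<in> blk A k j"
proof -
  obtain P where "P \<in> A k" "j \<in> P" using compatible_family_block_exists[OF assms] by blast
  then show "blk A k j \<in> A k" "j \<in> blk A k j" using blk_eq[OF assms(1,2)] by auto
qed

context
  fixes n :: nat and A :: "nat \<Rightarrow> nat set set"
  assumes n: "n \<ge> 1" and A: "compatible_family n A"
begin

lemma lower_petal_subset: "u \<in> lower_petals n A \<Longrightarrow> snd u \<subseteq> {1..n} - {fst u}"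
proof -
  assume u: "u \<in> lower_petals n A"
  then have u': "fst u \<le> n" "snd u \<in> A (fst u)" "0 \<notin> snd u" by (simp_all add: lower_petals_def)
  show ?thesis
  proof
    fix j assume j: "j \<in> snd u"
    then have "j \<in> {0..n} - {fst u}" using compatible_family_block_subset[OF A u'(1,2)] by (rule subsetD[rotated])
    moreover have "j \<noteq> 0" using j u'(3) by metis
    ultimately show "j \<in> {1..n} - {fst u}" by simp
  qed
qed

lemma finite_lower_petals: "finite (lower_petals n A)"
proof (rule finite_subset)
  show "lower_petals n A \<subseteq> {0..n} \<times> Pow {1..n}"
  proof
    fix u assume u: "u \<in> lower_petals n A"
    then have "fst u \<le> n" by (simp add: lower_petals_def)
    then show "u \<in> {0..n} \<times> Pow {1..n}" using lower_petal_subset[OF u] by (auto simp: mem_Times_iff)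
  qed
qed simp

lemma root_petal: "(0, {1..n}) \<in> lower_petals n A"
  using compatible_family_zero[OF A] by (simp add: lower_petals_def)

lemma parent_props:
  assumes "j \<in> {1..n}"
  shows "parent n A j \<in> lower_petals n A" "j \<in> snd (parent n A j)"
    "\<And>v. v \<in> lower_petals n A \<Longrightarrow> j \<in> snd v \<Longrightarrow> card (snd (parent n A j)) \<le> card (snd v)"
proof -
  let ?S = "{u \<in> lower_petals n A. j \<in> snd u}"
  have ne: "?S \<noteq> {}" using root_petal assms by force
  have fin: "finite ?S" using finite_lower_petals by simp
  have "parent n A j \<in> ?S" unfolding parent_def by (rule arg_min_if_finite(1)[OF fin ne])
  then show "parent n A j \<in> lower_petals n A" "j \<in> snd (parent n A j)" by auto
  fix v assume "v \<in> lower_petals n A" "j \<in> snd v"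
  then have v: "v \<in> ?S" by simp
  have m: "\<not> (\<exists>x\<in>?S. (card \<circ> snd) x < (card \<circ> snd) (parent n A j))"
    unfolding parent_def by (rule arg_min_if_finite(2)[OF fin ne])
  show "card (snd (parent n A j)) \<le> card (snd v)"
  proof (rule ccontr)
    assume "\<not> ?thesis"
    then have "\<exists>x\<in>?S. (card \<circ> snd) x < (card \<circ> snd) (parent n A j)" by (intro bexI[OF _ v]) simp
    with m show False by (rule notE)
  qed
qed

lemma parent_fst:
  assumes "j \<in> {1..n}" shows "fst (parent n A j) \<le> n" "fst (parent n A j) \<noteq> j"
    "snd (parent n A j) \<in> A (fst (parent n A j))" "0 \<notin> snd (parent n A j)"
    "fst (parent n A j) \<notin> snd (parent n A j)"
proof -
  note p = parent_props[OF assms]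
  show "fst (parent n A j) \<le> n" "snd (parent n A j) \<in> A (fst (parent n A j))" "0 \<notin> snd (parent n A j)"
    using p(1) by (auto simp: lower_petals_def)
  show "fst (parent n A j) \<noteq> j" "fst (parent n A j) \<notin> snd (parent n A j)"
    using lower_petal_subset[OF p(1)] p(2) by auto
qed

text \<open>Seen from a third label \<open>k\<close>, a label and the label above it lie on the same
  side. Otherwise the covering condition places \<open>k\<close> in the parent petal of
  \<open>j\<close> and shows that the petal of \<open>j\<close> at \<open>k\<close> avoids
  \<open>0\<close> and is properly contained in the parent petal, against its minimality.\<close>

lemma parent_same_block:
  assumes j: "j \<in> {1..n}" and k: "k \<le> n" "k \<noteq> j" "k \<noteq> fst (parent n A j)"
  shows "blk A k j = blk A k (fst (parent n A j))"
proof (rule ccontr)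
  let ?k = "fst (parent n A j)" and ?P = "snd (parent n A j)"
  assume ne: "blk A k j \<noteq> blk A k ?k"
  note p = parent_props[OF j] and q = parent_fst[OF j]
  have jn: "j \<le> n" using j by simp
  have R: "blk A k j \<in> A k" "j \<in> blk A k j" using blk_props[OF A k(1) jn] k by auto
  have S: "blk A k ?k \<in> A k" "?k \<in> blk A k ?k" using blk_props[OF A k(1) q(1)] k by auto
  have Q: "blk A ?k k \<in> A ?k" "k \<in> blk A ?k k" using blk_props[OF A q(1) k(1)] k by auto
  have dis: "i \<notin> blk A k ?k" if "i \<in> blk A k j" for i
    using compatible_family_block_unique[OF A k(1) R(1) S(1) that] ne by blast
  have cov: "i \<in> blk A k ?k \<or> i \<in> blk A ?k k" if "i \<le> n" for i
    using compatible_family_cover[OF A k(1) q(1) k(3) S(1) Q(1) S(2) Q(2) that] .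
  have "j \<in> blk A ?k k" using cov[OF jn] dis[OF R(2)] by blast
  then have P: "blk A ?k k = ?P" using compatible_family_block_unique[OF A q(1) Q(1) q(3) _ p(2)] by blast
  have "0 \<in> blk A k ?k" using cov[of 0] q(4) P by auto
  then have "0 \<notin> blk A k j" using dis by blast
  then have "(k, blk A k j) \<in> lower_petals n A" using k R by (simp add: lower_petals_def)
  then have c: "card ?P \<le> card (blk A k j)" using p(3)[of "(k, blk A k j)"] R by simp
  have sub: "blk A k j \<subseteq> ?P"
  proof
    fix i assume i: "i \<in> blk A k j"
    then have "i \<le> n" using compatible_family_block_subset[OF A k(1) R(1)] by auto
    then show "i \<in> ?P" using cov dis[OF i] P by auto
  qed
  moreover have "k \<in> ?P" "k \<notin> blk A k j" using Q P compatible_family_block_subset[OF A k(1) R(1)] by auto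
  ultimately have "blk A k j \<subset> ?P" by blast
  moreover have "finite ?P" using compatible_family_block_subset[OF A q(1) q(3)] finite_subset by blast
  ultimately have "card (blk A k j) < card ?P" using psubset_card_mono by blast
  then show False using c by simp
qed

text \<open>The depth of \<open>j\<close> in the rooted tree, counted in unlabelled vertices on the
  way to the root. It is the measure for climbing arguments.\<close>

definition above :: "nat \<Rightarrow> nat" where
  "above j = card {u \<in> lower_petals n A. j \<in> snd u}"

lemma above_parent:
  assumes j: "j \<in> {1..n}" shows "above (fst (parent n A j)) < above j"
  unfolding above_def
proof (rule psubset_card_mono)
  let ?k = "fst (parent n A j)"
  note p = parent_props[OF j] and q = parent_fst[OF j]
  show "finite {u \<in> lower_petals n A. j \<in> snd u}" using finite_lower_petals by simp
  have "j \<in> snd u" if u: "u \<in> lower_petals n A" "?k \<in> snd u" for u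
  proof -
    let ?i = "fst u"
    have i: "?i \<le> n" "snd u \<in> A ?i" "0 \<notin> snd u" using u by (auto simp: lower_petals_def)
    have ik: "?i \<noteq> ?k" using lower_petal_subset[OF u(1)] u(2) by auto
    have ij: "?i \<noteq> j"
    proof
      assume e: "?i = j"
      have "0 \<in> snd (parent n A j) \<or> 0 \<in> snd u"
        using compatible_family_cover[OF A q(1) _ q(2) q(3) _ p(2), of "snd u" 0] i u(2) e j by auto
      then show False using i q(4) by blast
    qed
    have "blk A ?i j = blk A ?i ?k" using parent_same_block[OF j i(1) ij ik] .
    also have "\<dots> = snd u" using blk_eq[OF A i(1,2) u(2)] .
    finally show ?thesis using blk_props(2)[OF A i(1), of j] j ij by auto
  qed
  moreover have "parent n A j \<in> {u \<in> lower_petals n A. j \<in> snd u}" "?k \<notin> snd (parent n A j)"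
    using p q by auto
  ultimately show "{u \<in> lower_petals n A. ?k \<in> snd u} \<subset> {u \<in> lower_petals n A. j \<in> snd u}" by blast
qed

context
  fixes f :: "nat \<times> nat set \<Rightarrow> nat"
  assumes f: "inj_on f (lower_petals n A)"
begin

text \<open>The injection \<open>f\<close> names the unlabelled vertices by numbers, as trees are
  encoded here. The first set of edges joins each unlabelled vertex to the label above it, the
  second each label but \<open>0\<close> to its parent.\<close>

definition tree_of :: ltree where
  "tree_of = (f ` lower_petals n A,
     (\<lambda>u. (fst u, f u)) ` lower_petals n A \<union> (\<lambda>j. (j, f (parent n A j))) ` {1..n})"

lemma tree_of_edges:
  "u \<in> lower_petals n A \<Longrightarrow> (k, f u) \<in> snd tree_of \<longleftrightarrow> k = fst u \<or> (k \<in> {1..n} \<and> parent n A k = u)"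
proof -
  assume u: "u \<in> lower_petals n A"
  have i: "f v = f u \<longleftrightarrow> v = u" if "v \<in> lower_petals n A" for v
    using inj_on_eq_iff[OF f that u] .
  show ?thesis
  proof
    assume "(k, f u) \<in> snd tree_of"
    then consider v where "v \<in> lower_petals n A" "k = fst v" "f v = f u"
      | "k \<in> {1..n}" "f (parent n A k) = f u" unfolding tree_of_def by force
    then show "k = fst u \<or> (k \<in> {1..n} \<and> parent n A k = u)"
      using i parent_props(1) by cases auto
  next
    assume "k = fst u \<or> (k \<in> {1..n} \<and> parent n A k = u)"
    then show "(k, f u) \<in> snd tree_of"
    proof
      assume "k = fst u"
      then show ?thesis using u unfolding tree_of_def by simp
    next
      assume "k \<in> {1..n} \<and> parent n A k = u"
      then show ?thesis unfolding tree_of_def snd_conv by (intro UnI2 image_eqI[of _ _ k]) auto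
    qed
  qed
qed

abbreviation "fv \<equiv> tverts n tree_of"

lemma fv_Inl: "Inl j \<in> fv \<longleftrightarrow> j \<le> n"
  by (auto simp: tverts_def)

lemma fv_Inr: "u \<in> lower_petals n A \<Longrightarrow> Inr (f u) \<in> fv"
  by (auto simp: tverts_def tree_of_def)

lemma fv_cases:
  assumes "a \<in> fv" obtains j where "a = Inl j" "j \<le> n" | u where "a = Inr (f u)" "u \<in> lower_petals n A"
  using assms by (auto simp: tverts_def tree_of_def)

lemma edge_fst:
  "u \<in> lower_petals n A \<Longrightarrow> Inr (f u) \<in> W \<Longrightarrow> Inl (fst u) \<in> W \<Longrightarrow> (Inr (f u), Inl (fst u)) \<in> adj_in tree_of W"
  using tree_of_edges[of u "fst u"] by (auto simp: adj_in_def tadj_def)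

lemma edge_parent:
  "j \<in> {1..n} \<Longrightarrow> Inl j \<in> W \<Longrightarrow> Inr (f (parent n A j)) \<in> W \<Longrightarrow> (Inl j, Inr (f (parent n A j))) \<in> adj_in tree_of W"
  using tree_of_edges[OF parent_props(1), of j j] by (auto simp: adj_in_def tadj_def)

lemma path_up:
  assumes "j \<in> {1..n}" "j \<noteq> k" "fst (parent n A j) \<noteq> k"
  shows "(Inl j, Inl (fst (parent n A j))) \<in> (adj_in tree_of (fv - {Inl k}))\<^sup>*"
proof -
  let ?W = "fv - {Inl k}"
  have m: "Inl j \<in> ?W" "Inr (f (parent n A j)) \<in> ?W" "Inl (fst (parent n A j)) \<in> ?W"
    using assms fv_Inl fv_Inr[OF parent_props(1)] parent_fst(1) by auto
  show ?thesis
    using edge_parent[OF assms(1) m(1,2)] edge_fst[OF parent_props(1)[OF assms(1)] m(2,3)] by (meson r_into_rtrancl rtrancl_into_rtrancl)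
qed

text \<open>Climbing from a label in the petal stays in the petal until the parent is
  \<open>u\<close> itself. This also yields a child of \<open>u\<close>, needed for valence
  2.\<close>

lemma reach_petal:
  assumes "u \<in> lower_petals n A" "j \<in> snd u"
  shows "(Inl j, Inr (f u)) \<in> (adj_in tree_of (fv - {Inl (fst u)}))\<^sup>* \<and> (\<exists>i\<in>{1..n}. parent n A i = u)"
  using assms(2)
proof (induction "above j" arbitrary: j rule: less_induct)
  case less
  let ?k = "fst u"
  have k: "?k \<le> n" "snd u \<in> A ?k" "0 \<notin> snd u" using assms(1) by (auto simp: lower_petals_def)
  have j: "j \<in> {1..n}" "j \<noteq> ?k" using lower_petal_subset[OF assms(1)] less by auto
  show ?case
  proof (cases "parent n A j = u")
    case True
    then have "(Inl j, Inr (f u)) \<in> adj_in tree_of (fv - {Inl ?k})"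
      using edge_parent[OF j(1), of "fv - {Inl ?k}"] j fv_Inl fv_Inr[OF assms(1)] by auto
    then show ?thesis using True j by blast
  next
    case False
    let ?i = "fst (parent n A j)"
    have ik: "?i \<noteq> ?k"
    proof
      assume e: "?i = ?k"
      have "snd (parent n A j) = snd u"
        using compatible_family_block_unique[OF A k(1) _ k(2) parent_props(2)[OF j(1)] less.prems] parent_fst(3)[OF j(1)] e by simp
      then show False using False e by (simp add: prod_eq_iff)
    qed
    have "?i \<in> snd u"
      using parent_same_block[OF j(1) k(1)] j(2) ik blk_eq[OF A k(1,2) less.prems]
        blk_props(2)[OF A k(1) parent_fst(1)[OF j(1)] ik] by auto
    from less.hyps[OF above_parent[OF j(1)] this] show ?thesis
      using path_up[OF j ik] by (meson rtrancl_trans)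
  qed
qed

lemma reach_root:
  assumes "k \<le> n" "k \<noteq> 0" "j \<le> n" "j \<noteq> k" "blk A k j = blk A k 0"
  shows "(Inl j, Inl 0) \<in> (adj_in tree_of (fv - {Inl k}))\<^sup>*"
  using assms(3-5)
proof (induction "above j" arbitrary: j rule: less_induct)
  case less
  show ?case
  proof (cases "j = 0")
    case False
    then have j: "j \<in> {1..n}" using less by simp
    let ?i = "fst (parent n A j)"
    note q = parent_fst[OF j]
    have z: "0 \<in> blk A k 0" using blk_props(2)[OF A assms(1), of 0] assms(2) by simp
    have ik: "?i \<noteq> k"
    proof
      assume e: "?i = k"
      then have "blk A k j = snd (parent n A j)"
        using blk_eq[OF A assms(1) _ parent_props(2)[OF j]] q(3) by simp
      then show False using less.prems(3) z q(4) by simp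
    qed
    have "blk A k ?i = blk A k 0"
      using parent_same_block[OF j assms(1)] less.prems ik by auto
    then have "(Inl ?i, Inl 0) \<in> (adj_in tree_of (fv - {Inl k}))\<^sup>*"
      using less.hyps[OF above_parent[OF j] q(1) ik] by blast
    then show ?thesis using path_up[OF j less.prems(2) ik] by (meson rtrancl_trans)
  qed simp
qed

lemma block_connected:
  assumes k: "k \<le> n" and P: "P \<in> A k" and ij: "i \<in> P" "j \<in> P"
  shows "(Inl i, Inl j) \<in> (adj_in tree_of (fv - {Inl k}))\<^sup>*"
proof (cases "0 \<in> P")
  case False
  then have u: "(k, P) \<in> lower_petals n A" using k P by (simp add: lower_petals_def)
  have "(Inl i, Inr (f (k, P))) \<in> (adj_in tree_of (fv - {Inl k}))\<^sup>*" "(Inl j, Inr (f (k, P))) \<in> (adj_in tree_of (fv - {Inl k}))\<^sup>*"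
    using reach_petal[OF u] ij by auto
  then show ?thesis by (meson adj_in_rtrancl_sym rtrancl_trans)
next
  case True
  have k0: "k \<noteq> 0" using True compatible_family_block_subset[OF A k P] by auto
  have b: "blk A k i = blk A k 0" "blk A k j = blk A k 0"
    using blk_eq[OF A k P] ij True by auto
  have "i \<le> n" "i \<noteq> k" "j \<le> n" "j \<noteq> k" using compatible_family_block_subset[OF A k P] ij by auto
  then show ?thesis using reach_root[OF k k0] b by (meson adj_in_rtrancl_sym rtrancl_trans)
qed

text \<open>Extends the assignment of petals at \<open>k\<close> from labels to all vertices. It is
  constant along edges that avoid \<open>k\<close>, which bounds the components of the tree without
  \<open>k\<close> from above.\<close>

definition vblk :: "nat \<Rightarrow> nat + nat \<Rightarrow> nat set" where
  "vblk k a = (case a of Inl j \<Rightarrow> blk A k j | Inr m \<Rightarrow>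
     (let u = inv_into (lower_petals n A) f m in if fst u = k then snd u else blk A k (fst u)))"

lemma vblk_Inr: "u \<in> lower_petals n A \<Longrightarrow> vblk k (Inr (f u)) = (if fst u = k then snd u else blk A k (fst u))"
  using f by (simp add: vblk_def)

lemma vblk_edge:
  assumes k: "k \<le> n" and u: "u \<in> lower_petals n A" and e: "(i, f u) \<in> snd tree_of" and i: "i \<noteq> k" "i \<le> n"
  shows "vblk k (Inl i) = vblk k (Inr (f u))"
proof -
  consider "i = fst u" | "i \<in> {1..n}" "parent n A i = u" using e tree_of_edges[OF u] by blast
  then show ?thesis
  proof cases
    case 1
    then show ?thesis using i by (simp add: vblk_Inr[OF u]) (simp add: vblk_def)
  next
    case 2
    show ?thesis
    proof (cases "fst u = k")
      case True
      then have "blk A k i = snd u"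
        using blk_eq[OF A k _ parent_props(2)[OF 2(1)]] parent_fst(3)[OF 2(1)] 2 by simp
      then show ?thesis using True by (simp add: vblk_Inr[OF u]) (simp add: vblk_def)
    next
      case False
      then show ?thesis using parent_same_block[OF 2(1) k] 2 i by (simp add: vblk_Inr[OF u]) (simp add: vblk_def)
    qed
  qed
qed

lemma vblk_path:
  assumes k: "k \<le> n" and "(a, b) \<in> (adj_in tree_of (fv - {Inl k}))\<^sup>*"
  shows "vblk k a = vblk k b"
  using assms(2)
proof (induction rule: rtrancl_induct)
  case (step b c)
  obtain i m where im: "(i, m) \<in> snd tree_of" "(b = Inl i \<and> c = Inr m) \<or> (b = Inr m \<and> c = Inl i)"
      "b \<in> fv - {Inl k}" "c \<in> fv - {Inl k}"
    using step(2) by (auto simp: adj_in_def tadj_def)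
  then have i: "i \<noteq> k" "i \<le> n" and "Inr m \<in> fv" using fv_Inl by auto
  then obtain u where u: "m = f u" "u \<in> lower_petals n A" by (auto elim: fv_cases)
  have "vblk k b = vblk k c" using vblk_edge[OF k u(2) _ i] im u by auto
  then show ?case using step by simp
qed simp

lemma tree_of_component:
  assumes k: "k \<le> n" and P: "P \<in> A k" and j: "j \<in> P"
  shows "{i. Inl i \<in> component tree_of (fv - {Inl k}) (Inl j)} = P"
proof
  show "P \<subseteq> {i. Inl i \<in> component tree_of (fv - {Inl k}) (Inl j)}"
  proof
    fix i assume i: "i \<in> P"
    then have "i \<le> n" "i \<noteq> k" using compatible_family_block_subset[OF A k P] by auto
    then show "i \<in> {i. Inl i \<in> component tree_of (fv - {Inl k}) (Inl j)}"
      using block_connected[OF k P j i] fv_Inl by (simp add: component_def)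
  qed
  show "{i. Inl i \<in> component tree_of (fv - {Inl k}) (Inl j)} \<subseteq> P"
  proof
    fix i assume "i \<in> {i. Inl i \<in> component tree_of (fv - {Inl k}) (Inl j)}"
    then have i: "i \<le> n" "i \<noteq> k" "(Inl j, Inl i) \<in> (adj_in tree_of (fv - {Inl k}))\<^sup>*"
      using fv_Inl by (auto simp: component_def)
    from vblk_path[OF k i(3)] have "blk A k i = P" using blk_eq[OF A k P j] by (simp add: vblk_def)
    then show "i \<in> P" using blk_props(2)[OF A k i(1,2)] by simp
  qed
qed

lemma tree_of_petals:
  assumes k: "k \<le> n" shows "petals n tree_of k = A k"
proof -
  have "\<exists>P\<in>A k. {i. Inl i \<in> component tree_of (fv - {Inl k}) a} = P" if a: "a \<in> fv - {Inl k}" for a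
  proof -
    obtain j where j: "j \<le> n" "j \<noteq> k" "(a, Inl j) \<in> (adj_in tree_of (fv - {Inl k}))\<^sup>*"
    proof -
      have "a \<in> fv" using a by simp
      then show ?thesis
      proof (cases rule: fv_cases)
        case (1 j)
        then show ?thesis using that a by auto
      next
        case (2 u)
        show ?thesis
        proof (cases "fst u = k")
          case False
          then have "(a, Inl (fst u)) \<in> adj_in tree_of (fv - {Inl k})"
            using edge_fst[OF 2(2), of "fv - {Inl k}"] a 2 fv_Inl by (auto simp: lower_petals_def)
          then show ?thesis using that[of "fst u"] False 2(2) by (auto simp: lower_petals_def)
        next
          case True
          have "snd u \<noteq> {}"
            using 2(2) partition_onD3[OF compatible_family_partition[OF A k]] True by (auto simp: lower_petals_def)
          then obtain i where i: "i \<in> snd u" by blast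
          have "(Inl i, a) \<in> (adj_in tree_of (fv - {Inl k}))\<^sup>*"
            using reach_petal[OF 2(2) i] True 2(1) by simp
          then have "(a, Inl i) \<in> (adj_in tree_of (fv - {Inl k}))\<^sup>*" by (rule adj_in_rtrancl_sym)
          moreover have "i \<in> {1..n} - {k}" using lower_petal_subset[OF 2(2)] i True by blast
          ultimately show ?thesis using that[of i] by auto
        qed
      qed
    qed
    show ?thesis
      using component_eq[OF j(3)] tree_of_component[OF k blk_props[OF A k j(1,2)]] blk_props(1)[OF A k j(1,2)] by metis
  qed
  then have "petals n tree_of k \<subseteq> A k" by (auto simp: petals_def Let_def)
  moreover have "A k \<subseteq> petals n tree_of k"
  proof
    fix P assume P: "P \<in> A k"
    then have "P \<noteq> {}" using partition_onD3[OF compatible_family_partition[OF A k]] by metis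
    then obtain j where j: "j \<in> P" by blast
    then have "Inl j \<in> fv - {Inl k}" using compatible_family_block_subset[OF A k P] fv_Inl by auto
    then show "P \<in> petals n tree_of k" using tree_of_component[OF k P j]
      unfolding petals_def Let_def by (intro CollectI exI[of _ "Inl j"]) simp
  qed
  ultimately show ?thesis by (rule subset_antisym)
qed

lemma tree_of_pointed: "pointed_labelled_tree n tree_of"
  unfolding pointed_labelled_tree_def
proof (intro conjI ballI)
  show "finite (fst tree_of)" using finite_lower_petals by (simp add: tree_of_def)
  show "snd tree_of \<subseteq> {0..n} \<times> fst tree_of"
    using parent_props(1) by (auto simp: tree_of_def lower_petals_def)
  show "connected_in tree_of fv"
  proof -
    have R: "(Inl j, Inl 0) \<in> (adj_in tree_of fv)\<^sup>*" if "j \<le> n" for j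
      using that
    proof (induction "above j" arbitrary: j rule: less_induct)
      case less
      show ?case
      proof (cases "j = 0")
        case False
        then have j: "j \<in> {1..n}" using less by simp
        have m: "Inl j \<in> fv" "Inr (f (parent n A j)) \<in> fv" "Inl (fst (parent n A j)) \<in> fv"
          using less.prems fv_Inl fv_Inr[OF parent_props(1)[OF j]] parent_fst(1)[OF j] by auto
        show ?thesis
          using edge_parent[OF j m(1,2)] edge_fst[OF parent_props(1)[OF j] m(2,3)]
            less.hyps[OF above_parent[OF j] parent_fst(1)[OF j]]
          by (meson converse_rtrancl_into_rtrancl)
      qed simp
    qed
    have "(a, Inl 0) \<in> (adj_in tree_of fv)\<^sup>*" if "a \<in> fv" for a
      using that
    proof (cases rule: fv_cases)
      case (1 j)
      then show ?thesis using R by simp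
    next
      case (2 u)
      then have u: "fst u \<le> n" by (simp add: lower_petals_def)
      then have "(a, Inl (fst u)) \<in> adj_in tree_of fv" using edge_fst[OF 2(2), of fv] that 2 fv_Inl by auto
      then show ?thesis using R[OF u] by (meson converse_rtrancl_into_rtrancl)
    qed
    then show ?thesis unfolding connected_in_def by (meson adj_in_rtrancl_sym rtrancl_trans)
  qed
  \<comment> \<open>Every vertex except the root \<open>0\<close> has exactly one edge leading
    upwards, and every edge arises in this way.\<close>
  show "card (snd tree_of) + 1 = card fv"
  proof -
    let ?E1 = "(\<lambda>u. (fst u, f u)) ` lower_petals n A" and ?E2 = "(\<lambda>j. (j, f (parent n A j))) ` {1..n}"
    have "inj_on (\<lambda>u. (fst u, f u)) (lower_petals n A)" using f by (auto simp: inj_on_def)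
    then have c1: "card ?E1 = card (lower_petals n A)" by (rule card_image)
    have c2: "card ?E2 = n" by (subst card_image) (auto simp: inj_on_def)
    have "?E1 \<inter> ?E2 = {}"
    proof (rule ccontr)
      assume "?E1 \<inter> ?E2 \<noteq> {}"
      then obtain e where "e \<in> ?E1" "e \<in> ?E2" by blast
      then obtain u j where u: "u \<in> lower_petals n A" "j \<in> {1..n}" "fst u = j" "f u = f (parent n A j)"
        by (elim imageE) simp
      then have "u = parent n A j" using f parent_props(1) by (auto simp: inj_on_def)
      then show False using u parent_fst(2)[OF u(2)] by simp
    qed
    then have "card (snd tree_of) = card (lower_petals n A) + n"
      using c1 c2 finite_lower_petals by (simp add: tree_of_def card_Un_disjoint)
    moreover have "card fv = (n + 1) + card (lower_petals n A)"
    proof -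
      have "card (Inl ` {0..n} :: (nat + nat) set) = n + 1" by (simp add: card_image)
      moreover have "card (Inr ` f ` lower_petals n A :: (nat + nat) set) = card (lower_petals n A)"
        using f by (simp add: card_image)
      ultimately show ?thesis using finite_lower_petals
        unfolding tverts_def tree_of_def by (subst card_Un_disjoint) auto
    qed
    ultimately show ?thesis by simp
  qed
  show "2 \<le> card {k. (k, m) \<in> snd tree_of}" if m: "m \<in> fst tree_of" for m
  proof -
    obtain u where u: "u \<in> lower_petals n A" "m = f u" using m unfolding tree_of_def fst_conv by (elim imageE)
    then have un: "fst u \<le> n" by (simp add: lower_petals_def)
    have "snd u \<noteq> {}"
      using u(1) partition_onD3[OF compatible_family_partition[OF A un]] by (auto simp: lower_petals_def)
    then obtain i where i: "i \<in> snd u" by blast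
    then obtain j where j: "j \<in> {1..n}" "parent n A j = u" using reach_petal[OF u(1)] by blast
    have ne: "j \<noteq> fst u" using parent_fst(2)[OF j(1)] j(2) by auto
    have s: "{fst u, j} \<subseteq> {k. (k, m) \<in> snd tree_of}" using tree_of_edges[OF u(1)] j u by auto
    have "{k. (k, m) \<in> snd tree_of} \<subseteq> {0..n}"
      using tree_of_edges[OF u(1)] u un by auto
    then have "finite {k. (k, m) \<in> snd tree_of}" by (rule finite_subset) simp
    from card_mono[OF this s] show ?thesis using ne by simp
  qed
  show "card {m. (0, m) \<in> snd tree_of} = 1"
  proof -
    have "{m. (0, m) \<in> snd tree_of} = {f (0, {1..n})}"
      using root_petal compatible_family_zero[OF A] by (auto simp: tree_of_def lower_petals_def image_iff)
    then show ?thesis by simp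
  qed
qed

lemma tree_of_family: "petal_family n tree_of = A"
proof
  fix k
  show "petal_family n tree_of k = A k"
    using tree_of_petals[of k] A by (cases "k \<le> n") (auto simp: petal_family_def compatible_family_def)
qed

end

end

lemma compatible_family_iff_tree:
  assumes "n \<ge> 1"
  shows "(\<exists>T. pointed_labelled_tree n T \<and> A = petal_family n T) \<longleftrightarrow> compatible_family n A"
proof
  assume "\<exists>T. pointed_labelled_tree n T \<and> A = petal_family n T"
  then show "compatible_family n A" using petal_family_compatible_family[OF assms] by blast
next
  assume A: "compatible_family n A"
  have "finite (lower_petals n A)" using finite_lower_petals[OF assms A] .
  then obtain f :: "nat \<times> nat set \<Rightarrow> nat" where f: "inj_on f (lower_petals n A)"
    using finite_imp_inj_to_nat_seg by blast
  show "\<exists>T. pointed_labelled_tree n T \<and> A = petal_family n T"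
    using tree_of_pointed[OF assms A f] tree_of_family[OF assms A f] by metis
qed

section \<open>The order on families\<close>

lemma compatible_family_block_nonempty:
  assumes "compatible_family n A" "k \<le> n" "P \<in> A k" obtains j where "j \<in> P" "j \<le> n" "j \<noteq> k"
proof -
  have "P \<noteq> {}" using partition_onD3[OF compatible_family_partition[OF assms(1,2)]] assms(3) by metis
  then obtain j where j: "j \<in> P" by blast
  then have "j \<in> {0..n} - {k}" using compatible_family_block_subset[OF assms] by (rule subsetD[rotated])
  then show ?thesis using that[OF j] by simp
qed

text \<open>Petals at one label are disjoint, so a petal is a union of petals of \<open>B\<close>
  exactly when those that meet it are contained in it. The order is thus refinement, from which
  transitivity and antisymmetry are easily read off.\<close>

lemma family_le_iff:
  assumes A: "compatible_family n A" and B: "compatible_family n B"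
  shows "family_le n A B \<longleftrightarrow> (\<forall>k\<le>n. \<forall>Q\<in>B k. \<exists>P\<in>A k. Q \<subseteq> P)"
proof
  assume le: "family_le n A B"
  show "\<forall>k\<le>n. \<forall>Q\<in>B k. \<exists>P\<in>A k. Q \<subseteq> P"
  proof (intro allI impI ballI)
    fix k Q assume k: "k \<le> n" and Q: "Q \<in> B k"
    obtain j where j: "j \<in> Q" "j \<le> n" "j \<noteq> k" using compatible_family_block_nonempty[OF B k Q] .
    obtain P where P: "P \<in> A k" "j \<in> P" using compatible_family_block_exists[OF A k j(2,3)] by blast
    obtain R where R: "R \<subseteq> B k" "P = \<Union> R" using le k P(1) unfolding family_le_def by metis
    obtain Q' where Q': "Q' \<in> R" "j \<in> Q'" using P(2) R(2) by blast
    have "Q' = Q" using compatible_family_block_unique[OF B k _ Q Q'(2) j(1)] R(1) Q'(1) by blast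
    then have "Q \<subseteq> P" using Q'(1) R(2) by blast
    then show "\<exists>P\<in>A k. Q \<subseteq> P" using P(1) by (rule bexI)
  qed
next
  assume r: "\<forall>k\<le>n. \<forall>Q\<in>B k. \<exists>P\<in>A k. Q \<subseteq> P"
  show "family_le n A B" unfolding family_le_def
  proof (intro allI impI ballI)
    fix k P assume k: "k \<le> n" and P: "P \<in> A k"
    have "P \<subseteq> \<Union> {Q \<in> B k. Q \<subseteq> P}"
    proof
      fix j assume j: "j \<in> P"
      then have "j \<le> n" "j \<noteq> k" using compatible_family_block_subset[OF A k P] by auto
      then obtain Q where Q: "Q \<in> B k" "j \<in> Q" using compatible_family_block_exists[OF B k] by blast
      obtain P' where P': "P' \<in> A k" "Q \<subseteq> P'" using r k Q(1) by metis
      have "P' = P" using compatible_family_block_unique[OF A k P'(1) P _ j] P'(2) Q(2) by blast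
      then show "j \<in> \<Union> {Q \<in> B k. Q \<subseteq> P}" using Q P' by blast
    qed
    then have "P = \<Union> {Q \<in> B k. Q \<subseteq> P}" by blast
    then show "\<exists>Q\<subseteq>B k. P = \<Union> Q" by (intro exI[of _ "{Q \<in> B k. Q \<subseteq> P}"]) blast
  qed
qed

lemma family_le_refl: "family_le n A A"
  unfolding family_le_def by (metis ccpo_Sup_singleton empty_subsetI insert_subset)

lemma family_le_trans:
  assumes "compatible_family n A" "compatible_family n B" "compatible_family n C" "family_le n A B" "family_le n B C"
  shows "family_le n A C"
proof -
  have "\<exists>P\<in>A k. Q \<subseteq> P" if k: "k \<le> n" and Q: "Q \<in> C k" for k Q
  proof -
    obtain R where R: "R \<in> B k" "Q \<subseteq> R" using assms(5) k Q unfolding family_le_iff[OF assms(2,3)] by metis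
    obtain P where P: "P \<in> A k" "R \<subseteq> P" using assms(4) k R(1) unfolding family_le_iff[OF assms(1,2)] by metis
    show ?thesis using P R by (metis subset_trans)
  qed
  then show ?thesis unfolding family_le_iff[OF assms(1,3)] by simp
qed

lemma family_le_antisym:
  assumes A: "compatible_family n A" and B: "compatible_family n B" and le: "family_le n A B" "family_le n B A"
  shows "A = B"
proof
  have sub: "B k \<subseteq> A k" if k: "k \<le> n" and A: "compatible_family n A" and B: "compatible_family n B"
    and le: "family_le n A B" "family_le n B A" for A B k
  proof
    fix Q assume Q: "Q \<in> B k"
    obtain P where P: "P \<in> A k" "Q \<subseteq> P" using le(1) k Q unfolding family_le_iff[OF A B] by metis
    obtain Q' where Q': "Q' \<in> B k" "P \<subseteq> Q'" using le(2) k P(1) unfolding family_le_iff[OF B A] by metis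
    obtain j where j: "j \<in> Q" using compatible_family_block_nonempty[OF B k Q] .
    have "Q = Q'" using compatible_family_block_unique[OF B k Q Q'(1) j] j P Q' by blast
    then have "Q = P" using P Q' by blast
    then show "Q \<in> A k" using P by simp
  qed
  fix k
  show "A k = B k"
  proof (cases "k \<le> n")
    case True
    then show ?thesis using sub[OF True A B le] sub[OF True B A le(2,1)] by (rule_tac subset_antisym)
  next
    case False
    then show ?thesis using A B unfolding compatible_family_def by simp
  qed
qed

definition zero_family :: "nat \<Rightarrow> nat \<Rightarrow> nat set set" where
  "zero_family n = (\<lambda>k. if k \<le> n then {{0..n} - {k}} else {})"

lemma trivial_tree_family:
  assumes "n \<ge> 1" shows "petal_family n (trivial_tree n) = zero_family n"
proof
  fix k
  let ?T = "trivial_tree n" and ?W = "tverts n (trivial_tree n) - {Inl k}"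
  have c: "(a, Inr 0) \<in> (adj_in ?T ?W)\<^sup>*" if "a \<in> ?W" for a
  proof (cases a)
    case (Inl j)
    then have "(a, Inr 0) \<in> adj_in ?T ?W"
      using that by (auto simp: adj_in_def tadj_def trivial_tree_def tverts_def)
    then show ?thesis by blast
  next
    case (Inr m)
    then have "a = Inr 0" using that by (auto simp: trivial_tree_def tverts_def)
    then show ?thesis by simp
  qed
  have "component ?T ?W a = ?W" if "a \<in> ?W" for a
    using c[OF that] c by (auto simp: component_def intro: rtrancl_trans adj_in_rtrancl_sym)
  then have "petals n ?T k = {{j. Inl j \<in> component ?T ?W a} | a. a \<in> ?W}" "\<And>a. a \<in> ?W \<Longrightarrow> {j. Inl j \<in> component ?T ?W a} = {0..n} - {k}"
    by (auto simp: petals_def tverts_def)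
  moreover have "Inr 0 \<in> ?W" by (simp add: trivial_tree_def tverts_def)
  ultimately have "petals n ?T k = {{0..n} - {k}}" by (auto intro!: exI[of _ "Inr 0"])
  then show "petal_family n ?T k = zero_family n k" by (simp add: petal_family_def zero_family_def)
qed

lemma zero_family_compatible_family: assumes "n \<ge> 1" shows "compatible_family n (zero_family n)"
proof -
  have "partition_on ({0..n} - {k}) {{0..n} - {k}}" if "k \<le> n" for k
  proof (rule partition_onI)
    have "(if k = 0 then 1 else 0) \<in> {0..n} - {k}" using assms by auto
    then show "{} \<notin> {{0..n} - {k}}" by auto
  qed auto
  moreover have "{0..n} - {0} = {1..n}" by auto
  ultimately show ?thesis unfolding compatible_family_def zero_family_def by auto
qed

lemma zero_family_least: assumes "n \<ge> 1" "compatible_family n A" shows "family_le n (zero_family n) A"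
  unfolding family_le_iff[OF zero_family_compatible_family[OF assms(1)] assms(2)]
  using compatible_family_block_subset[OF assms(2)] by (simp add: zero_family_def)

section \<open>Moves carried by a family\<close>

text \<open>Triviality on the petal of \<open>0\<close> is included for moves, since they are
  trivial at \<open>0\<close>.\<close>

definition carries :: "(nat \<Rightarrow> nat set set) \<Rightarrow> nat \<times> (nat \<Rightarrow> 'a) \<Rightarrow> bool" where
  "carries A a \<longleftrightarrow> (\<forall>P\<in>A (fst a). \<forall>i\<in>P. \<forall>j\<in>P. snd a i = snd a j)"

lemma crrD: "carries A a \<Longrightarrow> P \<in> A (fst a) \<Longrightarrow> i \<in> P \<Longrightarrow> j \<in> P \<Longrightarrow> snd a i = snd a j"
  unfolding carries_def by blast

lemma carries_map2:
  assumes "carries A (k, x)" "carries A (k, y)" shows "carries A (k, \<lambda>j. h (x j) (y j))"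
  unfolding carries_def fst_conv snd_conv
proof (intro ballI)
  fix P i j assume "P \<in> A k" "i \<in> P" "j \<in> P"
  then have "x i = x j" "y i = y j" using crrD[OF assms(1), of P i j] crrD[OF assms(2), of P i j] by simp_all
  then show "h (x i) (y i) = h (x j) (y j)" by simp
qed

lemma carries_map: "carries A (k, x) \<Longrightarrow> carries A (k, \<lambda>j. h (x j))"
  using carries_map2[of A k x x "\<lambda>a b. h a"] by simp

lemma carries_mono:
  assumes "compatible_family n A" "compatible_family n B" "family_le n A B" "carries A a" "fst a \<le> n" shows "carries B a"
  unfolding carries_def
proof (intro ballI)
  fix Q i j assume Q: "Q \<in> B (fst a)" "i \<in> Q" "j \<in> Q"
  obtain P where "P \<in> A (fst a)" "Q \<subseteq> P"
    using assms(3,5) Q(1) unfolding family_le_iff[OF assms(1,2)] by metis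
  then show "snd a i = snd a j" using crrD[OF assms(4)] Q by blast
qed

definition join_rel :: "nat \<Rightarrow> (nat \<times> (nat \<Rightarrow> 'a)) set \<Rightarrow> nat \<Rightarrow> (nat \<times> nat) set" where
  "join_rel n C k = {(i, j). i \<le> n \<and> j \<le> n \<and> i \<noteq> k \<and> j \<noteq> k \<and> (\<forall>a\<in>C. fst a = k \<longrightarrow> snd a i = snd a j)}"

text \<open>Two labels share a petal at \<open>k\<close> unless some move of \<open>C\<close> at
  \<open>k\<close> separates them. For a clique \<open>C\<close> this is the smallest family that
  carries all of \<open>C\<close>.\<close>

definition join_family :: "nat \<Rightarrow> (nat \<times> (nat \<Rightarrow> 'a)) set \<Rightarrow> nat \<Rightarrow> nat set set" where
  "join_family n C = (\<lambda>k. if k \<le> n then ({0..n} - {k}) // join_rel n C k else {})"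

lemma join_rel_equiv: "equiv ({0..n} - {k}) (join_rel n C k)"
proof (rule equivI)
  show "join_rel n C k \<subseteq> ({0..n} - {k}) \<times> ({0..n} - {k})" by (auto simp: join_rel_def)
  show "refl_on ({0..n} - {k}) (join_rel n C k)" by (rule refl_onI) (auto simp: join_rel_def)
  show "sym (join_rel n C k)" by (rule symI) (auto simp: join_rel_def)
  show "trans (join_rel n C k)" by (rule transI) (auto simp: join_rel_def)
qed

lemma join_family_mem:
  assumes "P \<in> join_family n C k" "i \<in> P" shows "P = {j. (i, j) \<in> join_rel n C k}"
proof -
  have "k \<le> n" using assms(1) by (auto simp: join_family_def split: if_splits)
  then have P: "P \<in> ({0..n} - {k}) // join_rel n C k" using assms(1) by (simp add: join_family_def)
  then obtain i' where i': "i' \<in> {0..n} - {k}" "P = join_rel n C k `` {i'}" by (rule quotientE)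
  then have "(i', i) \<in> join_rel n C k" using assms(2) by simp
  then have "join_rel n C k `` {i'} = join_rel n C k `` {i}" by (rule equiv_class_eq[OF join_rel_equiv])
  then show ?thesis using i'(2) by (simp add: Image_singleton)
qed

context free_factors
begin

text \<open>A label outside \<open>P\<close> and \<open>Q\<close> would be separated from
  \<open>l\<close> by a move of \<open>C\<close> at \<open>k\<close> and from \<open>k\<close> by a
  move of \<open>C\<close> at \<open>l\<close>, and these two moves would not be compatible. No move
  sits at \<open>0\<close>, so there is one petal there.\<close>

lemma join_family_compatible_family:
  assumes n: "n \<ge> 1" and C: "\<And>a b. a \<in> C \<Longrightarrow> b \<in> C \<Longrightarrow> compat a b" and C1: "\<And>a. a \<in> C \<Longrightarrow> fst a \<in> {1..n}"
  shows "compatible_family n (join_family n C)"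
  unfolding compatible_family_def
proof (intro conjI allI impI)
  fix k assume "k > n"
  then show "join_family n C k = {}" by (simp add: join_family_def)
next
  fix k assume "k \<le> n"
  then show "partition_on ({0..n} - {k}) (join_family n C k)"
    using partition_on_quotient[OF join_rel_equiv] by (simp add: join_family_def)
next
  have e: "join_rel n C 0 = {1..n} \<times> {1..n}" using C1 by (force simp: join_rel_def)
  have s: "{0..n} - {0} = {1..n}" by auto
  have "{1..n} // ({1..n} \<times> {1..n}) = {{1..n}}" using n by (auto simp: quotient_def)
  then show "join_family n C 0 = {{1..n}}" unfolding join_family_def e s by simp
next
  fix k l P Q assume kl: "k \<le> n" "l \<le> n" "k \<noteq> l" and P: "P \<in> join_family n C k" "l \<in> P" and Q: "Q \<in> join_family n C l" "k \<in> Q"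
  show "{0..n} \<subseteq> P \<union> Q"
  proof (rule ccontr)
    assume "\<not> {0..n} \<subseteq> P \<union> Q"
    then obtain j where "j \<in> {0..n}" "j \<notin> P \<union> Q" by (meson subsetI)
    then have j: "j \<le> n" "j \<notin> P" "j \<notin> Q" by simp_all
    have PQ: "(l, j) \<notin> join_rel n C k" "(k, j) \<notin> join_rel n C l"
      using j join_family_mem[OF P] join_family_mem[OF Q] by auto
    have ne: "j \<noteq> k" "j \<noteq> l" using j P Q by auto
    obtain a where a: "a \<in> C" "fst a = k" "snd a l \<noteq> snd a j" using PQ(1) j(1) kl ne by (auto simp: join_rel_def)
    obtain b where b: "b \<in> C" "fst b = l" "snd b k \<noteq> snd b j" using PQ(2) j(1) kl ne by (auto simp: join_rel_def)
    from C[OF a(1) b(1)] show False using a b kl j ne unfolding compat_def by metis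
  qed
qed

lemma join_family_carries: "a \<in> C \<Longrightarrow> carries (join_family n C) a"
  unfolding carries_def
proof (intro ballI)
  fix P i j assume a: "a \<in> C" and P: "P \<in> join_family n C (fst a)" "i \<in> P" "j \<in> P"
  have "(i, j) \<in> join_rel n C (fst a)" using join_family_mem[OF P(1,2)] P(3) by simp
  then show "snd a i = snd a j" using a by (simp add: join_rel_def)
qed

lemma join_family_le:
  assumes J: "compatible_family n (join_family n C)" and A: "compatible_family n A" and c: "\<And>a. a \<in> C \<Longrightarrow> carries A a"
  shows "family_le n (join_family n C) A"
  unfolding family_le_iff[OF J A]
proof (intro allI impI ballI)
  fix k Q assume k: "k \<le> n" and Q: "Q \<in> A k"
  obtain j where j: "j \<in> Q" "j \<le> n" "j \<noteq> k" using compatible_family_block_nonempty[OF A k Q] .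
  obtain P where P: "P \<in> join_family n C k" "j \<in> P" using compatible_family_block_exists[OF J k j(2,3)] by blast
  have "Q \<subseteq> P"
  proof
    fix i assume i: "i \<in> Q"
    have "i \<le> n" "i \<noteq> k" using i compatible_family_block_subset[OF A k Q] by auto
    moreover have "snd a j = snd a i" if "a \<in> C" "fst a = k" for a
      using crrD[OF c[OF that(1)], of Q j i] Q j i that(2) by simp
    ultimately have "(j, i) \<in> join_rel n C k" using j by (auto simp: join_rel_def)
    then show "i \<in> P" using join_family_mem[OF P] by simp
  qed
  then show "\<exists>P\<in>join_family n C k. Q \<subseteq> P" using P(1) by (rule bexI)
qed

text \<open>The petals in which the two factors see each other cover all labels, and each move is
  constant on its own petal.\<close>

lemma carries_compat:
  assumes A: "compatible_family n A" and a: "carries A a" "fst a \<le> n" and b: "carries A b" "fst b \<le> n"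
  shows "compat a b"
proof (cases "fst a = fst b")
  case False
  let ?P = "blk A (fst a) (fst b)" and ?Q = "blk A (fst b) (fst a)"
  have P: "?P \<in> A (fst a)" "fst b \<in> ?P" using blk_props[OF A a(2) b(2)] False by auto
  have Q: "?Q \<in> A (fst b)" "fst a \<in> ?Q" using blk_props[OF A b(2) a(2)] False by auto
  have "snd a j = snd a (fst b) \<or> snd b j = snd b (fst a)" if j: "j \<le> n" for j
    using compatible_family_cover[OF A a(2) b(2) False P(1) Q(1) P(2) Q(2) j]
  proof
    assume "j \<in> ?P"
    from crrD[OF a(1) P(1) this P(2)] show ?thesis by simp
  next
    assume "j \<in> ?Q"
    from crrD[OF b(1) Q(1) this Q(2)] show ?thesis by simp
  qed
  then show ?thesis by (simp add: compat_def)
qed (simp add: compat_def)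

section \<open>Equivalence of pairs\<close>

text \<open>A \<open>wh_step\<close> composes automorphisms that are all defined at its starting
  basis. Here one move is made at a time, at the basis reached so far; on pairs of a basis and a
  family both generate the same equivalence.\<close>

definition step :: "(nat \<Rightarrow> nat set set) \<Rightarrow> (nat \<Rightarrow> 'a set) \<Rightarrow> (nat \<Rightarrow> 'a set) \<Rightarrow> bool" where
  "step A H K \<longleftrightarrow> (\<exists>k x. is_move H k x \<and> carries A (k, x) \<and> K = conj_basis x H)"

lemma step_bas: "step A H K \<Longrightarrow> bas H \<Longrightarrow> bas K"
  unfolding step_def using bas_conj_basis by blast

lemma steps_bas: "(step A)\<^sup>*\<^sup>* H K \<Longrightarrow> bas H \<Longrightarrow> bas K"
  by (induction rule: rtranclp_induct) (auto intro: step_bas)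

lemma step_sym:
  assumes "step A H K" "bas H" shows "step A K H"
proof -
  obtain k x where x: "is_move H k x" "carries A (k, x)" "K = conj_basis x H" using assms(1) by (auto simp: step_def)
  have k: "k \<in> {1..n}" using x by (auto simp: is_move_def)
  note f = bas_fp[OF assms(2)]
  have "is_move K k (\<lambda>j. \<one> \<otimes> inv (x j))" using is_move_div[OF f x(1) is_move_one[OF k f]] x(3) by simp
  moreover have "conj_basis (\<lambda>j. \<one> \<otimes> inv (x j)) K = H"
    using conj_basis_div[OF assms(2) x(1) is_move_one[OF k f]] conj_basis_trivial[OF assms(2)] x(3) by simp
  moreover have "carries A (k, \<lambda>j. \<one> \<otimes> inv (x j))"
    using carries_map[OF x(2)] .
  ultimately show ?thesis unfolding step_def by metis
qed

lemma steps_sym: "(step A)\<^sup>*\<^sup>* H K \<Longrightarrow> bas H \<Longrightarrow> (step A)\<^sup>*\<^sup>* K H"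
proof (induction rule: rtranclp_induct)
  case (step K M)
  then have "step A M K" using step_sym steps_bas by blast
  then show ?case using step by (meson converse_rtranclp_into_rtranclp)
qed simp

definition img :: "('a \<Rightarrow> 'a) \<Rightarrow> (nat \<Rightarrow> 'a set) \<Rightarrow> nat \<Rightarrow> 'a set" where
  "img f H = (\<lambda>i. f ` H i)"

lemma step_img:
  assumes f: "f \<in> iso G G" and H: "bas H" and s: "step A H K" shows "step A (img f H) (img f K)"
proof -
  obtain k x where x: "is_move H k x" "carries A (k, x)" "K = conj_basis x H" using s by (auto simp: step_def)
  have hom: "f \<in> hom G G" using f by (simp add: iso_def)
  have f1: "f \<one> = \<one>" using hom_one[OF hom] by (simp add: is_group)
  have xc: "\<And>j. x j \<in> carrier G" using is_move_carrier[OF bas_fp[OF H] x(1)] .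
  have "is_move (img f H) k (f \<circ> x)" using x(1) f1 by (auto simp: is_move_def img_def)
  moreover have "carries A (k, f \<circ> x)" using carries_map[OF x(2)] by (simp add: comp_def)
  moreover have "img f K = conj_basis (f \<circ> x) (img f H)"
  proof
    fix i
    have "f (x i \<otimes> h \<otimes> inv (x i)) = f (x i) \<otimes> f h \<otimes> inv (f (x i))" if "h \<in> H i" for h
      using hom_mult[OF hom] xc bas_carrier[OF H that] group_hom.hom_inv[of G G f "x i"] hom
      by (simp add: group_hom_def group_hom_axioms_def is_group)
    then show "img f K i = conj_basis (f \<circ> x) (img f H) i"
      unfolding x(3) img_def conj_basis_def image_image comp_def by (intro image_cong) auto
  qed
  ultimately show ?thesis unfolding step_def by blast
qed

lemma steps_img:
  assumes f: "f \<in> iso G G" and H: "bas H" and s: "(step A)\<^sup>*\<^sup>* H K"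
  shows "(step A)\<^sup>*\<^sup>* (img f H) (img f K)"
  using s
proof (induction rule: rtranclp_induct)
  case (step K M)
  then show ?case using step_img[OF f steps_bas[OF step(1) H]] by (meson rtranclp.rtrancl_into_rtrancl)
qed simp

lemma carried_step:
  assumes H: "bas H" and A: "compatible_family n A" and c: "carried_whitehead G n H A \<phi>"
  shows "step A H (img \<phi> H)" "\<phi> \<in> iso G G"
proof -
  obtain k x where s: "sym_whitehead G n H k x \<phi>" and cby: "carried_by G A k x"
    using c by (auto simp: carried_whitehead_def)
  show "\<phi> \<in> iso G G" using s by (simp add: sym_whitehead_def)
  \<comment> \<open>A symmetric Whitehead automorphism restricts \<open>x\<close> only on
    \<open>1..n\<close>; the remaining entries are reset as \<open>is_move\<close> demands.\<close>
  define x' where "x' = (\<lambda>j. if j \<in> {1..n} then x j else \<one>)"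
  have k: "k \<in> {1..n}" using s by (simp add: sym_whitehead_def)
  have kn: "k \<le> n" using k by simp
  have ax: "is_move H k x'" using s by (auto simp: sym_whitehead_def is_move_def x'_def)
  have "carries A (k, x')" unfolding carries_def fst_conv snd_conv
  proof (intro ballI)
    fix P i j assume P: "P \<in> A k" "i \<in> P" "j \<in> P"
    have le: "i \<le> n" "j \<le> n" using compatible_family_block_subset[OF A kn P(1)] P by auto
    have e: "x i = x j" using cby P unfolding carried_by_def by blast
    have z: "x i = \<one>" "x j = \<one>" if "0 \<in> P" using cby P that unfolding carried_by_def by blast+
    show "x' i = x' j"
    proof (cases "0 \<in> P")
      case True
      then show ?thesis using z by (simp add: x'_def)
    next
      case False
      then have "i \<noteq> 0" "j \<noteq> 0" using P by metis+
      then show ?thesis using e le by (simp add: x'_def)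
    qed
  qed
  moreover have "img \<phi> H = conj_basis x' H"
  proof
    fix i show "img \<phi> H i = conj_basis x' H i"
    proof (cases "i \<in> {1..n}")
      case True
      then have "\<phi> h = x' i \<otimes> h \<otimes> inv (x' i)" if "h \<in> H i" for h
        using s that by (auto simp: sym_whitehead_def x'_def)
      then show ?thesis unfolding img_def conj_basis_def by (intro image_cong) auto
    next
      case False
      then show ?thesis using bas_off[OF H] by (simp add: img_def conj_basis_def)
    qed
  qed
  ultimately show "step A H (img \<phi> H)" using ax unfolding step_def by blast
qed

text \<open>The path grows at its start: the first automorphism is applied to the path already built
  for the others, since isomorphisms carry steps to steps, and its own step leads from
  \<open>H\<close> to the beginning of the transported path.\<close>

lemma carried_steps:
  assumes H: "bas H" and A: "compatible_family n A" and c: "\<forall>\<phi>\<in>set \<phi>s. carried_whitehead G n H A \<phi>"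
  shows "(step A)\<^sup>*\<^sup>* H (img (foldr (\<circ>) \<phi>s id) H)"
  using c
proof (induction \<phi>s)
  case Nil
  have "img (foldr (\<circ>) [] id) H = H" by (simp add: img_def)
  then show ?case by (simp only: rtranclp.rtrancl_refl)
next
  case (Cons \<phi> \<phi>s)
  have p: "step A H (img \<phi> H)" "\<phi> \<in> iso G G" using carried_step[OF H A] Cons.prems by auto
  have "(step A)\<^sup>*\<^sup>* (img \<phi> H) (img \<phi> (img (foldr (\<circ>) \<phi>s id) H))"
    by (rule steps_img[OF p(2) H Cons.IH]) (use Cons.prems in simp)
  moreover have "img \<phi> (img (foldr (\<circ>) \<phi>s id) H) = img (foldr (\<circ>) (\<phi> # \<phi>s) id) H"
    by (simp add: img_def image_comp)
  ultimately show ?case using p(1) by (metis converse_rtranclp_into_rtranclp)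
qed

lemma step_wh_step:
  assumes n: "n \<ge> 1" and H: "bas H" and A: "compatible_family n A" and s: "step A H K"
  shows "((H, A), (K, A)) \<in> wh_step G n Gs"
proof -
  obtain k x where x: "is_move H k x" "carries A (k, x)" "K = conj_basis x H" using s by (auto simp: step_def)
  note f = bas_fp[OF H]
  have xc: "\<And>j. x j \<in> carrier G" using is_move_carrier[OF f x(1)] .
  let ?\<phi> = "endo H x"
  have "sym_whitehead G n H k x ?\<phi>"
    using x(1) endo_is_move_iso[OF f x(1)] endo_letter[OF f xc] by (auto simp: sym_whitehead_def is_move_def)
  moreover have "carried_by G A k x"
    using crrD[OF x(2)] is_move_zero[OF x(1)] unfolding carried_by_def by (metis fst_conv snd_conv)
  ultimately have c: "carried_whitehead G n H A ?\<phi>" by (auto simp: carried_whitehead_def)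
  have "K = (\<lambda>i. foldr (\<circ>) [?\<phi>] id ` H i)"
  proof
    fix i show "K i = foldr (\<circ>) [?\<phi>] id ` H i"
      using conj_basis_eq_endo[OF f xc, of i] x(3) bas_off[OF H, of i] by (cases "i \<in> {1..n}") (auto simp: conj_basis_def)
  qed
  then show ?thesis using c H A step_bas[OF s H] compatible_family_iff_tree[OF n]
    unfolding wh_step_def lpairs_def by (auto intro!: exI[of _ "[?\<phi>]"])
qed

end

section \<open>Contractible posets\<close>

definition poset_map :: "'p set \<Rightarrow> ('p \<Rightarrow> 'p \<Rightarrow> bool) \<Rightarrow> ('p \<Rightarrow> 'p) \<Rightarrow> bool" where
  "poset_map P lq f \<longleftrightarrow> f ` P \<subseteq> P \<and> (\<forall>a\<in>P. \<forall>b\<in>P. lq a b \<longrightarrow> lq (f a) (f b))"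

definition poset_step :: "'p set \<Rightarrow> ('p \<Rightarrow> 'p \<Rightarrow> bool) \<Rightarrow> ('p \<Rightarrow> 'p) \<Rightarrow> ('p \<Rightarrow> 'p) \<Rightarrow> bool" where
  "poset_step P lq f g \<longleftrightarrow> poset_map P lq f \<and> poset_map P lq g \<and> ((\<forall>a\<in>P. lq (f a) (g a)) \<or> (\<forall>a\<in>P. lq (g a) (f a)))"

text \<open>A combinatorial form of contractibility: a finite zigzag of pointwise comparable
  monotone self-maps from the identity to a constant. For finite posets each member of the zigzag
  becomes a homotopy in \<open>poset_step_homotopic\<close>.\<close>

definition poset_contractible :: "'p set \<Rightarrow> ('p \<Rightarrow> 'p \<Rightarrow> bool) \<Rightarrow> bool" where
  "poset_contractible P lq \<longleftrightarrow> (\<exists>c\<in>P. (poset_step P lq)\<^sup>*\<^sup>* id (\<lambda>_. c))"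

text \<open>Precomposition with \<open>\<phi>\<close> turns a zigzag on \<open>P'\<close> into one
  on \<open>P\<close>; it is appended to the zigzag from the identity to
  \<open>\<phi>\<close>.\<close>

lemma poset_contractible_deform:
  assumes sub: "P' \<subseteq> P" and phi: "\<phi> ` P \<subseteq> P'" "poset_map P lq \<phi>" "(poset_step P lq)\<^sup>*\<^sup>* id \<phi>" and c: "poset_contractible P' lq"
  shows "poset_contractible P lq"
proof -
  obtain c where c: "c \<in> P'" "(poset_step P' lq)\<^sup>*\<^sup>* id (\<lambda>_. c)" using c by (auto simp: poset_contractible_def)
  have step: "poset_step P lq (f \<circ> \<phi>) (g \<circ> \<phi>)" if s: "poset_step P' lq f g" for f g
  proof -
    have m: "poset_map P lq (h \<circ> \<phi>)" if h: "poset_map P' lq h" for h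
      unfolding poset_map_def
    proof (intro conjI ballI impI)
      show "(h \<circ> \<phi>) ` P \<subseteq> P" using h phi(1) sub unfolding poset_map_def by auto
      fix a b assume ab: "a \<in> P" "b \<in> P" "lq a b"
      have "\<phi> a \<in> P'" "\<phi> b \<in> P'" "lq (\<phi> a) (\<phi> b)" using phi(1,2) ab unfolding poset_map_def by auto
      then show "lq ((h \<circ> \<phi>) a) ((h \<circ> \<phi>) b)" using h unfolding poset_map_def by simp
    qed
    have p: "\<phi> a \<in> P'" if "a \<in> P" for a using phi(1) that by blast
    show ?thesis using s m p unfolding poset_step_def by (auto simp: comp_def)
  qed
  have "(poset_step P lq)\<^sup>*\<^sup>* (id \<circ> \<phi>) (f \<circ> \<phi>)" if "(poset_step P' lq)\<^sup>*\<^sup>* id f" for f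
    using that
  proof (induction rule: rtranclp_induct)
    case (step f g)
    then show ?case using \<open>\<And>f g. poset_step P' lq f g \<Longrightarrow> poset_step P lq (f \<circ> \<phi>) (g \<circ> \<phi>)\<close>
      by (meson rtranclp.rtrancl_into_rtrancl)
  qed simp
  from this[OF c(2)] have "(poset_step P lq)\<^sup>*\<^sup>* \<phi> (\<lambda>_. c)" by (simp add: comp_def)
  then have "(poset_step P lq)\<^sup>*\<^sup>* id (\<lambda>_. c)" using phi(3) by (rule_tac rtranclp_trans)
  then show ?thesis using c(1) sub unfolding poset_contractible_def by blast
qed

lemma poset_contractible_iso:
  assumes c: "poset_contractible P lq" and h: "inj_on h P" and lq: "\<And>a b. a \<in> P \<Longrightarrow> b \<in> P \<Longrightarrow> lq' (h a) (h b) \<longleftrightarrow> lq a b"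
    and refl: "\<And>a. a \<in> P \<Longrightarrow> lq a a"
  shows "poset_contractible (h ` P) lq'"
proof -
  define k where "k = inv_into P h"
  have kh: "k (h a) = a" if "a \<in> P" for a using that h by (simp add: k_def)
  obtain c where c: "c \<in> P" "(poset_step P lq)\<^sup>*\<^sup>* id (\<lambda>_. c)" using c by (auto simp: poset_contractible_def)
  have m: "poset_map (h ` P) lq' (h \<circ> f \<circ> k)" if f: "poset_map P lq f" for f
    unfolding poset_map_def
  proof (intro conjI ballI impI)
    show "(h \<circ> f \<circ> k) ` (h ` P) \<subseteq> h ` P" using f kh unfolding poset_map_def by auto
    fix a b assume "a \<in> h ` P" "b \<in> h ` P" and ab: "lq' a b"
    then obtain x y where xy: "x \<in> P" "y \<in> P" "a = h x" "b = h y" by blast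
    then have "lq x y" using lq ab by simp
    then have "lq (f x) (f y)" "f x \<in> P" "f y \<in> P" using f xy unfolding poset_map_def by auto
    then show "lq' ((h \<circ> f \<circ> k) a) ((h \<circ> f \<circ> k) b)" using xy kh lq by simp
  qed
  have mi: "poset_map (h ` P) lq' id" by (simp add: poset_map_def)
  have s: "poset_step (h ` P) lq' (h \<circ> f \<circ> k) (h \<circ> g \<circ> k)" if fg: "poset_step P lq f g" for f g
  proof -
    have P: "f a \<in> P" "g a \<in> P" if "a \<in> P" for a using fg that unfolding poset_step_def poset_map_def by auto
    have "(\<forall>a\<in>h ` P. lq' ((h \<circ> f \<circ> k) a) ((h \<circ> g \<circ> k) a)) \<or> (\<forall>a\<in>h ` P. lq' ((h \<circ> g \<circ> k) a) ((h \<circ> f \<circ> k) a))"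
      using fg P lq kh unfolding poset_step_def by auto
    then show ?thesis using fg m unfolding poset_step_def by blast
  qed
  have "(poset_step (h ` P) lq')\<^sup>*\<^sup>* (h \<circ> id \<circ> k) (h \<circ> f \<circ> k)" if "(poset_step P lq)\<^sup>*\<^sup>* id f" for f
    using that
  proof (induction rule: rtranclp_induct)
    case (step f g)
    then show ?case using s by (meson rtranclp.rtrancl_into_rtrancl)
  qed simp
  from this[OF c(2)] have a: "(poset_step (h ` P) lq')\<^sup>*\<^sup>* (h \<circ> id \<circ> k) (\<lambda>_. h c)" by (simp add: comp_def)
  have "poset_map P lq id" by (simp add: poset_map_def)
  \<comment> \<open>Conjugating the identity by \<open>h\<close> gives the identity only on the
    image of \<open>P\<close>, so reflexivity is used for one more comparison.\<close>
  then have "poset_step (h ` P) lq' id (h \<circ> id \<circ> k)"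
    using mi m[of id] kh lq refl unfolding poset_step_def by auto
  then have "(poset_step (h ` P) lq')\<^sup>*\<^sup>* id (\<lambda>_. h c)" using a by (rule converse_rtranclp_into_rtranclp)
  then show ?thesis using c(1) unfolding poset_contractible_def by blast
qed

lemma finite_compatible_family: "finite {A. compatible_family n A}"
proof (rule finite_subset)
  show "{A. compatible_family n A} \<subseteq> {A. \<forall>k. (k \<in> {0..n} \<longrightarrow> A k \<in> Pow (Pow {0..n})) \<and> (k \<notin> {0..n} \<longrightarrow> A k = {})}"
  proof (intro subsetI CollectI allI conjI impI)
    fix A k assume A: "A \<in> {A. compatible_family n A}"
    then have A': "compatible_family n A" by simp
    { assume "k \<in> {0..n}"
      then have k: "k \<le> n" by simp
      have "P \<subseteq> {0..n}" if "P \<in> A k" for P using compatible_family_block_subset[OF A' k that] by blast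
      then show "A k \<in> Pow (Pow {0..n})" by blast }
    { assume "k \<notin> {0..n}"
      then show "A k = {}" using A unfolding compatible_family_def by simp }
  qed
  show "finite {A. \<forall>k. (k \<in> {0..n} \<longrightarrow> A k \<in> Pow (Pow {0..n})) \<and> (k \<notin> {0..n} \<longrightarrow> A k = {})}"
    by (rule finite_set_of_finite_funs) auto
qed

locale whitehead_poset = normed_factors G n Gs r L for G (structure) and n Gs r L +
  assumes n_pos: "n \<ge> 1"
begin

section \<open>Contractibility of the poset of reductive families\<close>

definition carrying :: "(nat \<times> (nat \<Rightarrow> 'a)) set \<Rightarrow> (nat \<Rightarrow> nat set set) set" where
  "carrying V = {A. compatible_family n A \<and> (\<exists>a\<in>V. carries A a)}"

definition carried :: "(nat \<times> (nat \<Rightarrow> 'a)) set \<Rightarrow> (nat \<Rightarrow> nat set set) \<Rightarrow> (nat \<times> (nat \<Rightarrow> 'a)) set" where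
  "carried V A = {a \<in> V. carries A a}"

abbreviation "fle \<equiv> family_le n"

context
  fixes V :: "(nat \<times> (nat \<Rightarrow> 'a)) set"
  assumes V: "\<And>a. a \<in> V \<Longrightarrow> fst a \<in> {1..n}"
begin

lemma carried_compat: "compatible_family n A \<Longrightarrow> a \<in> carried V A \<Longrightarrow> b \<in> carried V A \<Longrightarrow> compat a b"
  using carries_compat[of A a b] V[of a] V[of b] by (simp add: carried_def)

lemma carried_mono:
  assumes "A \<in> carrying V" "B \<in> carrying V" "fle A B" shows "carried V A \<subseteq> carried V B"
proof
  fix a assume a: "a \<in> carried V A"
  then have "carries B a" using assms carries_mono[of n A B a] V[of a] by (simp add: carrying_def carried_def)
  then show "a \<in> carried V B" using a by (simp add: carried_def)
qed

lemma join_family_clique: "C \<subseteq> V \<Longrightarrow> (\<And>a b. a \<in> C \<Longrightarrow> b \<in> C \<Longrightarrow> compat a b) \<Longrightarrow> compatible_family n (join_family n C)"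
  using join_family_compatible_family[OF n_pos, of C] V by blast

lemma join_family_mono:
  "C \<subseteq> D \<Longrightarrow> compatible_family n (join_family n C) \<Longrightarrow> compatible_family n (join_family n D) \<Longrightarrow> fle (join_family n C) (join_family n D)"
  using join_family_le[of C "join_family n D"] join_family_carries[of _ D] by blast

lemma join_poset_map:
  assumes F: "\<And>A. A \<in> carrying V \<Longrightarrow> F A \<subseteq> V \<and> F A \<noteq> {} \<and> (\<forall>a\<in>F A. \<forall>b\<in>F A. compat a b)"
    and mono: "\<And>A B. A \<in> carrying V \<Longrightarrow> B \<in> carrying V \<Longrightarrow> fle A B \<Longrightarrow> F A \<subseteq> F B"
  shows "poset_map (carrying V) fle (\<lambda>A. join_family n (F A))"
  unfolding poset_map_def
proof (intro conjI ballI impI)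
  have c: "compatible_family n (join_family n (F A))" if "A \<in> carrying V" for A using join_family_clique F[OF that] by blast
  show "(\<lambda>A. join_family n (F A)) ` carrying V \<subseteq> carrying V"
  proof
    fix B assume "B \<in> (\<lambda>A. join_family n (F A)) ` carrying V"
    then obtain A where A: "A \<in> carrying V" "B = join_family n (F A)" by blast
    then obtain a where "a \<in> F A" "a \<in> V" using F[OF A(1)] by blast
    then show "B \<in> carrying V" using c[OF A(1)] join_family_carries[of a "F A"] A(2) by (auto simp: carrying_def)
  qed
  fix A B assume "A \<in> carrying V" "B \<in> carrying V" "fle A B"
  then show "fle (join_family n (F A)) (join_family n (F B))" using join_family_mono[OF mono] c by blast
qed

text \<open>Each family is lowered to the smallest one that carries the same moves of
  \<open>V\<close>. After this first member of the zigzags below, only the cliques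
  \<open>carried V A\<close> matter.\<close>

lemma carried_join:
  "poset_map (carrying V) fle (\<lambda>A. join_family n (carried V A))" "poset_step (carrying V) fle id (\<lambda>A. join_family n (carried V A))"
proof -
  show p: "poset_map (carrying V) fle (\<lambda>A. join_family n (carried V A))"
  proof (rule join_poset_map)
    fix A assume A: "A \<in> carrying V"
    then show "carried V A \<subseteq> V \<and> carried V A \<noteq> {} \<and> (\<forall>a\<in>carried V A. \<forall>b\<in>carried V A. compat a b)"
      using carried_compat[of A] by (auto simp: carrying_def carried_def)
  qed (rule carried_mono)
  have "fle (join_family n (carried V A)) A" if A: "A \<in> carrying V" for A
  proof (rule join_family_le)
    show "compatible_family n A" using A by (simp add: carrying_def)
    then show "compatible_family n (join_family n (carried V A))"
      using join_family_clique[of "carried V A"] carried_compat by (auto simp: carried_def)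
  qed (simp add: carried_def)
  moreover have "poset_map (carrying V) fle id" by (simp add: poset_map_def)
  ultimately show "poset_step (carrying V) fle id (\<lambda>A. join_family n (carried V A))" using p unfolding poset_step_def by simp
qed

text \<open>The zigzag leads from \<open>A\<close> down to the join of its moves, up to the join
  with \<open>m\<close> added, and down to the join of \<open>m\<close> alone. Compatibility of
  \<open>m\<close> with all of \<open>V\<close> keeps the sets cliques.\<close>

lemma poset_contractible_cone:
  assumes m: "m \<in> V" "\<And>a. a \<in> V \<Longrightarrow> compat a m"
  shows "poset_contractible (carrying V) fle"
proof -
  let ?f1 = "\<lambda>A. join_family n (carried V A)" and ?f2 = "\<lambda>A. join_family n (insert m (carried V A))"
  have mm: "compat m m" by (simp add: compat_def)
  have F2: "insert m (carried V A) \<subseteq> V \<and> insert m (carried V A) \<noteq> {} \<and>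
      (\<forall>a\<in>insert m (carried V A). \<forall>b\<in>insert m (carried V A). compat a b)" if "A \<in> carrying V" for A
  proof -
    have "compatible_family n A" using that by (simp add: carrying_def)
    then have "compat a b" if "a \<in> carried V A" "b \<in> carried V A" for a b using carried_compat that by blast
    moreover have "compat a m" "compat m a" if "a \<in> carried V A" for a
      using m that compat_sym by (auto simp: carried_def)
    ultimately show ?thesis using m mm by (auto simp: carried_def)
  qed
  have c2: "compatible_family n (?f2 A)" if "A \<in> carrying V" for A using join_family_clique F2[OF that] by blast
  have p2: "poset_map (carrying V) fle ?f2"
    using carried_mono by (intro join_poset_map[OF F2]) blast+
  have c0: "compatible_family n (join_family n {m})" using join_family_clique[of "{m}"] m mm by blast
  have j: "join_family n {m} \<in> carrying V" using c0 m join_family_carries[of m "{m}"] by (auto simp: carrying_def)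
  have p0: "poset_map (carrying V) fle (\<lambda>_. join_family n {m})"
    using j family_le_refl by (auto simp: poset_map_def)
  have c1: "compatible_family n (?f1 A)" if "A \<in> carrying V" for A
    using carried_join(1) that unfolding poset_map_def by (auto simp: carrying_def)
  have "poset_step (carrying V) fle ?f1 ?f2"
    using carried_join(1) p2 join_family_mono[OF subset_insertI c1 c2] unfolding poset_step_def by blast
  moreover have "poset_step (carrying V) fle ?f2 (\<lambda>_. join_family n {m})"
    using p0 p2 join_family_mono[OF _ c0 c2] unfolding poset_step_def by blast
  ultimately have "(poset_step (carrying V) fle)\<^sup>*\<^sup>* id (\<lambda>_. join_family n {m})"
    using carried_join(2) by (meson r_into_rtranclp rtranclp_trans)
  then show ?thesis using j unfolding poset_contractible_def by blast
qed

text \<open>Wherever \<open>\<alpha>\<close> is carried, first add \<open>\<alpha>'\<close>, which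
  domination permits, and then delete \<open>\<alpha>\<close>. The last map takes values in families
  carrying a move other than \<open>\<alpha>\<close>.\<close>

lemma poset_contractible_dominated:
  assumes a: "\<alpha> \<in> V" "\<alpha>' \<in> V" "\<alpha>' \<noteq> \<alpha>" "fst \<alpha> = fst \<alpha>'"
    and dom: "\<And>b. b \<in> V \<Longrightarrow> compat \<alpha> b \<Longrightarrow> compat \<alpha>' b"
    and c: "poset_contractible (carrying (V - {\<alpha>})) fle"
  shows "poset_contractible (carrying V) fle"
proof -
  define F where "F A = carried V A \<union> (if \<alpha> \<in> carried V A then {\<alpha>'} else {})" for A
  have F: "F A \<subseteq> V \<and> F A \<noteq> {} \<and> (\<forall>a\<in>F A. \<forall>b\<in>F A. compat a b) \<and> F A - {\<alpha>} \<noteq> {}" if A: "A \<in> carrying V" for A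
  proof -
    have cA: "compatible_family n A" using A by (simp add: carrying_def)
    have cc: "compat a b" if "a \<in> carried V A" "b \<in> carried V A" for a b using carried_compat[OF cA] that .
    have d: "compat \<alpha>' b" "compat b \<alpha>'" if "\<alpha> \<in> carried V A" "b \<in> carried V A" for b
      using dom[of b] cc[OF that] compat_sym that by (auto simp: carried_def)
    have ne: "carried V A \<noteq> {}" using A by (auto simp: carrying_def carried_def)
    have "F A - {\<alpha>} \<noteq> {}"
    proof (cases "\<alpha> \<in> carried V A")
      case True
      then show ?thesis using a(3) by (auto simp: F_def)
    qed (use ne in \<open>auto simp: F_def\<close>)
    moreover have "compat \<alpha>' \<alpha>'" by (simp add: compat_def)
    ultimately show ?thesis using cc d a(2) by (auto simp: F_def carried_def)
  qed
  have mono: "F A \<subseteq> F B" if "A \<in> carrying V" "B \<in> carrying V" "fle A B" for A B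
    using carried_mono[OF that] by (auto simp: F_def)
  let ?f1 = "\<lambda>A. join_family n (carried V A)" and ?f2 = "\<lambda>A. join_family n (F A)" and ?f3 = "\<lambda>A. join_family n (F A - {\<alpha>})"
  have p2: "poset_map (carrying V) fle ?f2" by (rule join_poset_map) (use F mono in blast)+
  have p3: "poset_map (carrying V) fle ?f3" by (rule join_poset_map) (use F mono in blast)+
  have c1: "compatible_family n (?f1 A)" if "A \<in> carrying V" for A
    using carried_join(1) that unfolding poset_map_def by (auto simp: carrying_def)
  have c2: "compatible_family n (?f2 A)" if "A \<in> carrying V" for A using join_family_clique F[OF that] by blast
  have c3: "compatible_family n (?f3 A)" if "A \<in> carrying V" for A using join_family_clique[of "F A - {\<alpha>}"] F[OF that] by blast
  have "carried V A \<subseteq> F A" for A by (simp add: F_def)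
  then have "poset_step (carrying V) fle ?f1 ?f2"
    using carried_join(1) p2 join_family_mono[OF _ c1 c2] unfolding poset_step_def by blast
  moreover have "poset_step (carrying V) fle ?f2 ?f3"
    using p2 p3 join_family_mono[OF Diff_subset c3 c2] unfolding poset_step_def by blast
  ultimately have st: "(poset_step (carrying V) fle)\<^sup>*\<^sup>* id ?f3"
    using carried_join(2) by (meson r_into_rtranclp rtranclp_trans)
  have im: "?f3 ` carrying V \<subseteq> carrying (V - {\<alpha>})"
  proof
    fix B assume "B \<in> ?f3 ` carrying V"
    then obtain A where A: "A \<in> carrying V" "B = ?f3 A" by blast
    then obtain b where b: "b \<in> F A - {\<alpha>}" "b \<in> V - {\<alpha>}" using F[OF A(1)] by blast
    then show "B \<in> carrying (V - {\<alpha>})" using c3[OF A(1)] join_family_carries[OF b(1)] A(2) by (auto simp: carrying_def)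
  qed
  have sub: "carrying (V - {\<alpha>}) \<subseteq> carrying V" by (auto simp: carrying_def)
  show ?thesis using poset_contractible_deform[OF sub im p3 st c] .
qed

end

lemma reductive_fst: "a \<in> reductive H \<Longrightarrow> fst a \<in> {1..n}"
  by (auto simp: reductive_def is_move_def)

lemma finite_reductive: "bas H \<Longrightarrow> finite (reductive H)"
proof -
  assume H: "bas H"
  have "reductive H \<subseteq> (\<Union>k\<in>{1..n}. Pair k ` {x. is_move H k x})"
    by (auto simp: reductive_def is_move_def)
  moreover have "finite (\<Union>k\<in>{1..n}. Pair k ` {x. is_move H k x})" using finite_is_move[OF H] by blast
  ultimately show ?thesis by (rule finite_subset)
qed

definition spread :: "nat \<Rightarrow> nat \<times> (nat \<Rightarrow> 'a) \<Rightarrow> nat" where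
  "spread k a = card {j. j \<le> n \<and> j \<noteq> fst a \<and> snd a j \<noteq> snd a k}"

text \<open>The only delicate case is that of a move \<open>b\<close> at a factor \<open>i\<close> with \<open>y i \<noteq> y k\<close>. Compatibility then forces \<open>b\<close> to spread
  strictly less around \<open>k\<close> than \<open>(l, y)\<close>, so that by minimality \<open>b\<close> is compatible with \<open>(k, x)\<close>.\<close>

lemma uncross_dominates:
  assumes H: "bas H" and x: "is_move H k x" and y: "is_move H l y" and kl: "k \<noteq> l"
    and b: "fst b \<le> n" "compat (l, y) b"
    and min: "\<not> compat b (k, x) \<Longrightarrow> spread k (l, y) \<le> spread k b"
  shows "compat (l, uncross (l, y) (k, x)) b"
proof (cases "fst b = l")
  case True
  then show ?thesis by (simp add: compat_def)
next
  case False
  obtain i z where iz: "b = (i, z)" by (cases b)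
  have i: "i \<noteq> l" "i \<le> n" using False b(1) iz by auto
  have l: "l \<le> n" "k \<le> n" using x y by (auto simp: is_move_def)
  let ?u = "\<lambda>j. if j \<le> n \<and> j \<noteq> l \<and> j \<noteq> k \<and> y j \<noteq> y k \<and> x j \<noteq> x l then y k else y j"
  have lb: "y j = y i \<or> z j = z l" if "j \<le> n" "j \<noteq> i" "j \<noteq> l" for j
    using b(2) that i iz by (auto simp: compat_def)
  have "?u j = ?u i \<or> z j = z l" if j: "j \<le> n" "j \<noteq> l" "j \<noteq> i" for j
  proof (cases "y i = y k")
    case True
    then show ?thesis using lb[OF j(1,3,2)] by auto
  next
    case yi: False
    then have ik: "i \<noteq> k" by auto
    have zk: "z k = z l" using lb[of k] yi ik l kl by auto
    show ?thesis
    proof (cases "compat b (k, x)")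
      case True
      have c: "z j = z k \<or> x j = x i" if "j \<noteq> k" using True that j ik iz by (auto simp: compat_def)
      show ?thesis
      proof (cases "z j = z l")
        case zj: False
        then have jk: "j \<noteq> k" using zk by auto
        have "y j = y i" "x j = x i" using lb[OF j(1,3,2)] zj c[OF jk] zk by auto
        then show ?thesis using j jk i ik by auto
      qed simp
    next
      case False
      have "{j. j \<le> n \<and> j \<noteq> i \<and> z j \<noteq> z k} \<subset> {j. j \<le> n \<and> j \<noteq> l \<and> y j \<noteq> y k}"
      proof
        show "{j. j \<le> n \<and> j \<noteq> i \<and> z j \<noteq> z k} \<subseteq> {j. j \<le> n \<and> j \<noteq> l \<and> y j \<noteq> y k}"
        proof
          fix j assume "j \<in> {j. j \<le> n \<and> j \<noteq> i \<and> z j \<noteq> z k}"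
          then have j: "j \<le> n" "j \<noteq> i" "z j \<noteq> z k" by auto
          then have "j \<noteq> l" using zk by auto
          then show "j \<in> {j. j \<le> n \<and> j \<noteq> l \<and> y j \<noteq> y k}" using lb[OF j(1,2)] j zk yi by auto
        qed
        have "i \<in> {j. j \<le> n \<and> j \<noteq> l \<and> y j \<noteq> y k}" using i yi by simp
        then show "{j. j \<le> n \<and> j \<noteq> i \<and> z j \<noteq> z k} \<noteq> {j. j \<le> n \<and> j \<noteq> l \<and> y j \<noteq> y k}" by blast
      qed
      from psubset_card_mono[OF _ this] have "spread k b < spread k (l, y)" by (simp add: spread_def iz)
      then show ?thesis using min[OF False] by simp
    qed
  qed
  moreover have "uncross (l, y) (k, x) j = uncross (l, y) (k, x) i \<longleftrightarrow> ?u j = ?u i"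
    if "j \<le> n" "j \<noteq> l" for j
    using uncross_eq_iff[OF bas_fp[OF H] y i(2,1) that, of k x] .
  ultimately have "\<forall>j\<le>n. j \<noteq> l \<longrightarrow> j \<noteq> i \<longrightarrow>
      uncross (l, y) (k, x) j = uncross (l, y) (k, x) i \<or> z j = z l" by simp
  then show ?thesis unfolding compat_def iz fst_conv snd_conv by (rule disjI2)
qed

lemma reductive_contractible:
  assumes H: "bas H" and ne: "reductive H \<noteq> {}"
  shows "poset_contractible (carrying (reductive H)) fle"
proof -
  let ?M = "reductive H"
  define d where "d a = norm_diff H (conj_basis (snd a) H)" for a :: "nat \<times> (nat \<Rightarrow> 'a)"
  obtain m where m: "m \<in> ?M" "\<forall>t\<in>?M. \<not> lpos (\<lambda>g. d t g - d m g)"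
    using lexpos_max[OF wo finite_reductive[OF H] ne, of d] by blast
  obtain k x where kx: "m = (k, x)" by (cases m)
  have x: "is_move H k x" "lpos (d m)" using m(1) kx by (auto simp: reductive_def nless_def d_def)
  define N where "N = {a \<in> ?M. compat a m}"
  have mN: "m \<in> N" using m(1) by (simp add: N_def compat_def)
  \<comment> \<open>By maximality the uncrossed \<open>m\<close> reduces no more than
    \<open>m\<close>. The uncrossing inequality passes the difference to the other side: the
    uncrossed \<open>(l, y)\<close> reduces at least as much as \<open>(l, y)\<close>.\<close>
  have unc: "(l, uncross (l, y) (k, x)) \<in> N" if ly: "(l, y) \<in> ?M" "l \<noteq> k" for l y
  proof -
    have y: "is_move H l y" "lpos (d (l, y))" using ly by (auto simp: reductive_def nless_def d_def)
    let ?y = "(l, uncross (l, y) (k, x))" and ?x = "(k, uncross (k, x) (l, y))"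
    have ay: "is_move H l (snd ?y)" and ax: "is_move H k (snd ?x)"
      using uncross_is_move[OF bas_fp[OF H]] x(1) y(1) by auto
    have nx: "\<not> lpos (\<lambda>g. d ?x g - d m g)"
    proof
      assume p: "lpos (\<lambda>g. d ?x g - d m g)"
      have "lpos (d ?x)" using lexpos_add[OF wo x(2) p] by simp
      then have "?x \<in> ?M" using ax by (simp add: reductive_def nless_def d_def)
      then show False using m(2) p by blast
    qed
    have "lpos (\<lambda>g. d (l, y) g + (d m g - d ?x g))"
      using lexpos_add_nonneg[OF wo y(2), of "\<lambda>g. d m g - d ?x g"] nx by simp
    then have "lpos (d ?y)"
    proof (rule lexpos_mono[OF wo])
      fix g assume "g \<in> carrier G"
      from total_length_uncross[OF H x(1) y(1) ly(2)[symmetric] L[OF this]]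
      show "d (l, y) g + (d m g - d ?x g) \<le> d ?y g" by (simp add: d_def norm_diff_def kx)
    qed
    then have "?y \<in> ?M" using ay by (simp add: reductive_def nless_def d_def)
    then show ?thesis using uncross_compat[OF bas_fp[OF H] y(1) x(1) ly(2)] by (simp add: N_def kx)
  qed
  \<comment> \<open>Induction on the number of reductive moves crossing \<open>m\<close>. The one of
    least spread is removed; its uncrossed version lies in \<open>N\<close>, so it is still
    present.\<close>
  have "poset_contractible (carrying (N \<union> X')) fle" if "finite X'" "X' \<subseteq> ?M - N" for X'
    using that
  proof (induction "card X'" arbitrary: X')
    case 0
    then have "X' = {}" by simp
    moreover have "poset_contractible (carrying N) fle"
      by (rule poset_contractible_cone[OF _ mN]) (use reductive_fst in \<open>auto simp: N_def\<close>)
    ultimately show ?case by simp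
  next
    case (Suc c)
    then have "X' \<noteq> {}" by auto
    define a where "a = arg_min_on (spread k) X'"
    have a: "a \<in> X'" "\<And>b. b \<in> X' \<Longrightarrow> spread k a \<le> spread k b"
      using arg_min_if_finite[OF Suc.prems(1) \<open>X' \<noteq> {}\<close>, of "spread k"] unfolding a_def by (auto simp: not_less)
    obtain l y where ly: "a = (l, y)" by (cases a)
    have aM: "(l, y) \<in> ?M" "(l, y) \<notin> N" using a(1) Suc.prems(2) ly by auto
    \<comment> \<open>Here \<open>prepend_letter\<close> is the name of a fact. Moves at one factor
      are compatible, so a move that crosses \<open>m\<close> sits at another factor.\<close>
    then have prepend_letter: "l \<noteq> k" by (auto simp: N_def kx compat_def)
    have y: "is_move H l y" using aM by (auto simp: reductive_def)
    let ?a' = "(l, uncross (l, y) (k, x))"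
    have a'N: "?a' \<in> N" using unc[OF aM(1) prepend_letter] .
    have dom: "compat ?a' b" if b: "b \<in> N \<union> X'" "compat a b" for b
    proof (rule uncross_dominates[OF H x(1) y prepend_letter[symmetric]])
      have "b \<in> ?M" using b Suc.prems(2) by (auto simp: N_def)
      then show "fst b \<le> n" using reductive_fst[of b H] by simp
      show "compat (l, y) b" using b ly by simp
      assume "\<not> compat b (k, x)"
      then have "b \<in> X'" using b by (auto simp: N_def kx)
      then show "spread k (l, y) \<le> spread k b" using a(2) ly by simp
    qed
    have aN: "a \<notin> N" "a \<in> N \<union> X'" using a Suc.prems by auto
    have "poset_contractible (carrying (N \<union> (X' - {a}))) fle"
      using Suc a(1) by (intro Suc.hyps(1)) auto
    moreover have "N \<union> (X' - {a}) = (N \<union> X') - {a}" using aN by blast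
    ultimately have c: "poset_contractible (carrying ((N \<union> X') - {a})) fle" by simp
    have fs: "fst b \<in> {1..n}" if "b \<in> N \<union> X'" for b
    proof -
      have "b \<in> ?M" using that Suc.prems(2) by (auto simp: N_def)
      then show ?thesis by (rule reductive_fst)
    qed
    have na: "?a' \<in> N \<union> X'" "?a' \<noteq> a" "fst a = fst ?a'" using a'N aN ly by auto
    show ?case using poset_contractible_dominated[OF fs aN(2) na dom c] .
  qed
  from this[of "?M - N"] finite_reductive[OF H] have "poset_contractible (carrying (N \<union> (?M - N))) fle" by simp
  moreover have "N \<union> (?M - N) = ?M" by (auto simp: N_def)
  ultimately show ?thesis by simp
qed

end

section \<open>Order complexes and the vertices of the complex\<close>

definition order_complex :: "'v set \<Rightarrow> ('v \<Rightarrow> 'v \<Rightarrow> bool) \<Rightarrow> 'v set set" where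
  "order_complex P lq = {\<sigma>. \<sigma> \<noteq> {} \<and> finite \<sigma> \<and> \<sigma> \<subseteq> P \<and> (\<forall>a\<in>\<sigma>. \<forall>b\<in>\<sigma>. lq a b \<or> lq b a)}"

lemma chain_least:
  assumes "finite \<sigma>" "\<sigma> \<noteq> {}" "\<And>a b. a \<in> \<sigma> \<Longrightarrow> b \<in> \<sigma> \<Longrightarrow> lq a b \<or> lq b a"
    and "\<And>a b c. a \<in> \<sigma> \<Longrightarrow> b \<in> \<sigma> \<Longrightarrow> c \<in> \<sigma> \<Longrightarrow> lq a b \<Longrightarrow> lq b c \<Longrightarrow> lq a c"
  shows "\<exists>m\<in>\<sigma>. \<forall>a\<in>\<sigma>. lq m a"
  using assms
proof (induction rule: finite_ne_induct)
  case (singleton x)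
  then show ?case by blast
next
  case (insert x F)
  have "\<exists>m\<in>F. \<forall>a\<in>F. lq m a"
    by (rule insert.IH) (use insert.prems in blast)+
  then obtain m where m: "m \<in> F" "\<forall>a\<in>F. lq m a" by blast
  show ?case
  proof (cases "lq m x")
    case True
    then show ?thesis using m by blast
  next
    case False
    then have xm: "lq x m" using insert.prems(1)[of x m] m by blast
    have "lq x a" if "a \<in> F" for a using insert.prems(2)[of x m a] xm m that by blast
    moreover have "lq x x" using insert.prems(1)[of x x] by blast
    ultimately show ?thesis by blast
  qed
qed

context whitehead_poset
begin

definition cls :: "(nat \<Rightarrow> 'a set) \<Rightarrow> (nat \<Rightarrow> nat set set) \<Rightarrow> 'a lpair set" where
  "cls H A = lequiv G n Gs `` {(H, A)}"

lemma lpairs_iff: "(H, A) \<in> lpairs G n Gs \<longleftrightarrow> bas H \<and> compatible_family n A"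
  using compatible_family_iff_tree[OF n_pos, of A] by (simp add: lpairs_def)

lemma lequiv_steps:
  assumes "((H, A), q) \<in> lequiv G n Gs" and H: "bas H" and A: "compatible_family n A"
  shows "snd q = A \<and> (step A)\<^sup>*\<^sup>* H (fst q)"
  using assms(1) unfolding lequiv_def
proof (induction rule: rtrancl_induct)
  case (step p q)
  have p: "snd p = A" "(step A)\<^sup>*\<^sup>* H (fst p)" using step by auto
  have bp: "bas (fst p)" using steps_bas[OF p(2) H] .
  from step(2) have "snd q = A \<and> (step A)\<^sup>*\<^sup>* (fst p) (fst q)"
  proof
    assume "(p, q) \<in> wh_step G n Gs"
    then obtain H1 K1 \<phi>s where q: "p = (H1, A)" "q = (K1, A)"
      "\<forall>\<phi>\<in>set \<phi>s. carried_whitehead G n H1 A \<phi>" "K1 = (\<lambda>i. foldr (\<circ>) \<phi>s id ` H1 i)"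
      using p(1) unfolding wh_step_def by auto
    then have "(step A)\<^sup>*\<^sup>* H1 K1" using carried_steps[OF _ A, of H1 \<phi>s] bp by (simp add: img_def)
    then show ?thesis using q by simp
  next
    assume "(p, q) \<in> (wh_step G n Gs)\<inverse>"
    then obtain H1 K1 \<phi>s where q: "q = (H1, A)" "p = (K1, A)" "bas H1"
      "\<forall>\<phi>\<in>set \<phi>s. carried_whitehead G n H1 A \<phi>" "K1 = (\<lambda>i. foldr (\<circ>) \<phi>s id ` H1 i)"
      using p(1) unfolding wh_step_def by (auto simp: lpairs_iff)
    then have "(step A)\<^sup>*\<^sup>* H1 K1" using carried_steps[OF _ A, of H1 \<phi>s] by (simp add: img_def)
    then have "(step A)\<^sup>*\<^sup>* K1 H1" using steps_sym q(3) by blast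
    then show ?thesis using q by simp
  qed
  then show ?case using p(2) by auto
qed simp

lemma steps_lequiv:
  assumes "(step A)\<^sup>*\<^sup>* H K" and H: "bas H" and A: "compatible_family n A"
  shows "((H, A), (K, A)) \<in> lequiv G n Gs"
  using assms(1)
proof (induction rule: rtranclp_induct)
  case (step K M)
  have "((K, A), (M, A)) \<in> wh_step G n Gs"
    using step_wh_step[OF n_pos steps_bas[OF step(1) H] A step(2)] .
  then show ?case using step(3) unfolding lequiv_def by (meson UnI1 rtrancl.rtrancl_into_rtrancl)
qed (simp add: lequiv_def)

lemma cls_mem:
  assumes "bas H" "compatible_family n A"
  shows "(K, B) \<in> cls H A \<longleftrightarrow> B = A \<and> (step A)\<^sup>*\<^sup>* H K"
  using lequiv_steps[of H A "(K, B)"] steps_lequiv[of A H K] assms by (auto simp: cls_def)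

lemma cls_eq:
  assumes H: "bas H" and A: "compatible_family n A" and K: "bas K" and B: "compatible_family n B"
  shows "cls H A = cls K B \<longleftrightarrow> A = B \<and> (step A)\<^sup>*\<^sup>* H K"
proof
  assume "cls H A = cls K B"
  moreover have "(K, B) \<in> cls K B" using cls_mem[OF K B] by simp
  ultimately show "A = B \<and> (step A)\<^sup>*\<^sup>* H K" using cls_mem[OF H A] by auto
next
  assume r: "A = B \<and> (step A)\<^sup>*\<^sup>* H K"
  then have s: "(step A)\<^sup>*\<^sup>* K H" using steps_sym H by blast
  have "(M, C) \<in> cls H A \<longleftrightarrow> (M, C) \<in> cls K B" for M C
    using cls_mem[OF H A] cls_mem[OF K B] r s by (auto intro: rtranclp_trans)
  then show "cls H A = cls K B" by auto
qed

lemma LG_vertices_iff: "w \<in> LG_vertices G n Gs \<longleftrightarrow> (\<exists>H A. bas H \<and> compatible_family n A \<and> w = cls H A)"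
  unfolding LG_vertices_def quotient_def cls_def using lpairs_iff by auto

lemma cls_vertex: "bas H \<Longrightarrow> compatible_family n A \<Longrightarrow> cls H A \<in> LG_vertices G n Gs"
  using LG_vertices_iff by blast

lemma steps_mono:
  assumes A: "compatible_family n A" and B: "compatible_family n B" and le: "fle A B" and s: "(step A)\<^sup>*\<^sup>* H K"
  shows "(step B)\<^sup>*\<^sup>* H K"
proof -
  have "step B H K" if st: "step A H K" for H K
  proof -
    obtain k x where x: "is_move H k x" "carries A (k, x)" "K = conj_basis x H" using st by (auto simp: step_def)
    have "k \<le> n" using x(1) by (simp add: is_move_def)
    then have "carries B (k, x)" using carries_mono[OF A B le x(2)] by simp
    then show ?thesis using x by (auto simp: step_def)
  qed
  then show ?thesis using s by (metis mono_rtranclp)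
qed

text \<open>The order can be tested at any basis representing the lower vertex: moves carried by
  \<open>A\<close> are carried by every larger \<open>B\<close>, so a common basis can be moved to
  \<open>H\<close> within the upper class as well.\<close>

lemma LG_le_iff:
  assumes H: "bas H" and A: "compatible_family n A" and w: "w \<in> LG_vertices G n Gs"
  shows "LG_le n (cls H A) w \<longleftrightarrow> (\<exists>B. compatible_family n B \<and> w = cls H B \<and> fle A B)"
proof
  assume "LG_le n (cls H A) w"
  then obtain K A' B where K: "(K, A') \<in> cls H A" "(K, B) \<in> w" "fle A' B" by (auto simp: LG_le_def)
  then have A': "A' = A" "(step A)\<^sup>*\<^sup>* H K" using cls_mem[OF H A] by auto
  obtain M C where M: "bas M" "compatible_family n C" "w = cls M C" using w LG_vertices_iff by blast
  then have C: "B = C" "(step B)\<^sup>*\<^sup>* M K" using cls_mem[OF M(1,2)] K(2) by auto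
  have B: "compatible_family n B" using C M by simp
  have "(step B)\<^sup>*\<^sup>* H K" using steps_mono[OF A B] K(3) A' by blast
  then have "(step B)\<^sup>*\<^sup>* H M" using steps_sym[OF C(2) M(1)] by (rule rtranclp_trans)
  then have "w = cls H B" using cls_eq[OF H B M(1,2)] M(3) C(1) by simp
  then show "\<exists>B. compatible_family n B \<and> w = cls H B \<and> fle A B" using B K(3) A' by blast
next
  assume "\<exists>B. compatible_family n B \<and> w = cls H B \<and> fle A B"
  then obtain B where B: "compatible_family n B" "w = cls H B" "fle A B" by blast
  then show "LG_le n (cls H A) w" using cls_mem[OF H A] cls_mem[OF H B(1)] unfolding LG_le_def by blast
qed

lemma LG_le_cls:
  assumes H: "bas H" and A: "compatible_family n A" and B: "compatible_family n B"
  shows "LG_le n (cls H A) (cls H B) \<longleftrightarrow> fle A B"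
  using LG_le_iff[OF H A cls_vertex[OF H B]] cls_eq[OF H B H] B by auto

lemma LG_le_refl: "w \<in> LG_vertices G n Gs \<Longrightarrow> LG_le n w w"
  using LG_le_cls family_le_refl LG_vertices_iff by metis

lemma LG_le_trans:
  assumes u: "u \<in> LG_vertices G n Gs" and v: "v \<in> LG_vertices G n Gs" and w: "w \<in> LG_vertices G n Gs"
    and uv: "LG_le n u v" and vw: "LG_le n v w"
  shows "LG_le n u w"
proof -
  obtain H A where H: "bas H" "compatible_family n A" "u = cls H A" using u LG_vertices_iff by blast
  obtain B where B: "compatible_family n B" "v = cls H B" "fle A B" using uv LG_le_iff[OF H(1,2) v] H(3) by auto
  obtain C where C: "compatible_family n C" "w = cls H C" "fle B C" using vw LG_le_iff[OF H(1) B(1) w] B(2) by auto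
  then show ?thesis using LG_le_cls[OF H(1,2) C(1)] family_le_trans[OF H(2) B(1) C(1) B(3)] H(3) by simp
qed

lemma LG_le_antisym:
  assumes u: "u \<in> LG_vertices G n Gs" and v: "v \<in> LG_vertices G n Gs"
    and uv: "LG_le n u v" and vu: "LG_le n v u"
  shows "u = v"
proof -
  obtain H A where H: "bas H" "compatible_family n A" "u = cls H A" using u LG_vertices_iff by blast
  obtain B where B: "compatible_family n B" "v = cls H B" "fle A B" using uv LG_le_iff[OF H(1,2) v] H(3) by auto
  then have "fle B A" using vu LG_le_cls[OF H(1) B(1) H(2)] H(3) by simp
  then show ?thesis using family_le_antisym[OF H(2) B(1,3)] H(3) B(2) by simp
qed

lemma nuclear_cls: "nuclear G n Gs H = cls H (zero_family n)"
  unfolding nuclear_def cls_def trivial_tree_family[OF n_pos] ..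

text \<open>The only petal at a factor in the zero family contains \<open>0\<close>, so a carried
  move is trivial and no step leaves \<open>H\<close>. Nuclear vertices thus correspond to
  bases.\<close>

lemma nuclear_inj:
  assumes H: "bas H" and K: "bas K" and e: "nuclear G n Gs H = nuclear G n Gs K" shows "H = K"
proof -
  note z = zero_family_compatible_family[OF n_pos]
  have "(step (zero_family n))\<^sup>*\<^sup>* H K" using e cls_eq[OF H z K z] by (simp add: nuclear_cls)
  moreover have triv: "M' = M" if "bas M" "step (zero_family n) M M'" for M M'
  proof -
    obtain k x where x: "is_move M k x" "carries (zero_family n) (k, x)" "M' = conj_basis x M" using \<open>step (zero_family n) M M'\<close> by (auto simp: step_def)
    have k: "k \<in> {1..n}" "x k = \<one>" "\<And>j. j \<notin> {1..n} \<Longrightarrow> x j = \<one>" using x(1) by (auto simp: is_move_def)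
    have "x j = \<one>" for j
    proof (cases "j \<in> {1..n} \<and> j \<noteq> k")
      case True
      then have "x j = x 0" using crrD[OF x(2), of "{0..n} - {k}" j 0] k(1) by (simp add: zero_family_def)
      then show ?thesis using k by simp
    next
      case False
      then show ?thesis using k(2) k(3)[of j] by (cases "j = k") auto
    qed
    then have "x = (\<lambda>j. \<one>)" by (rule ext)
    then show ?thesis using x(3) conj_basis_trivial[OF \<open>bas M\<close>] by simp
  qed
  ultimately have "K = H"
  proof (induction rule: rtranclp_induct)
    case (step K M)
    then have "K = H" by simp
    then show ?case using triv[of H M] H step(2) by simp
  qed simp
  then show ?thesis by simp
qed

definition star_set :: "(nat \<Rightarrow> 'a set) \<Rightarrow> 'a lpair set set" where
  "star_set H = cls H ` {A. compatible_family n A}"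

lemma LG_complex_order: "LG_complex G n Gs = order_complex (LG_vertices G n Gs) (LG_le n)"
  by (simp add: LG_complex_def order_complex_def)

lemma star_set_iff:
  "bas H \<Longrightarrow> w \<in> star_set H \<longleftrightarrow> w \<in> LG_vertices G n Gs \<and> LG_le n (nuclear G n Gs H) w"
proof -
  assume H: "bas H"
  note z = zero_family_compatible_family[OF n_pos]
  show ?thesis unfolding nuclear_cls
  proof
    assume "w \<in> star_set H"
    then obtain A where A: "compatible_family n A" "w = cls H A" by (auto simp: star_set_def)
    then show "w \<in> LG_vertices G n Gs \<and> LG_le n (cls H (zero_family n)) w"
      using cls_vertex[OF H A(1)] LG_le_cls[OF H z A(1)] zero_family_least[OF n_pos A(1)] by simp
  next
    assume w: "w \<in> LG_vertices G n Gs \<and> LG_le n (cls H (zero_family n)) w"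
    then obtain B where "compatible_family n B" "w = cls H B" using LG_le_iff[OF H z, of w] by auto
    then show "w \<in> star_set H" by (simp add: star_set_def)
  qed
qed

lemma LG_star_order: "bas H \<Longrightarrow> LG_star G n Gs (nuclear G n Gs H) = order_complex (star_set H) (LG_le n)"
  unfolding LG_star_def LG_complex_order order_complex_def using star_set_iff[of H] by auto

section \<open>Families shared with a smaller nuclear vertex\<close>

text \<open>Along carried moves the reductions at the various factors vary independently; the witness \<open>x l\<close> below is
  the accumulated move at the factor \<open>l\<close>.\<close>

lemma steps_additive:
  assumes H: "bas H" and A: "compatible_family n A" and s: "(step A)\<^sup>*\<^sup>* H K"
  shows "\<exists>x. (\<forall>l\<in>{1..n}. is_move H l (x l) \<and> carries A (l, x l)) \<and>
     (\<forall>l\<in>{1..n}. \<forall>y. is_move K l y \<longrightarrow> carries A (l, y) \<longrightarrow> (\<exists>y'. is_move H l y' \<and> carries A (l, y') \<and>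
        (\<forall>g\<in>carrier G. norm_diff K (conj_basis y K) g = norm_diff H (conj_basis y' H) g - norm_diff H (conj_basis (x l) H) g))) \<and>
     (\<forall>g\<in>carrier G. norm_diff H K g = (\<Sum>l\<in>{1..n}. norm_diff H (conj_basis (x l) H) g))"
  using s
proof (induction rule: rtranclp_induct)
  case base
  have "carries A (l, \<lambda>j. \<one>)" for l by (simp add: carries_def)
  then show ?case using is_move_one[OF _ bas_fp[OF H]] conj_basis_trivial[OF H]
    by (intro exI[of _ "\<lambda>l j. \<one>"]) (auto simp: norm_diff_def)
next
  case (step K M)
  obtain x where x: "\<forall>l\<in>{1..n}. is_move H l (x l) \<and> carries A (l, x l)"
     and tra: "\<And>l y. l \<in> {1..n} \<Longrightarrow> is_move K l y \<Longrightarrow> carries A (l, y) \<Longrightarrow> \<exists>y'. is_move H l y' \<and> carries A (l, y') \<and>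
        (\<forall>g\<in>carrier G. norm_diff K (conj_basis y K) g = norm_diff H (conj_basis y' H) g - norm_diff H (conj_basis (x l) H) g)"
     and sm: "\<forall>g\<in>carrier G. norm_diff H K g = (\<Sum>l\<in>{1..n}. norm_diff H (conj_basis (x l) H) g)"
    using step.IH by blast
  have K: "bas K" using steps_bas[OF step(1) H] .
  obtain k z where z: "is_move K k z" "carries A (k, z)" "M = conj_basis z K" using step(2) by (auto simp: step_def)
  have k: "k \<in> {1..n}" using z(1) by (simp add: is_move_def)
  obtain z' where z': "is_move H k z'" "carries A (k, z')"
     "\<And>g. g \<in> carrier G \<Longrightarrow> norm_diff K M g = norm_diff H (conj_basis z' H) g - norm_diff H (conj_basis (x k) H) g"
    using tra[OF k z(1,2)] z(3) by blast
  have zc: "\<And>j. z j \<in> carrier G" using is_move_carrier[OF bas_fp[OF K] z(1)] .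
  have difadd: "norm_diff P Q g + norm_diff Q R g = norm_diff P R g" for P Q R g by (simp add: norm_diff_def)
  show ?case
  \<comment> \<open>Measured at \<open>H\<close>, the new step replaces the accumulated move at
    \<open>k\<close> by \<open>z'\<close> and leaves the other factors alone.\<close>
  proof (intro exI[of _ "x(k := z')"] conjI ballI allI impI)
    fix l assume "l \<in> {1..n}"
    then show "is_move H l ((x(k := z')) l)" "carries A (l, (x(k := z')) l)" using x z' by auto
  next
    fix g assume g: "g \<in> carrier G"
    have "(\<Sum>l\<in>{1..n}. norm_diff H (conj_basis ((x(k := z')) l) H) g)
       = norm_diff H (conj_basis z' H) g + (\<Sum>l\<in>{1..n} - {k}. norm_diff H (conj_basis (x l) H) g)"
      using k by (subst sum.remove[of _ k]) (auto intro!: sum.cong)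
    moreover have "norm_diff H K g = norm_diff H (conj_basis (x k) H) g + (\<Sum>l\<in>{1..n} - {k}. norm_diff H (conj_basis (x l) H) g)"
      using sm g k by (subst sum.remove[of _ k, symmetric]) auto
    ultimately show "norm_diff H M g = (\<Sum>l\<in>{1..n}. norm_diff H (conj_basis ((x(k := z')) l) H) g)"
      using z'(3)[OF g] difadd[of H K g M] by simp
  next
    fix l y assume l: "l \<in> {1..n}" and y: "is_move M l y" "carries A (l, y)"
    show "\<exists>y'. is_move H l y' \<and> carries A (l, y') \<and>
        (\<forall>g\<in>carrier G. norm_diff M (conj_basis y M) g = norm_diff H (conj_basis y' H) g - norm_diff H (conj_basis ((x(k := z')) l) H) g)"
    proof (cases "l = k")
      case True
      have ay: "is_move K k (\<lambda>j. y j \<otimes> z j)" using is_move_mult[OF bas_fp[OF K] z(1)] y(1) z(3) True by simp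
      have cy: "carries A (k, \<lambda>j. y j \<otimes> z j)" using carries_map2 y(2) z(2) True by blast
      have "\<And>j. y j \<in> carrier G" using is_move_carrier[OF bas_fp[OF bas_conj_basis[OF K z(1)]]] y(1) z(3) by simp
      then have e: "conj_basis y M = conj_basis (\<lambda>j. y j \<otimes> z j) K" using conj_basis_comp[OF K zc] z(3) by simp
      obtain y' where y': "is_move H k y'" "carries A (k, y')"
        "\<And>g. g \<in> carrier G \<Longrightarrow> norm_diff K (conj_basis y M) g = norm_diff H (conj_basis y' H) g - norm_diff H (conj_basis (x k) H) g"
        using tra[OF k ay cy] e by auto
      have "norm_diff M (conj_basis y M) g = norm_diff H (conj_basis y' H) g - norm_diff H (conj_basis z' H) g" if "g \<in> carrier G" for g
        using y'(3)[OF that] z'(3)[OF that] difadd[of K M g "conj_basis y M"] by simp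
      then show ?thesis using y'(1,2) True by auto
    next
      case False
      \<comment> \<open>At a factor other than \<open>k\<close> the move is carried back across
        \<open>z\<close>. Both are carried by \<open>A\<close>, hence compatible, so its reduction
        is the same before and after \<open>z\<close>.\<close>
      let ?y = "conj_by (inv (z l)) y"
      have ay: "is_move K l ?y" "conj_by (z l) ?y = y" using is_move_conj_by_inverse[OF bas_fp[OF K] z(1)] y(1) z(3) by auto
      have cy: "carries A (l, ?y)" unfolding conj_by_def using carries_map[OF y(2)] .
      have "k \<le> n" "l \<le> n" using k l by auto
      then have "compat (k, z) (l, ?y)" using carries_compat[OF A z(2) _ cy] by simp
      note nc = total_length_commute[OF K z(1) ay(1) False[symmetric] this L]
      obtain y' where y': "is_move H l y'" "carries A (l, y')"
        "\<And>g. g \<in> carrier G \<Longrightarrow> norm_diff K (conj_basis ?y K) g = norm_diff H (conj_basis y' H) g - norm_diff H (conj_basis (x l) H) g"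
        using tra[OF l ay(1) cy] by blast
      have "norm_diff M (conj_basis y M) g = norm_diff K (conj_basis ?y K) g" if "g \<in> carrier G" for g
        using nc[OF that] ay(2) z(3) by (simp add: norm_diff_def)
      then show ?thesis using y' False by auto
    qed
  qed
qed

text \<open>A reductive carried move leads directly to a smaller basis of the same class. Conversely
  the norm drops from \<open>H\<close> to \<open>K\<close> by a sum of drops of single carried
  moves, and a positive sum has a positive summand.\<close>

lemma carrying_reductive_iff:
  assumes H: "bas H" and A: "compatible_family n A"
  shows "A \<in> carrying (reductive H) \<longleftrightarrow> (\<exists>K. bas K \<and> nless K H \<and> cls K A = cls H A)"
proof
  assume "A \<in> carrying (reductive H)"
  then obtain k x where x: "is_move H k x" "nless (conj_basis x H) H" "carries A (k, x)"
    by (auto simp: carrying_def reductive_def)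
  have "step A H (conj_basis x H)" using x unfolding step_def by blast
  then have "(step A)\<^sup>*\<^sup>* H (conj_basis x H)" using r_into_rtranclp[of "step A" H "conj_basis x H"] by blast
  then have "cls (conj_basis x H) A = cls H A" using cls_eq[OF H A bas_conj_basis[OF H x(1)] A] by simp
  then show "\<exists>K. bas K \<and> nless K H \<and> cls K A = cls H A" using x bas_conj_basis[OF H x(1)] by blast
next
  assume "\<exists>K. bas K \<and> nless K H \<and> cls K A = cls H A"
  then obtain K where K: "bas K" "nless K H" "cls H A = cls K A" by metis
  then have "(step A)\<^sup>*\<^sup>* H K" using cls_eq[OF H A K(1) A] by simp
  then obtain x where x: "\<forall>l\<in>{1..n}. is_move H l (x l) \<and> carries A (l, x l)"
     "\<forall>g\<in>carrier G. norm_diff H K g = (\<Sum>l\<in>{1..n}. norm_diff H (conj_basis (x l) H) g)"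
    using steps_additive[OF H A] by blast
  have "lpos (\<lambda>g. \<Sum>l\<in>{1..n}. norm_diff H (conj_basis (x l) H) g)"
    using K(2) x(2) lexpos_cong[OF wo, of "norm_diff H K"] by (simp add: nless_def)
  then obtain l where l: "l \<in> {1..n}" "lpos (norm_diff H (conj_basis (x l) H))"
    using lexpos_sum[OF wo, of "{1..n}" "\<lambda>l. norm_diff H (conj_basis (x l) H)"] by auto
  then have "(l, x l) \<in> reductive H" using x(1) by (simp add: reductive_def nless_def)
  then show "A \<in> carrying (reductive H)" using x(1) l(1) A by (auto simp: carrying_def)
qed

definition lower_set :: "(nat \<Rightarrow> 'a set) \<Rightarrow> 'a lpair set set" where
  "lower_set H = cls H ` carrying (reductive H)"

lemma star_Int_lower:
  assumes H: "bas H"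
  shows "order_complex (star_set H) (LG_le n) \<inter> (\<Union>K\<in>{K. bas K \<and> nless K H}. order_complex (star_set K) (LG_le n))
    = order_complex (lower_set H) (LG_le n)" (is "?L = ?R")
proof
  show "?L \<subseteq> ?R"
  proof
    fix \<sigma> assume "\<sigma> \<in> ?L"
    then obtain K where K: "bas K" "nless K H" and s: "\<sigma> \<in> order_complex (star_set H) (LG_le n)" "\<sigma> \<in> order_complex (star_set K) (LG_le n)"
      by blast
    have "w \<in> lower_set H" if w: "w \<in> \<sigma>" for w
    proof -
      have "w \<in> star_set H" "w \<in> star_set K" using s w by (auto simp: order_complex_def)
      then obtain A B where AB: "compatible_family n A" "w = cls H A" "compatible_family n B" "w = cls K B" by (auto simp: star_set_def)
      then have "A = B" using cls_eq[OF H AB(1) K(1) AB(3)] by simp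
      then have "A \<in> carrying (reductive H)" using carrying_reductive_iff[OF H AB(1)] K AB by auto
      then show ?thesis using AB by (simp add: lower_set_def)
    qed
    then show "\<sigma> \<in> ?R" using s(1) by (auto simp: order_complex_def)
  qed
  show "?R \<subseteq> ?L"
  proof
    fix \<sigma> assume s: "\<sigma> \<in> ?R"
    have sub: "lower_set H \<subseteq> star_set H" by (auto simp: lower_set_def star_set_def carrying_def)
    have sV: "w \<in> LG_vertices G n Gs" if "w \<in> \<sigma>" for w
      using s sub star_set_iff[OF H] that by (auto simp: order_complex_def)
    \<comment> \<open>The least vertex of the chain lies in the star of some smaller basis, and
      stars are closed upwards, so one basis serves the entire chain.\<close>
    have "\<exists>m\<in>\<sigma>. \<forall>a\<in>\<sigma>. LG_le n m a"
    proof (rule chain_least)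
      fix a b c assume "a \<in> \<sigma>" "b \<in> \<sigma>" "c \<in> \<sigma>" "LG_le n a b" "LG_le n b c"
      then show "LG_le n a c" using LG_le_trans sV by blast
    qed (use s in \<open>auto simp: order_complex_def\<close>)
    then obtain m where m: "m \<in> \<sigma>" "\<forall>a\<in>\<sigma>. LG_le n m a" by blast
    then have "m \<in> lower_set H" using s by (auto simp: order_complex_def)
    then obtain A where A: "A \<in> carrying (reductive H)" "m = cls H A" by (auto simp: lower_set_def)
    then have cA: "compatible_family n A" by (simp add: carrying_def)
    obtain K where K: "bas K" "nless K H" "m = cls K A" using carrying_reductive_iff[OF H cA] A by auto
    have "w \<in> star_set K" if "w \<in> \<sigma>" for w
      using LG_le_iff[OF K(1) cA sV[OF that]] m(2) that K(3) by (auto simp: star_set_def)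
    then have "\<sigma> \<in> order_complex (star_set K) (LG_le n)" using s by (auto simp: order_complex_def)
    moreover have "\<sigma> \<in> order_complex (star_set H) (LG_le n)" using s sub by (auto simp: order_complex_def)
    ultimately show "\<sigma> \<in> ?L" using K by blast
  qed
qed

lemma lower_set_contractible:
  assumes H: "bas H" and K: "bas K" "nless K H"
  shows "poset_contractible (lower_set H) (LG_le n)"
  unfolding lower_set_def
proof (rule poset_contractible_iso)
  show "poset_contractible (carrying (reductive H)) fle"
    using reductive_contractible[OF H reductive_exists[OF H K]] .
  have c: "compatible_family n A" if "A \<in> carrying (reductive H)" for A using that by (simp add: carrying_def)
  show "inj_on (cls H) (carrying (reductive H))" using cls_eq[OF H c H c] by (auto simp: inj_on_def)
  show "LG_le n (cls H A) (cls H B) \<longleftrightarrow> fle A B" if "A \<in> carrying (reductive H)" "B \<in> carrying (reductive H)" for A B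
    using LG_le_cls[OF H c[OF that(1)] c[OF that(2)]] .
qed (rule family_le_refl)

lemma finite_star_set: "finite (star_set H)"
  using finite_compatible_family by (simp add: star_set_def)

end

section \<open>The weak topology\<close>

lemma geom_simplex_subset_realization: "\<sigma> \<in> K \<Longrightarrow> geom_simplex \<sigma> \<subseteq> realization K"
  by (auto simp: realization_def)

lemma openin_realization_top:
  "openin (realization_top K) U \<longleftrightarrow>
     U \<subseteq> realization K \<and> (\<forall>\<sigma>\<in>K. openin (top_of_set (geom_simplex \<sigma>)) (U \<inter> geom_simplex \<sigma>))"
proof -
  have "istopology (\<lambda>U. U \<subseteq> realization K \<and>
      (\<forall>\<sigma>\<in>K. openin (top_of_set (geom_simplex \<sigma>)) (U \<inter> geom_simplex \<sigma>)))"
    unfolding istopology_def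
  proof (intro conjI allI impI ballI)
    fix S T \<sigma>
    assume S: "S \<subseteq> realization K \<and> (\<forall>\<sigma>\<in>K. openin (top_of_set (geom_simplex \<sigma>)) (S \<inter> geom_simplex \<sigma>))"
      and T: "T \<subseteq> realization K \<and> (\<forall>\<sigma>\<in>K. openin (top_of_set (geom_simplex \<sigma>)) (T \<inter> geom_simplex \<sigma>))"
    show "S \<inter> T \<subseteq> realization K" using S by blast
    assume "\<sigma> \<in> K"
    then have "openin (top_of_set (geom_simplex \<sigma>)) (S \<inter> geom_simplex \<sigma>)"
      "openin (top_of_set (geom_simplex \<sigma>)) (T \<inter> geom_simplex \<sigma>)" using S T by blast+
    then have "openin (top_of_set (geom_simplex \<sigma>)) ((S \<inter> geom_simplex \<sigma>) \<inter> (T \<inter> geom_simplex \<sigma>))"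
      by (rule openin_Int)
    moreover have "(S \<inter> geom_simplex \<sigma>) \<inter> (T \<inter> geom_simplex \<sigma>) = S \<inter> T \<inter> geom_simplex \<sigma>" by blast
    ultimately show "openin (top_of_set (geom_simplex \<sigma>)) (S \<inter> T \<inter> geom_simplex \<sigma>)" by simp
  next
    fix \<U> \<sigma>
    assume U: "\<forall>U\<in>\<U>. U \<subseteq> realization K \<and> (\<forall>\<sigma>\<in>K. openin (top_of_set (geom_simplex \<sigma>)) (U \<inter> geom_simplex \<sigma>))"
    show "\<Union>\<U> \<subseteq> realization K" using U by blast
    assume "\<sigma> \<in> K"
    then have "openin (top_of_set (geom_simplex \<sigma>)) (\<Union>U\<in>\<U>. U \<inter> geom_simplex \<sigma>)"
      using U by (intro openin_Union) auto
    moreover have "(\<Union>U\<in>\<U>. U \<inter> geom_simplex \<sigma>) = \<Union>\<U> \<inter> geom_simplex \<sigma>" by blast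
    ultimately show "openin (top_of_set (geom_simplex \<sigma>)) (\<Union>\<U> \<inter> geom_simplex \<sigma>)" by simp
  qed
  then show ?thesis unfolding realization_top_def by (simp add: topology_inverse')
qed

lemma topspace_realization_top [simp]: "topspace (realization_top K) = realization K"
proof
  show "topspace (realization_top K) \<subseteq> realization K"
    using openin_realization_top[of K "topspace (realization_top K)"] by blast
  have "realization K \<inter> geom_simplex \<sigma> = geom_simplex \<sigma>" if "\<sigma> \<in> K" for \<sigma>
    using geom_simplex_subset_realization[OF that] by blast
  then have "openin (realization_top K) (realization K)" unfolding openin_realization_top by simp
  then show "realization K \<subseteq> topspace (realization_top K)" by (rule openin_subset)
qed

lemma realization_quotient:
  "quotient_map (sum_topology (\<lambda>\<sigma>. top_of_set (geom_simplex \<sigma>)) K) (realization_top K) snd"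
  unfolding quotient_map_def
proof (intro conjI allI impI)
  let ?S = "sum_topology (\<lambda>\<sigma>. top_of_set (geom_simplex \<sigma>)) K"
  show "snd ` topspace ?S = topspace (realization_top K)"
    by (force simp: realization_def image_iff)
  fix U assume U: "U \<subseteq> topspace (realization_top K)"
  have "{x. (\<sigma>, x) \<in> {x \<in> topspace ?S. snd x \<in> U}} = U \<inter> geom_simplex \<sigma>" if "\<sigma> \<in> K" for \<sigma>
    using that by auto
  moreover have "{x \<in> topspace ?S. snd x \<in> U} \<subseteq> Sigma K (topspace \<circ> (\<lambda>\<sigma>. top_of_set (geom_simplex \<sigma>)))"
    by auto
  ultimately show "openin ?S {x \<in> topspace ?S. snd x \<in> U} = openin (realization_top K) U"
    using U by (auto simp: openin_sum_topology openin_realization_top)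
qed

abbreviation "uint \<equiv> top_of_set {0..1::real}"

text \<open>The realization is a quotient of the disjoint sum of its simplices. A product of a
  quotient map with the locally compact interval is again a quotient map, so homotopies may be
  checked on each simplex.\<close>

lemma continuous_map_from_prod_realization:
  assumes c: "\<And>\<sigma>. \<sigma> \<in> K \<Longrightarrow> continuous_map (prod_topology uint (top_of_set (geom_simplex \<sigma>))) Y h"
  shows "continuous_map (prod_topology uint (realization_top K)) Y h"
proof -
  let ?S = "sum_topology (\<lambda>\<sigma>. top_of_set (geom_simplex \<sigma>)) K"
  let ?q = "\<lambda>(t, y). (t, snd y) :: real \<times> ('a \<Rightarrow> real)"
  have q: "quotient_map (prod_topology uint ?S) (prod_topology uint (realization_top K)) ?q"
  proof (rule quotient_map_prod_right[OF _ _ realization_quotient])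
    show "locally_compact_space uint"
      by (intro compact_imp_locally_compact_space) (auto simp: compact_space_subtopology)
    show "Hausdorff_space uint \<or> regular_space uint"
      by (simp add: Hausdorff_space_subtopology)
  qed
  have "continuous_map (prod_topology uint ?S) Y (h \<circ> ?q)"
    unfolding continuous_map_def
  proof (intro conjI allI impI)
    show "h \<circ> ?q \<in> topspace (prod_topology uint ?S) \<rightarrow> topspace Y"
    proof
      fix p assume "p \<in> topspace (prod_topology uint ?S)"
      then obtain t \<sigma> x where p: "p = (t, \<sigma>, x)" "t \<in> {0..1}" "\<sigma> \<in> K" "x \<in> geom_simplex \<sigma>" by auto
      then have "(t, x) \<in> topspace (prod_topology uint (top_of_set (geom_simplex \<sigma>)))" by simp
      then have "h (t, x) \<in> topspace Y"
        using c[OF p(3)] continuous_map_image_subset_topspace by blast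
      then show "(h \<circ> ?q) p \<in> topspace Y" using p by simp
    qed
    fix U assume U: "openin Y U"
    show "openin (prod_topology uint ?S) {x \<in> topspace (prod_topology uint ?S). (h \<circ> ?q) x \<in> U}"
      unfolding openin_prod_topology_alt
    proof (intro allI impI)
      fix t y assume ty: "(t, y) \<in> {x \<in> topspace (prod_topology uint ?S). (h \<circ> ?q) x \<in> U}"
      then obtain \<sigma> x where y: "y = (\<sigma>, x)" "t \<in> {0..1}" "\<sigma> \<in> K" "x \<in> geom_simplex \<sigma>" "h (t, x) \<in> U" by auto
      let ?P = "prod_topology uint (top_of_set (geom_simplex \<sigma>))"
      have o: "openin ?P {p \<in> topspace ?P. h p \<in> U}"
        using c[OF y(3)] U by (rule openin_continuous_map_preimage)
      have m: "(t, x) \<in> {p \<in> topspace ?P. h p \<in> U}" using y by simp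
      from o[unfolded openin_prod_topology_alt, rule_format, OF m] obtain A B where AB: "openin uint A" "openin (top_of_set (geom_simplex \<sigma>)) B"
        "t \<in> A" "x \<in> B" "A \<times> B \<subseteq> {p \<in> topspace ?P. h p \<in> U}"
        by (elim exE conjE) (rule that)
      have "openin ?S (Pair \<sigma> ` B)"
        using open_map_component_injection[OF y(3), of "\<lambda>\<sigma>. top_of_set (geom_simplex \<sigma>)"] AB(2)
        by (auto simp: open_map_def)
      moreover have "A \<times> Pair \<sigma> ` B \<subseteq> {x \<in> topspace (prod_topology uint ?S). (h \<circ> ?q) x \<in> U}"
      proof
        fix z assume "z \<in> A \<times> Pair \<sigma> ` B"
        then obtain s b where z: "z = (s, \<sigma>, b)" "s \<in> A" "b \<in> B" by auto
        then have "(s, b) \<in> {p \<in> topspace ?P. h p \<in> U}" using AB(5) by blast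
        then show "z \<in> {x \<in> topspace (prod_topology uint ?S). (h \<circ> ?q) x \<in> U}" using z y(3) by simp
      qed
      ultimately show "\<exists>A B. openin uint A \<and> openin ?S B \<and> t \<in> A \<and> y \<in> B \<and>
          A \<times> B \<subseteq> {x \<in> topspace (prod_topology uint ?S). (h \<circ> ?q) x \<in> U}"
        using AB y(1) by (intro exI[of _ A] exI[of _ "Pair \<sigma> ` B"]) auto
    qed
  qed
  then show ?thesis using continuous_compose_quotient_map[OF q] by blast
qed

lemma continuous_map_realization_mono:
  assumes "K \<subseteq> K'" shows "continuous_map (realization_top K) (realization_top K') id"
  unfolding continuous_map_def
proof (intro conjI allI impI)
  have "realization K \<subseteq> realization K'" using assms by (auto simp: realization_def)
  then show "id \<in> topspace (realization_top K) \<rightarrow> topspace (realization_top K')" by auto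
  fix U assume U: "openin (realization_top K') U"
  have "{x \<in> topspace (realization_top K). id x \<in> U} \<inter> geom_simplex \<sigma> = U \<inter> geom_simplex \<sigma>" if "\<sigma> \<in> K" for \<sigma>
    using geom_simplex_subset_realization[OF that] by auto
  then show "openin (realization_top K) {x \<in> topspace (realization_top K). id x \<in> U}"
    using U assms unfolding openin_realization_top by auto
qed

section \<open>Finite complexes\<close>

lemma continuous_on_app:
  fixes f :: "'s::topological_space \<Rightarrow> 'v \<Rightarrow> real"
  shows "continuous_on S f \<Longrightarrow> continuous_on S (\<lambda>p. f p v)"
  by (rule continuous_on_compose2[OF continuous_on_product_coordinates]) auto

lemma closed_geom_simplex: "closed (geom_simplex \<sigma>)"
proof -
  have "closed {f :: 'a \<Rightarrow> real. 0 \<le> f v}" for v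
    by (intro closed_Collect_le continuous_on_const continuous_on_product_coordinates)
  moreover have "closed {f :: 'a \<Rightarrow> real. v \<notin> \<sigma> \<longrightarrow> f v = 0}" for v
    by (cases "v \<in> \<sigma>") (auto intro!: closed_Collect_eq)
  moreover have "closed {f :: 'a \<Rightarrow> real. sum f \<sigma> = 1}"
    by (intro closed_Collect_eq continuous_on_sum continuous_on_const continuous_on_product_coordinates)
  ultimately have "closed ({f. \<forall>v. 0 \<le> f v} \<inter> {f. \<forall>v. v \<notin> \<sigma> \<longrightarrow> f v = 0} \<inter> {f :: 'a \<Rightarrow> real. sum f \<sigma> = 1})"
    by (intro closed_Int closed_Collect_all)
  moreover have "geom_simplex \<sigma> = {f. \<forall>v. 0 \<le> f v} \<inter> {f. \<forall>v. v \<notin> \<sigma> \<longrightarrow> f v = 0} \<inter> {f. sum f \<sigma> = 1}"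
    by (auto simp: geom_simplex_def)
  ultimately show ?thesis by simp
qed

lemma closed_realization: "finite K \<Longrightarrow> closed (realization K)"
  unfolding realization_def by (intro closed_UN ballI closed_geom_simplex)

text \<open>Finitely many closed simplices can be glued along closed sets, so the weak topology is
  the subspace topology. Finite stages can then be treated with
  \<open>continuous_on\<close>.\<close>

lemma realization_top_finite:
  assumes "finite K" shows "realization_top K = top_of_set (realization K)"
  unfolding topology_eq
proof (intro allI iffI)
  fix U assume U: "openin (realization_top K) U"
  have "closed ((geom_simplex \<sigma>) - U)" if "\<sigma> \<in> K" for \<sigma>
  proof -
    have "openin (top_of_set (geom_simplex \<sigma>)) (U \<inter> geom_simplex \<sigma>)"
      using U that by (auto simp: openin_realization_top)
    then have "closedin (top_of_set (geom_simplex \<sigma>)) (geom_simplex \<sigma> - (U \<inter> geom_simplex \<sigma>))"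
      by (simp add: closedin_def double_diff)
    then have "closed (geom_simplex \<sigma> - (U \<inter> geom_simplex \<sigma>))"
      using closedin_closed_trans closed_geom_simplex by blast
    moreover have "geom_simplex \<sigma> - (U \<inter> geom_simplex \<sigma>) = geom_simplex \<sigma> - U" by blast
    ultimately show ?thesis by simp
  qed
  then have "closed (\<Union>\<sigma>\<in>K. geom_simplex \<sigma> - U)" using assms by (intro closed_UN) auto
  then have o: "open (- (\<Union>\<sigma>\<in>K. geom_simplex \<sigma> - U))" by (rule open_Compl)
  have "U = realization K \<inter> - (\<Union>\<sigma>\<in>K. geom_simplex \<sigma> - U)"
    using U by (auto simp: openin_realization_top realization_def)
  then show "openin (top_of_set (realization K)) U" using o openin_open_Int by metis
next
  fix U assume "openin (top_of_set (realization K)) U"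
  then obtain W where W: "open W" "U = realization K \<inter> W" by (auto simp: openin_open)
  have "U \<inter> geom_simplex \<sigma> = geom_simplex \<sigma> \<inter> W" if "\<sigma> \<in> K" for \<sigma>
    using W geom_simplex_subset_realization[OF that] by blast
  then show "openin (realization_top K) U" using W by (auto simp: openin_realization_top openin_open_Int)
qed

lemma geom_simplex_mono:
  assumes "\<sigma> \<subseteq> \<tau>" "finite \<tau>" shows "geom_simplex \<sigma> \<subseteq> geom_simplex \<tau>"
proof
  fix x assume x: "x \<in> geom_simplex \<sigma>"
  then have "sum x \<tau> = sum x \<sigma>" using assms by (intro sum.mono_neutral_right) (auto simp: geom_simplex_def)
  then show "x \<in> geom_simplex \<tau>" using x assms by (auto simp: geom_simplex_def)
qed

lemma geom_simplex_shrink: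
  assumes "x \<in> geom_simplex \<sigma>" "finite \<sigma>" "\<tau> \<subseteq> \<sigma>" "\<And>v. v \<notin> \<tau> \<Longrightarrow> x v = 0"
  shows "x \<in> geom_simplex \<tau>"
proof -
  have "sum x \<sigma> = sum x \<tau>" using assms by (intro sum.mono_neutral_right) auto
  then show ?thesis using assms by (auto simp: geom_simplex_def)
qed

lemma finite_order_complex: "finite P \<Longrightarrow> finite (order_complex P lq)"
  by (rule finite_subset[of _ "Pow P"]) (auto simp: order_complex_def)

lemma order_complex_subset:
  "\<sigma> \<in> order_complex P lq \<Longrightarrow> \<tau> \<subseteq> \<sigma> \<Longrightarrow> \<tau> \<noteq> {} \<Longrightarrow> \<tau> \<in> order_complex P lq"
  by (auto simp: order_complex_def intro: finite_subset)

lemma sum_pos_nonempty: "sum (x :: 'a \<Rightarrow> real) \<tau> = 1 \<Longrightarrow> \<tau> \<noteq> {}"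
  by auto

section \<open>Comparable poset maps are homotopic\<close>

text \<open>The simplicial map of a vertex map in barycentric coordinates: the weights are pushed
  forward.\<close>

definition rmap :: "'v set \<Rightarrow> ('v \<Rightarrow> 'v) \<Rightarrow> ('v \<Rightarrow> real) \<Rightarrow> 'v \<Rightarrow> real" where
  "rmap P f x = (\<lambda>v. \<Sum>a\<in>P. if f a = v then x a else 0)"

locale finite_poset =
  fixes P :: "'v set" and lq :: "'v \<Rightarrow> 'v \<Rightarrow> bool"
  assumes finP: "finite P"
    and refl: "a \<in> P \<Longrightarrow> lq a a"
    and trans: "a \<in> P \<Longrightarrow> b \<in> P \<Longrightarrow> c \<in> P \<Longrightarrow> lq a b \<Longrightarrow> lq b c \<Longrightarrow> lq a c"
    and antisym: "a \<in> P \<Longrightarrow> b \<in> P \<Longrightarrow> lq a b \<Longrightarrow> lq b a \<Longrightarrow> a = b"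
begin

abbreviation "R \<equiv> realization (order_complex P lq)"

text \<open>A point lies in the realization iff it is a probability vector on \<open>P\<close> whose
  support is a chain; membership becomes a matter of coordinates.\<close>

lemma realization_iff:
  "x \<in> R \<longleftrightarrow> (\<forall>v. 0 \<le> x v) \<and> (\<forall>v. v \<notin> P \<longrightarrow> x v = 0) \<and> sum x P = 1 \<and>
     (\<forall>a\<in>P. \<forall>b\<in>P. x a \<noteq> 0 \<longrightarrow> x b \<noteq> 0 \<longrightarrow> lq a b \<or> lq b a)"
proof
  assume "x \<in> R"
  then obtain \<sigma> where s: "\<sigma> \<in> order_complex P lq" "x \<in> geom_simplex \<sigma>" by (auto simp: realization_def)
  have "\<sigma> \<subseteq> P" using s by (simp add: order_complex_def)
  then have "x \<in> geom_simplex P" using geom_simplex_mono[OF _ finP] s by blast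
  moreover have "a \<in> \<sigma>" if "x a \<noteq> 0" for a using s that by (auto simp: geom_simplex_def)
  ultimately show "(\<forall>v. 0 \<le> x v) \<and> (\<forall>v. v \<notin> P \<longrightarrow> x v = 0) \<and> sum x P = 1 \<and>
     (\<forall>a\<in>P. \<forall>b\<in>P. x a \<noteq> 0 \<longrightarrow> x b \<noteq> 0 \<longrightarrow> lq a b \<or> lq b a)"
    using s(1) unfolding geom_simplex_def order_complex_def by simp
next
  assume x: "(\<forall>v. 0 \<le> x v) \<and> (\<forall>v. v \<notin> P \<longrightarrow> x v = 0) \<and> sum x P = 1 \<and>
     (\<forall>a\<in>P. \<forall>b\<in>P. x a \<noteq> 0 \<longrightarrow> x b \<noteq> 0 \<longrightarrow> lq a b \<or> lq b a)"
  let ?s = "{a \<in> P. x a \<noteq> 0}"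
  have "x \<in> geom_simplex P" using x by (simp add: geom_simplex_def)
  then have g: "x \<in> geom_simplex ?s" by (rule geom_simplex_shrink[OF _ finP]) (use x in auto)
  then have "sum x ?s = 1" by (simp add: geom_simplex_def)
  then have "?s \<noteq> {}" by (rule sum_pos_nonempty)
  then have "?s \<in> order_complex P lq" using x finP by (auto simp: order_complex_def)
  then show "x \<in> R" using g by (auto simp: realization_def)
qed

definition below :: "('v \<Rightarrow> real) \<Rightarrow> 'v \<Rightarrow> real" where
  "below x a = (\<Sum>b\<in>{b \<in> P. lq b a \<and> b \<noteq> a}. x b)"

text \<open>The homotopy fills the chain from below: at time \<open>t\<close> the lowest part of total mass \<open>1 - t\<close> is mapped by
  \<open>f\<close> and the rest by \<open>g\<close>, so that the image is always supported on a chain.\<close>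

definition low :: "real \<Rightarrow> ('v \<Rightarrow> real) \<Rightarrow> 'v \<Rightarrow> real" where
  "low t x a = min (x a) (max 0 (1 - t - below x a))"

definition htp :: "('v \<Rightarrow> 'v) \<Rightarrow> ('v \<Rightarrow> 'v) \<Rightarrow> real \<times> ('v \<Rightarrow> real) \<Rightarrow> 'v \<Rightarrow> real" where
  "htp f g p = (\<lambda>v. \<Sum>a\<in>P. (if f a = v then low (fst p) (snd p) a else 0) +
     (if g a = v then snd p a - low (fst p) (snd p) a else 0))"

lemma htp_continuous: "continuous_on S (htp f g)"
proof (rule continuous_on_coordinatewise_then_product)
  fix v
  have c: "continuous_on S (\<lambda>p. snd p a)" for a :: 'v
    by (rule continuous_on_app) (intro continuous_intros)
  have b: "continuous_on S (\<lambda>p. below (snd p) a)" for a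
    unfolding below_def by (intro continuous_on_sum c)
  have l: "continuous_on S (\<lambda>p. low (fst p) (snd p) a)" for a
    unfolding low_def by (intro continuous_intros c b)
  have i: "continuous_on S (\<lambda>p. if Q then h p else 0)" if "continuous_on S h" for Q and h :: "_ \<Rightarrow> real"
    using that by (cases Q) auto
  show "continuous_on S (\<lambda>p. htp f g p v)"
    unfolding htp_def by (intro continuous_on_sum continuous_on_add i continuous_on_diff c l)
qed

lemma low_bounds: "x \<in> R \<Longrightarrow> 0 \<le> low t x a \<and> low t x a \<le> x a"
  unfolding low_def realization_iff by auto

text \<open>If \<open>b\<close> were strictly below \<open>a\<close>, all mass up to and including
  \<open>b\<close> would count as mass below \<open>a\<close>. As \<open>b\<close> is not entirely
  in the low part, that mass exceeds \<open>1 - t\<close>, and nothing of \<open>a\<close> would be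
  low.\<close>

lemma low_order:
  assumes x: "x \<in> R" and a: "a \<in> P" "low t x a \<noteq> 0" and b: "b \<in> P" "low t x b \<noteq> x b"
  shows "lq a b"
proof (rule ccontr)
  assume n: "\<not> lq a b"
  have pos: "0 \<le> x v" for v using x realization_iff by blast
  have "x a \<noteq> 0" "x b \<noteq> 0" using a b low_bounds[OF x, of t a] low_bounds[OF x, of t b] by auto
  then have ba: "lq b a" "b \<noteq> a" using x a b n realization_iff refl by auto
  have sub: "insert b {c \<in> P. lq c b \<and> c \<noteq> b} \<subseteq> {c \<in> P. lq c a \<and> c \<noteq> a}"
    using ba a b trans antisym by blast
  have "x b + below x b = sum x (insert b {c \<in> P. lq c b \<and> c \<noteq> b})"
    unfolding below_def using finP by simp
  also have "\<dots> \<le> below x a" unfolding below_def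
    by (rule sum_mono2[OF _ sub]) (use finP pos in auto)
  finally have "x b + below x b \<le> below x a" .
  moreover have "1 - t - below x b < x b" using b(2) pos[of b] unfolding low_def by (auto simp: min_def max_def split: if_splits)
  ultimately have "low t x a = 0" using pos[of a] unfolding low_def by auto
  then show False using a by simp
qed

lemma sum_fibres:
  assumes "f ` P \<subseteq> P" shows "(\<Sum>v\<in>P. \<Sum>a\<in>P. if f a = v then h a else 0) = (\<Sum>a\<in>P. (h a :: real))"
proof -
  have "(\<Sum>v\<in>P. \<Sum>a\<in>P. if f a = v then h a else 0) = (\<Sum>a\<in>P. \<Sum>v\<in>P. if f a = v then h a else 0)"
    by (rule sum.swap)
  also have "\<dots> = (\<Sum>a\<in>P. h a)" using assms finP by (intro sum.cong) (auto simp: sum.delta)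
  finally show ?thesis .
qed

text \<open>Only a vertex \<open>f a\<close> beside a vertex \<open>g b\<close> needs an argument:
  then \<open>a\<close> is below \<open>b\<close> by \<open>low_order\<close>, and
  \<open>f a\<close> is below \<open>f b\<close>, hence below \<open>g b\<close>.\<close>

lemma htp_image:
  assumes f: "poset_map P lq f" and g: "poset_map P lq g" and fg: "\<And>a. a \<in> P \<Longrightarrow> lq (f a) (g a)" and x: "x \<in> R"
  shows "htp f g (t, x) \<in> R"
proof -
  have fP: "f ` P \<subseteq> P" "g ` P \<subseteq> P" using f g by (auto simp: poset_map_def)
  have fm: "lq (f a) (f b)" "lq (g a) (g b)" if "a \<in> P" "b \<in> P" "lq a b" for a b
    using f g that by (auto simp: poset_map_def)
  have lb: "0 \<le> low t x a" "low t x a \<le> x a" for a using low_bounds[OF x] by auto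
  let ?h = "htp f g (t, x)"
  have "\<forall>v. 0 \<le> ?h v" unfolding htp_def fst_conv snd_conv
    by (intro allI sum_nonneg add_nonneg_nonneg) (use lb in auto)
  moreover have "\<forall>v. v \<notin> P \<longrightarrow> ?h v = 0"
  proof (intro allI impI)
    fix v assume v: "v \<notin> P"
    have "f a \<noteq> v \<and> g a \<noteq> v" if "a \<in> P" for a using fP v that by blast
    then show "?h v = 0" unfolding htp_def by (intro sum.neutral) auto
  qed
  moreover have "sum ?h P = 1"
  proof -
    have "sum ?h P = (\<Sum>v\<in>P. \<Sum>a\<in>P. if f a = v then low t x a else 0) +
        (\<Sum>v\<in>P. \<Sum>a\<in>P. if g a = v then x a - low t x a else 0)"
      unfolding htp_def fst_conv snd_conv by (simp add: sum.distrib)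
    also have "\<dots> = (\<Sum>a\<in>P. low t x a) + (\<Sum>a\<in>P. x a - low t x a)"
      using sum_fibres[OF fP(1)] sum_fibres[OF fP(2)] by simp
    also have "\<dots> = sum x P" by (simp add: sum_subtractf)
    finally show ?thesis using x realization_iff by simp
  qed
  moreover have "\<forall>u\<in>P. \<forall>v\<in>P. ?h u \<noteq> 0 \<longrightarrow> ?h v \<noteq> 0 \<longrightarrow> lq u v \<or> lq v u"
  proof (intro ballI impI)
    fix u v assume uv: "u \<in> P" "v \<in> P" "?h u \<noteq> 0" "?h v \<noteq> 0"
    have ex: "\<exists>a\<in>P. x a \<noteq> 0 \<and> ((f a = u \<and> low t x a \<noteq> 0) \<or> (g a = u \<and> low t x a \<noteq> x a))" if hu: "?h u \<noteq> 0" for u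
    proof -
      have "\<exists>a\<in>P. (if f a = u then low t x a else 0) + (if g a = u then x a - low t x a else 0) \<noteq> 0"
      proof (rule ccontr)
        assume n: "\<not> ?thesis"
        have "?h u = 0" unfolding htp_def fst_conv snd_conv
          by (rule sum.neutral) (use n in blast)
        then show False using hu by simp
      qed
      then obtain a where a: "a \<in> P" "(if f a = u then low t x a else 0) + (if g a = u then x a - low t x a else 0) \<noteq> 0"
        by blast
      then have "(f a = u \<and> low t x a \<noteq> 0) \<or> (g a = u \<and> low t x a \<noteq> x a)" by (auto split: if_splits)
      moreover from this have "x a \<noteq> 0" using lb[of a] by auto
      ultimately show ?thesis using a by blast
    qed
    obtain a where a: "a \<in> P" "x a \<noteq> 0" "(f a = u \<and> low t x a \<noteq> 0) \<or> (g a = u \<and> low t x a \<noteq> x a)"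
      using ex[OF uv(3)] by blast
    obtain b where b: "b \<in> P" "x b \<noteq> 0" "(f b = v \<and> low t x b \<noteq> 0) \<or> (g b = v \<and> low t x b \<noteq> x b)"
      using ex[OF uv(4)] by blast
    have ab: "lq a b \<or> lq b a" using x a b realization_iff by auto
    have P: "f a \<in> P" "f b \<in> P" "g a \<in> P" "g b \<in> P" using fP a b by auto
    consider "f a = u" "f b = v" | "g a = u" "g b = v" | "f a = u" "low t x a \<noteq> 0" "g b = v" "low t x b \<noteq> x b"
      | "g a = u" "low t x a \<noteq> x a" "f b = v" "low t x b \<noteq> 0" using a b by blast
    then show "lq u v \<or> lq v u"
    proof cases
      case 1
      then show ?thesis using ab fm a b by auto
    next
      case 2
      then show ?thesis using ab fm a b by auto
    next
      case 3
      then have "lq a b" using low_order[OF x a(1) _ b(1)] by blast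
      then have "lq (f a) (g b)" using trans[OF P(1,2,4)] fm(1)[OF a(1) b(1)] fg[OF b(1)] by blast
      then show ?thesis using 3 by simp
    next
      case 4
      then have "lq b a" using low_order[OF x b(1) _ a(1)] by blast
      then have "lq (f b) (g a)" using trans[OF P(2,1,3)] fm(1)[OF b(1) a(1)] fg[OF a(1)] by blast
      then show ?thesis using 4 by simp
    qed
  qed
  ultimately show ?thesis unfolding realization_iff by blast
qed

lemma htp_ends:
  assumes x: "x \<in> R" shows "htp f g (0, x) = rmap P f x" "htp f g (1, x) = rmap P g x"
proof -
  have pos: "0 \<le> x v" for v using x realization_iff by blast
  have "low 0 x a = x a" if a: "a \<in> P" for a
  proof -
    have "x a + below x a = sum x (insert a {b \<in> P. lq b a \<and> b \<noteq> a})" unfolding below_def using finP by simp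
    also have "\<dots> \<le> sum x P" by (rule sum_mono2[OF finP]) (use a pos in auto)
    finally have "x a \<le> 1 - below x a" using x realization_iff by auto
    then show ?thesis using pos[of a] by (simp add: low_def)
  qed
  then show "htp f g (0, x) = rmap P f x" by (auto simp: htp_def rmap_def intro!: sum.cong)
  have "below x a \<ge> 0" for a unfolding below_def using pos by (simp add: sum_nonneg)
  then have "low 1 x a = 0" for a using pos[of a] by (auto simp: low_def)
  then show "htp f g (1, x) = rmap P g x" by (auto simp: htp_def rmap_def intro!: sum.cong)
qed

lemma poset_step_homotopic:
  assumes "poset_step P lq f g"
  shows "homotopic_with (\<lambda>_. True) (top_of_set R) (top_of_set R) (rmap P f) (rmap P g)"
proof -
  have *: "homotopic_with (\<lambda>_. True) (top_of_set R) (top_of_set R) (rmap P f) (rmap P g)"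
    if f: "poset_map P lq f" and g: "poset_map P lq g" and fg: "\<And>a. a \<in> P \<Longrightarrow> lq (f a) (g a)" for f g
  proof (subst homotopic_with, simp, intro exI[of _ "htp f g"] conjI allI ballI)
    show "continuous_map (prod_topology uint (top_of_set R)) (top_of_set R) (htp f g)"
      using htp_continuous htp_image[OF f g fg] by auto
  qed (use htp_ends in auto)
  show ?thesis using assms *[of f g] *[of g f] unfolding poset_step_def by (auto simp: homotopic_with_sym)
qed

lemma rmap_id: "x \<in> R \<Longrightarrow> rmap P id x = x"
  unfolding rmap_def using finP realization_iff by (auto simp: sum.delta fun_eq_iff)

lemma rmap_const: "x \<in> R \<Longrightarrow> rmap P (\<lambda>_. c) x = (\<lambda>v. if c = v then 1 else 0)"
  unfolding rmap_def using realization_iff by (auto simp: fun_eq_iff)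

lemma poset_contractible_contractible:
  assumes "poset_contractible P lq" shows "contractible_space (top_of_set R)" "R \<noteq> {}"
proof -
  obtain c where c: "c \<in> P" "(poset_step P lq)\<^sup>*\<^sup>* id (\<lambda>_. c)" using assms by (auto simp: poset_contractible_def)
  let ?d = "\<lambda>v. if c = v then 1 else 0 :: real"
  have "?d \<in> R" unfolding realization_iff using c(1) finP refl by (auto simp: sum.delta)
  then show "R \<noteq> {}" by blast
  have i: "continuous_map (top_of_set R) (top_of_set R) (rmap P id)"
    using rmap_id by (auto intro: continuous_map_eq[of _ _ id])
  have "homotopic_with (\<lambda>_. True) (top_of_set R) (top_of_set R) (rmap P id) (rmap P f)"
    if "(poset_step P lq)\<^sup>*\<^sup>* id f" for f
    using that
  proof (induction rule: rtranclp_induct)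
    case base
    then show ?case using i by (simp add: id_def)
  next
    case (step f g)
    then show ?case using poset_step_homotopic by (meson homotopic_with_trans)
  qed
  from this[OF c(2)] have "homotopic_with (\<lambda>_. True) (top_of_set R) (top_of_set R) (rmap P id) (rmap P (\<lambda>_. c))" .
  then have "homotopic_with (\<lambda>_. True) (top_of_set R) (top_of_set R) id (\<lambda>x. ?d)"
    by (rule homotopic_with_eq) (auto simp: rmap_id rmap_const)
  then show "contractible_space (top_of_set R)" unfolding contractible_space_def by blast
qed

end

lemmas continuous_on_pairs = continuous_on_Pair continuous_on_mult continuous_on_diff continuous_on_min
  continuous_on_const continuous_on_fst continuous_on_snd continuous_on_id

section \<open>Attaching a cone along a contractible subcomplex\<close>

text \<open>A point determines its support, the smallest simplex containing it. Both complexes are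
  closed under nonempty faces, so the support belongs to both.\<close>

lemma realization_Int:
  assumes K: "\<And>\<sigma>. \<sigma> \<in> K \<Longrightarrow> finite \<sigma>" "\<And>\<sigma> \<tau>. \<sigma> \<in> K \<Longrightarrow> \<tau> \<subseteq> \<sigma> \<Longrightarrow> \<tau> \<noteq> {} \<Longrightarrow> \<tau> \<in> K"
    and M: "\<And>\<sigma>. \<sigma> \<in> M \<Longrightarrow> finite \<sigma>" "\<And>\<sigma> \<tau>. \<sigma> \<in> M \<Longrightarrow> \<tau> \<subseteq> \<sigma> \<Longrightarrow> \<tau> \<noteq> {} \<Longrightarrow> \<tau> \<in> M"
  shows "realization K \<inter> realization M = realization (K \<inter> M)"
proof
  show "realization (K \<inter> M) \<subseteq> realization K \<inter> realization M" by (auto simp: realization_def)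
  show "realization K \<inter> realization M \<subseteq> realization (K \<inter> M)"
  proof
    fix x assume "x \<in> realization K \<inter> realization M"
    then obtain \<sigma> \<tau> where s: "\<sigma> \<in> K" "x \<in> geom_simplex \<sigma>" and t: "\<tau> \<in> M" "x \<in> geom_simplex \<tau>"
      by (auto simp: realization_def)
    let ?u = "{v. x v \<noteq> 0}"
    have u: "?u \<subseteq> \<sigma>" "?u \<subseteq> \<tau>" using s t by (auto simp: geom_simplex_def)
    have g: "x \<in> geom_simplex ?u" by (rule geom_simplex_shrink[OF s(2) K(1)[OF s(1)] u(1)]) simp
    then have "sum x ?u = 1" by (simp add: geom_simplex_def)
    then have "?u \<noteq> {}" by (rule sum_pos_nonempty)
    then have "?u \<in> K \<inter> M" using K(2)[OF s(1) u(1)] M(2)[OF t(1) u(2)] by blast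
    then show "x \<in> realization (K \<inter> M)" using g by (auto simp: realization_def)
  qed
qed

context finite_poset
begin

context
  fixes S v h a0
  assumes SP: "S \<subseteq> P" and v: "v \<in> P" "v \<notin> S" and least: "\<And>a. a \<in> P \<Longrightarrow> lq v a"
    and hc: "continuous_on ({0..1::real} \<times> realization (order_complex S lq)) h"
    and hi: "\<And>t x. t \<in> {0..1} \<Longrightarrow> x \<in> realization (order_complex S lq) \<Longrightarrow> h (t, x) \<in> realization (order_complex S lq)"
    and h0: "\<And>x. x \<in> realization (order_complex S lq) \<Longrightarrow> h (0, x) = x"
    and h1: "\<And>x. x \<in> realization (order_complex S lq) \<Longrightarrow> h (1, x) = a0"
    and a0: "a0 \<in> realization (order_complex S lq)"
begin

abbreviation "RS \<equiv> realization (order_complex S lq)"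

lemma sub_poset: "finite_poset S lq"
proof
  have P: "a \<in> P" if "a \<in> S" for a using SP that by blast
  show "finite S" using SP finP by (rule finite_subset)
  show "lq a a" if "a \<in> S" for a using refl[OF P[OF that]] .
  show "lq a c" if "a \<in> S" "b \<in> S" "c \<in> S" "lq a b" "lq b c" for a b c
    using trans[OF P[OF that(1)] P[OF that(2)] P[OF that(3)] that(4,5)] .
  show "a = b" if "a \<in> S" "b \<in> S" "lq a b" "lq b a" for a b
    using antisym[OF P[OF that(1)] P[OF that(2)] that(3,4)] .
qed

lemma RS_iff:
  "x \<in> RS \<longleftrightarrow> (\<forall>v. 0 \<le> x v) \<and> (\<forall>v. v \<notin> S \<longrightarrow> x v = 0) \<and> sum x S = 1 \<and>
     (\<forall>a\<in>S. \<forall>b\<in>S. x a \<noteq> 0 \<longrightarrow> x b \<noteq> 0 \<longrightarrow> lq a b \<or> lq b a)"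
  using finite_poset.realization_iff[OF sub_poset] .

definition sm :: "('v \<Rightarrow> real) \<Rightarrow> real" where "sm x = sum x S"

definition on_S :: "('v \<Rightarrow> real) \<Rightarrow> 'v \<Rightarrow> real" where "on_S x = (\<lambda>a. if a \<in> S then x a else 0)"

definition dv :: "'v \<Rightarrow> real" where "dv = (\<lambda>a. if a = v then 1 else 0)"

text \<open>Chosen such that \<open>om s * s\<close> is 0 for \<open>s\<close> up to 1/2 and
  \<open>2 * s - 1\<close> afterwards; the maximum keeps the fraction defined and
  continuous.\<close>

definition om :: "real \<Rightarrow> real" where "om s = 2 - 1 / max s (1/2)"

text \<open>With \<open>s\<close> the mass of \<open>x\<close> on \<open>S\<close>: first push \<open>x\<close> into the cone over \<open>S\<close> so that everything with
  \<open>s \<le> 1/2\<close> reaches the apex \<open>v\<close>, then apply the contraction of \<open>S\<close> up to time \<open>2 - 2 s\<close>, and finally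
  move to the base of the cone.\<close>

definition E1 :: "real \<times> ('v \<Rightarrow> real) \<Rightarrow> 'v \<Rightarrow> real" where
  "E1 p = (\<lambda>a. (1 - fst p) * snd p a + fst p *
     (om (sm (snd p)) * on_S (snd p) a + (1 - om (sm (snd p)) * sm (snd p)) * dv a))"

text \<open>The weight on the base of the cone. For \<open>t\<close> up to 1/2 it stays at the value
  reached by \<open>E1\<close>, while the contraction runs; then it grows linearly to 1. For
  \<open>s = 1\<close> it is constantly 1.\<close>

definition uu :: "real \<Rightarrow> real \<Rightarrow> real" where
  "uu t s = max 0 (2 * s - 1) + (1 - max 0 (2 * s - 1)) * max 0 (2 * t - 1)"

text \<open>The time inside the contraction \<open>h\<close>. It is constantly 0 for
  \<open>s = 1\<close>, so the base is fixed, and for \<open>s = 1/2\<close> it has reached 1 when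
  \<open>uu\<close> begins to leave 0.\<close>

definition th :: "real \<Rightarrow> real \<Rightarrow> real" where
  "th t s = min 1 (2 * t) * min 1 (2 - 2 * s)"

text \<open>The direction of \<open>x\<close> within \<open>S\<close> does not exist when
  \<open>x\<close> is the apex, so for small mass it is replaced by the point \<open>a0\<close>. At
  mass 1/2 both branches agree: either \<open>uu\<close> is 0, or \<open>th\<close> is 1 and
  \<open>h\<close> has arrived at \<open>a0\<close>.\<close>

definition E2 :: "real \<times> ('v \<Rightarrow> real) \<Rightarrow> 'v \<Rightarrow> real" where
  "E2 p = (if sm (snd p) \<le> 1/2
     then (\<lambda>a. uu (fst p) (sm (snd p)) * a0 a + (1 - uu (fst p) (sm (snd p))) * dv a)
     else (\<lambda>a. uu (fst p) (sm (snd p)) * h (th (fst p) (sm (snd p)), \<lambda>b. on_S (snd p) b / sm (snd p)) a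
        + (1 - uu (fst p) (sm (snd p))) * dv a))"

definition EE :: "real \<times> ('v \<Rightarrow> real) \<Rightarrow> 'v \<Rightarrow> real" where
  "EE p = (if fst p \<le> 1/2 then E1 (2 * fst p, snd p) else E2 (2 * fst p - 1, snd p))"

lemma R_D:
  assumes "x \<in> R"
  shows "0 \<le> x a" "a \<notin> P \<Longrightarrow> x a = 0" "sum x P = 1"
    "a \<in> P \<Longrightarrow> b \<in> P \<Longrightarrow> x a \<noteq> 0 \<Longrightarrow> x b \<noteq> 0 \<Longrightarrow> lq a b \<or> lq b a"
  using assms unfolding realization_iff by blast+

lemma sm_bounds: assumes x: "x \<in> R" shows "0 \<le> sm x" "sm x \<le> 1"
proof -
  show "0 \<le> sm x" unfolding sm_def using R_D(1)[OF x] by (simp add: sum_nonneg)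
  have "sum x S \<le> sum x P" using SP finP R_D(1)[OF x] by (intro sum_mono2) auto
  then show "sm x \<le> 1" using R_D(3)[OF x] by (simp add: sm_def)
qed

lemma RS_D: assumes x: "x \<in> RS" shows "x \<in> R" "sm x = 1" "on_S x = x"
proof -
  have r: "\<forall>v. 0 \<le> x v" "\<forall>v. v \<notin> S \<longrightarrow> x v = 0" "sum x S = 1"
     "\<forall>a\<in>S. \<forall>b\<in>S. x a \<noteq> 0 \<longrightarrow> x b \<noteq> 0 \<longrightarrow> lq a b \<or> lq b a" using x unfolding RS_iff by blast+
  have "sum x P = sum x S" using SP finP r by (intro sum.mono_neutral_right) auto
  then show "x \<in> R" unfolding realization_iff using r SP by (metis subsetD)
  show "sm x = 1" using r by (simp add: sm_def)
  show "on_S x = x" using r(2) by (auto simp: on_S_def)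
qed

lemma sum_dv: "sum dv P = 1"
  using v finP by (simp add: dv_def)

lemma cone_mem:
  assumes y: "y \<in> RS" and u: "0 \<le> u" "u \<le> 1"
  shows "(\<lambda>a. u * y a + (1 - u) * dv a) \<in> R"
proof -
  note yR = R_D[OF RS_D(1)[OF y]]
  have nn: "\<forall>a. 0 \<le> u * y a + (1 - u) * dv a" using yR(1) u by (simp add: dv_def)
  have z: "\<forall>a. a \<notin> P \<longrightarrow> u * y a + (1 - u) * dv a = 0" using yR(2) v by (auto simp: dv_def)
  have s: "(\<Sum>a\<in>P. u * y a + (1 - u) * dv a) = 1"
    using yR(3) sum_dv by (simp add: sum.distrib flip: sum_distrib_left)
  have c: "lq a b \<or> lq b a" if "a \<in> P" "b \<in> P" "u * y a + (1 - u) * dv a \<noteq> 0" "u * y b + (1 - u) * dv b \<noteq> 0" for a b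
  proof (cases "a = v \<or> b = v")
    case True
    then show ?thesis using least that by auto
  next
    case False
    then have "y a \<noteq> 0" "y b \<noteq> 0" using that by (auto simp: dv_def)
    then show ?thesis using yR(4) that by blast
  qed
  show ?thesis unfolding realization_iff using nn z s c by blast
qed

lemma om_bounds: assumes "0 \<le> s" "s \<le> 1" shows "0 \<le> om s" "0 \<le> om s * s" "om s * s \<le> 1"
proof -
  have "1 / max s (1/2) \<le> 2" by (cases "s \<le> 1/2") (auto simp: max_def divide_le_eq)
  then show o: "0 \<le> om s" by (simp add: om_def)
  then show "0 \<le> om s * s" using assms by simp
  show "om s * s \<le> 1"
  proof (cases "s \<le> 1/2")
    case True
    then show ?thesis by (simp add: om_def max_def)
  next
    case False
    then have "om s * s = 2 * s - 1" by (simp add: om_def max_def field_simps)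
    then show ?thesis using assms by simp
  qed
qed

lemma E1_mem:
  assumes x: "x \<in> R" and t: "0 \<le> t" "t \<le> 1" shows "E1 (t, x) \<in> R"
proof -
  note xR = R_D[OF x] and b = om_bounds[OF sm_bounds[OF x]]
  let ?e = "\<lambda>a. (1 - t) * x a + t * (om (sm x) * on_S x a + (1 - om (sm x) * sm x) * dv a)"
  have e: "E1 (t, x) = ?e" by (simp add: E1_def)
  have nn: "\<forall>a. 0 \<le> ?e a" using xR(1) t b by (auto simp: dv_def on_S_def)
  have z: "\<forall>a. a \<notin> P \<longrightarrow> ?e a = 0" using xR(2) v SP by (auto simp: dv_def on_S_def)
  have "sum (on_S x) P = sum (on_S x) S" using SP finP by (intro sum.mono_neutral_right) (auto simp: on_S_def)
  then have sx: "sum (on_S x) P = sm x" by (simp add: sm_def on_S_def)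
  have "sum ?e P = (1 - t) * sum x P + t * (om (sm x) * sum (on_S x) P + (1 - om (sm x) * sm x) * sum dv P)"
    by (simp add: sum.distrib flip: sum_distrib_left)
  then have s: "sum ?e P = 1" using sx sum_dv xR(3) by simp
  have c: "lq a b \<or> lq b a" if "a \<in> P" "b \<in> P" "?e a \<noteq> 0" "?e b \<noteq> 0" for a b
  proof (cases "a = v \<or> b = v")
    case True
    then show ?thesis using least that by auto
  next
    case False
    have "?e c = 0" if "x c = 0" "c \<noteq> v" for c using that by (simp add: dv_def on_S_def)
    then have "x a \<noteq> 0" "x b \<noteq> 0" using that(3,4) False by blast+
    then show ?thesis using xR(4) that by blast
  qed
  show ?thesis unfolding realization_iff e using nn z s c by blast
qed

lemma base_mem:
  assumes x: "x \<in> R" and s: "sm x > 0" shows "(\<lambda>b. on_S x b / sm x) \<in> RS"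
proof -
  note xR = R_D[OF x]
  have "(\<Sum>b\<in>S. on_S x b / sm x) = 1"
    using s by (simp add: on_S_def sm_def flip: sum_divide_distrib)
  moreover have "\<forall>a\<in>S. \<forall>b\<in>S. on_S x a / sm x \<noteq> 0 \<longrightarrow> on_S x b / sm x \<noteq> 0 \<longrightarrow> lq a b \<or> lq b a"
    using xR(4) SP by (auto simp: on_S_def)
  ultimately show ?thesis unfolding RS_iff using xR(1) s by (simp add: on_S_def)
qed

lemma uu_bounds: "0 \<le> s \<Longrightarrow> s \<le> 1 \<Longrightarrow> 0 \<le> t \<Longrightarrow> t \<le> 1 \<Longrightarrow> 0 \<le> uu t s \<and> uu t s \<le> 1"
proof -
  assume a: "0 \<le> s" "s \<le> 1" "0 \<le> t" "t \<le> 1"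
  let ?w = "max 0 (2 * s - 1)" and ?m = "max 0 (2 * t - 1)"
  have w: "0 \<le> ?w" "?w \<le> 1" "0 \<le> ?m" "?m \<le> 1" using a by auto
  have "(1 - ?w) * ?m \<le> (1 - ?w) * 1" using w by (intro mult_left_mono) auto
  moreover have "0 \<le> (1 - ?w) * ?m" using w by (intro mult_nonneg_nonneg) auto
  ultimately have "0 \<le> ?w + (1 - ?w) * ?m" "?w + (1 - ?w) * ?m \<le> ?w + (1 - ?w) * 1"
    using w(1) by (simp_all only: add_nonneg_nonneg add_left_mono)
  then show ?thesis unfolding uu_def by simp
qed

lemma th_bounds: "0 \<le> s \<Longrightarrow> s \<le> 1 \<Longrightarrow> 0 \<le> t \<Longrightarrow> t \<le> 1 \<Longrightarrow> th t s \<in> {0..1}"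
  unfolding th_def by (auto intro!: mult_le_one mult_nonneg_nonneg)

lemma E2_mem:
  assumes x: "x \<in> R" and t: "0 \<le> t" "t \<le> 1" shows "E2 (t, x) \<in> R"
proof (cases "sm x \<le> 1/2")
  case True
  then show ?thesis using cone_mem[OF a0] uu_bounds[OF sm_bounds[OF x] t] by (simp add: E2_def)
next
  case False
  then have "h (th t (sm x), \<lambda>b. on_S x b / sm x) \<in> RS"
    using hi[OF th_bounds[OF sm_bounds[OF x] t]] base_mem[OF x] by simp
  then show ?thesis using cone_mem uu_bounds[OF sm_bounds[OF x] t] False by (simp add: E2_def)
qed

lemma E2_end: assumes x: "x \<in> R" shows "E2 (1, x) \<in> RS"
proof -
  have u: "uu 1 s = 1" for s by (simp add: uu_def)
  show ?thesis
  proof (cases "sm x \<le> 1/2")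
    case True
    then show ?thesis using a0 by (simp add: E2_def u)
  next
    case False
    then have "h (th 1 (sm x), \<lambda>b. on_S x b / sm x) \<in> RS"
      using hi[OF th_bounds[OF sm_bounds[OF x]]] base_mem[OF x] by simp
    then show ?thesis using False by (simp add: E2_def u)
  qed
qed

lemma E_fixed: assumes x: "x \<in> RS" shows "E1 (t, x) = x" "E2 (t, x) = x"
proof -
  note r = RS_D[OF x]
  show "E1 (t, x) = x" using r by (simp add: E1_def om_def algebra_simps)
  have "th t 1 = 0" "uu t 1 = 1" by (simp_all add: th_def uu_def)
  then show "E2 (t, x) = x" using r h0[OF x] by (simp add: E2_def)
qed

lemma E_match: assumes x: "x \<in> R" shows "E1 (1, x) = E2 (0, x)"
proof (cases "sm x \<le> 1/2")
  case True
  then have "max 0 (2 * sm x - 1) = 0" "max (sm x) (1/2) = 1/2" by simp_all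
  then show ?thesis using True by (simp add: E1_def E2_def om_def uu_def)
next
  case False
  have "h (0, \<lambda>b. on_S x b / sm x) = (\<lambda>b. on_S x b / sm x)" using h0 base_mem[OF x] False by simp
  moreover have "om (sm x) = (2 * sm x - 1) / sm x" using False by (simp add: om_def max_def field_simps)
  ultimately show ?thesis using False by (simp add: E1_def E2_def uu_def th_def fun_eq_iff)
qed

lemma sm_continuous: "continuous_on T f \<Longrightarrow> continuous_on T (\<lambda>p. sm (f p))"
  unfolding sm_def by (intro continuous_on_sum continuous_on_app)

lemma on_S_continuous: "continuous_on T f \<Longrightarrow> continuous_on T (\<lambda>p. on_S (f p) a)"
  unfolding on_S_def by (cases "a \<in> S") (auto intro: continuous_on_app)

lemma E1_continuous: "continuous_on T E1"
proof (rule continuous_on_coordinatewise_then_product)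
  fix a
  have s: "continuous_on T (\<lambda>p :: real \<times> ('v \<Rightarrow> real). snd p)" by (intro continuous_intros)
  have "continuous_on T (\<lambda>p. om (sm (snd p)))"
    unfolding om_def by (intro continuous_intros sm_continuous s) (auto simp: max_def)
  moreover have "continuous_on T (\<lambda>p. fst p)" by (intro continuous_intros)
  ultimately show "continuous_on T (\<lambda>p. E1 p a)"
    unfolding E1_def by (intro continuous_on_add continuous_on_mult continuous_on_diff continuous_on_const
        sm_continuous[OF s] on_S_continuous[OF s] continuous_on_app[OF s])
qed

lemma E2_continuous: "continuous_on ({0..1::real} \<times> R) E2"
proof -
  let ?T = "{0..1::real} \<times> R"
  have s: "continuous_on T (\<lambda>p :: real \<times> ('v \<Rightarrow> real). snd p)" for T by (intro continuous_intros)
  have u: "continuous_on T (\<lambda>p. uu (fst p) (sm (snd p)))" for T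
    unfolding uu_def by (intro continuous_intros sm_continuous s)
  have t: "continuous_on T (\<lambda>p. th (fst p) (sm (snd p)))" for T
    unfolding th_def by (intro continuous_intros sm_continuous s)
  have eq: "E2 = (\<lambda>p. if sm (snd p) \<le> 1/2
     then (\<lambda>a. uu (fst p) (sm (snd p)) * a0 a + (1 - uu (fst p) (sm (snd p))) * dv a)
     else (\<lambda>a. uu (fst p) (sm (snd p)) * h (th (fst p) (sm (snd p)), \<lambda>b. on_S (snd p) b / sm (snd p)) a
        + (1 - uu (fst p) (sm (snd p))) * dv a))" by (rule ext) (simp add: E2_def)
  show ?thesis unfolding eq
  proof (rule continuous_on_cases_le)
    show "continuous_on {p \<in> ?T. sm (snd p) \<le> 1/2}
       (\<lambda>p a. uu (fst p) (sm (snd p)) * a0 a + (1 - uu (fst p) (sm (snd p))) * dv a)"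
      by (rule continuous_on_coordinatewise_then_product) (intro continuous_intros u)
    let ?U = "{p \<in> ?T. 1/2 \<le> sm (snd p)}"
    have "continuous_on ?U (\<lambda>p. (th (fst p) (sm (snd p)), \<lambda>b. on_S (snd p) b / sm (snd p)))"
      by (intro continuous_on_Pair t continuous_on_coordinatewise_then_product continuous_on_divide
          on_S_continuous sm_continuous s) auto
    moreover have "(\<lambda>p. (th (fst p) (sm (snd p)), \<lambda>b. on_S (snd p) b / sm (snd p))) ` ?U \<subseteq> {0..1} \<times> RS"
    proof (intro subsetI)
      fix q assume "q \<in> (\<lambda>p. (th (fst p) (sm (snd p)), \<lambda>b. on_S (snd p) b / sm (snd p))) ` ?U"
      then obtain p where p: "p \<in> ?T" "1/2 \<le> sm (snd p)"
        "q = (th (fst p) (sm (snd p)), \<lambda>b. on_S (snd p) b / sm (snd p))" by blast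
      then have x: "snd p \<in> R" "0 \<le> fst p" "fst p \<le> 1" by auto
      show "q \<in> {0..1} \<times> RS"
        using th_bounds[OF sm_bounds[OF x(1)] x(2,3)] base_mem[OF x(1)] p(2,3) by simp
    qed
    ultimately have hh: "continuous_on ?U (\<lambda>p. h (th (fst p) (sm (snd p)), \<lambda>b. on_S (snd p) b / sm (snd p)))"
      by (rule continuous_on_compose2[OF hc])
    show "continuous_on ?U (\<lambda>p a. uu (fst p) (sm (snd p)) * h (th (fst p) (sm (snd p)), \<lambda>b. on_S (snd p) b / sm (snd p)) a
        + (1 - uu (fst p) (sm (snd p))) * dv a)"
      by (rule continuous_on_coordinatewise_then_product)
        (intro continuous_on_add continuous_on_mult continuous_on_diff continuous_on_const u continuous_on_app[OF hh])
    show "continuous_on ?T (\<lambda>p. sm (snd p))" by (intro sm_continuous s)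
    fix p assume p: "p \<in> ?T" "sm (snd p) = 1/2"
    then have "snd p \<in> R" "sm (snd p) > 0" by auto
    then have x: "(\<lambda>b. on_S (snd p) b / sm (snd p)) \<in> RS" by (rule base_mem)
    show "(\<lambda>a. uu (fst p) (sm (snd p)) * a0 a + (1 - uu (fst p) (sm (snd p))) * dv a) =
      (\<lambda>a. uu (fst p) (sm (snd p)) * h (th (fst p) (sm (snd p)), \<lambda>b. on_S (snd p) b / sm (snd p)) a
        + (1 - uu (fst p) (sm (snd p))) * dv a)"
    proof (cases "fst p \<le> 1/2")
      case True
      then show ?thesis using p(2) by (simp add: uu_def)
    next
      case False
      then have "th (fst p) (sm (snd p)) = 1" by (simp add: th_def p(2))
      then have "h (th (fst p) (sm (snd p)), \<lambda>b. on_S (snd p) b / sm (snd p)) = a0" using h1[OF x] by (simp only:)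
      then show ?thesis by (simp only:)
    qed
  qed
qed

lemma EE_continuous: "continuous_on ({0..1::real} \<times> R) EE"
proof -
  have eq: "EE = (\<lambda>p. if fst p \<le> 1/2 then E1 (2 * fst p, snd p) else E2 (2 * fst p - 1, snd p))"
    by (rule ext) (simp add: EE_def)
  show ?thesis unfolding eq
  proof (rule continuous_on_cases_le)
    show "continuous_on {p \<in> {0..1} \<times> R. fst p \<le> 1/2} (\<lambda>p. E1 (2 * fst p, snd p))"
      by (rule continuous_on_compose2[OF E1_continuous[of UNIV]]) (auto intro!: continuous_on_pairs)
    show "continuous_on {p \<in> {0..1} \<times> R. 1/2 \<le> fst p} (\<lambda>p. E2 (2 * fst p - 1, snd p))"
      by (rule continuous_on_compose2[OF E2_continuous]) (auto intro!: continuous_on_pairs)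
    show "continuous_on ({0..1::real} \<times> R) fst" by (intro continuous_intros)
    fix p assume "p \<in> {0..1::real} \<times> R" "fst p = 1/2"
    then have "snd p \<in> R" "2 * fst p = 1" by auto
    then show "E1 (2 * fst p, snd p) = E2 (2 * fst p - 1, snd p)" using E_match[of "snd p"] by simp
  qed
qed

lemma EE_props:
  assumes x: "x \<in> R" and t: "t \<in> {0..1}"
  shows "EE (t, x) \<in> R" "EE (0, x) = x" "EE (1, x) \<in> RS" "x \<in> RS \<Longrightarrow> EE (t, x) = x"
  using E1_mem[OF x, of "2 * t"] E2_mem[OF x, of "2 * t - 1"] t E2_end[OF x] E_fixed[of x]
  by (auto simp: EE_def E1_def)

end

lemma cone_deformation:
  assumes SP: "S \<subseteq> P" and v: "v \<in> P" "v \<notin> S" and least: "\<And>a. a \<in> P \<Longrightarrow> lq v a"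
    and con: "contractible_space (top_of_set (realization (order_complex S lq)))"
    and ne: "realization (order_complex S lq) \<noteq> {}"
  shows "\<exists>E. continuous_on ({0..1::real} \<times> R) E \<and> (\<forall>t\<in>{0..1}. \<forall>x\<in>R. E (t, x) \<in> R) \<and>
     (\<forall>x\<in>R. E (0, x) = x \<and> E (1, x) \<in> realization (order_complex S lq)) \<and>
     (\<forall>t\<in>{0..1}. \<forall>x\<in>realization (order_complex S lq). E (t, x) = x)"
proof -
  let ?RS = "realization (order_complex S lq)"
  obtain a0 where "homotopic_with (\<lambda>x. True) (top_of_set ?RS) (top_of_set ?RS) id (\<lambda>x. a0)"
    using con by (auto simp: contractible_space_def)
  then obtain h where h: "continuous_on ({0..1::real} \<times> ?RS) h" "h \<in> {0..1} \<times> ?RS \<rightarrow> ?RS"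
     "\<And>x. h (0, x) = x" "\<And>x. h (1, x) = a0"
    unfolding homotopic_with_def by auto
  have hi: "h (t, x) \<in> ?RS" if "t \<in> {0..1}" "x \<in> ?RS" for t x using h(2) that by (auto simp: Pi_iff)
  have a0: "a0 \<in> ?RS" using ne hi[of 1] h(4) by auto
  note ass = SP v least h(1) hi h(3) h(4) a0
  have sub: "?RS \<subseteq> R" using RS_D(1)[OF ass] by blast
  have z: "(0 :: real) \<in> {0..1}" by simp
  show ?thesis
  proof (intro exI[of _ "EE S v h a0"] conjI ballI)
    show "continuous_on ({0..1} \<times> R) (EE S v h a0)" by (rule EE_continuous[OF ass])
    show "EE S v h a0 (t, x) \<in> R" if "t \<in> {0..1}" "x \<in> R" for t x
      by (rule EE_props(1)[OF ass that(2,1)])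
    show "EE S v h a0 (0, x) = x" if "x \<in> R" for x by (rule EE_props(2)[OF ass that z])
    show "EE S v h a0 (1, x) \<in> ?RS" if "x \<in> R" for x by (rule EE_props(3)[OF ass that z])
    show "EE S v h a0 (t, x) = x" if "t \<in> {0..1}" "x \<in> ?RS" for t x
      by (rule EE_props(4)[OF ass subsetD[OF sub that(2)] that])
  qed
qed

lemma glue_deformation:
  assumes SP: "S \<subseteq> P" and v: "v \<in> P" "v \<notin> S" and least: "\<And>a. a \<in> P \<Longrightarrow> lq v a"
    and con: "contractible_space (top_of_set (realization (order_complex S lq)))"
    and ne: "realization (order_complex S lq) \<noteq> {}"
    and K: "finite K" "\<And>\<sigma>. \<sigma> \<in> K \<Longrightarrow> finite \<sigma>" "\<And>\<sigma> \<tau>. \<sigma> \<in> K \<Longrightarrow> \<tau> \<subseteq> \<sigma> \<Longrightarrow> \<tau> \<noteq> {} \<Longrightarrow> \<tau> \<in> K"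
    and KP: "K \<inter> order_complex P lq = order_complex S lq"
    and M: "M = K \<union> order_complex P lq"
  shows "\<exists>D. continuous_on ({0..1::real} \<times> realization M) D \<and> (\<forall>t\<in>{0..1}. \<forall>x\<in>realization M. D (t, x) \<in> realization M) \<and>
     (\<forall>x\<in>realization M. D (1, x) = x \<and> D (0, x) \<in> realization K) \<and>
     (\<forall>t\<in>{0..1}. \<forall>x\<in>realization K. D (t, x) = x)"
proof -
  let ?RS = "realization (order_complex S lq)" and ?X = "realization K"
  have "\<exists>E. continuous_on ({0..1::real} \<times> R) E \<and> (\<forall>t\<in>{0..1}. \<forall>x\<in>R. E (t, x) \<in> R) \<and>
     (\<forall>x\<in>R. E (0, x) = x \<and> E (1, x) \<in> ?RS) \<and> (\<forall>t\<in>{0..1}. \<forall>x\<in>?RS. E (t, x) = x)"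
    by (rule cone_deformation[OF SP v _ con ne]) (rule least)
  then obtain E where E: "continuous_on ({0..1::real} \<times> R) E" "\<forall>t\<in>{0..1}. \<forall>x\<in>R. E (t, x) \<in> R"
     "\<forall>x\<in>R. E (0, x) = x \<and> E (1, x) \<in> ?RS" "\<forall>t\<in>{0..1}. \<forall>x\<in>?RS. E (t, x) = x"
    by blast
  have i: "?X \<inter> R = ?RS"
    unfolding KP[symmetric]
    by (rule realization_Int[OF K(2,3)]) (auto simp: order_complex_def intro: finite_subset)
  have MU: "realization M = ?X \<union> R" by (auto simp: M realization_def)
  \<comment> \<open>The deformation of the cone fixes \<open>?RS\<close> and thus extends by the
    identity on \<open>?X\<close>. Time is reversed: 1 is the identity and 0 lands in
    \<open>?X\<close>, as the telescope expects.\<close>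
  define D where "D = (\<lambda>p. if snd p \<in> ?X then snd p else E (1 - fst p, snd p))"
  have c: "continuous_on (({0..1} \<times> ?X) \<union> ({0..1} \<times> R)) D"
    unfolding D_def
  proof (rule continuous_on_cases)
    show "closed ({0..1::real} \<times> ?X)" using closed_realization[OF K(1)] by (intro closed_Times) auto
    show "closed ({0..1::real} \<times> R)"
      using closed_realization[OF finite_order_complex[OF finP]] by (intro closed_Times) auto
    show "continuous_on ({0..1::real} \<times> ?X) snd" by (intro continuous_intros)
    show "continuous_on ({0..1::real} \<times> R) (\<lambda>p. E (1 - fst p, snd p))"
      by (rule continuous_on_compose2[OF E(1)]) (auto intro!: continuous_on_pairs)
    show "\<forall>p. p \<in> {0..1} \<times> ?X \<and> snd p \<notin> ?X \<or> p \<in> {0..1} \<times> R \<and> snd p \<in> ?X \<longrightarrow> snd p = E (1 - fst p, snd p)"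
    proof (intro allI impI)
      fix p assume "p \<in> {0..1::real} \<times> ?X \<and> snd p \<notin> ?X \<or> p \<in> {0..1} \<times> R \<and> snd p \<in> ?X"
      then have "p \<in> {0..1} \<times> R" "snd p \<in> ?X" by (auto simp: mem_Times_iff)
      then have "fst p \<in> {0..1}" "snd p \<in> ?X \<inter> R" by (simp_all only: mem_Times_iff Int_iff simp_thms)
      then have p: "fst p \<in> {0..1}" "snd p \<in> ?RS" unfolding i by simp_all
      then show "snd p = E (1 - fst p, snd p)" using E(4) by simp
    qed
  qed
  have iS: "?RS \<subseteq> ?X" using i by blast
  show ?thesis
  proof (intro exI[of _ D] conjI ballI)
    show "continuous_on ({0..1} \<times> realization M) D"
      using c by (simp add: MU Sigma_Un_distrib2 Times_Un_distrib1 flip: Sigma_Un_distrib2)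
  next
    fix t :: real and x assume "t \<in> {0..1}" "x \<in> realization M"
    then show "D (t, x) \<in> realization M" using E(2) by (auto simp: D_def MU)
  next
    fix x assume x: "x \<in> realization M"
    then show "D (1, x) = x" using E(3) by (auto simp: D_def MU)
    show "D (0, x) \<in> ?X" using x E(3) iS by (auto simp: D_def MU)
  qed (simp add: D_def)
qed

end

section \<open>Telescoping\<close>

text \<open>Time runs downwards. Between \<open>m + 1\<close> and \<open>m\<close> the map
  \<open>D m\<close> deforms stage \<open>Suc m\<close> into stage \<open>m\<close>, above that the
  points of stage \<open>Suc m\<close> rest, and at time 0 everything has arrived in stage
  0.\<close>

fun tele :: "(nat \<Rightarrow> real \<times> 'x \<Rightarrow> 'x) \<Rightarrow> nat \<Rightarrow> real \<Rightarrow> 'x \<Rightarrow> 'x" where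
  "tele D 0 t x = x"
| "tele D (Suc m) t x = (if real m \<le> t then D m (min 1 (t - real m), x) else tele D m t (D m (0, x)))"

text \<open>Infinitely many deformations have to be traversed before stage 0 is reached. With
  \<open>s\<close> from 0 to 1, the substitution \<open>1 / s - 1\<close> makes the time come down
  from infinity. A point of stage \<open>m\<close> rests until the time falls below
  \<open>m\<close>, so there is no problem at \<open>s = 0\<close>.\<close>

lemma telescope_contractible:
  fixes Y :: "nat \<Rightarrow> 'v set set"
  assumes fin: "\<And>m. finite (Y m)" and mono: "\<And>m. Y m \<subseteq> Y (Suc m)" and K: "K = (\<Union>m. Y m)"
    and Dc: "\<And>m. continuous_on ({0..1::real} \<times> realization (Y (Suc m))) (D m)"
    and Di: "\<And>m t x. t \<in> {0..1} \<Longrightarrow> x \<in> realization (Y (Suc m)) \<Longrightarrow> D m (t, x) \<in> realization (Y (Suc m))"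
    and D1: "\<And>m x. x \<in> realization (Y (Suc m)) \<Longrightarrow> D m (1, x) = x"
    and D0: "\<And>m x. x \<in> realization (Y (Suc m)) \<Longrightarrow> D m (0, x) \<in> realization (Y m)"
    and Dr: "\<And>m t x. t \<in> {0..1} \<Longrightarrow> x \<in> realization (Y m) \<Longrightarrow> D m (t, x) = x"
    and base: "contractible_space (realization_top (Y 0))"
  shows "contractible_space (realization_top K)"
proof -
  let ?R = "\<lambda>m. realization (Y m)"
  have Rmono: "?R m \<subseteq> ?R (Suc m)" for m using mono[of m] by (auto simp: realization_def)
  have ge: "tele D m t x = x" if "x \<in> ?R m" "t \<ge> real m" for m t x
    using that D1 by (cases m) auto
  have mem: "tele D m t x \<in> ?R m" if "x \<in> ?R m" "t \<ge> 0" for m t x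
    using that
  proof (induction m arbitrary: x)
    case (Suc m)
    show ?case
    proof (cases "real m \<le> t")
      case True
      then show ?thesis using Di[of "min 1 (t - real m)" x m] Suc.prems by simp
    next
      case False
      then show ?thesis using Suc.IH[OF D0[OF Suc.prems(1)] Suc.prems(2)] Rmono by auto
    qed
  qed simp
  have mem0: "tele D m 0 x \<in> ?R 0" if "x \<in> ?R m" for m x
    using that
  proof (induction m arbitrary: x)
    case (Suc m)
    show ?case
    proof (cases m)
      case 0
      then show ?thesis using D0[OF Suc.prems] by simp
    next
      case (Suc m')
      then show ?thesis using Suc.IH[OF D0[OF Suc.prems]] by simp
    qed
  qed simp
  have ext: "tele D (Suc m) t x = tele D m t x" if "x \<in> ?R m" "t \<ge> 0" for m t x
  proof (cases "real m \<le> t")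
    case True
    then show ?thesis using Dr[of "min 1 (t - real m)" x m] ge[OF that(1) True] that by simp
  next
    case False
    then show ?thesis using Dr[of 0 x m] that by simp
  qed
  have ext': "tele D (m + j) t x = tele D m t x \<and> x \<in> ?R (m + j)" if "x \<in> ?R m" "t \<ge> 0" for m j t x
    using that
  proof (induction j)
    case (Suc j)
    then show ?case using ext[of x "m + j" t] Rmono[of "m + j"] by auto
  qed simp
  have cont: "continuous_on ({0..} \<times> ?R m) (\<lambda>p. tele D m (fst p) (snd p))" for m
  proof (induction m)
    case 0
    then show ?case by (simp add: continuous_on_snd)
  next
    case (Suc m)
    have "continuous_on ({0..} \<times> ?R (Suc m)) (\<lambda>p. if real m \<le> fst p then D m (min 1 (fst p - real m), snd p)
        else tele D m (fst p) (D m (0, snd p)))"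
    proof (rule continuous_on_cases_le[where a = "real m" and h = fst and f = "\<lambda>p. tele D m (fst p) (D m (0, snd p))"
          and g = "\<lambda>p. D m (min 1 (fst p - real m), snd p)" and S = "{0..} \<times> ?R (Suc m)", THEN continuous_on_eq])
      have c0: "continuous_on {p \<in> {0..} \<times> ?R (Suc m). fst p \<le> real m} (\<lambda>p. D m (0, snd p))"
        by (rule continuous_on_compose2[OF Dc]) (auto intro!: continuous_on_pairs)
      show "continuous_on {p \<in> {0..} \<times> ?R (Suc m). fst p \<le> real m} (\<lambda>p. tele D m (fst p) (D m (0, snd p)))"
        using D0 by (intro continuous_on_compose2[OF Suc, where f = "\<lambda>p. (fst p, D m (0, snd p))", simplified]
            continuous_on_Pair c0 continuous_on_fst continuous_on_id) auto
      show "continuous_on {p \<in> {0..} \<times> ?R (Suc m). real m \<le> fst p} (\<lambda>p. D m (min 1 (fst p - real m), snd p))"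
        by (rule continuous_on_compose2[OF Dc]) (auto intro!: continuous_on_pairs)
      show "continuous_on ({0..} \<times> ?R (Suc m)) fst" by (intro continuous_intros)
      fix p assume p: "p \<in> {0::real..} \<times> ?R (Suc m)"
      have z: "tele D m (fst p) (D m (0, snd p)) = D m (min 1 (fst p - real m), snd p)" if "fst p = real m"
        using ge[of "D m (0, snd p)" m "fst p"] D0[of "snd p" m] p that by auto
      then show "fst p = real m \<Longrightarrow> tele D m (fst p) (D m (0, snd p)) = D m (min 1 (fst p - real m), snd p)" .
      show "(if fst p \<le> real m then tele D m (fst p) (D m (0, snd p)) else D m (min 1 (fst p - real m), snd p)) =
         (if real m \<le> fst p then D m (min 1 (fst p - real m), snd p) else tele D m (fst p) (D m (0, snd p)))"
        using z by auto
    qed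
    then show ?case by simp
  qed
  \<comment> \<open>The least stage is only a choice: by \<open>ext'\<close> every stage containing
    the point gives the same value.\<close>
  define \<Phi> where "\<Phi> t x = tele D (LEAST m. x \<in> ?R m) t x" for t x
  have Phi: "\<Phi> t x = tele D m t x" if "x \<in> ?R m" "t \<ge> 0" for m t x
  proof -
    let ?l = "LEAST m. x \<in> ?R m"
    have "x \<in> ?R ?l" "?l \<le> m" using that(1) by (auto intro: LeastI Least_le)
    then have "tele D (?l + (m - ?l)) t x = tele D ?l t x" using ext' that(2) by blast
    then show ?thesis using \<open>?l \<le> m\<close> by (simp add: \<Phi>_def)
  qed
  define \<Psi> where "\<Psi> = (\<lambda>p. if fst p = 0 then snd p else \<Phi> (1 / fst p - 1) (snd p))"
  have Psi_cont: "continuous_on ({0..1} \<times> ?R m) \<Psi>" for m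
  proof -
    \<comment> \<open>The parameter at which the time \<open>1 / s - 1\<close> equals
      \<open>m\<close>; stage \<open>m\<close> does not move for smaller parameters.\<close>
    let ?a = "1 / (real m + 1)"
    have small: "\<Psi> p = snd p" if p: "p \<in> {0..1::real} \<times> ?R m" "fst p \<le> ?a" for p
    proof (cases "fst p = 0")
      case False
      then have "fst p > 0" using p by auto
      then have "real m \<le> 1 / fst p - 1" using p(2) by (simp add: field_simps)
      moreover have "snd p \<in> ?R m" using p by auto
      ultimately show ?thesis using Phi[of "snd p" m "1 / fst p - 1"] ge[of "snd p" m] by (simp add: \<Psi>_def)
    qed (simp add: \<Psi>_def)
    have big: "\<Psi> p = tele D m (1 / fst p - 1) (snd p)" if p: "p \<in> {0..1} \<times> ?R m" "?a \<le> fst p" for p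
    proof -
      have "?a > 0" by simp
      then have "fst p > 0" using p(2) by linarith
      then show ?thesis using Phi[of "snd p" m "1 / fst p - 1"] p by (auto simp: \<Psi>_def field_simps)
    qed
    have pos: "fst p \<noteq> 0" if "?a \<le> fst p" for p :: "real \<times> ('v \<Rightarrow> real)"
    proof -
      have "?a > 0" by simp
      then show ?thesis using that by linarith
    qed
    have "continuous_on ({0..1} \<times> ?R m) (\<lambda>p. if fst p \<le> ?a then snd p else tele D m (1 / fst p - 1) (snd p))"
    proof (rule continuous_on_cases_le)
      show "continuous_on {p \<in> {0..1} \<times> ?R m. fst p \<le> ?a} snd" by (intro continuous_intros)
      show "continuous_on {p \<in> {0..1} \<times> ?R m. ?a \<le> fst p} (\<lambda>p. tele D m (1 / fst p - 1) (snd p))"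
      proof (rule continuous_on_compose2[OF cont, where f = "\<lambda>p. (1 / fst p - 1, snd p)", simplified])
        show "continuous_on {p \<in> {0..1} \<times> ?R m. ?a \<le> fst p} (\<lambda>p. (1 / fst p - 1, snd p))"
          by (intro continuous_intros) (use pos in auto)
        show "(\<lambda>p. (1 / fst p - 1, snd p)) ` {p \<in> {0..1} \<times> ?R m. ?a \<le> fst p} \<subseteq> {0..} \<times> ?R m"
        proof
          fix q assume "q \<in> (\<lambda>p. (1 / fst p - 1, snd p)) ` {p \<in> {0..1} \<times> ?R m. ?a \<le> fst p}"
          then obtain p where p: "p \<in> {0..1} \<times> ?R m" "?a \<le> fst p" "q = (1 / fst p - 1, snd p)" by blast
          then have "fst p > 0" "fst p \<le> 1" using pos[OF p(2)] by (auto simp: less_le)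
          then have "1 / fst p \<ge> 1" by simp
          then show "q \<in> {0..} \<times> ?R m" using p by auto
        qed
      qed
      show "continuous_on ({0..1} \<times> ?R m) fst" by (intro continuous_intros)
      show "snd p = tele D m (1 / fst p - 1) (snd p)" if "p \<in> {0..1} \<times> ?R m" "fst p = ?a" for p
        using small[OF that(1)] big[OF that(1)] that(2) by simp
    qed
    then show ?thesis
      by (rule continuous_on_eq) (use small big in auto)
  qed
  have Psi_mem: "\<Psi> (t, x) \<in> ?R m" if "t \<in> {0..1}" "x \<in> ?R m" for t x m
  proof (cases "t = 0")
    case False
    then have "1 / t - 1 \<ge> 0" using that by simp
    then show ?thesis using Phi[OF that(2)] mem[OF that(2)] False by (simp add: \<Psi>_def)
  qed (use that in \<open>simp add: \<Psi>_def\<close>)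
  have top: "realization_top (Y m) = top_of_set (?R m)" for m using realization_top_finite[OF fin] .
  have YK: "Y m \<subseteq> K" for m using K by blast
  have incl: "continuous_map (top_of_set (?R m)) (realization_top K) id" for m
    using continuous_map_realization_mono[OF YK[of m]] top by simp
  have cPsi: "continuous_map (prod_topology uint (realization_top K)) (realization_top K) \<Psi>"
  proof (rule continuous_map_from_prod_realization)
    fix \<sigma> assume "\<sigma> \<in> K"
    then obtain m where m: "\<sigma> \<in> Y m" using K by blast
    then have s: "geom_simplex \<sigma> \<subseteq> ?R m" by (rule geom_simplex_subset_realization)
    have "continuous_map (top_of_set ({0..1} \<times> geom_simplex \<sigma>)) (top_of_set (?R m)) \<Psi>"
      using continuous_on_subset[OF Psi_cont[of m], of "{0..1} \<times> geom_simplex \<sigma>"] s Psi_mem by auto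
    then have "continuous_map (top_of_set ({0..1} \<times> geom_simplex \<sigma>)) (realization_top K) (id \<circ> \<Psi>)"
      using continuous_map_compose incl by blast
    then show "continuous_map (prod_topology uint (top_of_set (geom_simplex \<sigma>))) (realization_top K) \<Psi>" by simp
  qed
  let ?f = "\<lambda>x. \<Psi> (1, x)"
  have h1: "homotopic_with (\<lambda>_. True) (realization_top K) (realization_top K) id ?f"
    unfolding homotopic_with_def using cPsi by (intro exI[of _ \<Psi>]) (auto simp: \<Psi>_def)
  have f0: "?f x \<in> ?R 0" if xK: "x \<in> realization K" for x
  proof -
    obtain m where "x \<in> ?R m" using xK K by (auto simp: realization_def)
    then show ?thesis using Phi[of x m 0] mem0 by (simp add: \<Psi>_def)
  qed
  have cf0: "continuous_map (realization_top K) (top_of_set (?R 0)) ?f"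
    unfolding continuous_map_def
  proof (intro conjI allI impI)
    show "?f \<in> topspace (realization_top K) \<rightarrow> topspace (top_of_set (?R 0))" using f0 by auto
    fix U assume U: "openin (top_of_set (?R 0)) U"
    show "openin (realization_top K) {x \<in> topspace (realization_top K). ?f x \<in> U}"
      unfolding openin_realization_top
    proof (intro conjI ballI)
      show "{x \<in> topspace (realization_top K). ?f x \<in> U} \<subseteq> realization K" by auto
      fix \<sigma> assume s: "\<sigma> \<in> K"
      then obtain m where m: "\<sigma> \<in> Y m" using K by blast
      have sr: "geom_simplex \<sigma> \<subseteq> realization K" "geom_simplex \<sigma> \<subseteq> ?R m"
        using geom_simplex_subset_realization s m by auto
      have "continuous_on (geom_simplex \<sigma>) ?f"
        by (rule continuous_on_compose2[OF Psi_cont[of m]]) (use sr in \<open>auto intro!: continuous_on_pairs\<close>)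
      moreover have "?f \<in> geom_simplex \<sigma> \<rightarrow> ?R 0" using f0 sr by blast
      ultimately have "continuous_map (top_of_set (geom_simplex \<sigma>)) (top_of_set (?R 0)) ?f" by simp
      from openin_continuous_map_preimage[OF this U]
      have "openin (top_of_set (geom_simplex \<sigma>)) {x \<in> geom_simplex \<sigma>. ?f x \<in> U}" by simp
      moreover have "{x \<in> topspace (realization_top K). ?f x \<in> U} \<inter> geom_simplex \<sigma> = {x \<in> geom_simplex \<sigma>. ?f x \<in> U}"
        using sr by auto
      ultimately show "openin (top_of_set (geom_simplex \<sigma>)) ({x \<in> topspace (realization_top K). ?f x \<in> U} \<inter> geom_simplex \<sigma>)"
        by simp
    qed
  qed
  obtain a where a: "homotopic_with (\<lambda>_. True) (top_of_set (?R 0)) (top_of_set (?R 0)) id (\<lambda>x. a)"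
    using base unfolding top contractible_space_def by blast
  have "homotopic_with (\<lambda>_. True) (top_of_set (?R 0)) (realization_top K) (id \<circ> id) (id \<circ> (\<lambda>x. a))"
    by (rule homotopic_with_compose_continuous_map_left[OF a incl]) simp
  then have "homotopic_with (\<lambda>_. True) (realization_top K) (realization_top K) ((id \<circ> id) \<circ> ?f) ((id \<circ> (\<lambda>x. a)) \<circ> ?f)"
    by (rule homotopic_with_compose_continuous_map_right[OF _ cf0]) simp
  then have "homotopic_with (\<lambda>_. True) (realization_top K) (realization_top K) ?f (\<lambda>x. a)" by (simp add: comp_def)
  with h1 have "homotopic_with (\<lambda>_. True) (realization_top K) (realization_top K) id (\<lambda>x. a)"
    by (rule homotopic_with_trans)
  then show ?thesis unfolding contractible_space_def by blast
qed

section \<open>Gluing the stars\<close>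

context whitehead_poset
begin

lemma star_set_vertex: "bas H \<Longrightarrow> w \<in> star_set H \<Longrightarrow> w \<in> LG_vertices G n Gs"
  using star_set_iff by blast

lemma lower_set_subset: "lower_set H \<subseteq> star_set H"
  by (auto simp: lower_set_def star_set_def carrying_def)

lemma star_poset:
  assumes H: "bas H" and "Q \<subseteq> star_set H" shows "finite_poset Q (LG_le n)"
proof
  have V: "w \<in> LG_vertices G n Gs" if "w \<in> Q" for w using star_set_vertex[OF H] assms(2) that by blast
  show "finite Q" using finite_subset[OF assms(2) finite_star_set] .
  show "LG_le n a a" if "a \<in> Q" for a using LG_le_refl[OF V[OF that]] .
  show "LG_le n a c" if "a \<in> Q" "b \<in> Q" "c \<in> Q" "LG_le n a b" "LG_le n b c" for a b c
    using LG_le_trans[OF V[OF that(1)] V[OF that(2)] V[OF that(3)] that(4,5)] .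
  show "a = b" if "a \<in> Q" "b \<in> Q" "LG_le n a b" "LG_le n b a" for a b
    using LG_le_antisym[OF V[OF that(1)] V[OF that(2)] that(3,4)] .
qed

lemma lower_complex_contractible:
  assumes H: "bas H" and K: "bas K" "nless K H"
  shows "contractible_space (top_of_set (realization (order_complex (lower_set H) (LG_le n))))"
    "realization (order_complex (lower_set H) (LG_le n)) \<noteq> {}"
  using finite_poset.poset_contractible_contractible[OF star_poset[OF H lower_set_subset] lower_set_contractible[OF assms]]
  by auto

lemma lower_complex_contractible_complex:
  assumes H: "bas H" and K: "bas K" "nless K H"
  shows "contractible_complex (order_complex (lower_set H) (LG_le n))"
proof -
  have "finite (lower_set H)" using finite_subset[OF lower_set_subset finite_star_set] .
  then have "finite (order_complex (lower_set H) (LG_le n))" by (rule finite_order_complex)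
  from realization_top_finite[OF this] show ?thesis
    unfolding contractible_complex_def using lower_complex_contractible[OF assms] by (simp only: simp_thms)
qed

lemma nuclear_in_star: "bas H \<Longrightarrow> nuclear G n Gs H \<in> star_set H"
  unfolding nuclear_cls star_set_def using zero_family_compatible_family[OF n_pos] by blast

lemma nuclear_least: "bas H \<Longrightarrow> w \<in> star_set H \<Longrightarrow> LG_le n (nuclear G n Gs H) w"
  using star_set_iff by blast

lemma norm_diff_self: "\<not> nless H H"
  by (simp add: nless_def norm_diff_def lexpos_def)

lemma nless_trans: "nless H K \<Longrightarrow> nless K M \<Longrightarrow> nless H M"
proof -
  assume "nless H K" "nless K M"
  then have "lpos (\<lambda>g. norm_diff K H g + norm_diff M K g)" unfolding nless_def by (rule lexpos_add[OF wo])
  moreover have "(\<lambda>g. norm_diff K H g + norm_diff M K g) = norm_diff M H" by (auto simp: norm_diff_def)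
  ultimately show ?thesis by (simp add: nless_def)
qed

text \<open>Makes the nuclear vertex a proper apex, outside the subcomplex along which its star is
  attached. It could lie there only if a smaller basis gave the same nuclear vertex.\<close>

lemma nuclear_not_lower: assumes H: "bas H" shows "nuclear G n Gs H \<notin> lower_set H"
proof
  note z = zero_family_compatible_family[OF n_pos]
  assume "nuclear G n Gs H \<in> lower_set H"
  then obtain A where A: "A \<in> carrying (reductive H)" "cls H (zero_family n) = cls H A"
    by (auto simp: lower_set_def nuclear_cls)
  have "compatible_family n A" using A(1) by (simp add: carrying_def)
  then have "A = zero_family n" using cls_eq[OF H z H, of A] A(2) by simp
  then have "zero_family n \<in> carrying (reductive H)" using A(1) by simp
  then obtain K where K: "bas K" "nless K H" "cls K (zero_family n) = cls H (zero_family n)"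
    unfolding carrying_reductive_iff[OF H z] by blast
  have "K = H" using nuclear_inj[OF K(1) H] K(3) by (simp add: nuclear_cls)
  then show False using K(2) norm_diff_self[of H] by simp
qed

lemma star_contractible:
  assumes H: "bas H"
  shows "contractible_space (realization_top (order_complex (star_set H) (LG_le n)))"
    "realization (order_complex (star_set H) (LG_le n)) \<noteq> {}"
proof -
  let ?c = "nuclear G n Gs H"
  have "poset_map (star_set H) (LG_le n) id" "poset_map (star_set H) (LG_le n) (\<lambda>_. ?c)"
    using nuclear_in_star[OF H] nuclear_least[OF H] by (auto simp: poset_map_def)
  then have "poset_step (star_set H) (LG_le n) id (\<lambda>_. ?c)"
    using nuclear_least[OF H] by (auto simp: poset_step_def)
  then have "poset_contractible (star_set H) (LG_le n)"
    using nuclear_in_star[OF H] unfolding poset_contractible_def by blast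
  from finite_poset.poset_contractible_contractible[OF star_poset[OF H subset_refl] this]
  show "contractible_space (realization_top (order_complex (star_set H) (LG_le n)))"
    "realization (order_complex (star_set H) (LG_le n)) \<noteq> {}"
    using realization_top_finite[OF finite_order_complex[OF finite_star_set]] by auto
qed

lemma LG_contractible:
  assumes fin: "\<And>H. bas H \<Longrightarrow> finite {K. bas K \<and> nless K H}"
    and tot: "\<And>H K. bas H \<Longrightarrow> bas K \<Longrightarrow> H \<noteq> K \<Longrightarrow> nless H K \<or> nless K H"
    and ex: "\<exists>H. bas H"
  shows "contractible_complex (LG_complex G n Gs)"
proof -
  \<comment> \<open>Finite by assumption and injective because the order is total, so stars can be
    attached one at a time.\<close>
  define rank where "rank H = card {K. bas K \<and> nless K H}" for H
  let ?oc = "\<lambda>H. order_complex (star_set H) (LG_le n)"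
  have mono: "rank K < rank H" if "bas H" "bas K" "nless K H" for H K
  proof -
    have "{M. bas M \<and> nless M K} \<subset> {M. bas M \<and> nless M H}"
      using that nless_trans norm_diff_self by blast
    then show ?thesis unfolding rank_def by (rule psubset_card_mono[OF fin[OF that(1)]])
  qed
  have rank_iff: "rank K < rank H \<longleftrightarrow> nless K H" if "bas H" "bas K" for H K
    using mono[OF that] mono[OF that(2,1)] tot[OF that] by (cases "H = K") auto
  have rank_inj: "H = K" if "bas H" "bas K" "rank H = rank K" for H K
    using tot[OF that(1,2)] mono[OF that(1,2)] mono[OF that(2,1)] that(3) by auto
  define Y where "Y m = (\<Union>H\<in>{H. bas H \<and> rank H \<le> m}. ?oc H)" for m
  have finb: "finite {H. bas H \<and> rank H \<le> m}" for m
  proof (rule finite_imageD[of rank])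
    show "finite (rank ` {H. bas H \<and> rank H \<le> m})" by (rule finite_subset[of _ "{..m}"]) auto
    show "inj_on rank {H. bas H \<and> rank H \<le> m}" using rank_inj by (auto simp: inj_on_def)
  qed
  have finY: "finite (Y m)" for m
    unfolding Y_def using finb finite_order_complex[OF finite_star_set] by blast
  have monoY: "Y m \<subseteq> Y (Suc m)" for m unfolding Y_def by (intro UN_mono) auto
  obtain H0 where H0: "bas H0" "\<And>H. bas H \<Longrightarrow> rank H0 \<le> rank H"
    using ex_has_least_nat[of bas _ rank] ex by blast
  have r0: "rank H0 = 0"
  proof -
    have "{K. bas K \<and> nless K H0} = {}" using mono[OF H0(1)] H0(2) by (auto simp: not_less[symmetric])
    then show ?thesis by (simp only: rank_def card.empty)
  qed
  have Y0: "Y 0 = ?oc H0"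
  proof -
    have "H = H0" if "bas H" "rank H \<le> 0" for H using rank_inj[OF that(1) H0(1)] that(2) r0 by simp
    then have "{H. bas H \<and> rank H \<le> 0} = {H0}" using H0(1) r0 by blast
    then show ?thesis by (simp add: Y_def)
  qed
  have "LG_complex G n Gs = (\<Union>m. Y m)"
  proof
    show "(\<Union>m. Y m) \<subseteq> LG_complex G n Gs"
      unfolding Y_def LG_complex_order order_complex_def using star_set_vertex by blast
    show "LG_complex G n Gs \<subseteq> (\<Union>m. Y m)"
    proof
      fix \<sigma> assume s: "\<sigma> \<in> LG_complex G n Gs"
      then have sV: "w \<in> LG_vertices G n Gs" if "w \<in> \<sigma>" for w
        using that by (auto simp: LG_complex_order order_complex_def)
      have "\<exists>m\<in>\<sigma>. \<forall>a\<in>\<sigma>. LG_le n m a"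
      proof (rule chain_least)
        fix a b c assume "a \<in> \<sigma>" "b \<in> \<sigma>" "c \<in> \<sigma>" "LG_le n a b" "LG_le n b c"
        then show "LG_le n a c" using LG_le_trans sV by blast
      qed (use s in \<open>auto simp: LG_complex_order order_complex_def\<close>)
      then obtain m where m: "m \<in> \<sigma>" "\<forall>a\<in>\<sigma>. LG_le n m a" by blast
      obtain H A where H: "bas H" "compatible_family n A" "m = cls H A" using sV[OF m(1)] LG_vertices_iff by blast
      have "w \<in> star_set H" if "w \<in> \<sigma>" for w
        using LG_le_iff[OF H(1,2) sV[OF that]] m(2) that H(3) by (auto simp: star_set_def)
      then have "\<sigma> \<in> ?oc H" using s by (auto simp: LG_complex_order order_complex_def)
      then have "\<sigma> \<in> Y (rank H)" unfolding Y_def using H(1) by blast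
      then show "\<sigma> \<in> (\<Union>m. Y m)" by blast
    qed
  qed
  note LGY = this
  have "\<exists>D. continuous_on ({0..1::real} \<times> realization (Y (Suc m))) D \<and>
     (\<forall>t\<in>{0..1}. \<forall>x\<in>realization (Y (Suc m)). D (t, x) \<in> realization (Y (Suc m))) \<and>
     (\<forall>x\<in>realization (Y (Suc m)). D (1, x) = x \<and> D (0, x) \<in> realization (Y m)) \<and>
     (\<forall>t\<in>{0..1}. \<forall>x\<in>realization (Y m). D (t, x) = x)" for m
  proof (cases "\<exists>H. bas H \<and> rank H = Suc m")
    case False
    \<comment> \<open>If no basis has rank \<open>Suc m\<close>, nothing is attached and the stage
      is repeated without motion.\<close>
    then have "{H. bas H \<and> rank H \<le> Suc m} = {H. bas H \<and> rank H \<le> m}" by (auto simp: le_Suc_eq)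
    then have "Y (Suc m) = Y m" by (simp add: Y_def)
    then show ?thesis by (intro exI[of _ snd]) (simp add: continuous_on_snd continuous_on_id)
  next
    case True
    then obtain H where H: "bas H" "rank H = Suc m" by blast
    have "{K. bas K \<and> nless K H} \<noteq> {}"
    proof
      assume "{K. bas K \<and> nless K H} = {}"
      then have "rank H = 0" by (simp only: rank_def card.empty)
      then show False using H(2) by simp
    qed
    then obtain K where K: "bas K" "nless K H" by blast
    \<comment> \<open>The previous stage consists of the stars of exactly the bases below
      \<open>H\<close>, the union that occurs in \<open>star_Int_lower\<close>.\<close>
    have low: "{K. bas K \<and> rank K \<le> m} = {K. bas K \<and> nless K H}"
      using rank_iff[OF H(1)] unfolding H(2) less_Suc_eq_le by blast
    have "K = H" if "bas K" "rank K = Suc m" for K using rank_inj[OF that(1) H(1)] that(2) H(2) by simp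
    then have "{K. bas K \<and> rank K \<le> Suc m} = insert H {K. bas K \<and> rank K \<le> m}"
      using H unfolding le_Suc_eq by blast
    then have YS: "Y (Suc m) = Y m \<union> ?oc H" by (auto simp: Y_def)
    have YI: "Y m \<inter> ?oc H = order_complex (lower_set H) (LG_le n)"
      using star_Int_lower[OF H(1)] unfolding Y_def low by blast
    show ?thesis
    proof (rule finite_poset.glue_deformation[OF star_poset[OF H(1) subset_refl] lower_set_subset
          nuclear_in_star[OF H(1)] nuclear_not_lower[OF H(1)] _ lower_complex_contractible[OF H(1) K] finY _ _ YI YS])
      show "LG_le n (nuclear G n Gs H) a" if "a \<in> star_set H" for a using nuclear_least[OF H(1) that] .
      show "finite \<sigma>" if "\<sigma> \<in> Y m" for \<sigma> using that by (auto simp: Y_def order_complex_def)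
      show "\<tau> \<in> Y m" if "\<sigma> \<in> Y m" "\<tau> \<subseteq> \<sigma>" "\<tau> \<noteq> {}" for \<sigma> \<tau>
        using that order_complex_subset unfolding Y_def by blast
    qed
  qed
  then obtain D where D: "\<And>m. continuous_on ({0..1::real} \<times> realization (Y (Suc m))) (D m) \<and>
     (\<forall>t\<in>{0..1}. \<forall>x\<in>realization (Y (Suc m)). D m (t, x) \<in> realization (Y (Suc m))) \<and>
     (\<forall>x\<in>realization (Y (Suc m)). D m (1, x) = x \<and> D m (0, x) \<in> realization (Y m)) \<and>
     (\<forall>t\<in>{0..1}. \<forall>x\<in>realization (Y m). D m (t, x) = x)" by metis
  have "contractible_space (realization_top (LG_complex G n Gs))"
  proof (rule telescope_contractible[OF finY monoY LGY])
    show "contractible_space (realization_top (Y 0))" unfolding Y0 by (rule star_contractible[OF H0(1)])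
  qed (use D in blast)+
  moreover have "realization (LG_complex G n Gs) \<noteq> {}"
  proof -
    have "realization (Y 0) \<subseteq> realization (LG_complex G n Gs)"
      unfolding LGY by (auto simp: realization_def)
    then show ?thesis using star_contractible(2)[OF H0(1)] unfolding Y0 by blast
  qed
  ultimately show ?thesis by (simp add: contractible_complex_def)
qed

end

section \<open>Recovering bases from lengths and counting them\<close>

context free_factors
begin

lemma basis_exists: "\<exists>H. bas H"
proof -
  let ?H = "\<lambda>i. if i \<in> {1..n} then Gs i else {}"
  have "fp ?H" by (rule fp_cong[OF _ Gs]) simp
  moreover have "conjugate_subgroups G (?H i) (Gs i)" if i: "i \<in> {1..n}" for i
  proof -
    have "(\<lambda>h. \<one> \<otimes> h \<otimes> inv \<one>) ` Gs i = id ` Gs i"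
      using fp_carrier[OF Gs i] by (intro image_cong) auto
    then show ?thesis using i unfolding conjugate_subgroups_def by (intro bexI[of _ \<one>]) auto
  qed
  ultimately have "bas ?H" by (simp add: is_basis_def)
  then show ?thesis by blast
qed

text \<open>Conjugating each factor back to the given one is a homomorphism that turns lengths over
  \<open>K\<close> into lengths over \<open>Gs\<close>. The factors of \<open>K\<close> are
  preimages under it, so the homomorphism encodes the basis.\<close>

lemma basis_pullback:
  assumes K: "bas K"
  shows "\<exists>\<psi>\<in>hom G G. (\<forall>i\<in>{1..n}. K i = {g \<in> carrier G. \<psi> g \<in> Gs i}) \<and>
     (\<forall>g\<in>carrier G. word_length G n Gs (\<psi> g) = word_length G n K g)"
proof -
  obtain c where c: "\<And>j. c j \<in> carrier G" "\<And>j. j \<in> {1..n} \<Longrightarrow> K j = (\<lambda>h. c j \<otimes> h \<otimes> inv (c j)) ` Gs j"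
    using bas_from_Gs[OF K] by metis
  note fK = bas_fp[OF K]
  let ?d = "\<lambda>j. inv (c j)" and ?\<psi> = "endo K (\<lambda>j. inv (c j))"
  have d: "\<And>j. ?d j \<in> carrier G" using c(1) by simp
  have hom: "?\<psi> \<in> hom G G" using endo_hom[OF fK d] .
  have KG: "?\<psi> h \<in> Gs i" if i: "i \<in> {1..n}" and h: "h \<in> K i" for i h
  proof -
    obtain g where g: "g \<in> Gs i" "h = c i \<otimes> g \<otimes> inv (c i)" using h c(2)[OF i] by blast
    have "?\<psi> h = inv (c i) \<otimes> (c i \<otimes> g \<otimes> inv (c i)) \<otimes> inv (inv (c i))"
      using endo_letter[OF fK d i h] g(2) by simp
    also have "\<dots> = g" using conj_conj[of "c i" "inv (c i)" g] c(1)[of i] fp_carrier[OF Gs i g(1)] by simp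
    finally show ?thesis using g(1) by simp
  qed
  have ker: "h = \<one>" if i: "i \<in> {1..n}" and h: "h \<in> K i" and e: "?\<psi> h = \<one>" for i h
  proof (rule conj_eq_one)
    show "inv (c i) \<in> carrier G" using c(1) by simp
    show "h \<in> carrier G" using bas_carrier[OF K h] .
    show "inv (c i) \<otimes> h \<otimes> inv (inv (c i)) = \<one>" using endo_letter[OF fK d i h] e by simp
  qed
  have nf: "nf G n Gs (?\<psi> g) = map (\<lambda>p. (fst p, ?\<psi> (snd p))) (nf G n K g)" if "g \<in> carrier G" for g
    by (rule nf_transport[OF fK Gs hom _ _ that]) (use KG ker in blast)+
  have "K i = {g \<in> carrier G. ?\<psi> g \<in> Gs i}" if i: "i \<in> {1..n}" for i
  proof
    show "K i \<subseteq> {g \<in> carrier G. ?\<psi> g \<in> Gs i}" using KG[OF i] bas_carrier[OF K] by blast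
    show "{g \<in> carrier G. ?\<psi> g \<in> Gs i} \<subseteq> K i"
    proof
      fix g assume "g \<in> {g \<in> carrier G. ?\<psi> g \<in> Gs i}"
      then have g: "g \<in> carrier G" "?\<psi> g \<in> Gs i" by auto
      show "g \<in> K i"
      proof (cases "?\<psi> g = \<one>")
        case True
        then have "nf G n K g = []" using nf[OF g(1)] nf_one[OF Gs] by simp
        then have "g = \<one>" using nf_eval[OF fK g(1)] by simp
        then show ?thesis using subgroup.one_closed[OF fp_subgroup[OF fK i]] by simp
      next
        case False
        then have "nf G n Gs (?\<psi> g) = [(i, ?\<psi> g)]" using nf_letter[OF Gs i g(2)] by simp
        then obtain k where k: "nf G n K g = [(i, k)]" using nf[OF g(1)] by (auto simp: Cons_eq_map_conv)
        have "k \<in> K i" using nf_reduced[OF fK g(1)] k by simp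
        moreover have "g = k" using nf_eval[OF fK g(1)] k bas_carrier[OF K \<open>k \<in> K i\<close>] by simp
        ultimately show ?thesis by simp
      qed
    qed
  qed
  moreover have "word_length G n Gs (?\<psi> g) = word_length G n K g" if "g \<in> carrier G" for g
    using nf[OF that] by (simp add: word_length_nf)
  ultimately show ?thesis using hom by blast
qed

lemma finite_length_ball: "finite {g \<in> carrier G. word_length G n Gs g \<le> C}"
proof -
  let ?A = "{1..n} \<times> (\<Union>i\<in>{1..n}. Gs i)"
  have "finite {w. set w \<subseteq> ?A \<and> length w \<le> C}" using Gs_finite by (intro finite_lists_length_le) auto
  moreover have "{g \<in> carrier G. word_length G n Gs g \<le> C} \<subseteq> word_eval G ` {w. set w \<subseteq> ?A \<and> length w \<le> C}"
  proof
    fix g assume "g \<in> {g \<in> carrier G. word_length G n Gs g \<le> C}"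
    then have g: "g \<in> carrier G" "length (nf G n Gs g) \<le> C" by (auto simp: word_length_nf)
    have "set (nf G n Gs g) \<subseteq> ?A" using nf_reduced[OF Gs g(1)] by (force simp: reduced_word_def mem_Times_iff)
    then show "g \<in> word_eval G ` {w. set w \<subseteq> ?A \<and> length w \<le> C}"
      using nf_eval[OF Gs g(1)] g(2) by (intro image_eqI[of _ _ "nf G n Gs g"]) auto
  qed
  ultimately show ?thesis by (rule finite_surj)
qed

text \<open>The encoding homomorphism is determined by its values at the finitely many letters of
  \<open>Gs\<close>. The value at a letter has the length of that letter over \<open>K\<close>, so
  it lies in a ball, which is finite.\<close>

lemma finite_bounded_bases:
  "finite {K. bas K \<and> (\<forall>i\<in>{1..n}. \<forall>s\<in>Gs i. word_length G n K s \<le> C)}" (is "finite ?B")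
proof -
  let ?S = "\<Union>i\<in>{1..n}. Gs i"
  define good where "good K \<psi> \<longleftrightarrow> \<psi> \<in> hom G G \<and> (\<forall>i\<in>{1..n}. K i = {g \<in> carrier G. \<psi> g \<in> Gs i}) \<and>
     (\<forall>g\<in>carrier G. word_length G n Gs (\<psi> g) = word_length G n K g)" for K \<psi>
  define \<Psi> where "\<Psi> K = (SOME \<psi>. good K \<psi>)" for K
  have P: "\<Psi> K \<in> hom G G \<and> (\<forall>i\<in>{1..n}. K i = {g \<in> carrier G. \<Psi> K g \<in> Gs i}) \<and>
     (\<forall>g\<in>carrier G. word_length G n Gs (\<Psi> K g) = word_length G n K g)" if "bas K" for K
  proof -
    have "\<exists>\<psi>. good K \<psi>" using basis_pullback[OF that] unfolding good_def by blast
    then have "good K (\<Psi> K)" unfolding \<Psi>_def by (rule someI_ex)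
    then show ?thesis unfolding good_def .
  qed
  let ?r = "\<lambda>K s. if s \<in> ?S then \<Psi> K s else \<one>"
  let ?F = "{f. \<forall>s. (s \<in> ?S \<longrightarrow> f s \<in> {g \<in> carrier G. word_length G n Gs g \<le> C}) \<and> (s \<notin> ?S \<longrightarrow> f s = \<one>)}"
  have "finite ?F" using Gs_finite finite_length_ball by (intro finite_set_of_finite_funs) auto
  moreover have "?r ` ?B \<subseteq> ?F"
  proof
    fix f assume "f \<in> ?r ` ?B"
    then obtain K where K: "bas K" "\<forall>i\<in>{1..n}. \<forall>s\<in>Gs i. word_length G n K s \<le> C" "f = ?r K" by blast
    have "\<Psi> K s \<in> carrier G \<and> word_length G n Gs (\<Psi> K s) \<le> C" if sS: "s \<in> ?S" for s
    proof -
      obtain i where i: "i \<in> {1..n}" "s \<in> Gs i" using sS by blast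
      have sc: "s \<in> carrier G" using fp_carrier[OF Gs i] .
      have "word_length G n Gs (\<Psi> K s) = word_length G n K s" using P[OF K(1)] sc by blast
      moreover have "\<Psi> K s \<in> carrier G" using P[OF K(1)] sc hom_in_carrier[of "\<Psi> K" G G s] by blast
      ultimately show ?thesis using K(2) i by simp
    qed
    then show "f \<in> ?F" unfolding K(3) by auto
  qed
  ultimately have fin: "finite (?r ` ?B)" by (rule finite_subset[rotated])
  have "inj_on ?r ?B"
  proof (rule inj_onI)
    fix K M assume K: "K \<in> ?B" and M: "M \<in> ?B" and e: "?r K = ?r M"
    have bK: "bas K" "bas M" using K M by auto
    have "\<Psi> K s = \<Psi> M s" if "i \<in> {1..n}" "s \<in> Gs i" for i s
    proof -
      have "s \<in> ?S" using that by blast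
      then show ?thesis using fun_cong[OF e, of s] by simp
    qed
    then have eq: "\<Psi> K g = \<Psi> M g" if "g \<in> carrier G" for g
      using hom_eq_on[OF Gs _ _ _ that] P[OF bK(1)] P[OF bK(2)] by blast
    show "K = M"
    proof
      fix i
      show "K i = M i"
      proof (cases "i \<in> {1..n}")
        case True
        have "K i = {g \<in> carrier G. \<Psi> K g \<in> Gs i}" "M i = {g \<in> carrier G. \<Psi> M g \<in> Gs i}"
          using P[OF bK(1)] P[OF bK(2)] True by blast+
        then show ?thesis using eq by auto
      qed (use bas_off[OF bK(1)] bas_off[OF bK(2)] in simp)
    qed
  qed
  then show ?thesis using finite_imageD[OF fin] by blast
qed

text \<open>Two bases with the same length function have the same letters; the retraction of \<open>G\<close> onto the factor
  \<open>K j\<close> shows that a letter lies in the factor of its own conjugacy type.\<close>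

lemma length_determines_subset:
  assumes H: "bas H" and K: "bas K" and eq: "\<And>g. g \<in> carrier G \<Longrightarrow> word_length G n H g = word_length G n K g"
    and i: "i \<in> {1..n}"
  shows "H i \<subseteq> K i"
proof
  fix h assume h: "h \<in> H i"
  note fH = bas_fp[OF H] and fK = bas_fp[OF K]
  have hc: "h \<in> carrier G" using bas_carrier[OF H h] .
  show "h \<in> K i"
  proof (cases "h = \<one>")
    case True
    then show ?thesis using subgroup.one_closed[OF fp_subgroup[OF fK i]] by simp
  next
    case False
    have "length (nf G n K h) = 1"
      using eq[OF hc] nf_letter[OF fH i h False] by (simp add: word_length_nf)
    then obtain p where p: "nf G n K h = [p]" by (auto simp: length_Suc_conv)
    have pj: "fst p \<in> {1..n}" "snd p \<in> K (fst p)" using nf_reduced[OF fK hc] p by auto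
    have "h = snd p" using nf_eval[OF fK hc] p bas_carrier[OF K pj(2)] by simp
    then have hK: "h \<in> K (fst p)" using pj by simp
    have "fst p = i"
    proof (rule ccontr)
      assume ne: "fst p \<noteq> i"
      let ?j = "fst p"
      let ?f = "\<lambda>l g. if l = ?j then g else \<one>"
      have fc: "\<And>l g. l \<in> {1..n} \<Longrightarrow> g \<in> K l \<Longrightarrow> ?f l g \<in> carrier G" using bas_carrier[OF K] by auto
      have fh: "\<And>l g g'. l \<in> {1..n} \<Longrightarrow> g \<in> K l \<Longrightarrow> g' \<in> K l \<Longrightarrow> ?f l (g \<otimes> g') = ?f l g \<otimes> ?f l g'" by auto
      let ?\<rho> = "hom_ext K ?f"
      have hom: "?\<rho> \<in> hom G G" by (rule hom_ext_hom[OF fK fc fh])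
      have rl: "?\<rho> g = ?f l g" if "l \<in> {1..n}" "g \<in> K l" for l g
        by (rule hom_ext_letter[OF fK fc fh that])
      obtain d where d: "\<And>l. d l \<in> carrier G" "H = conj_basis d K" using bas_conj[OF H K] by metis
      obtain k where k: "k \<in> K i" "h = d i \<otimes> k \<otimes> inv (d i)" using h d(2) by (auto simp: conj_basis_def)
      have kc: "k \<in> carrier G" using bas_carrier[OF K k(1)] .
      have rc: "?\<rho> (d i) \<in> carrier G" using hom_in_carrier[OF hom d(1)] .
      have "?\<rho> h = ?\<rho> (d i) \<otimes> ?\<rho> k \<otimes> ?\<rho> (inv (d i))"
        using k(2) hom_mult[OF hom] d(1)[of i] kc by simp
      also have "\<dots> = ?\<rho> (d i) \<otimes> ?\<rho> (inv (d i))" using rl[OF i k(1)] ne rc by auto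
      also have "\<dots> = ?\<rho> (d i \<otimes> inv (d i))" using hom_mult[OF hom, of "d i" "inv (d i)"] d(1)[of i] by simp
      also have "\<dots> = \<one>" using d(1)[of i] hom_one[OF hom] by (simp add: is_group)
      finally show False using rl[OF pj(1) hK] False by simp
    qed
    then show ?thesis using hK by simp
  qed
qed

lemma length_determines_basis:
  assumes H: "bas H" and K: "bas K" and eq: "\<And>g. g \<in> carrier G \<Longrightarrow> word_length G n H g = word_length G n K g"
  shows "H = K"
proof
  fix i
  show "H i = K i"
  proof (cases "i \<in> {1..n}")
    case True
    then show ?thesis
      using length_determines_subset[OF H K eq True] length_determines_subset[OF K H eq[symmetric] True] by blast
  qed (use bas_off[OF H] bas_off[OF K] in simp)
qed

end

theorem theorem5p2:
  fixes G :: "('a, 'b) monoid_scheme" and n :: nat and Gs :: "nat \<Rightarrow> 'a set"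
    and r :: "('a \<times> 'a) set"
  assumes "group G"
    and "n \<ge> 1"
    and "is_free_product G n Gs"
    and "\<forall>i\<in>{1..n}. finite (Gs i) \<and> Gs i \<noteq> {\<one>\<^bsub>G\<^esub>}"
    and "well_order_on (carrier G) r"
  shows "(\<forall>v\<in>nuclear_vertices G n Gs.
            (\<exists>u\<in>nuclear_vertices G n Gs. nuclear_less G n Gs r u v) \<longrightarrow>
            contractible_complex
              (LG_star G n Gs v \<inter>
               (\<Union>u\<in>{u \<in> nuclear_vertices G n Gs. nuclear_less G n Gs r u v}.
                   LG_star G n Gs u)))
         \<and> contractible_complex (LG_complex G n Gs)"
proof -
  have ff: "free_factors G n Gs"
    using assms by (simp add: free_factors_def free_factors_axioms_def factored_group_def)
  interpret F: free_factors G n Gs by (rule ff)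
  have wp: "whitehead_poset G n Gs r L'" if "\<And>g. g \<in> carrier G \<Longrightarrow> set (L' g) \<subseteq> carrier G" for L'
    using ff assms that
    by (simp add: whitehead_poset_def whitehead_poset_axioms_def normed_factors_def normed_factors_axioms_def)
  interpret A: whitehead_poset G n Gs r "\<lambda>g. [g]" by (rule wp) simp
  have nless: "A.nless K H \<longleftrightarrow> lex_less (carrier G) r (word_length G n K) (word_length G n H)" for H K
    by (simp add: A.nless_def A.norm_diff_def[abs_def] lex_less_lexpos)
  have part1: "contractible_complex (LG_star G n Gs v \<inter>
      (\<Union>u\<in>{u \<in> nuclear_vertices G n Gs. nuclear_less G n Gs r u v}. LG_star G n Gs u))"
    if v: "v \<in> nuclear_vertices G n Gs" and ex: "\<exists>u\<in>nuclear_vertices G n Gs. nuclear_less G n Gs r u v" for v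
  proof -
    obtain H where H: "F.bas H" "v = nuclear G n Gs H" using v by (auto simp: nuclear_vertices_def)
    \<comment> \<open>A nuclear vertex determines its basis, so the bases quantified in
      \<open>nuclear_less\<close> can be fixed.\<close>
    have lt: "nuclear_less G n Gs r u v \<longleftrightarrow> (\<exists>K. F.bas K \<and> u = nuclear G n Gs K \<and> A.nless K H)" for u
      unfolding nuclear_less_def nless H(2) using A.nuclear_inj[OF H(1)] H(1) by metis
    have U: "{u \<in> nuclear_vertices G n Gs. nuclear_less G n Gs r u v} = nuclear G n Gs ` {K. F.bas K \<and> A.nless K H}"
      unfolding lt by (auto simp: nuclear_vertices_def)
    have "LG_star G n Gs v \<inter> (\<Union>u\<in>{u \<in> nuclear_vertices G n Gs. nuclear_less G n Gs r u v}. LG_star G n Gs u)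
        = order_complex (A.lower_set H) (LG_le n)"
      unfolding U using A.star_Int_lower[OF H(1)] A.LG_star_order H by simp
    moreover obtain K where "F.bas K" "A.nless K H" using ex lt by blast
    ultimately show ?thesis using A.lower_complex_contractible_complex[OF H(1)] by simp
  qed
  have part2: "contractible_complex (LG_complex G n Gs)"
  proof -
    have "carrier G \<noteq> {}" using F.one_closed by blast
    \<comment> \<open>The least element is compared first. Its coordinate is replaced by the total
      length of a list containing it and all letters of the given factors, so these lengths are
      bounded on all bases below a given one.\<close>
    then obtain g0 where g0: "g0 \<in> carrier G" "\<And>b. b \<in> carrier G \<Longrightarrow> b \<noteq> g0 \<Longrightarrow> (g0, b) \<in> r"
      using wo_min[OF assms(5) subset_refl] by metis
    let ?S = "(\<Union>i\<in>{1..n}. Gs i) - {g0}"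
    have "finite ?S" using F.Gs_finite by auto
    then obtain S where S: "set S = ?S" using finite_list by blast
    have Sc: "set S \<subseteq> carrier G" unfolding S using F.fp_carrier[OF F.Gs] by auto
    \<comment> \<open>Beside \<open>S\<close> the element \<open>g0\<close> is listed exactly once.
      Equal norms then give equal lengths: at all other elements directly, hence on
      \<open>S\<close>, hence at \<open>g0\<close>.\<close>
    define L' where "L' g = (if g = g0 then S @ [g0] else [g])" for g
    interpret B: whitehead_poset G n Gs r L' by (rule wp) (use Sc g0 in \<open>auto simp: L'_def\<close>)
    show ?thesis
    proof (rule B.LG_contractible[OF _ _ F.basis_exists])
      fix H assume H: "F.bas H"
      let ?C = "F.total_length (L' g0) H"
      have "{K. F.bas K \<and> B.nless K H} \<subseteq> {K. F.bas K \<and> (\<forall>i\<in>{1..n}. \<forall>s\<in>Gs i. word_length G n K s \<le> ?C)}"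
      proof (intro subsetI CollectI conjI ballI)
        fix K assume K: "K \<in> {K. F.bas K \<and> B.nless K H}"
        then show "F.bas K" by simp
        have "lexpos (carrier G) r (B.norm_diff H K)" using K by (simp add: B.nless_def)
        then obtain a where a: "a \<in> carrier G" "B.norm_diff H K a > 0"
          "\<And>b. b \<in> carrier G \<Longrightarrow> (b, a) \<in> r \<Longrightarrow> b \<noteq> a \<Longrightarrow> B.norm_diff H K b = 0" unfolding lexpos_def by blast
        \<comment> \<open>The coordinate \<open>g0\<close> either decides the comparison or precedes
          the deciding one.\<close>
        have "B.norm_diff H K g0 \<ge> 0" using a(2) a(3)[OF g0(1)] g0(2)[OF a(1)] by (cases "a = g0") auto
        then have le: "F.total_length (L' g0) K \<le> ?C" by (simp add: B.norm_diff_def)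
        have mem: "word_length G n K s \<le> F.total_length xs K" if "s \<in> set xs" for s xs
          using that by (induction xs) auto
        fix i s assume "i \<in> {1..n}" "s \<in> Gs i"
        then have "s \<in> insert g0 ?S" by blast
        then have "s \<in> set (L' g0)" using S by (auto simp: L'_def)
        from mem[OF this] le show "word_length G n K s \<le> ?C" by simp
      qed
      then show "finite {K. F.bas K \<and> B.nless K H}" by (rule finite_subset[OF _ F.finite_bounded_bases])
    next
      fix H K assume HK: "F.bas H" "F.bas K" "H \<noteq> K"
      show "B.nless H K \<or> B.nless K H"
      proof (rule ccontr)
        assume n: "\<not> ?thesis"
        have neg: "(\<lambda>a. - B.norm_diff H K a) = B.norm_diff K H" by (auto simp: B.norm_diff_def)
        have z: "B.norm_diff H K g = 0" if "g \<in> carrier G" for g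
        proof (rule ccontr)
          assume "B.norm_diff H K g \<noteq> 0"
          from lexpos_total[where d = "B.norm_diff H K" and a = g, OF assms(5) that this] show False
            using n unfolding neg by (simp add: B.nless_def)
        qed
        have other: "word_length G n H g = word_length G n K g" if "g \<in> carrier G" "g \<noteq> g0" for g
          using z[OF that(1)] that(2) by (simp add: B.norm_diff_def L'_def)
        have "F.total_length xs H = F.total_length xs K" if "set xs \<subseteq> set S" for xs
          using that
        proof (induction xs)
          case (Cons s xs)
          then have "s \<in> carrier G" "s \<noteq> g0" using Sc S by auto
          then show ?case using Cons other by simp
        qed simp
        then have "F.total_length S H = F.total_length S K" by blast
        then have "word_length G n H g0 = word_length G n K g0" using z[OF g0(1)] by (simp add: B.norm_diff_def L'_def)
        then have "word_length G n H g = word_length G n K g" if "g \<in> carrier G" for g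
          using other[OF that] by (cases "g = g0") auto
        then show False using F.length_determines_basis[OF HK(1,2)] HK(3) by blast
      qed
    qed
  qed
  show ?thesis using part1 part2 by blast
qed

end
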